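(* Let $\mathcal X$ be a smooth projective geometrically irreducible curve of genus $g_{\mathcal X}$ over $\mathbb F_q$, let $D=P_1+\cdots+P_N$ be a sum of distinct $\mathbb F_q$-rational points, and let $G$ be a divisor with $\operatorname{Supp}G\cap\operatorname{Supp}D=\emptyset$. Let $\eta$ be a differential of $\mathcal X$ over $\mathbb F_q$ with $v_P(\eta)=-1$ and $\operatorname{Res}_P(\eta)=1$ for every $P\in\operatorname{Supp}D$, and put $K=\operatorname{div}(\eta)$, $A=D-G+K$. Then the following hold. (1) $\deg(G\wedge A)+\deg(G\vee A)=N+2g_{\mathcal X}-2$; in particular the conditions $\deg(G\vee A)<N$ and $\deg(G\wedge A)>2g_{\mathcal X}-2$ are equivalent. (2) If $\deg(G\wedge A)>2g_{\mathcal X}-2$, then $$\operatorname{Hull}(C_L(D,G))=C_L(D,G\wedge A)\quad\text{and}\quad\dim\operatorname{Hull}(C_L(D,G))=\deg(G\wedge A)+1-g_{\mathcal X}.$$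
   Context: For a divisor $G$, $L(G)=\{h\in\mathbb F_q(\mathcal X)^*:\operatorname{div}(h)+G\ge 0\}\cup\{0\}$. If $\operatorname{Supp} G\cap \operatorname{Supp} D=\emptyset$, then $C_L(D,G)\subseteq\mathbb F_q^N$ is the image of $L(G)\to\mathbb F_q^N$, $h\mapsto(h(P_1),\dots,h(P_N))$. The dual $C^\perp$ is taken with respect to the standard bilinear form on $\mathbb F_q^N$ and $\operatorname{Hull}(C)=C\cap C^\perp$. By the classical duality theorem $C_L(D,G)^\perp=C_L(D,A)$. The meet $G_1\wedge G_2$ and join $G_1\vee G_2$ of two divisors are their coefficientwise minimum and maximum. *)

theory Defs
  imports
    "HOL-Analysis.Cartesian_Space"
    "HOL-Computational_Algebra.Polynomial"
    "HOL-Library.Function_Algebras"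
begin

text \<open>
  A smooth projective geometrically irreducible curve over a finite field \<open>k\<close> is given by its
  function field \<open>F\<close>, with the constants embedded by \<open>\<iota> : k \<rightarrow> F\<close>, and its closed points are the
  valuation rings (local rings) of \<open>F/k\<close>. As \<open>k\<close> is perfect, geometric irreducibility says that
  \<open>k\<close> is algebraically closed in \<open>F\<close>.
\<close>

definition poly_at :: "('k::field \<Rightarrow> 'f::field) \<Rightarrow> 'k poly \<Rightarrow> 'f \<Rightarrow> 'f" where
  "poly_at \<iota> p x = poly (map_poly \<iota> p) x"

definition algebraic_over :: "('k::field \<Rightarrow> 'f::field) \<Rightarrow> 'f \<Rightarrow> bool" where
  "algebraic_over \<iota> x \<longleftrightarrow> (\<exists>p. p \<noteq> 0 \<and> poly_at \<iota> p x = 0)"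

definition rational_subfield :: "('k::field \<Rightarrow> 'f::field) \<Rightarrow> 'f \<Rightarrow> 'f set" where
  "rational_subfield \<iota> x = {poly_at \<iota> p x / poly_at \<iota> q x | p q. poly_at \<iota> q x \<noteq> 0}"

locale function_field =
  fixes \<iota> :: "'k::{field,finite} \<Rightarrow> 'f::field"
  assumes one: "\<iota> 1 = 1"
    and add: "\<iota> (a + b) = \<iota> a + \<iota> b"
    and mult: "\<iota> (a * b) = \<iota> a * \<iota> b"
    and one_variable: "\<exists>x. \<not> algebraic_over \<iota> x \<and>
      (\<exists>B. finite B \<and>
        (\<forall>f. \<exists>c. (\<forall>b\<in>B. c b \<in> rational_subfield \<iota> x) \<and> f = (\<Sum>b\<in>B. c b * b)))"
    and constants: "algebraic_over \<iota> x \<Longrightarrow> x \<in> range \<iota>"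


subsection \<open>Closed points\<close>

definition place :: "('k::field \<Rightarrow> 'f::field) \<Rightarrow> 'f set \<Rightarrow> bool" where
  "place \<iota> P \<longleftrightarrow> range \<iota> \<subset> P \<and> P \<noteq> UNIV \<and>
     (\<forall>x\<in>P. \<forall>y\<in>P. x - y \<in> P \<and> x * y \<in> P) \<and> (\<forall>z. z \<in> P \<or> inverse z \<in> P)"

definition max_ideal :: "'f::field set \<Rightarrow> 'f set" where
  "max_ideal P = {z \<in> P. z = 0 \<or> inverse z \<notin> P}"

definition uniformizer :: "'f::field set \<Rightarrow> 'f \<Rightarrow> bool" where
  "uniformizer P t \<longleftrightarrow> max_ideal P = (\<lambda>u. t * u) ` P"

text \<open>Meaningful for \<open>z \<noteq> 0\<close> only; the value \<open>v(0) = \<infinity>\<close> is not represented.\<close>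

definition place_val :: "'f::field set \<Rightarrow> 'f \<Rightarrow> int" where
  "place_val P z = (THE n. \<exists>t u. uniformizer P t \<and> u \<in> P - max_ideal P \<and> z = t powi n * u)"

text \<open>
  The dimension over \<open>k\<close> of the residue field \<open>P / max_ideal P\<close>, as the largest number of elements
  of \<open>P\<close> that are linearly independent modulo \<open>max_ideal P\<close>.
\<close>

definition place_degree :: "('k::field \<Rightarrow> 'f::field) \<Rightarrow> 'f set \<Rightarrow> nat" where
  "place_degree \<iota> P = Sup {card B | B. finite B \<and> B \<subseteq> P \<and>
     (\<forall>c. (\<Sum>b\<in>B. \<iota> (c b) * b) \<in> max_ideal P \<longrightarrow> (\<forall>b\<in>B. c b = 0))}"

definition rational_place :: "('k::field \<Rightarrow> 'f::field) \<Rightarrow> 'f set \<Rightarrow> bool" where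
  "rational_place \<iota> P \<longleftrightarrow> place \<iota> P \<and> place_degree \<iota> P = 1"

text \<open>The value \<open>h(P) \<in> k\<close> at a rational point \<open>P\<close> of a function \<open>h\<close> regular at \<open>P\<close>.\<close>

definition value_at :: "('k::field \<Rightarrow> 'f::field) \<Rightarrow> 'f set \<Rightarrow> 'f \<Rightarrow> 'k" where
  "value_at \<iota> P h = (THE c. h - \<iota> c \<in> max_ideal P)"


subsection \<open>Divisors\<close>

text \<open>
  Divisors are finitely supported functions from closed points to integers. Sums, order, meet
  (\<open>inf\<close>) and join (\<open>sup\<close>) are the pointwise operations on functions; on integers \<open>inf\<close> and
  \<open>sup\<close> are minimum and maximum.
\<close>

definition div_supp :: "('f set \<Rightarrow> int) \<Rightarrow> 'f set set" where
  "div_supp G = {P. G P \<noteq> 0}"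

definition is_divisor :: "('k::field \<Rightarrow> 'f::field) \<Rightarrow> ('f set \<Rightarrow> int) \<Rightarrow> bool" where
  "is_divisor \<iota> G \<longleftrightarrow> finite (div_supp G) \<and> div_supp G \<subseteq> Collect (place \<iota>)"

definition point_divisor :: "'f set \<Rightarrow> 'f set \<Rightarrow> int" where
  "point_divisor P = (\<lambda>Q. if Q = P then 1 else 0)"

definition div_degree :: "('k::field \<Rightarrow> 'f::field) \<Rightarrow> ('f set \<Rightarrow> int) \<Rightarrow> int" where
  "div_degree \<iota> G = (\<Sum>P\<in>div_supp G. G P * int (place_degree \<iota> P))"

definition div_fun :: "('k::field \<Rightarrow> 'f::field) \<Rightarrow> 'f \<Rightarrow> 'f set \<Rightarrow> int" where
  "div_fun \<iota> h = (\<lambda>P. if place \<iota> P then place_val P h else 0)"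

definition riemann_roch_space :: "('k::field \<Rightarrow> 'f::field) \<Rightarrow> ('f set \<Rightarrow> int) \<Rightarrow> 'f set" where
  "riemann_roch_space \<iota> G = {h. h \<noteq> 0 \<and> 0 \<le> div_fun \<iota> h + G} \<union> {0}"

definition ell :: "('k::field \<Rightarrow> 'f::field) \<Rightarrow> ('f set \<Rightarrow> int) \<Rightarrow> nat" where
  "ell \<iota> G = vector_space.dim (\<lambda>c x. \<iota> c * x) (riemann_roch_space \<iota> G)"

text \<open>By Riemann's theorem the supremum is a maximum.\<close>

definition genus :: "('k::field \<Rightarrow> 'f::field) \<Rightarrow> int" where
  "genus \<iota> = Sup {div_degree \<iota> G - int (ell \<iota> G) + 1 | G. is_divisor \<iota> G}"


subsection \<open>Differentials\<close>

definition k_derivation :: "('k::field \<Rightarrow> 'f::field) \<Rightarrow> ('f \<Rightarrow> 'f) \<Rightarrow> bool" where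
  "k_derivation \<iota> \<delta> \<longleftrightarrow> (\<forall>c. \<delta> (\<iota> c) = 0) \<and> (\<forall>x y. \<delta> (x + y) = \<delta> x + \<delta> y) \<and>
     (\<forall>x y. \<delta> (x * y) = x * \<delta> y + y * \<delta> x)"

text \<open>
  Kaehler differentials of \<open>F/k\<close>. The \<open>F\<close>-space of differentials embeds into its double dual,
  which is the dual of the space of \<open>k\<close>-derivations of \<open>F\<close>, with \<open>dx\<close> acting as
  \<open>\<delta> \<mapsto> \<delta> x\<close>; it is the \<open>F\<close>-span of the \<open>dx\<close> in there. The value 0 outside the derivations
  makes equality of functions equality of differentials.
\<close>

definition kaehler_d :: "('k::field \<Rightarrow> 'f::field) \<Rightarrow> 'f \<Rightarrow> ('f \<Rightarrow> 'f) \<Rightarrow> 'f" where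
  "kaehler_d \<iota> x = (\<lambda>\<delta>. if k_derivation \<iota> \<delta> then \<delta> x else 0)"

definition scale_diff :: "'f::field \<Rightarrow> (('f \<Rightarrow> 'f) \<Rightarrow> 'f) \<Rightarrow> ('f \<Rightarrow> 'f) \<Rightarrow> 'f" where
  "scale_diff h \<omega> = (\<lambda>\<delta>. h * \<omega> \<delta>)"

definition differentials :: "('k::field \<Rightarrow> 'f::field) \<Rightarrow> (('f \<Rightarrow> 'f) \<Rightarrow> 'f) set" where
  "differentials \<iota> = {\<Sum>x\<in>B. scale_diff (g x) (kaehler_d \<iota> x) | g B. finite B}"

text \<open>
  For a uniformizer \<open>t\<close> at \<open>P\<close> every differential is \<open>h dt\<close> for a unique \<open>h\<close>, and the valuation
  of \<open>h\<close> does not depend on \<open>t\<close>. Meaningful for nonzero differentials only.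
\<close>

definition val_diff ::
  "('k::field \<Rightarrow> 'f::field) \<Rightarrow> 'f set \<Rightarrow> (('f \<Rightarrow> 'f) \<Rightarrow> 'f) \<Rightarrow> int" where
  "val_diff \<iota> P \<omega> =
     (THE n. \<exists>t h. uniformizer P t \<and> \<omega> = scale_diff h (kaehler_d \<iota> t) \<and> n = place_val P h)"

definition div_diff ::
  "('k::field \<Rightarrow> 'f::field) \<Rightarrow> (('f \<Rightarrow> 'f) \<Rightarrow> 'f) \<Rightarrow> 'f set \<Rightarrow> int" where
  "div_diff \<iota> \<omega> = (\<lambda>P. if place \<iota> P then val_diff \<iota> P \<omega> else 0)"

text \<open>
  The residue at a rational point: if \<open>\<omega> = h dt\<close> and the expansion of \<open>h\<close> in \<open>t\<close> has the
  principal part \<open>a\<^sub>m t\<^sup>-\<^sup>m + \<dots> + a\<^sub>1 t\<^sup>-\<^sup>1\<close>, it is the coefficient \<open>a\<^sub>1\<close>. It does not depend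
  on the uniformizer \<open>t\<close>.
\<close>

definition residue_at ::
  "('k::field \<Rightarrow> 'f::field) \<Rightarrow> 'f set \<Rightarrow> (('f \<Rightarrow> 'f) \<Rightarrow> 'f) \<Rightarrow> 'k" where
  "residue_at \<iota> P \<omega> =
     (THE r. \<exists>t h m a. uniformizer P t \<and> \<omega> = scale_diff h (kaehler_d \<iota> t) \<and> m \<ge> 1 \<and>
        h - (\<Sum>i=1..m. \<iota> (a i) * inverse t ^ i) \<in> P \<and> r = a (1::nat))"


subsection \<open>Codes\<close>

text \<open>
  The family \<open>P\<close> of distinct rational points, indexed by a finite type, fixes the coordinates;
  \<open>D\<close> is the sum of its members.
\<close>

definition sum_points :: "('n::finite \<Rightarrow> 'f set) \<Rightarrow> 'f set \<Rightarrow> int" where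
  "sum_points P = (\<Sum>i\<in>UNIV. point_divisor (P i))"

definition evaluation_code ::
  "('k::field \<Rightarrow> 'f::field) \<Rightarrow> ('n::finite \<Rightarrow> 'f set) \<Rightarrow> ('f set \<Rightarrow> int) \<Rightarrow> ('k ^ 'n) set" where
  "evaluation_code \<iota> P G = (\<lambda>h. \<chi> i. value_at \<iota> (P i) h) ` riemann_roch_space \<iota> G"

definition dual_code :: "('k::field ^ 'n::finite) set \<Rightarrow> ('k ^ 'n) set" where
  "dual_code C = {x. \<forall>y\<in>C. (\<Sum>i\<in>UNIV. x $ i * y $ i) = 0}"

definition code_hull :: "('k::field ^ 'n::finite) set \<Rightarrow> ('k ^ 'n) set" where
  "code_hull C = C \<inter> dual_code C"

end

theory Submission
  imports Defs "HOL-Computational_Algebra.Primes"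
begin

text \<open>
  Write \<open>k\<close> for the finite field of constants. The statement about codes follows from two facts on the
  curve: \<open>C\<^sub>L(D, G)\<close> has the dual \<open>C\<^sub>L(D, A)\<close>, and \<open>deg K = 2 g - 2\<close> with \<open>ell E = deg E + 1 - g\<close> for
  divisors \<open>E\<close> of degree larger than that. Indeed meet and join of \<open>G\<close> and \<open>A\<close> have together the degree of
  \<open>G + A = D + K\<close>. If the join has degree less than \<open>N\<close>, a word of the hull, which is given by
  \<open>f \<in> L G\<close> and by \<open>h \<in> L A\<close>, forces \<open>f = h\<close>, because \<open>f - h\<close> lies in \<open>L (G \<or> A - D) = 0\<close>
  (\<open>ev_eq_imp_eq\<close>). So the hull is the injective image of \<open>L G \<inter> L A = L (G \<and> A)\<close>.

  Riemann's theorem is proved by counting: as \<open>k\<close> is finite, dimensions are exponents of finite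
  indices. The degree over \<open>k(y)\<close> bounds the zeros of \<open>y\<close> (\<open>zeros_le\<close>), principal
  divisors have degree 0 (\<open>deg_div_fun\<close>), and the index of \<open>adele_box D\<close> plus the functions in the adeles
  is \<open>|k|\<close> to the index of speciality \<open>ell D - deg D + g - 1\<close> (\<open>idx_adeles\<close>).

  Serre duality is obtained from Tate's residue. Compress multiplication by adeles to the integral
  adeles; the commutator of the compressions of \<open>a\<close> and \<open>b\<close> has finite rank, and its trace is the sum of
  the residues of \<open>a db\<close>. It vanishes when \<open>a\<close> and \<open>b\<close> are functions, since the functions are
  complementary to the integral adeles up to finite dimension (\<open>residue_trace_principal\<close>). For
  \<open>\<eta> = \<Sum> g dx\<close> this gives a functional \<open>\<omega>\<close> on the adeles, the sum of the residues of \<open>a \<eta>\<close>, which vanishes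
  on functions. Over the field of \<open>p\<close>-th powers the functions have the powers of a uniformizer as a basis,
  so \<open>\<eta> = h dt\<close> at each place and \<open>\<omega>\<close> can be computed from \<open>h\<close> and \<open>t\<close> (\<open>differential_eq_scale\<close>). A simple pole
  contributes the trace of a multiplication on the residue field; that trace form is not zero
  (\<open>trace_M_nonzero\<close>), so the order of \<open>\<eta>\<close> at \<open>P\<close> is exactly the conductor of \<open>\<omega>\<close> at \<open>P\<close>.

  By counting, all functionals that vanish on some box and on the functions are multiples of \<open>\<omega>\<close>
  (\<open>weil_differential_multiple\<close>). Hence an adele killed by all \<open>f \<omega>\<close> with \<open>f \<in> L (K - D)\<close> lies in \<open>adele_box D\<close> plus the
  functions (\<open>duality\<close>). Dimensions give \<open>riemann_roch\<close> and the degree of \<open>K\<close>. Applied to the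
  adele whose components at the points of \<open>D\<close> are the letters of a word, \<open>duality\<close> says that a word orthogonal
  to \<open>C\<^sub>L(D, G)\<close> consists of the values of a function in \<open>L A\<close> (\<open>dual_evaluation_code\<close>).
\<close>


section \<open>Counting cosets\<close>

definition add_subgroup :: "'a::ab_group_add set \<Rightarrow> bool" where
  "add_subgroup U \<longleftrightarrow> 0 \<in> U \<and> (\<forall>x\<in>U. \<forall>y\<in>U. x - y \<in> U)"

definition coset :: "'a::ab_group_add set \<Rightarrow> 'a \<Rightarrow> 'a set" where
  "coset U v = {w. v - w \<in> U}"

text \<open>For nonempty \<open>V\<close> the value 0 means an infinite index, so finiteness is expressed by \<open>0 < idx V U\<close>.\<close>

definition idx :: "'a::ab_group_add set \<Rightarrow> 'a set \<Rightarrow> nat" where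
  "idx V U = card (coset U ` V)"

definition sumset :: "'a::ab_group_add set \<Rightarrow> 'a set \<Rightarrow> 'a set" where
  "sumset V W = {v + w | v w. v \<in> V \<and> w \<in> W}"

lemma add_subgroup_zero: "add_subgroup U \<Longrightarrow> 0 \<in> U"
  and add_subgroup_diff: "add_subgroup U \<Longrightarrow> x \<in> U \<Longrightarrow> y \<in> U \<Longrightarrow> x - y \<in> U"
  by (auto simp: add_subgroup_def)

lemma add_subgroup_minus: "add_subgroup U \<Longrightarrow> x \<in> U \<Longrightarrow> - x \<in> U"
  using add_subgroup_diff[of U 0 x] add_subgroup_zero[of U] by simp

lemma add_subgroup_add: "add_subgroup U \<Longrightarrow> x \<in> U \<Longrightarrow> y \<in> U \<Longrightarrow> x + y \<in> U"
proof -
  assume a: "add_subgroup U" "x \<in> U" "y \<in> U"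
  have "x - (- y) \<in> U" by (rule add_subgroup_diff[OF a(1,2) add_subgroup_minus[OF a(1,3)]])
  then show ?thesis by simp
qed

lemma add_subgroup_Int: "add_subgroup U \<Longrightarrow> add_subgroup V \<Longrightarrow> add_subgroup (U \<inter> V)"
  unfolding add_subgroup_def by blast

lemma add_subgroup_sumset:
  assumes "add_subgroup U" "add_subgroup V" shows "add_subgroup (sumset U V)"
proof -
  have "(u + v) - (u' + v') \<in> sumset U V"
    if "u \<in> U" "u' \<in> U" "v \<in> V" "v' \<in> V" for u u' v v'
  proof -
    have "(u + v) - (u' + v') = (u - u') + (v - v')" by (simp add: algebra_simps)
    then show ?thesis unfolding sumset_def
      using add_subgroup_diff[OF assms(1) that(1,2)] add_subgroup_diff[OF assms(2) that(3,4)] by blast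
  qed
  moreover have "0 \<in> sumset U V" unfolding sumset_def
    using add_subgroup_zero[OF assms(1)] add_subgroup_zero[OF assms(2)] by force
  ultimately show ?thesis unfolding add_subgroup_def by (auto simp: sumset_def)
qed

lemma coset_eq_iff: assumes "add_subgroup U" shows "coset U v = coset U w \<longleftrightarrow> v - w \<in> U"
proof
  assume "coset U v = coset U w"
  moreover have "w \<in> coset U w" by (simp add: coset_def add_subgroup_zero assms)
  ultimately show "v - w \<in> U" by (auto simp: coset_def)
next
  assume a: "v - w \<in> U"
  have "v - x \<in> U \<longleftrightarrow> w - x \<in> U" for x
    using add_subgroup_diff[OF assms, of "v - x" "v - w"] add_subgroup_add[OF assms, of "w - x" "v - w"] a
    by (auto simp: algebra_simps)
  then show "coset U v = coset U w" by (auto simp: coset_def)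
qed

lemma idx_eqI:
  assumes U: "add_subgroup U"
    and f: "\<And>v w. v \<in> V \<Longrightarrow> w \<in> V \<Longrightarrow> f v = f w \<longleftrightarrow> v - w \<in> U"
  shows "idx V U = card (f ` V)"
proof -
  define g where "g = (\<lambda>c. f (SOME v. v \<in> V \<and> coset U v = c))"
  have g: "g (coset U v) = f v" if "v \<in> V" for v
  proof -
    have "(SOME w. w \<in> V \<and> coset U w = coset U v) \<in> V \<and>
      coset U (SOME w. w \<in> V \<and> coset U w = coset U v) = coset U v"
      using someI[of "\<lambda>w. w \<in> V \<and> coset U w = coset U v" v] that by blast
    then show ?thesis unfolding g_def using f[OF _ that] coset_eq_iff[OF U] by blast
  qed
  have "bij_betw g (coset U ` V) (f ` V)"
    by (rule bij_betw_imageI) (auto simp: inj_on_def g image_image f coset_eq_iff[OF U] cong: image_cong)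
  then show ?thesis unfolding idx_def by (rule bij_betw_same_card)
qed

lemma idx_tower:
  assumes U: "add_subgroup U" and W: "add_subgroup W" and V: "add_subgroup V"
    and "U \<subseteq> W" "W \<subseteq> V"
  shows "idx V U = idx V W * idx W U"
proof -
  define r where "r = (\<lambda>v. SOME w. w \<in> V \<and> coset W w = coset W v)"
  have r: "r v \<in> V" "coset W (r v) = coset W v" if "v \<in> V" for v
    using someI[of "\<lambda>w. w \<in> V \<and> coset W w = coset W v" v] that unfolding r_def by auto
  have rW: "v - r v \<in> W" if "v \<in> V" for v
    using r(2)[OF that] coset_eq_iff[OF W] by metis
  have rc: "r v = r w" if "coset W v = coset W w" for v w
    using that unfolding r_def by simp
  have rr: "r (r v + w) = r v" if "v \<in> V" "w \<in> W" for v w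
  proof (rule rc)
    have "coset W (r v + w) = coset W (r v)" using that by (simp add: coset_eq_iff[OF W])
    then show "coset W (r v + w) = coset W v" using r(2)[OF that(1)] by simp
  qed
  define f where "f = (\<lambda>v. (coset W v, coset U (v - r v)))"
  have "f v = f w \<longleftrightarrow> v - w \<in> U" if "v \<in> V" "w \<in> V" for v w
  proof
    assume "f v = f w"
    then have c: "coset W v = coset W w" "coset U (v - r v) = coset U (w - r w)" by (simp_all add: f_def)
    from rc[OF c(1)] c(2) have "coset U (v - r w) = coset U (w - r w)" by simp
    then show "v - w \<in> U" using coset_eq_iff[OF U, of "v - r w" "w - r w"] by simp
  next
    assume a: "v - w \<in> U"
    then have "coset W v = coset W w" using coset_eq_iff[OF W] assms by blast
    moreover from this have "r v = r w" by (rule rc)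
    ultimately show "f v = f w" using a unfolding f_def by (simp add: coset_eq_iff[OF U])
  qed
  then have "idx V U = card (f ` V)" by (rule idx_eqI[OF U])
  also have "f ` V = (coset W ` V) \<times> (coset U ` W)"
  proof (intro equalityI subsetI)
    fix z assume "z \<in> f ` V" then show "z \<in> (coset W ` V) \<times> (coset U ` W)"
      using rW by (auto simp: f_def)
  next
    fix z assume "z \<in> (coset W ` V) \<times> (coset U ` W)"
    then obtain v w where z: "v \<in> V" "w \<in> W" "z = (coset W v, coset U w)" by auto
    have "r v + w \<in> V" using r(1)[OF z(1)] z(2) assms add_subgroup_add[OF V] by blast
    moreover have "coset W (r v + w) = coset W v"
      using r(2)[OF z(1)] coset_eq_iff[OF W, of "r v + w" "r v"] z(2) by simp
    ultimately show "z \<in> f ` V" using rr[OF z(1,2)] z(3)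
      by (intro image_eqI[of _ _ "r v + w"]) (auto simp: f_def)
  qed
  finally show ?thesis by (simp add: idx_def card_cartesian_product)
qed

lemma idx_second_iso:
  assumes V: "add_subgroup V" and W: "add_subgroup W"
  shows "idx (sumset V W) W = idx V (V \<inter> W)"
proof -
  have "coset W ` sumset V W = coset W ` V"
  proof (intro equalityI subsetI)
    fix c assume "c \<in> coset W ` sumset V W"
    then obtain v w where "v \<in> V" "w \<in> W" "c = coset W (v + w)" by (auto simp: sumset_def)
    then show "c \<in> coset W ` V" using coset_eq_iff[OF W, of "v + w" v] by auto
  next
    fix c assume "c \<in> coset W ` V"
    then obtain v where v: "v \<in> V" "c = coset W v" by auto
    then have "v + 0 \<in> sumset V W" unfolding sumset_def using add_subgroup_zero[OF W] by blast
    then show "c \<in> coset W ` sumset V W" using v by auto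
  qed
  moreover have "idx V (V \<inter> W) = card (coset W ` V)"
    by (rule idx_eqI[OF add_subgroup_Int[OF V W]])
      (auto simp: coset_eq_iff[OF W] add_subgroup_diff[OF V])
  ultimately show ?thesis by (simp add: idx_def)
qed

lemma idx_trivial: "idx V {0} = card V"
proof -
  have "idx V {0} = card ((\<lambda>x. x) ` V)" by (rule idx_eqI) (auto simp: add_subgroup_def)
  then show ?thesis by simp
qed

lemma add_subgroup_trivial: "add_subgroup {0}" by (simp add: add_subgroup_def)

lemma idx_self: assumes "add_subgroup U" shows "idx U U = 1"
proof -
  have "idx U U = card ((\<lambda>_. ()) ` U)"
    by (rule idx_eqI[OF assms]) (auto simp: add_subgroup_diff[OF assms])
  also have "(\<lambda>_. ()) ` U = {()}" using add_subgroup_zero[OF assms] by auto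
  finally show ?thesis by simp
qed

lemma idx_eq_1D:
  assumes "add_subgroup U" "U \<subseteq> V" "idx V U = 1" shows "V = U"
proof -
  obtain c where c: "coset U ` V = {c}" using assms(3) unfolding idx_def by (auto simp: card_1_singleton_iff)
  have "0 \<in> V" using assms add_subgroup_zero by blast
  then have "v - 0 \<in> U" if "v \<in> V" for v
    using c that coset_eq_iff[OF assms(1), of v 0] by blast
  then show ?thesis using assms by auto
qed


section \<open>Indices of subspaces over a finite field\<close>

locale finite_scalars = vector_space scale
  for scale :: "'k::{field,finite} \<Rightarrow> 'b::ab_group_add \<Rightarrow> 'b"
begin

lemma subspace_add_subgroup: "subspace U \<Longrightarrow> add_subgroup U"
  by (simp add: add_subgroup_def subspace_0 subspace_diff)

lemma card_scalars: "2 \<le> CARD('k)"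
proof -
  have "card {0, 1::'k} \<le> CARD('k)" by (rule card_mono) auto
  then show ?thesis by simp
qed

lemma power_card_inject: "CARD('k) ^ i = CARD('k) ^ j \<longleftrightarrow> i = j"
  using card_scalars by (intro power_inject_exp) auto

lemma power_card_le_iff: "CARD('k) ^ i \<le> CARD('k) ^ j \<longleftrightarrow> i \<le> j"
  using card_scalars by (intro power_increasing_iff) auto

lemma power_card_less_iff: "CARD('k) ^ i < CARD('k) ^ j \<longleftrightarrow> i < j"
  using card_scalars by (intro power_strict_increasing_iff) auto

lemma idx_span_insert:
  assumes U: "subspace U" and v: "v \<notin> U"
  shows "idx (span (insert v U)) U = CARD('k)"
proof -
  have U': "add_subgroup U" by (rule subspace_add_subgroup[OF U])
  have sp: "span (insert v U) = {x. \<exists>c. x - scale c v \<in> U}"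
    using U by (simp add: span_insert span_eq_iff[THEN iffD2])
  have "coset U ` span (insert v U) = (\<lambda>c. coset U (scale c v)) ` UNIV"
  proof (intro equalityI subsetI)
    fix z assume "z \<in> coset U ` span (insert v U)"
    then obtain x c where "z = coset U x" "x - scale c v \<in> U" using sp by auto
    then show "z \<in> (\<lambda>c. coset U (scale c v)) ` UNIV" using coset_eq_iff[OF U'] by blast
  next
    fix z assume "z \<in> (\<lambda>c. coset U (scale c v)) ` UNIV"
    then show "z \<in> coset U ` span (insert v U)"
      using span_scale[OF span_base[of v "insert v U"]] by auto
  qed
  moreover have "inj (\<lambda>c. coset U (scale c v))"
  proof (rule injI)
    fix c d assume "coset U (scale c v) = coset U (scale d v)"
    then have "scale (c - d) v \<in> U" using coset_eq_iff[OF U'] by (simp add: scale_left_diff_distrib)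
    then have "c - d \<noteq> 0 \<Longrightarrow> v \<in> U" using subspace_scale[OF U, of "scale (c-d) v" "inverse (c - d)"] by simp
    then show "c = d" using v by auto
  qed
  ultimately show ?thesis by (simp add: idx_def card_image)
qed

text \<open>Representatives of a basis of \<open>V\<close> modulo \<open>U\<close>.\<close>

definition cobasis :: "'b set \<Rightarrow> 'b set \<Rightarrow> 'b set \<Rightarrow> bool" where
  "cobasis V U B \<longleftrightarrow> finite B \<and> B \<subseteq> V \<and>
     (\<forall>c. (\<Sum>b\<in>B. scale (c b) b) \<in> U \<longrightarrow> (\<forall>b\<in>B. c b = 0)) \<and>
     (\<forall>v\<in>V. \<exists>c. v - (\<Sum>b\<in>B. scale (c b) b) \<in> U)"

lemma cobasis_finite: "cobasis V U B \<Longrightarrow> finite B"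
  and cobasis_subset: "cobasis V U B \<Longrightarrow> B \<subseteq> V"
  and cobasis_independent: "cobasis V U B \<Longrightarrow> (\<Sum>b\<in>B. scale (c b) b) \<in> U \<Longrightarrow> b \<in> B \<Longrightarrow> c b = 0"
  unfolding cobasis_def by simp_all

lemma cobasis_spans:
  assumes "cobasis V U B" "v \<in> V"
  obtains c where "v - (\<Sum>b\<in>B. scale (c b) b) \<in> U"
  using assms unfolding cobasis_def by meson

lemma cobasis_insert:
  assumes U: "subspace U" and V: "subspace V" and v: "v \<in> V" "v \<notin> U" "U \<subseteq> V"
    and B: "cobasis V (span (insert v U)) B"
  shows "cobasis V U (insert v B)" "v \<notin> B"
proof -
  have sp: "span (insert v U) = {x. \<exists>c. x - scale c v \<in> U}"
    using U by (simp add: span_insert span_eq_iff[THEN iffD2])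
  have fB: "finite B" using B by (simp add: cobasis_def)
  show vB: "v \<notin> B"
  proof
    assume "v \<in> B"
    then have "(\<Sum>b\<in>B. scale (if b = v then 1 else 0) b) = v"
      using fB by (simp add: if_distrib[of "\<lambda>c. scale c _"] cong: if_cong)
    moreover have "v \<in> span (insert v U)" by (rule span_base) simp
    ultimately have "(\<Sum>b\<in>B. scale (if b = v then 1 else 0) b) \<in> span (insert v U)" by simp
    from cobasis_independent[OF B this \<open>v \<in> B\<close>] show False by simp
  qed
  show "cobasis V U (insert v B)" unfolding cobasis_def
  proof (intro conjI allI impI)
    show "finite (insert v B)" "insert v B \<subseteq> V" using B v by (auto simp: cobasis_def)
    fix c assume "(\<Sum>b\<in>insert v B. scale (c b) b) \<in> U"
    then have a: "scale (c v) v + (\<Sum>b\<in>B. scale (c b) b) \<in> U" using fB vB by simp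
    then have "(\<Sum>b\<in>B. scale (c b) b) - scale (- c v) v \<in> U" by (simp add: algebra_simps)
    then have "(\<Sum>b\<in>B. scale (c b) b) \<in> span (insert v U)" unfolding sp by blast
    then have c0: "\<forall>b\<in>B. c b = 0" using cobasis_independent[OF B] by auto
    then have "scale (c v) v \<in> U" using a by simp
    then have "c v \<noteq> 0 \<Longrightarrow> v \<in> U" using subspace_scale[OF U, of "scale (c v) v" "inverse (c v)"] by simp
    then show "\<forall>b\<in>insert v B. c b = 0" using v c0 by auto
  next
    show "\<forall>x\<in>V. \<exists>c. x - (\<Sum>b\<in>insert v B. scale (c b) b) \<in> U"
    proof
      fix x assume "x \<in> V"
      then obtain c where "x - (\<Sum>b\<in>B. scale (c b) b) \<in> span (insert v U)"
        using cobasis_spans[OF B] by auto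
      then obtain d where d: "x - (\<Sum>b\<in>B. scale (c b) b) - scale d v \<in> U" using sp by blast
      have "(\<Sum>b\<in>B. scale ((c(v := d)) b) b) = (\<Sum>b\<in>B. scale (c b) b)"
        by (rule sum.cong) (use vB in auto)
      then have "x - (\<Sum>b\<in>insert v B. scale ((c(v := d)) b) b) \<in> U"
        using d fB vB by (simp add: algebra_simps)
      then show "\<exists>c. x - (\<Sum>b\<in>insert v B. scale (c b) b) \<in> U" by blast
    qed
  qed
qed

lemma span_insert_subset:
  assumes "subspace V" "v \<in> V" "U \<subseteq> V" shows "span (insert v U) \<subseteq> V"
  using assms by (intro span_minimal) auto

lemma cobasis_exists:
  assumes "subspace U" "subspace V" "U \<subseteq> V" "0 < idx V U"
  shows "\<exists>B. cobasis V U B"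
  using assms
proof (induction "idx V U" arbitrary: U rule: less_induct)
  case less
  show ?case
  proof (cases "U = V")
    case True
    then show ?thesis by (intro exI[of _ "{}"]) (auto simp: cobasis_def)
  next
    case False
    then obtain v where v: "v \<in> V" "v \<notin> U" using less.prems by auto
    let ?U = "span (insert v U)"
    have sub: "U \<subseteq> ?U" "?U \<subseteq> V" using span_insert_subset[OF less.prems(2) v(1) less.prems(3)]
      by (auto intro: span_base)
    have t: "idx V U = idx V ?U * CARD('k)"
      using idx_tower[of U ?U V] sub less.prems subspace_add_subgroup idx_span_insert[OF less.prems(1) v(2)]
      by simp
    then have "0 < idx V ?U" using less.prems by (cases "idx V ?U") auto
    moreover have "idx V ?U < idx V U" using t calculation card_scalars by simp
    ultimately obtain B where "cobasis V ?U B" using less.hyps[of ?U] less.prems sub by auto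
    then show ?thesis using cobasis_insert[OF less.prems(1,2) v less.prems(3)] by blast
  qed
qed

lemma inj_on_combinations:
  assumes U: "subspace U" and ind: "\<And>c b. (\<Sum>b\<in>B. scale (c b) b) \<in> U \<Longrightarrow> b \<in> B \<Longrightarrow> c b = 0"
  shows "inj_on (\<lambda>c. coset U (\<Sum>b\<in>B. scale (c b) b)) (PiE B (\<lambda>_. UNIV))"
proof (rule inj_onI)
  fix c d assume cd: "c \<in> PiE B (\<lambda>_. UNIV)" "d \<in> PiE B (\<lambda>_. UNIV)"
    "coset U (\<Sum>b\<in>B. scale (c b) b) = coset U (\<Sum>b\<in>B. scale (d b) b)"
  then have "(\<Sum>b\<in>B. scale (c b - d b) b) \<in> U" using coset_eq_iff[OF subspace_add_subgroup[OF U]]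
    by (simp add: scale_left_diff_distrib sum_subtractf)
  then have "c b - d b = 0" if "b \<in> B" for b using ind[of "\<lambda>b. c b - d b"] that by simp
  then show "c = d" using cd by (intro PiE_ext[OF cd(1,2)]) auto
qed

lemma cobasis_card:
  assumes "subspace U" "subspace V" "cobasis V U B"
  shows "idx V U = CARD('k) ^ card B"
proof -
  have U: "add_subgroup U" by (rule subspace_add_subgroup) fact
  let ?s = "\<lambda>c. \<Sum>b\<in>B. scale (c b) b"
  have fB: "finite B" using assms(3) by (simp add: cobasis_def)
  have "coset U ` V = (\<lambda>c. coset U (?s c)) ` (PiE B (\<lambda>_. UNIV))"
  proof (intro equalityI subsetI)
    fix z assume "z \<in> coset U ` V"
    then obtain v where v: "v \<in> V" "z = coset U v" by auto
    from cobasis_spans[OF assms(3) v(1)] obtain c where "v - ?s c \<in> U" .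
    moreover have "?s (restrict c B) = ?s c" by (rule sum.cong) auto
    ultimately have "z = coset U (?s (restrict c B))" using v coset_eq_iff[OF U] by simp
    then show "z \<in> (\<lambda>c. coset U (?s c)) ` (PiE B (\<lambda>_. UNIV))"
      by (intro image_eqI[of _ _ "restrict c B"]) simp_all
  next
    fix z assume "z \<in> (\<lambda>c. coset U (?s c)) ` (PiE B (\<lambda>_. UNIV))"
    then obtain c where "z = coset U (?s c)" by auto
    moreover have "?s c \<in> V"
      using cobasis_subset[OF assms(3)] by (intro subspace_sum[OF assms(2)] subspace_scale[OF assms(2)]) auto
    ultimately show "z \<in> coset U ` V" by simp
  qed
  moreover have "inj_on (\<lambda>c. coset U (?s c)) (PiE B (\<lambda>_. UNIV))"
    by (rule inj_on_combinations[OF assms(1)]) (use cobasis_independent[OF assms(3)] in blast)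
  ultimately show ?thesis using fB by (simp add: idx_def card_image card_PiE)
qed

text \<open>Adjoining to \<open>U\<close> a vector of \<open>V\<close> outside of it divides the index by the number of scalars and lowers
  by one the number of vectors that force a relation.\<close>

lemma idx_le_power:
  assumes "subspace U" "subspace V" "U \<subseteq> V"
    and "\<And>z::nat \<Rightarrow> 'b. (\<And>j. j \<le> m \<Longrightarrow> z j \<in> V) \<Longrightarrow>
      \<exists>c. (\<exists>j\<le>m. c j \<noteq> 0) \<and> (\<Sum>j\<le>m. scale (c j) (z j)) \<in> U"
  shows "0 < idx V U \<and> idx V U \<le> CARD('k) ^ m"
  using assms
proof (induction m arbitrary: U)
  case 0
  have "v \<in> U" if "v \<in> V" for v
  proof -
    have "\<exists>c. (\<exists>j\<le>0::nat. c j \<noteq> 0) \<and> (\<Sum>j\<le>0::nat. scale (c j) v) \<in> U"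
      using "0.prems"(4)[of "\<lambda>_. v"] that by simp
    then obtain c where "c (0::nat) \<noteq> 0" "scale (c 0) v \<in> U" by auto
    then show ?thesis using subspace_scale[OF "0.prems"(1), of "scale (c 0) v" "inverse (c 0)"] by simp
  qed
  then have "U = V" using "0.prems" by auto
  then show ?case using idx_self[OF subspace_add_subgroup[OF "0.prems"(1)]] by simp
next
  case (Suc m)
  show ?case
  proof (cases "U = V")
    case True
    then show ?thesis using idx_self[OF subspace_add_subgroup[OF Suc.prems(1)]] card_scalars by simp
  next
    case False
    then obtain v where v: "v \<in> V" "v \<notin> U" using Suc.prems by auto
    let ?U = "span (insert v U)"
    have sub: "U \<subseteq> ?U" "?U \<subseteq> V" using span_insert_subset[OF Suc.prems(2) v(1) Suc.prems(3)]
      by (auto intro: span_base)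
    have sp: "?U = {x. \<exists>c. x - scale c v \<in> U}"
      using Suc.prems(1) by (simp add: span_insert span_eq_iff[THEN iffD2])
    have t: "idx V U = idx V ?U * CARD('k)"
      using idx_tower[of U ?U V] sub Suc.prems subspace_add_subgroup idx_span_insert[OF Suc.prems(1) v(2)]
      by simp
    have "0 < idx V ?U \<and> idx V ?U \<le> CARD('k) ^ m"
    proof (rule Suc.IH[OF subspace_span Suc.prems(2) sub(2)])
      fix z :: "nat \<Rightarrow> 'b" assume z: "\<And>j. j \<le> m \<Longrightarrow> z j \<in> V"
      let ?z = "z(Suc m := v)"
      have "?z j \<in> V" if "j \<le> Suc m" for j using z v that by (auto simp: le_Suc_eq)
      then obtain c where c: "\<exists>j\<le>Suc m. c j \<noteq> 0" "(\<Sum>j\<le>Suc m. scale (c j) (?z j)) \<in> U"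
        using Suc.prems(4)[of ?z] by blast
      have "(\<Sum>j\<le>m. scale (c j) (?z j)) = (\<Sum>j\<le>m. scale (c j) (z j))"
        by (rule sum.cong) auto
      then have s: "(\<Sum>j\<le>m. scale (c j) (z j)) + scale (c (Suc m)) v \<in> U" using c(2) by simp
      then have "(\<Sum>j\<le>m. scale (c j) (z j)) - scale (- c (Suc m)) v \<in> U" by simp
      then have "(\<Sum>j\<le>m. scale (c j) (z j)) \<in> ?U" unfolding sp by blast
      moreover have "\<exists>j\<le>m. c j \<noteq> 0"
      proof (rule ccontr)
        assume n: "\<not> (\<exists>j\<le>m. c j \<noteq> 0)"
        then have "(\<Sum>j\<le>m. scale (c j) (z j)) = 0" by simp
        moreover have "c (Suc m) \<noteq> 0" using c(1) n by (auto simp: le_Suc_eq)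
        ultimately show False using s v(2)
          subspace_scale[OF Suc.prems(1), of "scale (c (Suc m)) v" "inverse (c (Suc m))"] by simp
      qed
      ultimately show "\<exists>c. (\<exists>j\<le>m. c j \<noteq> 0) \<and> (\<Sum>j\<le>m. scale (c j) (z j)) \<in> ?U" by blast
    qed
    then show ?thesis using t by (simp add: mult.commute)
  qed
qed

lemma card_subspace:
  assumes "subspace L" "finite L" shows "card L = CARD('k) ^ dim L"
proof -
  have s: "subspace {0}" by simp
  have "0 < card L" using assms subspace_0 card_gt_0_iff by fastforce
  then obtain B where B: "cobasis L {0} B"
    using cobasis_exists[OF s assms(1)] idx_trivial[of L] assms(1) subspace_0 by auto
  have "independent B"
    using cobasis_independent[OF B] cobasis_finite[OF B] by (intro independent_if_scalars_zero) auto
  moreover have "L \<subseteq> span B"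
  proof
    fix v assume "v \<in> L"
    from cobasis_spans[OF B this] obtain c where "v = (\<Sum>b\<in>B. scale (c b) b)" by auto
    moreover have "(\<Sum>b\<in>B. scale (c b) b) \<in> span B" by (intro span_sum span_scale span_base)
    ultimately show "v \<in> span B" by simp
  qed
  ultimately have "dim L = card B" using B dim_unique[of B L "card B"] by (auto simp: cobasis_def)
  then show ?thesis using cobasis_card[OF s assms(1) B] by (simp add: idx_trivial)
qed

lemma independent_modulo_le:
  assumes U: "subspace U" and V: "subspace V" and "0 < idx V U" "finite B" "B \<subseteq> V"
    and ind: "\<And>c. (\<Sum>b\<in>B. scale (c b) b) \<in> U \<Longrightarrow> (\<forall>b\<in>B. c b = 0)"
  shows "CARD('k) ^ card B \<le> idx V U"
proof -
  let ?s = "\<lambda>c. \<Sum>b\<in>B. scale (c b) b"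
  have "inj_on (\<lambda>c. coset U (?s c)) (PiE B (\<lambda>_. UNIV))"
    by (rule inj_on_combinations[OF U]) (use ind in blast)
  then have "card (PiE B (\<lambda>_. UNIV :: 'k set)) = card ((\<lambda>c. coset U (?s c)) ` (PiE B (\<lambda>_. UNIV)))"
    by (simp add: card_image)
  also have "\<dots> \<le> card (coset U ` V)"
  proof (rule card_mono)
    show "finite (coset U ` V)" using \<open>0 < idx V U\<close> unfolding idx_def by (rule card_ge_0_finite)
    have "?s c \<in> V" for c
      using \<open>B \<subseteq> V\<close> by (intro subspace_sum[OF V] subspace_scale[OF V]) auto
    then show "(\<lambda>c. coset U (?s c)) ` (PiE B (\<lambda>_. UNIV)) \<subseteq> coset U ` V" by auto
  qed
  finally show ?thesis using assms(4) by (simp add: idx_def card_PiE)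
qed

end


section \<open>Algebraic dependence over polynomials in one element\<close>

lemma card_degree_le:
  "finite {p::'k::{field,finite} poly. degree p \<le> e} \<and> card {p::'k poly. degree p \<le> e} = CARD('k) ^ (e + 1)"
proof (induction e)
  case 0
  have eq: "{p::'k poly. degree p \<le> 0} = (\<lambda>a. [:a:]) ` UNIV"
    by (auto simp: degree_eq_zeroE elim: degree_eq_zeroE)
  show ?case unfolding eq by (simp add: card_image inj_on_def)
next
  case (Suc e)
  have eq: "{p::'k poly. degree p \<le> Suc e} = (\<lambda>(a,p). pCons a p) ` (UNIV \<times> {p. degree p \<le> e})"
  proof (intro equalityI subsetI)
    fix p :: "'k poly" assume p: "p \<in> {p. degree p \<le> Suc e}"
    obtain a q where "p = pCons a q" by (cases p)
    then show "p \<in> (\<lambda>(a,p). pCons a p) ` (UNIV \<times> {p. degree p \<le> e})"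
      using p by (auto simp: degree_pCons_eq_if split: if_splits)
  qed (auto simp: degree_pCons_eq_if)
  have "inj_on (\<lambda>(a,p). pCons a p) (UNIV \<times> {p::'k poly. degree p \<le> e})" by (auto simp: inj_on_def)
  then show ?case unfolding eq using Suc by (simp add: card_image card_cartesian_product)
qed

lemma card_polynomial_families:
  assumes "finite I"
  shows "card (PiE I (\<lambda>_. {p::'k::{field,finite} poly. degree p \<le> l})) = CARD('k) ^ ((l + 1) * card I)"
proof -
  have "card (PiE I (\<lambda>_. {p::'k poly. degree p \<le> l})) = (CARD('k) ^ (l + 1)) ^ card I"
    using assms card_degree_le[of l, where ?'k='k] by (simp add: card_PiE)
  then show ?thesis by (simp only: power_mult)
qed

context function_field
begin

lemma \<iota>_0 [simp]: "\<iota> 0 = 0"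
proof -
  have "\<iota> 0 + \<iota> 0 = \<iota> 0 + 0" using add[of 0 0] by (simp only: Groups.add_0_right)
  then show ?thesis by (rule add_left_imp_eq)
qed

lemma \<iota>_1 [simp]: "\<iota> 1 = 1" by (rule one)

lemma \<iota>_minus: "\<iota> (- a) = - \<iota> a"
  using add[of a "-a"] by (simp add: eq_neg_iff_add_eq_0 add.commute)

lemma \<iota>_diff: "\<iota> (a - b) = \<iota> a - \<iota> b"
  using add[of a "-b"] by (simp add: \<iota>_minus)

lemma \<iota>_eq_0_iff [simp]: "\<iota> a = 0 \<longleftrightarrow> a = 0"
proof
  assume "\<iota> a = 0"
  then show "a = 0" using mult[of a "inverse a"] one by (cases "a = 0") auto
qed simp

lemma \<iota>_eq_iff [simp]: "\<iota> a = \<iota> b \<longleftrightarrow> a = b"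
  using \<iota>_eq_0_iff[of "a - b"] by (simp add: \<iota>_diff)

lemma \<iota>_inverse: "\<iota> (inverse a) = inverse (\<iota> a)"
  using mult[of a "inverse a"] by (cases "a = 0") (auto simp: field_simps)

sublocale FV: finite_scalars "\<lambda>c (x::'f). \<iota> c * x"
  by unfold_locales (auto simp: algebra_simps add mult)

sublocale AV: finite_scalars "\<lambda>c (a::'f set \<Rightarrow> 'f) Q. \<iota> c * a Q"
  by unfold_locales (auto simp: algebra_simps add mult fun_eq_iff)

lemma poly_at_0 [simp]: "poly_at \<iota> 0 x = 0" by (simp add: poly_at_def)

lemma poly_at_pCons [simp]: "poly_at \<iota> (pCons a p) x = \<iota> a + x * poly_at \<iota> p x"
  by (simp add: poly_at_def map_poly_pCons)

lemma poly_at_1 [simp]: "poly_at \<iota> 1 x = 1" using poly_at_pCons[of 1 0 x] by (simp add: one_pCons)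

lemma poly_at_add [simp]: "poly_at \<iota> (p + q) x = poly_at \<iota> p x + poly_at \<iota> q x"
  by (induction p q rule: poly_induct2) (auto simp: algebra_simps add)

lemma poly_at_minus [simp]: "poly_at \<iota> (- p) x = - poly_at \<iota> p x"
  by (induction p) (auto simp: algebra_simps \<iota>_minus)

lemma poly_at_diff [simp]: "poly_at \<iota> (p - q) x = poly_at \<iota> p x - poly_at \<iota> q x"
  using poly_at_add[of p "-q" x] by simp

lemma poly_at_smult [simp]: "poly_at \<iota> (smult a p) x = \<iota> a * poly_at \<iota> p x"
  by (induction p) (auto simp: algebra_simps mult)

lemma poly_at_mult [simp]: "poly_at \<iota> (p * q) x = poly_at \<iota> p x * poly_at \<iota> q x"
  by (induction p) (auto simp: algebra_simps)

lemma poly_at_monom: "poly_at \<iota> (monom c n) x = \<iota> c * x ^ n"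
  by (induction n) (auto simp: monom_0 monom_Suc algebra_simps)

lemma poly_at_sum: "poly_at \<iota> (sum f A) x = (\<Sum>i\<in>A. poly_at \<iota> (f i) x)"
  by (induction A rule: infinite_finite_induct) auto

lemma poly_at_altdef:
  assumes "degree p \<le> n" shows "poly_at \<iota> p x = (\<Sum>i\<le>n. \<iota> (coeff p i) * x ^ i)"
  using poly_at_sum[of "\<lambda>i. monom (coeff p i) i" "{..n}" x] poly_as_sum_of_monoms'[OF assms]
  by (simp add: poly_at_monom)

lemma poly_at_split: "poly_at \<iota> p x = \<iota> (coeff p 0) + x * poly_at \<iota> (poly_shift 1 p) x"
proof -
  have "p = pCons (coeff p 0) (poly_shift 1 p)"
    by (rule poly_eqI) (auto simp: coeff_poly_shift coeff_pCons split: nat.split)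
  then show ?thesis using poly_at_pCons[of "coeff p 0" "poly_shift 1 p" x] by simp
qed

text \<open>For transcendental \<open>y\<close> this says that the function field has degree at most \<open>m\<close> over \<open>k(y)\<close>,
  with denominators cleared.\<close>

definition dep :: "'f \<Rightarrow> nat \<Rightarrow> bool" where
  "dep y m \<longleftrightarrow> (\<forall>z::nat \<Rightarrow> 'f. \<exists>p::nat \<Rightarrow> 'k poly.
     (\<exists>j\<le>m. p j \<noteq> 0) \<and> (\<Sum>j\<le>m. poly_at \<iota> (p j) y * z j) = 0)"

text \<open>
  This is finiteness of the degree of the function field over \<open>k(y)\<close>, proved by the pigeonhole
  principle. Written with denominators in a fixed transcendental element, the combinations
  of \<open>m + 1\<close> given elements with polynomials in \<open>y\<close> of degree at most \<open>l\<close> as coefficients fall into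
  a space whose dimension grows like \<open>d n l\<close>, where \<open>d\<close> depends on \<open>y\<close> only and \<open>n\<close> is the size of a
  spanning set, while the number of coefficients grows like \<open>(m + 1) l\<close>.
\<close>

lemma dep_exists: "\<exists>m. dep y m"
proof -
  obtain x B where B: "finite B"
    and gen: "\<And>f. \<exists>c. (\<forall>b\<in>B. c b \<in> rational_subfield \<iota> x) \<and> f = (\<Sum>b\<in>B. c b * b)"
    using one_variable by meson
  define n where "n = card B"
  define M where "M = (\<lambda>e. {\<Sum>b\<in>B. poly_at \<iota> (c b) x * b | c. \<forall>b\<in>B. degree (c b) \<le> e})"
  have MI: "(\<Sum>b\<in>B. poly_at \<iota> (c b) x * b) \<in> M e" if "\<forall>b\<in>B. degree (c b) \<le> e" for c e
    using that unfolding M_def by blast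
  have ME: "\<exists>c. (\<forall>b\<in>B. degree (c b) \<le> e) \<and> f = (\<Sum>b\<in>B. poly_at \<iota> (c b) x * b)" if "f \<in> M e" for f e
    using that unfolding M_def by blast
  have M0: "0 \<in> M e" for e using MI[of "\<lambda>_. 0" e] by simp
  have Madd: "f + g \<in> M e" if fg: "f \<in> M e" "g \<in> M e" for f g e
  proof -
    from ME[OF fg(1)] obtain c
      where "\<forall>b\<in>B. degree (c b) \<le> e" "f = (\<Sum>b\<in>B. poly_at \<iota> (c b) x * b)" by auto
    moreover from ME[OF fg(2)] obtain d
      where "\<forall>b\<in>B. degree (d b) \<le> e" "g = (\<Sum>b\<in>B. poly_at \<iota> (d b) x * b)" by auto
    ultimately show ?thesis using MI[of "\<lambda>b. c b + d b" e]
      by (simp add: sum.distrib[symmetric] algebra_simps degree_add_le)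
  qed
  have Msum: "sum f I \<in> M e" if "\<And>i. i \<in> I \<Longrightarrow> f i \<in> M e" for f and I :: "'i set" and e
    using that by (induction I rule: infinite_finite_induct) (auto simp: M0 Madd)
  have Mpoly: "poly_at \<iota> r x * f \<in> M (e + d)" if f: "f \<in> M e" and r: "degree r \<le> d" for f e r d
  proof -
    from ME[OF f] obtain c where c: "\<forall>b\<in>B. degree (c b) \<le> e" "f = (\<Sum>b\<in>B. poly_at \<iota> (c b) x * b)" by auto
    have "degree (r * c b) \<le> e + d" if "b \<in> B" for b
      using degree_mult_le[of r "c b"] c(1) r that by fastforce
    then have "(\<Sum>b\<in>B. poly_at \<iota> (r * c b) x * b) \<in> M (e + d)" by (intro MI) auto
    then show ?thesis using c by (simp add: sum_distrib_left mult.assoc)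
  qed
  have Mmono: "f \<in> M e'" if "f \<in> M e" "e \<le> e'" for f e e'
    using Mpoly[of f e 1 "e' - e"] that by simp
  have Mscale: "\<iota> a * f \<in> M e" if "f \<in> M e" for a f e
    using Mpoly[of f e "[:a:]" 0] that by simp
  have Mcard: "finite (M e) \<and> card (M e) \<le> CARD('k) ^ ((e + 1) * n)" for e
  proof -
    let ?E = "PiE B (\<lambda>_. {p::'k poly. degree p \<le> e})"
    have "M e \<subseteq> (\<lambda>c. \<Sum>b\<in>B. poly_at \<iota> (c b) x * b) ` ?E"
    proof
      fix f assume "f \<in> M e"
      from ME[OF this] obtain c where c: "\<forall>b\<in>B. degree (c b) \<le> e" "f = (\<Sum>b\<in>B. poly_at \<iota> (c b) x * b)"
        by auto
      then show "f \<in> (\<lambda>c. \<Sum>b\<in>B. poly_at \<iota> (c b) x * b) ` ?E"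
        by (intro image_eqI[of _ _ "restrict c B"]) auto
    qed
    moreover have fin: "finite ?E" using B card_degree_le[of e] by (intro finite_PiE) auto
    ultimately have "finite (M e) \<and> card (M e) \<le> card ?E"
      by (auto intro: finite_subset surj_card_le)
    then show ?thesis using card_polynomial_families[OF B, of e, where ?'k='k] by (simp only: n_def simp_thms)
  qed
  \<comment> \<open>The elements with a denominator in \<open>k[x]\<close>; by the choice of \<open>B\<close> these are all.\<close>
  define E where "E = {z. \<exists>r e. poly_at \<iota> r x \<noteq> 0 \<and> poly_at \<iota> r x * z \<in> M e}"
  have Eadd: "z + w \<in> E" if zw: "z \<in> E" "w \<in> E" for z w
  proof -
    obtain r e s d where rs: "poly_at \<iota> r x \<noteq> 0" "poly_at \<iota> r x * z \<in> M e"
      "poly_at \<iota> s x \<noteq> 0" "poly_at \<iota> s x * w \<in> M d" using zw unfolding E_def by blast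
    let ?e = "max (e + degree s) (d + degree r)"
    have "poly_at \<iota> s x * (poly_at \<iota> r x * z) \<in> M ?e" "poly_at \<iota> r x * (poly_at \<iota> s x * w) \<in> M ?e"
      using Mpoly[OF rs(2) order.refl, of s] Mpoly[OF rs(4) order.refl, of r] by (auto elim: Mmono)
    then have "poly_at \<iota> (r * s) x * (z + w) \<in> M ?e" using Madd by (simp add: algebra_simps)
    then show ?thesis using rs unfolding E_def by (auto intro!: exI[of _ "r * s"])
  qed
  have E: "z \<in> E" for z
  proof -
    obtain c where c: "\<And>b. b \<in> B \<Longrightarrow> c b \<in> rational_subfield \<iota> x" "z = (\<Sum>b\<in>B. c b * b)"
      using gen[of z] by auto
    have t: "c b * b \<in> E" if b: "b \<in> B" for b
    proof -
      obtain p q where pq: "c b = poly_at \<iota> p x / poly_at \<iota> q x" "poly_at \<iota> q x \<noteq> 0"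
        using c(1)[OF b] unfolding rational_subfield_def by blast
      have "(\<Sum>b'\<in>B. poly_at \<iota> (if b' = b then p else 0) x * b') \<in> M (degree p)" by (rule MI) auto
      also have "(\<Sum>b'\<in>B. poly_at \<iota> (if b' = b then p else 0) x * b')
          = (\<Sum>b'\<in>B. if b' = b then poly_at \<iota> p x * b' else 0)" by (rule sum.cong) auto
      also have "\<dots> = poly_at \<iota> q x * (c b * b)" using B b pq by simp
      finally show ?thesis using pq unfolding E_def by blast
    qed
    have "0 \<in> E" unfolding E_def using M0 by (auto intro!: exI[of _ 1])
    then have "(\<Sum>b\<in>S. c b * b) \<in> E" if "S \<subseteq> B" for S
      using that by (induction S rule: infinite_finite_induct) (auto simp: t Eadd)
    then show ?thesis using c by simp
  qed
  have Efin: "\<exists>r e. poly_at \<iota> r x \<noteq> 0 \<and> (\<forall>z\<in>Z. poly_at \<iota> r x * z \<in> M e)" if "finite Z" for Z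
    using that
  proof induction
    case empty
    then show ?case by (auto intro!: exI[of _ 1])
  next
    case (insert w Z)
    then obtain s d where s: "poly_at \<iota> s x \<noteq> 0" "\<forall>z\<in>Z. poly_at \<iota> s x * z \<in> M d" by blast
    obtain r e where r: "poly_at \<iota> r x \<noteq> 0" "poly_at \<iota> r x * w \<in> M e" using E[of w] unfolding E_def by blast
    let ?e = "max (e + degree s) (d + degree r)"
    have "poly_at \<iota> (r * s) x * w \<in> M ?e"
      using Mpoly[OF r(2) order.refl, of s] by (simp add: mult_ac) (auto elim: Mmono)
    moreover have "poly_at \<iota> (r * s) x * z \<in> M ?e" if "z \<in> Z" for z
      using Mpoly[OF s(2)[rule_format, OF that] order.refl, of r] by (simp add: mult_ac) (auto elim: Mmono)
    ultimately have "\<forall>z\<in>insert w Z. poly_at \<iota> (r * s) x * z \<in> M ?e" by blast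
    moreover have "poly_at \<iota> (r * s) x \<noteq> 0" using r s by simp
    ultimately show ?case by blast
  qed
  obtain r d0 where r: "poly_at \<iota> r x \<noteq> 0" "\<forall>z\<in>(\<lambda>b. y * b) ` B. poly_at \<iota> r x * z \<in> M d0"
    using Efin[of "(\<lambda>b. y * b) ` B"] B by blast
  define d where "d = max d0 (degree r)"
  define Q where "Q = poly_at \<iota> r x"
  have Q0: "Q \<noteq> 0" using r by (simp add: Q_def)
  have Qf: "Q * f \<in> M (e + d)" if "f \<in> M e" for f e
    using Mpoly[OF that, of r d] by (simp add: Q_def d_def)
  have Qyf: "Q * (y * f) \<in> M (e + d)" if "f \<in> M e" for f e
  proof -
    from ME[OF that] obtain c where c: "\<forall>b\<in>B. degree (c b) \<le> e" "f = (\<Sum>b\<in>B. poly_at \<iota> (c b) x * b)" by auto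
    have "Q * (y * b) \<in> M d" if "b \<in> B" for b
      using r(2) that by (intro Mmono[of _ d0 d]) (auto simp: Q_def d_def)
    then have "(\<Sum>b\<in>B. poly_at \<iota> (c b) x * (Q * (y * b))) \<in> M (d + e)"
      using c by (intro Msum Mpoly) auto
    then show ?thesis using c by (simp add: sum_distrib_left mult_ac add.commute)
  qed
  have Qyi: "Q ^ l * (y ^ i * f) \<in> M (e + d * l)" if f: "f \<in> M e" and "i \<le> l" for f e i l
    using \<open>i \<le> l\<close>
  proof (induction l arbitrary: i)
    case 0
    then show ?case using f by simp
  next
    case (Suc l)
    show ?case
    proof (cases i)
      case 0
      then show ?thesis using Qf[OF Suc.IH[of 0]] by (simp add: mult_ac add_ac)
    next
      case (Suc i')
      then show ?thesis using Qyf[OF Suc.IH[of i']] Suc.prems by (simp add: mult_ac add_ac)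
    qed
  qed
  \<comment> \<open>\<open>Q\<close> clears the denominators of \<open>y\<close>, each factor \<open>y\<close> raising degrees by at most \<open>d\<close>.\<close>
  define m where "m = d * n"
  have "\<exists>p::nat \<Rightarrow> 'k poly. (\<exists>j\<le>m. p j \<noteq> 0) \<and> (\<Sum>j\<le>m. poly_at \<iota> (p j) y * z j) = 0" for z :: "nat \<Rightarrow> 'f"
  proof -
    obtain s e where s: "poly_at \<iota> s x \<noteq> 0" "\<forall>w\<in>z ` {..m}. poly_at \<iota> s x * w \<in> M e"
      using Efin[of "z ` {..m}"] by blast
    define R where "R = poly_at \<iota> s x"
    \<comment> \<open>Large enough for \<open>(e + d l + 1) n < (l + 1) (d n + 1)\<close>.\<close>
    define l where "l = (e + 1) * n"
    let ?E = "PiE {..m} (\<lambda>_. {p::'k poly. degree p \<le> l})"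
    define \<Phi> where "\<Phi> = (\<lambda>p. Q ^ l * R * (\<Sum>j\<le>m. poly_at \<iota> (p j) y * z j))"
    have img: "\<Phi> ` ?E \<subseteq> M (e + d * l)"
    proof
      fix g assume "g \<in> \<Phi> ` ?E"
      then obtain p where p: "p \<in> ?E" "g = \<Phi> p" by auto
      have "g = (\<Sum>j\<le>m. \<Sum>i\<le>l. \<iota> (coeff (p j) i) * (Q ^ l * (y ^ i * (R * z j))))"
        unfolding p(2) \<Phi>_def sum_distrib_left
      proof (rule sum.cong[OF refl])
        fix j assume "j \<in> {..m}"
        then have "degree (p j) \<le> l" using p(1) by auto
        then show "Q ^ l * R * (poly_at \<iota> (p j) y * z j) = (\<Sum>i\<le>l. \<iota> (coeff (p j) i) * (Q ^ l * (y ^ i * (R * z j))))"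
          by (simp add: poly_at_altdef sum_distrib_left sum_distrib_right mult_ac)
      qed
      also have "\<dots> \<in> M (e + d * l)"
        using s by (intro Msum Mscale Qyi) (auto simp: R_def)
      finally show "g \<in> M (e + d * l)" .
    qed
    have "card ?E = CARD('k) ^ ((l + 1) * (m + 1))"
      by (simp only: card_polynomial_families[OF finite_atMost] card_atMost Suc_eq_plus1)
    moreover have "card (M (e + d * l)) \<le> CARD('k) ^ ((e + d * l + 1) * n)" using Mcard by blast
    moreover have "(e + d * l + 1) * n < (l + 1) * (m + 1)"
      by (simp add: m_def l_def algebra_simps)
    then have "CARD('k) ^ ((e + d * l + 1) * n) < CARD('k) ^ ((l + 1) * (m + 1))"
      using FV.power_card_less_iff by blast
    ultimately have "card (M (e + d * l)) < card ?E" by linarith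
    moreover have "card (\<Phi> ` ?E) \<le> card (M (e + d * l))" using Mcard img by (intro card_mono) auto
    ultimately have "\<not> inj_on \<Phi> ?E" using card_image[of \<Phi> ?E] by auto
    then obtain p p' where pp: "p \<in> ?E" "p' \<in> ?E" "p \<noteq> p'" "\<Phi> p = \<Phi> p'" unfolding inj_on_def by blast
    have "R \<noteq> 0" using s by (simp add: R_def)
    then have "(\<Sum>j\<le>m. poly_at \<iota> (p j - p' j) y * z j) = 0"
      using pp(4) Q0 by (simp add: \<Phi>_def left_diff_distrib sum_subtractf)
    moreover have "\<exists>j\<le>m. p j - p' j \<noteq> 0"
    proof (rule ccontr)
      assume "\<not> ?thesis"
      then have "p = p'" by (intro PiE_ext[OF pp(1,2)]) auto
      then show False using pp(3) by simp
    qed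
    ultimately show ?thesis by (intro exI[of _ "\<lambda>j. p j - p' j"]) simp
  qed
  then show ?thesis unfolding dep_def by blast
qed

text \<open>As \<open>y \<noteq> 0\<close>, a common factor \<open>y\<close> of the coefficients can be cancelled.\<close>

lemma dep_normalized:
  assumes "dep y m" "y \<noteq> 0"
  shows "\<exists>p::nat \<Rightarrow> 'k poly. (\<exists>j\<le>m. coeff (p j) 0 \<noteq> 0) \<and> (\<Sum>j\<le>m. poly_at \<iota> (p j) y * z j) = 0"
proof -
  have "\<exists>p::nat \<Rightarrow> 'k poly. (\<exists>j\<le>m. coeff (p j) 0 \<noteq> 0) \<and> (\<Sum>j\<le>m. poly_at \<iota> (p j) y * z j) = 0"
    if "\<exists>j\<le>m. p j \<noteq> 0" "(\<Sum>j\<le>m. poly_at \<iota> (p j) y * z j) = 0" for p :: "nat \<Rightarrow> 'k poly"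
    using that
  proof (induction "\<Sum>j\<le>m. degree (p j)" arbitrary: p rule: less_induct)
    case less
    show ?case
    proof (cases "\<exists>j\<le>m. coeff (p j) 0 \<noteq> 0")
      case True
      then show ?thesis using less.prems by blast
    next
      case False
      define p' where "p' = (\<lambda>j. SOME q. p j = pCons 0 q)"
      have p': "p j = pCons 0 (p' j)" if "j \<le> m" for j
      proof -
        obtain a q where aq: "p j = pCons a q" by (cases "p j")
        then have "a = 0" using False that by auto
        then show ?thesis unfolding p'_def using aq someI[of "\<lambda>q. p j = pCons 0 q" q] by simp
      qed
      obtain j where j: "j \<le> m" "p j \<noteq> 0" using less.prems by blast
      have "(\<Sum>j\<le>m. degree (p' j)) < (\<Sum>j\<le>m. degree (p j))"
      proof (rule sum_strict_mono_ex1)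
        show "\<forall>i\<in>{..m}. degree (p' i) \<le> degree (p i)" using p' by (auto simp: degree_pCons_eq_if)
        show "\<exists>i\<in>{..m}. degree (p' i) < degree (p i)" using p'[OF j(1)] j
          by (intro bexI[of _ j]) (auto simp: degree_pCons_eq_if)
      qed simp
      moreover have "\<exists>j\<le>m. p' j \<noteq> 0" using p'[OF j(1)] j by (intro exI[of _ j]) auto
      moreover have "(\<Sum>j\<le>m. poly_at \<iota> (p j) y * z j) = y * (\<Sum>j\<le>m. poly_at \<iota> (p' j) y * z j)"
        unfolding sum_distrib_left by (rule sum.cong) (auto simp: p')
      then have "(\<Sum>j\<le>m. poly_at \<iota> (p' j) y * z j) = 0" using less.prems assms(2) by simp
      ultimately show ?thesis by (rule less.hyps)
    qed
  qed
  then show ?thesis using assms(1) unfolding dep_def by blast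
qed

text \<open>
  A relation with coefficients in \<open>k[x]\<close>, not all divisible by \<open>x\<close>, turns into a \<open>k\<close>-linear
  relation modulo \<open>x\<close>. Hence the degree over \<open>k(x)\<close> bounds the quotient by \<open>x\<close> of every subring
  that contains \<open>k[x]\<close>.
\<close>

lemma idx_multiples_le:
  assumes R: "FV.subspace R" "\<And>a b. a \<in> R \<Longrightarrow> b \<in> R \<Longrightarrow> a * b \<in> R" "1 \<in> R"
    and x: "x \<in> R" "x \<noteq> 0" and m: "dep x m"
  shows "0 < idx R ((\<lambda>a. x * a) ` R) \<and> idx R ((\<lambda>a. x * a) ` R) \<le> CARD('k) ^ m"
proof (rule FV.idx_le_power)
  have p: "poly_at \<iota> p x \<in> R" for p
  proof (induction p)
    case (pCons a p)
    then show ?case using R x FV.subspace_scale[OF R(1,3), of a] by (simp add: FV.subspace_add)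
  qed (use R in \<open>simp add: FV.subspace_0\<close>)
  show "FV.subspace ((\<lambda>a. x * a) ` R)"
  proof (rule FV.subspaceI)
    show "0 \<in> (\<lambda>a. x * a) ` R" using FV.subspace_0[OF R(1)] by force
    fix a b assume "a \<in> (\<lambda>a. x * a) ` R" "b \<in> (\<lambda>a. x * a) ` R"
    then obtain u v where "a = x * u" "b = x * v" "u \<in> R" "v \<in> R" by auto
    then show "a + b \<in> (\<lambda>a. x * a) ` R"
      by (intro image_eqI[of _ _ "u + v"]) (auto simp: algebra_simps FV.subspace_add[OF R(1)])
  next
    fix c a assume "a \<in> (\<lambda>a. x * a) ` R"
    then obtain u where "a = x * u" "u \<in> R" by auto
    then show "\<iota> c * a \<in> (\<lambda>a. x * a) ` R"
      by (intro image_eqI[of _ _ "\<iota> c * u"]) (simp_all add: FV.subspace_scale[OF R(1)])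
  qed
  show "FV.subspace R" "(\<lambda>a. x * a) ` R \<subseteq> R" using R x by auto
  fix z :: "nat \<Rightarrow> 'f" assume z: "\<And>j. j \<le> m \<Longrightarrow> z j \<in> R"
  obtain p :: "nat \<Rightarrow> 'k poly" where p0: "\<exists>j\<le>m. coeff (p j) 0 \<noteq> 0"
    and rel: "(\<Sum>j\<le>m. poly_at \<iota> (p j) x * z j) = 0"
    using dep_normalized[OF m x(2)] by blast
  define q where "q = (\<lambda>j. poly_shift 1 (p j))"
  have "poly_at \<iota> (p j) x = \<iota> (coeff (p j) 0) + x * poly_at \<iota> (q j) x" for j
    unfolding q_def by (rule poly_at_split)
  then have "(\<Sum>j\<le>m. \<iota> (coeff (p j) 0) * z j) + x * (\<Sum>j\<le>m. poly_at \<iota> (q j) x * z j) = 0"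
    using rel by (simp add: algebra_simps sum.distrib sum_distrib_left)
  then have "(\<Sum>j\<le>m. \<iota> (coeff (p j) 0) * z j) = x * (- (\<Sum>j\<le>m. poly_at \<iota> (q j) x * z j))"
    by (simp add: eq_neg_iff_add_eq_0)
  moreover have "- (\<Sum>j\<le>m. poly_at \<iota> (q j) x * z j) \<in> R"
    using z by (intro FV.subspace_neg FV.subspace_sum R p) auto
  ultimately have "(\<Sum>j\<le>m. \<iota> (coeff (p j) 0) * z j) \<in> (\<lambda>a. x * a) ` R" by (rule image_eqI)
  with p0 show "\<exists>c. (\<exists>j\<le>m. c j \<noteq> 0) \<and> (\<Sum>j\<le>m. \<iota> (c j) * z j) \<in> (\<lambda>a. x * a) ` R"
    by (intro exI[of _ "\<lambda>j. coeff (p j) 0"]) simp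
qed

end


section \<open>Places are discrete valuation rings\<close>

definition place_unit :: "'f::field set \<Rightarrow> 'f \<Rightarrow> bool" where
  "place_unit P u \<longleftrightarrow> u \<in> P - max_ideal P"

text \<open>The functions with at least an \<open>n\<close>-fold zero at \<open>P\<close>, the function 0 included.\<close>

definition ordset :: "'f::field set \<Rightarrow> int \<Rightarrow> 'f set" where
  "ordset P n = {z. z = 0 \<or> n \<le> place_val P z}"

context function_field
begin

lemma place_const: "place \<iota> P \<Longrightarrow> \<iota> c \<in> P"
  and place_diff: "place \<iota> P \<Longrightarrow> x \<in> P \<Longrightarrow> y \<in> P \<Longrightarrow> x - y \<in> P"
  and place_mult: "place \<iota> P \<Longrightarrow> x \<in> P \<Longrightarrow> y \<in> P \<Longrightarrow> x * y \<in> P"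
  and place_inverse: "place \<iota> P \<Longrightarrow> z \<notin> P \<Longrightarrow> inverse z \<in> P"
  by (auto simp: place_def)

lemma place_0: "place \<iota> P \<Longrightarrow> 0 \<in> P" using place_const[of P 0] by simp
lemma place_1: "place \<iota> P \<Longrightarrow> 1 \<in> P" using place_const[of P 1] by simp

lemma place_add: assumes "place \<iota> P" "x \<in> P" "y \<in> P" shows "x + y \<in> P"
  using place_diff[OF assms(1,2) place_diff[OF assms(1) place_0[OF assms(1)] assms(3)]] by simp

lemma place_power: "place \<iota> P \<Longrightarrow> x \<in> P \<Longrightarrow> x ^ n \<in> P"
  by (induction n) (auto simp: place_1 place_mult)

lemma place_poly_at: "place \<iota> P \<Longrightarrow> x \<in> P \<Longrightarrow> poly_at \<iota> p x \<in> P"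
  by (induction p) (auto simp: place_0 place_add place_mult place_const)

lemma place_subspace: "place \<iota> P \<Longrightarrow> FV.subspace P"
  by (rule FV.subspaceI) (auto simp: place_0 place_add place_mult place_const)

lemma max_ideal_subset: "max_ideal P \<subseteq> P" by (auto simp: max_ideal_def)

lemma zero_in_max_ideal: "place \<iota> P \<Longrightarrow> 0 \<in> max_ideal P" by (simp add: max_ideal_def place_0)

lemma max_ideal_mult:
  assumes P: "place \<iota> P" and x: "x \<in> max_ideal P" and w: "w \<in> P" shows "x * w \<in> max_ideal P"
proof (cases "x * w = 0")
  case False
  have "inverse (x * w) \<notin> P"
  proof
    assume "inverse (x * w) \<in> P"
    then have "w * inverse (x * w) \<in> P" by (intro place_mult P w)
    then have "inverse x \<in> P" using False by (simp add: field_simps)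
    then show False using x False by (simp add: max_ideal_def)
  qed
  then show ?thesis using x w by (simp add: max_ideal_def place_mult[OF P])
qed (auto simp: zero_in_max_ideal[OF P])

lemma one_notin_max_ideal: "place \<iota> P \<Longrightarrow> 1 \<notin> max_ideal P" by (simp add: max_ideal_def place_1)

lemma const_in_max_ideal: assumes P: "place \<iota> P" and "\<iota> c \<in> max_ideal P" shows "c = 0"
proof (rule ccontr)
  assume "c \<noteq> 0"
  have "\<iota> c * \<iota> (inverse c) \<in> max_ideal P" by (intro max_ideal_mult assms place_const)
  then show False using \<open>c \<noteq> 0\<close> one_notin_max_ideal[OF P] by (simp add: mult[symmetric])
qed

lemma max_ideal_add:
  assumes P: "place \<iota> P" and x: "x \<in> max_ideal P" and y: "y \<in> max_ideal P" shows "x + y \<in> max_ideal P"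
proof (cases "x = 0 \<or> y = 0")
  case False
  show ?thesis
  proof (cases "x / y \<in> P")
    case True
    then have "y * (x / y + 1) \<in> max_ideal P" by (intro max_ideal_mult P y place_add place_1)
    then show ?thesis using False by (simp add: field_simps)
  next
    case f: False
    then have "y / x \<in> P" using place_inverse[OF P f] by simp
    then have "x * (1 + y / x) \<in> max_ideal P" by (intro max_ideal_mult P x place_add place_1)
    then show ?thesis using False by (simp add: field_simps)
  qed
qed (use x y in auto)

lemma max_ideal_subspace: assumes P: "place \<iota> P" shows "FV.subspace (max_ideal P)"
proof (rule FV.subspaceI)
  fix c x assume "x \<in> max_ideal P"
  then show "\<iota> c * x \<in> max_ideal P" using max_ideal_mult[OF P _ place_const[OF P]] by (metis mult.commute)
qed (auto simp: zero_in_max_ideal max_ideal_add P)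

lemma max_ideal_nonzero: assumes P: "place \<iota> P" obtains x where "x \<in> max_ideal P" "x \<noteq> 0"
proof -
  obtain z where z: "z \<notin> P" using P by (auto simp: place_def)
  then have "inverse z \<in> max_ideal P" using place_inverse[OF P z] by (simp add: max_ideal_def)
  moreover have "inverse z \<noteq> 0" using z place_0[OF P] by auto
  ultimately show ?thesis using that by blast
qed

lemma not_dvd_max_ideal:
  assumes P: "place \<iota> P" "w / z \<notin> P" shows "z / w \<in> max_ideal P"
  using place_inverse[OF assms] assms by (simp add: max_ideal_def)

text \<open>
  A chain of strict divisors of \<open>x\<close> is independent over \<open>k(x)\<close>: in a relation with coefficients
  in \<open>k[x]\<close>, not all divisible by \<open>x\<close>, the term of least order among those with a coefficient
  prime to \<open>x\<close> dominates all other terms.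
\<close>

lemma no_long_chain:
  assumes P: "place \<iota> P" and x: "x \<in> max_ideal P" "x \<noteq> 0" "dep x m"
    and z: "\<And>j. j \<le> m \<Longrightarrow> z j \<in> max_ideal P" "\<And>j. j \<le> m \<Longrightarrow> x / z j \<in> P" "\<And>j. j \<le> m \<Longrightarrow> z j \<noteq> 0"
    and chain: "\<And>i j. i < j \<Longrightarrow> j \<le> m \<Longrightarrow> z i / z j \<in> max_ideal P"
  shows False
proof -
  have xP: "x \<in> P" using x max_ideal_subset by blast
  obtain p :: "nat \<Rightarrow> 'k poly" where p: "\<exists>j\<le>m. coeff (p j) 0 \<noteq> 0"
    and rel: "(\<Sum>j\<le>m. poly_at \<iota> (p j) x * z j) = 0" using dep_normalized[OF x(3,2)] by blast
  define q where "q = (\<lambda>j. poly_shift 1 (p j))"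
  have px: "poly_at \<iota> (p j) x = \<iota> (coeff (p j) 0) + x * poly_at \<iota> (q j) x" for j
    unfolding q_def by (rule poly_at_split)
  define J where "J = {j. j \<le> m \<and> coeff (p j) 0 \<noteq> 0}"
  define j0 where "j0 = Max J"
  have J: "finite J" "J \<noteq> {}" using p by (auto simp: J_def)
  have j0: "j0 \<le> m" "coeff (p j0) 0 \<noteq> 0" using Max_in[OF J] by (auto simp: j0_def J_def)
  have other: "poly_at \<iota> (p i) x * z i / z j0 \<in> max_ideal P" if i: "i \<le> m" "i \<noteq> j0" for i
  proof (cases "coeff (p i) 0 = 0")
    case True
    have "z i * (poly_at \<iota> (q i) x * (x / z j0)) \<in> max_ideal P"
      by (intro max_ideal_mult z place_mult place_poly_at P xP i j0)
    then show ?thesis using px[of i] True by (simp add: mult_ac)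
  next
    case False
    then have "i \<le> j0" using i Max_ge[OF J(1), of i] unfolding j0_def by (simp add: J_def)
    then have "i < j0" using i by simp
    then have "(z i / z j0) * poly_at \<iota> (p i) x \<in> max_ideal P"
      by (intro max_ideal_mult chain place_poly_at P xP j0)
    then show ?thesis by (simp add: mult_ac)
  qed
  have "(\<Sum>j\<le>m. poly_at \<iota> (p j) x * z j) = poly_at \<iota> (p j0) x * z j0 + (\<Sum>j\<in>{..m}-{j0}. poly_at \<iota> (p j) x * z j)"
    using j0 by (simp add: sum.remove)
  then have "poly_at \<iota> (p j0) x * z j0 = - (\<Sum>j\<in>{..m}-{j0}. poly_at \<iota> (p j) x * z j)"
    using rel by (simp add: eq_neg_iff_add_eq_0)
  then have "poly_at \<iota> (p j0) x = - (\<Sum>j\<in>{..m}-{j0}. poly_at \<iota> (p j) x * z j / z j0)"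
    using z(3)[OF j0(1)] by (simp add: sum_divide_distrib[symmetric] field_simps)
  also have "\<dots> \<in> max_ideal P"
    using other by (intro FV.subspace_neg FV.subspace_sum max_ideal_subspace P) auto
  finally have "poly_at \<iota> (p j0) x \<in> max_ideal P" .
  moreover have "x * poly_at \<iota> (q j0) x \<in> max_ideal P" by (intro max_ideal_mult P x place_poly_at xP)
  ultimately have "poly_at \<iota> (p j0) x - x * poly_at \<iota> (q j0) x \<in> max_ideal P"
    by (intro FV.subspace_diff[OF max_ideal_subspace[OF P]])
  then show False using px[of j0] const_in_max_ideal[OF P] j0 by simp
qed

text \<open>Without a uniformizer every element of the maximal ideal has a proper divisor in it, and iterating
  this choice gives arbitrarily long chains.\<close>

lemma uniformizer_exists: assumes P: "place \<iota> P" obtains t where "uniformizer P t"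
proof (rule ccontr)
  assume "\<not> thesis"
  then have no: "\<not> uniformizer P t" for t using that by blast
  obtain x where x: "x \<in> max_ideal P" "x \<noteq> 0" using max_ideal_nonzero[OF P] by blast
  obtain m where m: "dep x m" using dep_exists by blast
  have step: "\<exists>w. w \<in> max_ideal P \<and> w \<noteq> 0 \<and> z / w \<in> max_ideal P" if z: "z \<in> max_ideal P" "z \<noteq> 0" for z
  proof -
    have "(\<lambda>u. z * u) ` P \<subseteq> max_ideal P" using max_ideal_mult[OF P z(1)] by auto
    then obtain w where w: "w \<in> max_ideal P" "w \<notin> (\<lambda>u. z * u) ` P"
      using no[of z] unfolding uniformizer_def by blast
    have "w / z \<notin> P" using w z by (auto simp: image_iff)
    moreover have "w \<noteq> 0" using w place_0[OF P] by (auto simp: image_iff)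
    ultimately show ?thesis using w not_dvd_max_ideal[OF P] by blast
  qed
  define s where "s = (\<lambda>z. SOME w. w \<in> max_ideal P \<and> w \<noteq> 0 \<and> z / w \<in> max_ideal P)"
  have s: "s z \<in> max_ideal P \<and> s z \<noteq> 0 \<and> z / s z \<in> max_ideal P" if "z \<in> max_ideal P" "z \<noteq> 0" for z
    unfolding s_def by (rule someI_ex) (rule step[OF that])
  define f where "f = (\<lambda>n. (s ^^ n) x)"
  have f: "f n \<in> max_ideal P \<and> f n \<noteq> 0" for n
    by (induction n) (use x s in \<open>auto simp: f_def\<close>)
  have fS: "f n / f (Suc n) \<in> max_ideal P" for n
    using s[of "f n"] f[of n] by (simp add: f_def)
  have fd: "f i / f (Suc (i + d)) \<in> max_ideal P" for i d
  proof (induction d)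
    case (Suc d)
    have "f i / f (Suc (i + d)) * (f (Suc (i + d)) / f (Suc (i + Suc d))) \<in> max_ideal P"
      using Suc fS[of "Suc (i + d)"] max_ideal_subset by (intro max_ideal_mult P) auto
    then show ?case using f[of "Suc (i + d)"] by simp
  qed (simp add: fS)
  have chain: "f i / f j \<in> max_ideal P" if "i < j" for i j
    using fd[of i "j - Suc i"] that by simp
  have "x / f j \<in> P" for j
    using chain[of 0 j] max_ideal_subset[of P] x place_1[OF P] by (cases "j = 0") (auto simp: f_def)
  then show False using no_long_chain[OF P x m, of f] f chain by blast
qed

lemma uniformizer_max_ideal: assumes "place \<iota> P" "uniformizer P t" shows "t \<in> max_ideal P" "t \<noteq> 0"
proof -
  show "t \<in> max_ideal P" using assms(2) place_1[OF assms(1)] unfolding uniformizer_def by force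
  obtain x where "x \<in> max_ideal P" "x \<noteq> 0" using max_ideal_nonzero[OF assms(1)] by blast
  then show "t \<noteq> 0" using assms(2) unfolding uniformizer_def by auto
qed

lemma place_unit_iff: "place \<iota> P \<Longrightarrow> place_unit P u \<longleftrightarrow> u \<noteq> 0 \<and> u \<in> P \<and> inverse u \<in> P"
  by (auto simp: place_unit_def max_ideal_def place_0)

lemma place_unit_mult: "place \<iota> P \<Longrightarrow> place_unit P u \<Longrightarrow> place_unit P v \<Longrightarrow> place_unit P (u * v)"
  by (simp add: place_unit_iff place_mult)

lemma place_unit_inverse: "place \<iota> P \<Longrightarrow> place_unit P u \<Longrightarrow> place_unit P (inverse u)"
  by (simp add: place_unit_iff)

lemma place_unit_1: "place \<iota> P \<Longrightarrow> place_unit P 1" by (simp add: place_unit_iff place_1)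

lemma place_unit_powi: assumes "place \<iota> P" "place_unit P u" shows "place_unit P (u powi n)"
proof -
  have "place_unit P (u ^ k)" for k
    by (induction k) (auto simp: place_unit_1 place_unit_mult assms)
  then show ?thesis using place_unit_inverse[OF assms(1)] by (simp add: power_int_def power_inverse)
qed

text \<open>If all powers of \<open>t\<close> divided \<open>z\<close>, they would form arbitrarily long chains of divisors of \<open>z\<close>.\<close>

lemma unit_factor_nat:
  assumes P: "place \<iota> P" and t: "uniformizer P t" and z: "z \<in> P" "z \<noteq> 0"
  shows "\<exists>n u. place_unit P u \<and> z = t ^ n * u"
proof (cases "z \<in> max_ideal P")
  case False
  then show ?thesis using z by (intro exI[of _ "0::nat"] exI[of _ z]) (simp add: place_unit_def)
next
  case zm: True
  note tm = uniformizer_max_ideal[OF P t]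
  have tP: "t \<in> P" using tm max_ideal_subset by blast
  have "\<exists>n. z / t ^ n \<notin> P"
  proof (rule ccontr)
    assume "\<not> ?thesis"
    then have all: "z / t ^ n \<in> P" for n by blast
    obtain m where m: "dep z m" using dep_exists by blast
    have tn: "t ^ Suc n \<in> max_ideal P" for n
      using max_ideal_mult[OF P tm(1) place_power[OF P tP, of n]] by simp
    define c where "c = (\<lambda>j. t ^ (Suc m - j))"
    have "c j \<in> max_ideal P" if "j \<le> m" for j using tn[of "m - j"] that by (simp add: c_def Suc_diff_le)
    moreover have "z / c j \<in> P" "c j \<noteq> 0" for j using all tm by (auto simp: c_def)
    moreover have "c i / c j \<in> max_ideal P" if "i < j" "j \<le> m" for i j
    proof -
      have "c i = c j * t ^ (j - i)" using that by (simp add: c_def flip: power_add)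
      then have "c i / c j = t ^ (j - i)" using tm by (simp add: c_def)
      moreover have "t ^ (j - i) \<in> max_ideal P"
        using tn[of "j - Suc i"] that Suc_diff_Suc[of i j] by metis
      ultimately show ?thesis by simp
    qed
    ultimately show False using no_long_chain[OF P zm z(2) m, of c] by blast
  qed
  define n where "n = (LEAST n. z / t ^ n \<notin> P)"
  have n: "z / t ^ n \<notin> P" using \<open>\<exists>n. _\<close> unfolding n_def by (rule LeastI_ex)
  have n0: "n \<noteq> 0" using n z by (cases n) auto
  have n1: "z / t ^ (n - 1) \<in> P" using not_less_Least[of "n - 1" "\<lambda>n. z / t ^ n \<notin> P"] n0
    unfolding n_def[symmetric] by auto
  have "z / t ^ (n - 1) \<notin> max_ideal P"
  proof
    assume "z / t ^ (n - 1) \<in> max_ideal P"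
    then obtain w where "w \<in> P" "z / t ^ (n - 1) = t * w" using t unfolding uniformizer_def by auto
    moreover have "t ^ n = t * t ^ (n - 1)" using n0 by (cases n) auto
    ultimately have "z / t ^ n = w" using tm by (simp add: field_simps)
    then show False using n \<open>w \<in> P\<close> by simp
  qed
  then have "place_unit P (z / t ^ (n - 1))" using n1 by (simp add: place_unit_def)
  then show ?thesis using tm by (intro exI[of _ "n - 1"] exI[of _ "z / t ^ (n - 1)"]) simp
qed

lemma unit_factor:
  assumes P: "place \<iota> P" and t: "uniformizer P t" and z: "z \<noteq> 0"
  obtains n u where "place_unit P u" "z = t powi n * u"
proof (cases "z \<in> P")
  case True
  then show ?thesis using unit_factor_nat[OF P t True z] that[of _ "int _"] by (metis power_int_of_nat)
next
  case False
  then obtain n u where u: "place_unit P u" "inverse z = t ^ n * u"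
    using unit_factor_nat[OF P t place_inverse[OF P False]] z by auto
  then have "z = inverse (t ^ n * u)" by (metis inverse_inverse_eq)
  then have "z = t powi (- int n) * inverse u" by (simp add: power_int_minus mult_ac)
  then show ?thesis using that place_unit_inverse[OF P u(1)] by blast
qed

lemma uniformizer_power_unit:
  assumes P: "place \<iota> P" and t: "uniformizer P t" and u: "place_unit P (t powi n)" shows "n = 0"
proof (rule ccontr)
  assume n: "n \<noteq> 0"
  note tm = uniformizer_max_ideal[OF P t]
  have tP: "t \<in> P" using tm max_ideal_subset by blast
  have "place_unit P (t powi int (nat \<bar>n\<bar>))"
    using u place_unit_inverse[OF P u] by (cases "n < 0") (auto simp: power_int_minus[symmetric] simp del: power_int_of_nat)
  then have "place_unit P (t ^ nat \<bar>n\<bar>)" by (simp only: power_int_of_nat)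
  moreover have "t ^ nat \<bar>n\<bar> = t * t ^ (nat \<bar>n\<bar> - 1)" using n by (cases "nat \<bar>n\<bar>") auto
  then have "t ^ nat \<bar>n\<bar> \<in> max_ideal P" using max_ideal_mult[OF P tm(1) place_power[OF P tP]] by simp
  ultimately show False by (simp add: place_unit_def)
qed

text \<open>Two uniformizers differ by a unit, so the exponent depends on the element alone.\<close>

lemma place_val_eqI:
  assumes P: "place \<iota> P" and t: "uniformizer P t" and u: "place_unit P u"
  shows "place_val P (t powi n * u) = n"
  unfolding place_val_def
proof (rule the_equality)
  show "\<exists>s w. uniformizer P s \<and> w \<in> P - max_ideal P \<and> t powi n * u = s powi n * w"
    using t u unfolding place_unit_def by blast
  fix k assume "\<exists>s w. uniformizer P s \<and> w \<in> P - max_ideal P \<and> t powi n * u = s powi k * w"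
  then obtain s w where s: "uniformizer P s" "place_unit P w" "t powi n * u = s powi k * w"
    unfolding place_unit_def by blast
  note tm = uniformizer_max_ideal[OF P t] and sm = uniformizer_max_ideal[OF P s(1)]
  obtain a where a: "a \<in> P" "s = t * a" using sm t unfolding uniformizer_def by auto
  obtain b where b: "b \<in> P" "t = s * b" using tm s unfolding uniformizer_def by auto
  have "a * b = 1" using a b sm tm by (metis mult.assoc mult_cancel_left1 mult.commute)
  then have a1: "place_unit P a" using a b P by (auto simp: place_unit_iff inverse_unique)
  have "t powi n * u = t powi k * a powi k * w" using s a by (simp add: power_int_mult_distrib)
  then have "t powi (n - k) = a powi k * w * inverse u"
    using tm place_unit_iff[OF P, of u] u by (simp add: power_int_diff field_simps)
  then have "place_unit P (t powi (n - k))"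
    using a1 s u by (simp add: place_unit_mult place_unit_powi place_unit_inverse P)
  from uniformizer_power_unit[OF P t this] show "k = n" by simp
qed

lemma val_factor:
  assumes "place \<iota> P" "uniformizer P t" "z \<noteq> 0"
  obtains u where "place_unit P u" "z = t powi (place_val P z) * u"
  using unit_factor[OF assms] place_val_eqI[OF assms(1,2)] by metis

lemma val_unit: assumes "place \<iota> P" "place_unit P u" shows "place_val P u = 0"
proof -
  obtain t where "uniformizer P t" using uniformizer_exists assms by blast
  from place_val_eqI[OF assms(1) this assms(2), of 0] show ?thesis by simp
qed

lemma val_mult:
  assumes P: "place \<iota> P" and "x \<noteq> 0" "y \<noteq> 0"
  shows "place_val P (x * y) = place_val P x + place_val P y"
proof -
  obtain t where t: "uniformizer P t" using uniformizer_exists P by blast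
  obtain u where u: "place_unit P u" "x = t powi (place_val P x) * u" using val_factor[OF P t \<open>x \<noteq> 0\<close>] .
  obtain v where v: "place_unit P v" "y = t powi (place_val P y) * v" using val_factor[OF P t \<open>y \<noteq> 0\<close>] .
  have "x * y = (t powi (place_val P x) * u) * (t powi (place_val P y) * v)" using u(2) v(2) by simp
  also have "\<dots> = t powi (place_val P x + place_val P y) * (u * v)"
    using uniformizer_max_ideal[OF P t] by (simp add: power_int_add mult_ac)
  finally show ?thesis using place_val_eqI[OF P t place_unit_mult[OF P u(1) v(1)]] by simp
qed

lemma val_1: "place \<iota> P \<Longrightarrow> place_val P 1 = 0" by (simp add: val_unit place_unit_1)

lemma val_const: assumes "place \<iota> P" "c \<noteq> 0" shows "place_val P (\<iota> c) = 0"
  using assms by (intro val_unit) (auto simp: place_unit_iff place_const simp flip: \<iota>_inverse)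

lemma val_inverse: assumes "place \<iota> P" "x \<noteq> 0" shows "place_val P (inverse x) = - place_val P x"
  using val_mult[OF assms(1,2), of "inverse x"] val_1[OF assms(1)] assms by simp

lemma val_divide: "place \<iota> P \<Longrightarrow> x \<noteq> 0 \<Longrightarrow> y \<noteq> 0 \<Longrightarrow> place_val P (x / y) = place_val P x - place_val P y"
  by (simp add: divide_inverse val_mult val_inverse)

lemma val_minus: "place \<iota> P \<Longrightarrow> x \<noteq> 0 \<Longrightarrow> place_val P (- x) = place_val P x"
  using val_mult[of P "\<iota> (-1)" x] val_const[of P "-1"] by (simp add: \<iota>_minus)

lemma val_power: assumes "place \<iota> P" "x \<noteq> 0" shows "place_val P (x ^ n) = int n * place_val P x"
  by (induction n) (use assms in \<open>auto simp: val_1 val_mult algebra_simps\<close>)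

lemma val_powi: assumes "place \<iota> P" "x \<noteq> 0" shows "place_val P (x powi n) = n * place_val P x"
  using assms by (auto simp: power_int_def val_power val_inverse simp flip: power_inverse)

lemma val_uniformizer: assumes "place \<iota> P" "uniformizer P t" shows "place_val P t = 1"
  using place_val_eqI[OF assms place_unit_1[OF assms(1)], of 1] by simp

lemma place_iff_val: assumes P: "place \<iota> P" and "z \<noteq> 0" shows "z \<in> P \<longleftrightarrow> 0 \<le> place_val P z"
proof -
  obtain t where t: "uniformizer P t" using uniformizer_exists P by blast
  have nonneg: "0 \<le> place_val P w" if w: "w \<in> P" "w \<noteq> 0" for w
  proof -
    obtain n u where "place_unit P u" "w = t ^ n * u" using unit_factor_nat[OF P t w] by auto
    then show ?thesis using place_val_eqI[OF P t, of u "int n"] by simp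
  qed
  show ?thesis
  proof
    assume "0 \<le> place_val P z"
    show "z \<in> P"
    proof (rule ccontr)
      assume n: "z \<notin> P"
      have "inverse z \<in> P" by (rule place_inverse[OF P n])
      then have "0 \<le> place_val P (inverse z)" using nonneg assms by simp
      then have "place_val P z = 0" using \<open>0 \<le> place_val P z\<close> assms by (simp add: val_inverse)
      moreover obtain u where "place_unit P u" "z = t powi (place_val P z) * u" using val_factor[OF P t assms(2)] .
      ultimately show False using n by (simp add: place_unit_def)
    qed
  qed (use nonneg assms in auto)
qed

lemma max_ideal_iff_val:
  assumes P: "place \<iota> P" and z: "z \<noteq> 0" shows "z \<in> max_ideal P \<longleftrightarrow> 1 \<le> place_val P z"
  using assms place_iff_val[OF P, of z] place_iff_val[OF P, of "inverse z"] val_inverse[OF P z]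
  by (auto simp: max_ideal_def)

lemma uniformizer_iff_val:
  assumes P: "place \<iota> P" shows "uniformizer P t \<longleftrightarrow> t \<noteq> 0 \<and> place_val P t = 1"
proof
  assume t: "t \<noteq> 0 \<and> place_val P t = 1"
  show "uniformizer P t" unfolding uniformizer_def
  proof (intro equalityI subsetI)
    fix z assume z: "z \<in> max_ideal P"
    have "z / t \<in> P" if "z \<noteq> 0" using z t that place_iff_val[OF P, of "z / t"] max_ideal_iff_val[OF P that]
      by (simp add: val_divide[OF P])
    then have "z / t \<in> P" using place_0[OF P] by (cases "z = 0") auto
    then show "z \<in> (\<lambda>u. t * u) ` P" using t by (intro image_eqI[of _ _ "z / t"]) auto
  next
    fix z assume "z \<in> (\<lambda>u. t * u) ` P"
    then obtain u where u: "u \<in> P" "z = t * u" by auto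
    have "t \<in> max_ideal P" using max_ideal_iff_val[OF P] t by simp
    then show "z \<in> max_ideal P" using u max_ideal_mult[OF P] by simp
  qed
qed (use uniformizer_max_ideal[OF P] val_uniformizer[OF P] in auto)

lemma ordset_0: assumes P: "place \<iota> P" shows "ordset P 0 = P"
proof -
  have "z \<in> ordset P 0 \<longleftrightarrow> z \<in> P" for z
    by (cases "z = 0") (simp_all add: ordset_def place_0[OF P] place_iff_val[OF P])
  then show ?thesis by blast
qed

lemma ordset_1: assumes P: "place \<iota> P" shows "ordset P 1 = max_ideal P"
proof -
  have "z \<in> ordset P 1 \<longleftrightarrow> z \<in> max_ideal P" for z
    by (cases "z = 0") (simp_all add: ordset_def zero_in_max_ideal[OF P] max_ideal_iff_val[OF P])
  then show ?thesis by blast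
qed

lemma ordset_antimono: "m \<le> n \<Longrightarrow> ordset P n \<subseteq> ordset P m" by (auto simp: ordset_def)

lemma zero_in_ordset [simp]: "0 \<in> ordset P n" by (simp add: ordset_def)

lemma ordset_mult_iff:
  assumes "place \<iota> P" "s \<noteq> 0" shows "s * x \<in> ordset P n \<longleftrightarrow> x \<in> ordset P (n - place_val P s)"
  using assms by (cases "x = 0") (auto simp: ordset_def val_mult)

lemma ordset_mult:
  assumes "place \<iota> P" "x \<in> ordset P m" "y \<in> ordset P n" shows "x * y \<in> ordset P (m + n)"
  using assms by (cases "x = 0 \<or> y = 0") (auto simp: ordset_def val_mult)

lemma val_exists: assumes "place \<iota> P" obtains s where "s \<noteq> 0" "place_val P s = n"
proof -
  obtain t where t: "uniformizer P t" using uniformizer_exists assms by blast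
  then have "t \<noteq> 0" "place_val P t = 1" using uniformizer_iff_val[OF assms] by auto
  then show ?thesis using that[of "t powi n"] val_powi[OF assms] by simp
qed

lemma ordset_subspace: assumes P: "place \<iota> P" shows "FV.subspace (ordset P n)"
proof (rule FV.subspaceI)
  obtain s where s: "s \<noteq> 0" "place_val P s = - n" using val_exists P by blast
  have iff: "x \<in> ordset P n \<longleftrightarrow> s * x \<in> P" for x
    using ordset_mult_iff[OF P s(1), of x 0] s ordset_0[OF P] by simp
  show "x + y \<in> ordset P n" if "x \<in> ordset P n" "y \<in> ordset P n" for x y
    using that place_add[OF P] by (simp add: iff algebra_simps)
  show "\<iota> c * x \<in> ordset P n" if "x \<in> ordset P n" for c x
    using that place_mult[OF P place_const[OF P, of c], of "s * x"] by (simp add: iff mult_ac)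
qed simp

lemma val_add_ge:
  assumes "place \<iota> P" "x + y \<noteq> 0" "x \<noteq> 0 \<Longrightarrow> n \<le> place_val P x" "y \<noteq> 0 \<Longrightarrow> n \<le> place_val P y"
  shows "n \<le> place_val P (x + y)"
  using FV.subspace_add[OF ordset_subspace[OF assms(1)], of x n y] assms by (auto simp: ordset_def)

lemma val_add_eq:
  assumes P: "place \<iota> P" and "x \<noteq> 0" "y = 0 \<or> place_val P x < place_val P y"
  shows "x + y \<noteq> 0 \<and> place_val P (x + y) = place_val P x"
proof (cases "y = 0")
  case False
  have "x + y \<noteq> 0"
  proof
    assume "x + y = 0"
    then have "y = - x" by (simp add: eq_neg_iff_add_eq_0 add.commute)
    then show False using assms False val_minus[OF P] by simp
  qed
  moreover have "place_val P x \<le> place_val P (x + y)" using assms calculation by (intro val_add_ge) auto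
  moreover have "\<not> place_val P x < place_val P (x + y)"
  proof
    assume "place_val P x < place_val P (x + y)"
    then have "place_val P x + 1 \<le> place_val P ((x + y) + (- y))"
      using assms(2,3) False val_minus[OF P False] by (intro val_add_ge[OF P, of "x + y" "- y"] impI; simp)
    then show False by simp
  qed
  ultimately show ?thesis by simp
qed (use assms in auto)


subsection \<open>The degree of a place\<close>

lemma idx_ordset_Suc: assumes P: "place \<iota> P" shows "idx (ordset P n) (ordset P (n + 1)) = idx P (max_ideal P)"
proof -
  obtain s where s: "s \<noteq> 0" "place_val P s = - n" using val_exists P by blast
  note m = FV.subspace_add_subgroup[OF max_ideal_subspace[OF P]]
  have iff0: "x \<in> ordset P n \<longleftrightarrow> s * x \<in> P" for x
    using ordset_mult_iff[OF P s(1), of x 0] s ordset_0[OF P] by simp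
  have iff1: "x \<in> ordset P (n + 1) \<longleftrightarrow> s * x \<in> max_ideal P" for x
    using ordset_mult_iff[OF P s(1), of x 1] s ordset_1[OF P] by (simp add: add.commute)
  have "idx (ordset P n) (ordset P (n + 1)) = card ((\<lambda>v. coset (max_ideal P) (s * v)) ` ordset P n)"
    by (rule idx_eqI[OF FV.subspace_add_subgroup[OF ordset_subspace[OF P]]])
      (simp add: coset_eq_iff[OF m] iff1 right_diff_distrib)
  also have "(\<lambda>v. coset (max_ideal P) (s * v)) ` ordset P n = coset (max_ideal P) ` P"
  proof (intro equalityI subsetI)
    fix c assume "c \<in> coset (max_ideal P) ` P"
    then obtain v where "v \<in> P" "c = coset (max_ideal P) v" by auto
    then show "c \<in> (\<lambda>v. coset (max_ideal P) (s * v)) ` ordset P n"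
      using s by (intro image_eqI[of _ _ "v / s"]) (auto simp: iff0)
  qed (auto simp: iff0)
  finally show ?thesis by (simp add: idx_def)
qed

lemma idx_residue_pos: assumes P: "place \<iota> P" shows "0 < idx P (max_ideal P)"
proof -
  obtain x where x: "x \<in> max_ideal P" "x \<noteq> 0" using max_ideal_nonzero[OF P] by blast
  obtain m where m: "dep x m" using dep_exists by blast
  have xP: "x \<in> P" using x max_ideal_subset by blast
  have pos: "0 < idx P ((\<lambda>a. x * a) ` P)"
    using idx_multiples_le[OF place_subspace[OF P] place_mult[OF P] place_1[OF P] xP x(2) m] by blast
  have "(\<lambda>a. x * a) ` P = ordset P (place_val P x)"
  proof (intro equalityI subsetI)
    fix z assume "z \<in> ordset P (place_val P x)"
    then have "z / x \<in> ordset P 0" using ordset_mult_iff[OF P x(2), of "z / x" "place_val P x"] x by simp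
    then show "z \<in> (\<lambda>a. x * a) ` P" using x ordset_0[OF P] by (intro image_eqI[of _ _ "z / x"]) auto
  next
    fix z assume "z \<in> (\<lambda>a. x * a) ` P"
    then obtain a where "a \<in> ordset P 0" "z = x * a" using ordset_0[OF P] by auto
    then show "z \<in> ordset P (place_val P x)" using ordset_mult_iff[OF P x(2), of a "place_val P x"] by simp
  qed
  then have "(\<lambda>a. x * a) ` P \<subseteq> max_ideal P" "add_subgroup ((\<lambda>a. x * a) ` P)"
    using max_ideal_mult[OF P x(1)] FV.subspace_add_subgroup[OF ordset_subspace[OF P, of "place_val P x"]]
    by (blast, simp)
  then have "idx P ((\<lambda>a. x * a) ` P) = idx P (max_ideal P) * idx (max_ideal P) ((\<lambda>a. x * a) ` P)"
    using idx_tower FV.subspace_add_subgroup[OF max_ideal_subspace[OF P]]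
      FV.subspace_add_subgroup[OF place_subspace[OF P]] max_ideal_subset by blast
  then show ?thesis using pos by (cases "idx P (max_ideal P)") auto
qed

text \<open>A basis of the residue field is an independent family of largest size.\<close>

lemma idx_residue: assumes P: "place \<iota> P" shows "idx P (max_ideal P) = CARD('k) ^ place_degree \<iota> P"
proof -
  note s = max_ideal_subspace[OF P] place_subspace[OF P]
  obtain B where B: "FV.cobasis P (max_ideal P) B"
    using FV.cobasis_exists[OF s max_ideal_subset idx_residue_pos[OF P]] by blast
  note cB = FV.cobasis_card[OF s B]
  have "place_degree \<iota> P = card B" unfolding place_degree_def
  proof (rule cSup_eq_maximum)
    show "card B \<in> {card B |B. finite B \<and> B \<subseteq> P \<and>
        (\<forall>c. (\<Sum>b\<in>B. \<iota> (c b) * b) \<in> max_ideal P \<longrightarrow> (\<forall>b\<in>B. c b = 0))}"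
      using B unfolding FV.cobasis_def by blast
    fix x assume "x \<in> {card B |B. finite B \<and> B \<subseteq> P \<and>
        (\<forall>c. (\<Sum>b\<in>B. \<iota> (c b) * b) \<in> max_ideal P \<longrightarrow> (\<forall>b\<in>B. c b = 0))}"
    then obtain C where C: "x = card C" "finite C" "C \<subseteq> P"
      "\<And>c. (\<Sum>b\<in>C. \<iota> (c b) * b) \<in> max_ideal P \<Longrightarrow> (\<forall>b\<in>C. c b = 0)" by blast
    from FV.independent_modulo_le[OF s idx_residue_pos[OF P] C(2,3,4)] show "x \<le> card B"
      using cB C(1) FV.power_card_le_iff by simp
  qed
  then show ?thesis using cB by simp
qed

lemma place_degree_pos: assumes P: "place \<iota> P" shows "0 < place_degree \<iota> P"
proof (rule ccontr)
  assume "\<not> ?thesis"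
  then have "idx P (max_ideal P) = 1" using idx_residue[OF P] by simp
  then have "P = max_ideal P"
    by (intro idx_eq_1D FV.subspace_add_subgroup max_ideal_subspace P max_ideal_subset)
  then show False using one_notin_max_ideal[OF P] place_1[OF P] by simp
qed

lemma idx_ordset:
  assumes P: "place \<iota> P" shows "idx (ordset P n) (ordset P (n + int e)) = CARD('k) ^ (e * place_degree \<iota> P)"
proof (induction e)
  case 0
  then show ?case using idx_self[OF FV.subspace_add_subgroup[OF ordset_subspace[OF P]]] by simp
next
  case (Suc e)
  have "idx (ordset P n) (ordset P (n + int (Suc e)))
      = idx (ordset P n) (ordset P (n + int e)) * idx (ordset P (n + int e)) (ordset P (n + int (Suc e)))"
    by (intro idx_tower FV.subspace_add_subgroup ordset_subspace P ordset_antimono) auto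
  then show ?case using Suc idx_ordset_Suc[OF P, of "n + int e"] idx_residue[OF P]
    by (simp add: power_add algebra_simps)
qed

end


section \<open>Existence of places and weak approximation\<close>

context function_field
begin

text \<open>
  Chevalley's argument: a subring that contains \<open>k[y]\<close> and is maximal among those without the inverse
  of \<open>y\<close> is a valuation ring. If neither \<open>z\<close> nor its inverse belongs to it, then 1 is \<open>y\<close> times a
  polynomial in \<open>z\<close> and also \<open>y\<close> times a polynomial in the inverse of \<open>z\<close>; the relation of smaller degree
  lowers the degree of the other one.
\<close>

lemma zero_exists:
  assumes y: "\<not> algebraic_over \<iota> y"
  obtains P where "place \<iota> P" "y \<in> max_ideal P"
proof -
  define \<A> where "\<A> = {R. range \<iota> \<subseteq> R \<and> y \<in> R \<and> (\<forall>a\<in>R. \<forall>b\<in>R. a - b \<in> R \<and> a * b \<in> R) \<and> inverse y \<notin> R}"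
  have alg: "\<not> algebraic_over \<iota> y \<Longrightarrow> p \<noteq> 0 \<Longrightarrow> poly_at \<iota> p y \<noteq> 0" for p
    by (auto simp: algebraic_over_def)
  have y0: "y \<noteq> 0" using alg[OF y, of "[:0,1:]"] by auto
  let ?R0 = "range (\<lambda>p. poly_at \<iota> p y)"
  have "?R0 \<in> \<A>" unfolding \<A>_def
  proof (intro CollectI conjI ballI)
    have "\<iota> c \<in> ?R0" for c by (rule range_eqI[of _ _ "[:c:]"]) simp
    then show "range \<iota> \<subseteq> ?R0" by blast
    show "y \<in> ?R0" by (auto intro!: range_eqI[of _ _ "[:0,1:]"])
    show "inverse y \<notin> ?R0"
    proof
      assume "inverse y \<in> ?R0"
      then obtain p where "poly_at \<iota> p y = inverse y" by auto
      then have "poly_at \<iota> (pCons (-1) p) y = 0" using y0 by (simp add: \<iota>_minus)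
      moreover have "pCons (-1) p \<noteq> 0" by simp
      ultimately show False using alg[OF y] by blast
    qed
    fix a b assume "a \<in> ?R0" "b \<in> ?R0"
    then obtain p q where pq: "a = poly_at \<iota> p y" "b = poly_at \<iota> q y" by auto
    show "a - b \<in> ?R0" by (rule range_eqI[of _ _ "p - q"]) (simp add: pq)
    show "a * b \<in> ?R0" by (rule range_eqI[of _ _ "p * q"]) (simp add: pq)
  qed
  then have ne: "\<A> \<noteq> {}" by blast
  \<comment> \<open>Zorn's lemma for the subrings that contain \<open>k[y]\<close> but not the inverse of \<open>y\<close>.\<close>
  have un: "\<Union>C \<in> \<A>" if C: "C \<noteq> {}" "subset.chain \<A> C" for C
  proof -
    have CA: "R \<in> \<A>" if "R \<in> C" for R using C that by (auto simp: subset.chain_def)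
    have dir: "\<exists>T\<in>C. a \<in> T \<and> b \<in> T" if ab: "a \<in> \<Union>C" "b \<in> \<Union>C" for a b
    proof -
      obtain R where R: "R \<in> C" "a \<in> R" using ab by blast
      obtain S where S: "S \<in> C" "b \<in> S" using ab by blast
      note RS = R S
      then have "R \<subseteq> S \<or> S \<subseteq> R" using C unfolding subset.chain_def by blast
      then show ?thesis using RS by blast
    qed
    obtain R where R: "R \<in> C" using C by blast
    have "a - b \<in> \<Union>C \<and> a * b \<in> \<Union>C" if ab: "a \<in> \<Union>C" "b \<in> \<Union>C" for a b
    proof -
      obtain T where "T \<in> C" "a \<in> T" "b \<in> T" using dir[OF ab] by blast
      then show ?thesis using CA[of T] unfolding \<A>_def by blast
    qed
    moreover have "range \<iota> \<subseteq> \<Union>C" "y \<in> \<Union>C" using R CA[OF R] unfolding \<A>_def by blast+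
    moreover have "inverse y \<notin> \<Union>C" using CA unfolding \<A>_def by blast
    ultimately show ?thesis unfolding \<A>_def by blast
  qed
  obtain R where R: "R \<in> \<A>" and max: "\<And>X. X \<in> \<A> \<Longrightarrow> R \<subseteq> X \<Longrightarrow> X = R"
    using subset_Zorn_nonempty[OF ne un] by auto
  have Rc: "\<iota> c \<in> R" for c using R by (auto simp: \<A>_def)
  have Ry: "y \<in> R" and Riy: "inverse y \<notin> R" using R by (auto simp: \<A>_def)
  have Rd: "a - b \<in> R" and Rm: "a * b \<in> R" if "a \<in> R" "b \<in> R" for a b using R that by (auto simp: \<A>_def)
  have R0: "0 \<in> R" and R1: "1 \<in> R" using Rc[of 0] Rc[of 1] by auto
  have Ra: "a + b \<in> R" if "a \<in> R" "b \<in> R" for a b using Rd[OF that(1) Rd[OF R0 that(2)]] by simp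
  have Rs: "sum f I \<in> R" if "\<And>i. i \<in> I \<Longrightarrow> f i \<in> R" for f and I :: "nat set"
    using that by (induction I rule: infinite_finite_induct) (auto simp: R0 Ra)
  define RP where "RP = {p :: 'f poly. \<forall>i. coeff p i \<in> R}"
  have RPm: "p * q \<in> RP" if "p \<in> RP" "q \<in> RP" for p q
    using that by (auto simp: RP_def coeff_mult intro!: Rs Rm)
  have RPa: "p + q \<in> RP" and RPd: "p - q \<in> RP" if "p \<in> RP" "q \<in> RP" for p q
    using that by (auto simp: RP_def Ra Rd)
  have RPmon: "monom a n \<in> RP" if "a \<in> R" for a n using that R0 by (auto simp: RP_def)
  have RPs: "sum f I \<in> RP" if "\<And>i. i \<in> I \<Longrightarrow> f i \<in> RP" for f and I :: "nat set"
    using that RPmon[OF R0, of 0] by (induction I rule: infinite_finite_induct) (auto simp: RPa)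
  \<comment> \<open>Adjoining \<open>z\<close> to \<open>R\<close> yields the inverse of \<open>y\<close>, by maximality.\<close>
  have adj: "\<exists>p\<in>RP. y * poly p z = 1" if z: "z \<notin> R" for z
  proof (rule ccontr)
    assume no: "\<not> ?thesis"
    let ?X = "(\<lambda>p. poly p z) ` RP"
    have "?X \<in> \<A>" unfolding \<A>_def
    proof (intro CollectI conjI ballI subsetI)
      show "a \<in> ?X" if "a \<in> range \<iota>" for a
        using that Rc RPmon by (intro image_eqI[of _ _ "monom a 0"]) (auto simp: poly_monom)
      show "y \<in> ?X" using Ry RPmon by (intro image_eqI[of _ _ "monom y 0"]) (auto simp: poly_monom)
      show "inverse y \<notin> ?X" using no y0 by (auto simp: field_simps)
      fix a b assume "a \<in> ?X" "b \<in> ?X"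
      then obtain p q where pq: "p \<in> RP" "q \<in> RP" "a = poly p z" "b = poly q z" by auto
      show "a - b \<in> ?X" using pq RPd by (intro image_eqI[of _ _ "p - q"]) auto
      show "a * b \<in> ?X" using pq RPm by (intro image_eqI[of _ _ "p * q"]) auto
    qed
    moreover have "R \<subseteq> ?X"
    proof
      fix a assume "a \<in> R" then show "a \<in> ?X"
        using RPmon by (intro image_eqI[of _ _ "monom a 0"]) (auto simp: poly_monom)
    qed
    ultimately have "?X = R" by (rule max)
    moreover have "z \<in> ?X" using RPmon[OF R1, of 1] by (intro image_eqI[of _ _ "monom 1 1"]) (auto simp: poly_monom)
    ultimately show False using z by simp
  qed
  \<comment> \<open>So \<open>y\<close> is in the Jacobson radical of \<open>R\<close>: a relation of the kind \<open>adj\<close> for the inverse of \<open>c = 1 - y b\<close>,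
    multiplied by a power of \<open>c\<close>, would put the inverse of \<open>y\<close> into \<open>R\<close>.\<close>
  have unit: "inverse (1 - y * b) \<in> R" if b: "b \<in> R" for b
  proof (rule ccontr)
    define c where "c = 1 - y * b"
    have cn: "\<exists>r\<in>R. c ^ n = 1 - y * r" for n
    proof (induction n)
      case (Suc n)
      then obtain r where r: "r \<in> R" "c ^ n = 1 - y * r" by blast
      have "c ^ Suc n = (1 - y * b) * (1 - y * r)" by (simp only: power_Suc r(2)) (simp only: c_def)
      also have "\<dots> = 1 - y * (b + r - y * b * r)" by (simp add: algebra_simps)
      finally show ?case using b Ry r by (intro bexI[of _ "b + r - y * b * r"] Ra Rd Rm)
    qed (use R0 in auto)
    have c0: "c \<noteq> 0" using b Riy y0 by (auto simp: c_def) (metis inverse_unique)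
    assume "\<not> inverse (1 - y * b) \<in> R"
    then obtain p where p: "p \<in> RP" "y * poly p (inverse c) = 1" using adj[of "inverse c"] by (auto simp: c_def)
    define n where "n = degree p"
    have cR: "c \<in> R" unfolding c_def by (intro Rd R1 Rm Ry b)
    have cRi: "c ^ i \<in> R" for i by (induction i) (auto simp: R1 Rm cR)
    define s where "s = c ^ n * poly p (inverse c)"
    have "s = (\<Sum>i\<le>n. coeff p i * c ^ (n - i))"
      unfolding s_def n_def poly_altdef sum_distrib_left
      by (rule sum.cong) (use c0 in \<open>auto simp: power_diff field_simps\<close>)
    moreover have "\<dots> \<in> R" using p by (intro Rs Rm cRi) (auto simp: RP_def)
    ultimately have "s \<in> R" by simp
    have "c ^ n = y * s" using p(2) by (simp add: s_def mult.left_commute)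
    moreover obtain r where "r \<in> R" "c ^ n = 1 - y * r" using cn by blast
    ultimately have "y * (s + r) = 1" by (simp add: algebra_simps)
    then have "inverse y = s + r" by (rule inverse_unique)
    then show False using Riy Ra[OF \<open>s \<in> R\<close> \<open>r \<in> R\<close>] by simp
  qed
  have deg0: "0 < degree p" if "p \<in> RP" "y * poly p z = 1" for p z
  proof (rule ccontr)
    assume "\<not> 0 < degree p"
    then obtain a where "p = [:a:]" by (metis degree_eq_zeroE gr0I)
    then have "a \<in> R" "inverse y = a" using that by (auto simp: RP_def dest: spec[of _ "0::nat"] intro: inverse_unique)
    then show False using Riy by simp
  qed
  have lower: "\<exists>p'\<in>RP. y * poly p' z = 1 \<and> degree p' < degree p"
    if p: "p \<in> RP" "y * poly p z = 1" and q: "q \<in> RP" "y * poly q (inverse z) = 1"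
      and le: "degree q \<le> degree p" and z0: "z \<noteq> 0" for p q z
  proof -
    define n m where "n = degree p" and "m = degree q"
    have nm: "0 < n" "0 < m" "m \<le> n" using deg0[OF p] deg0[OF q] le by (auto simp: n_def m_def)
    define c where "c = 1 - y * coeff q 0"
    have ci: "inverse c \<in> R" using unit[of "coeff q 0"] q by (auto simp: c_def RP_def)
    have c0: "c \<noteq> 0"
    proof
      assume "c = 0"
      then have "inverse y = coeff q 0" by (intro inverse_unique) (simp add: c_def)
      then show False using Riy q by (auto simp: RP_def)
    qed
    define h where "h = (\<Sum>j\<in>{1..m}. monom (inverse c * coeff q j) (m - j))"
    have hRP: "h \<in> RP" unfolding h_def using q ci by (intro RPs RPmon Rm) (auto simp: RP_def)
    have dh: "degree h \<le> m - 1" unfolding h_def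
      by (intro degree_sum_le) (auto intro!: order.trans[OF degree_monom_le])
    have "poly q (inverse z) = (\<Sum>j\<le>m. coeff q j * inverse z ^ j)" by (simp add: poly_altdef m_def)
    also have "\<dots> = coeff q 0 + (\<Sum>j\<in>{1..m}. coeff q j * inverse z ^ j)"
      by (subst atMost_atLeast0) (simp add: sum.atLeast_Suc_atMost)
    finally have "c = y * (\<Sum>j\<in>{1..m}. coeff q j * inverse z ^ j)"
      using q(2) by (simp add: c_def algebra_simps)
    then have "z ^ m = y * (\<Sum>j\<in>{1..m}. z ^ m * (inverse c * (coeff q j * inverse z ^ j)))"
    proof -
      assume c: "c = y * (\<Sum>j\<in>{1..m}. coeff q j * inverse z ^ j)"
      have "y * (\<Sum>j\<in>{1..m}. z ^ m * (inverse c * (coeff q j * inverse z ^ j)))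
          = z ^ m * inverse c * (y * (\<Sum>j\<in>{1..m}. coeff q j * inverse z ^ j))"
        by (simp add: sum_distrib_left mult_ac)
      also have "\<dots> = z ^ m" unfolding c[symmetric] using c0 by simp
      finally show ?thesis by simp
    qed
    also have "(\<Sum>j\<in>{1..m}. z ^ m * (inverse c * (coeff q j * inverse z ^ j))) = poly h z"
      unfolding h_def poly_sum by (rule sum.cong) (use z0 in \<open>auto simp: poly_monom power_diff field_simps\<close>)
    finally have zm: "z ^ m = y * poly h z" .
    define p' where "p' = (p - monom (coeff p n) n) + monom (y * coeff p n) (n - m) * h"
    have "p' \<in> RP" unfolding p'_def using p Ry by (intro RPa RPd RPm hRP RPmon Rm) (auto simp: RP_def)
    moreover have "z ^ n = z ^ (n - m) * z ^ m" using nm by (simp flip: power_add)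
    then have "poly p' z = poly p z" by (simp add: p'_def poly_monom zm)
    then have "y * poly p' z = 1" using p by simp
    moreover have "degree p' < n"
    proof -
      have "degree (p - monom (coeff p n) n) \<le> n - 1"
        by (rule degree_le) (auto simp: coeff_eq_0 n_def nm dest!: nat_neq_iff[THEN iffD1])
      moreover have "degree (monom (y * coeff p n) (n - m) * h) \<le> (n - m) + (m - 1)"
        by (rule order.trans[OF degree_mult_le]) (intro add_mono degree_monom_le dh)
      ultimately have "degree p' \<le> n - 1" unfolding p'_def using nm by (intro degree_add_le) auto
      then show ?thesis using nm by simp
    qed
    ultimately show ?thesis by (auto simp: n_def)
  qed
  have val: "z \<in> R \<or> inverse z \<in> R" for z
  proof (rule ccontr)
    assume n: "\<not> ?thesis"
    then have z0: "z \<noteq> 0" using R0 by auto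
    define good where "good = (\<lambda>w n. \<exists>p\<in>RP. y * poly p w = 1 \<and> degree p = n)"
    have ex: "\<exists>n. good w n" if "w \<notin> R" for w using adj[OF that] by (auto simp: good_def)
    define n m where "n = (LEAST n. good z n)" and "m = (LEAST n. good (inverse z) n)"
    have gn: "good z n" "good (inverse z) m"
      unfolding n_def m_def using ex n by (auto intro: LeastI_ex)
    then obtain p q where pq: "p \<in> RP" "y * poly p z = 1" "degree p = n"
      "q \<in> RP" "y * poly q (inverse z) = 1" "degree q = m" by (auto simp: good_def)
    show False
    proof (cases "m \<le> n")
      case True
      then obtain p' where "p' \<in> RP" "y * poly p' z = 1" "degree p' < n"
        using lower[OF pq(1,2,4,5)] pq z0 by auto
      then have "good z (degree p')" "degree p' < n" by (auto simp: good_def)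
      then show False unfolding n_def using not_less_Least by blast
    next
      case False
      then obtain p' where "p' \<in> RP" "y * poly p' (inverse z) = 1" "degree p' < m"
        using lower[OF pq(4,5), of p] pq z0 by auto
      then have "good (inverse z) (degree p')" "degree p' < m" by (auto simp: good_def)
      then show False unfolding m_def using not_less_Least by blast
    qed
  qed
  have "y \<notin> range \<iota>"
  proof
    assume "y \<in> range \<iota>"
    then obtain c where "y = \<iota> c" by auto
    then have "poly_at \<iota> [:-c, 1:] y = 0" by (simp add: \<iota>_minus)
    then show False using alg[OF y, of "[:-c, 1:]"] by simp
  qed
  then have "place \<iota> R" unfolding place_def using Rc Ry Riy Rd Rm val by auto
  moreover have "y \<in> max_ideal R" using Ry Riy by (simp add: max_ideal_def)
  ultimately show ?thesis using that by blast
qed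

text \<open>A discrete valuation ring is a maximal subring: an element outside of it has a pole, and
  powers of a pole absorb every function.\<close>

lemma place_not_subset:
  assumes P: "place \<iota> P" and Q: "place \<iota> Q" and "P \<noteq> Q"
  obtains z where "z \<in> P" "z \<notin> Q"
proof (rule ccontr)
  assume "\<not> thesis"
  then have sub: "P \<subseteq> Q" using that by blast
  then obtain z where z: "z \<in> Q" "z \<notin> P" using assms by blast
  have z0: "z \<noteq> 0" using z place_0[OF P] by auto
  then have vz: "place_val P z < 0" using z place_iff_val[OF P] by auto
  have "w \<in> Q" for w
  proof (cases "w = 0")
    case False
    define n where "n = nat \<bar>place_val P w\<bar>"
    have "int n * place_val P z \<le> int n * (- 1)" using vz by (intro mult_left_mono) auto
    then have "0 \<le> place_val P (w / z ^ n)"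
      using z0 False by (simp add: val_divide val_power P n_def)
    then have "w / z ^ n \<in> Q" using place_iff_val[OF P, of "w / z ^ n"] z0 False sub by auto
    then have "w / z ^ n * z ^ n \<in> Q" by (intro place_mult Q place_power z)
    then show ?thesis using z0 by simp
  qed (simp add: place_0[OF Q])
  then show False using Q by (auto simp: place_def)
qed

text \<open>To add the place \<open>Q\<close> to those where \<open>y\<close> has poles, a power of a function with a zero at \<open>P\<close> and a pole at
  \<open>Q\<close> is added to \<open>y\<close>; the exponent is so large that no two poles cancel.\<close>

lemma separate_place:
  assumes "finite S" "\<And>Q. Q \<in> S \<Longrightarrow> place \<iota> Q" "place \<iota> P" "P \<notin> S"
  shows "\<exists>u. u \<noteq> 0 \<and> 0 < place_val P u \<and> (\<forall>Q\<in>S. place_val Q u < 0)"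
  using assms
proof (induction S)
  case empty
  then obtain t where "uniformizer P t" using uniformizer_exists by blast
  then show ?case using uniformizer_iff_val[OF \<open>place \<iota> P\<close>] by (intro exI[of _ t]) auto
next
  case (insert Q S)
  have P: "place \<iota> P" and Q: "place \<iota> Q" and PQ: "P \<noteq> Q" using insert.prems by auto
  obtain y where y: "y \<noteq> 0" "0 < place_val P y" "\<And>R. R \<in> S \<Longrightarrow> place_val R y < 0" using insert by auto
  obtain a b where ab: "a \<in> P" "a \<notin> Q" "b \<in> Q" "b \<notin> P"
    using place_not_subset[OF P Q PQ] place_not_subset[OF Q P] PQ by metis
  define z where "z = a / b"
  have ab0: "a \<noteq> 0" "b \<noteq> 0" using ab place_0[OF P] place_0[OF Q] by auto
  have z: "z \<noteq> 0" "0 < place_val P z" "place_val Q z < 0"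
    using ab ab0 place_iff_val[OF P] place_iff_val[OF Q] by (auto simp: z_def val_divide P Q not_le)
  define n where "n = Suc (nat (\<Sum>R\<in>insert Q S. \<bar>place_val R y\<bar>))"
  have neg: "y + z ^ n \<noteq> 0 \<and> place_val R (y + z ^ n) < 0" if R: "R \<in> insert Q S" for R
  proof -
    have pR: "place \<iota> R" using insert.prems R by auto
    have "\<bar>place_val R y\<bar> \<le> (\<Sum>R\<in>insert Q S. \<bar>place_val R y\<bar>)"
      using insert.hyps R by (intro member_le_sum) auto
    then have yn: "\<bar>place_val R y\<bar> < int n" unfolding n_def by linarith
    have vz: "place_val R (z ^ n) = int n * place_val R z" using z by (simp add: val_power pR)
    have neg1: "place_val R y < 0 \<or> place_val R z < 0" using R y z by auto
    consider "place_val R z < 0" | "place_val R z = 0" | "0 < place_val R z" by linarith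
    then have "place_val R (z ^ n) < place_val R y \<and> place_val R (z ^ n) < 0
      \<or> place_val R y < place_val R (z ^ n) \<and> place_val R y < 0"
    proof cases
      case 1
      then have "int n * place_val R z \<le> int n * (-1)" by (intro mult_left_mono) auto
      then show ?thesis using vz yn by linarith
    next
      case 2
      then show ?thesis using vz neg1 by simp
    next
      case 3
      then have "int n * place_val R z \<ge> int n * 1" by (intro mult_left_mono) auto
      then show ?thesis using vz yn neg1 3 by linarith
    qed
    then show ?thesis
    proof
      assume "place_val R y < place_val R (z ^ n) \<and> place_val R y < 0"
      then show ?thesis using val_add_eq[OF pR y(1), of "z ^ n"] by simp
    next
      assume "place_val R (z ^ n) < place_val R y \<and> place_val R (z ^ n) < 0"
      then show ?thesis using val_add_eq[OF pR, of "z ^ n" y] z by (simp add: add.commute)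
    qed
  qed
  have n0: "y + z ^ n \<noteq> 0" using neg[of Q] by simp
  have "0 < int n" unfolding n_def by (simp only: of_nat_0_less_iff zero_less_Suc)
  then have "0 < int n * place_val P z" using z by (intro mult_pos_pos) auto
  then have "1 \<le> place_val P (y + z ^ n)"
    using y z n0 P by (intro val_add_ge) (auto simp: val_power)
  then show ?case using neg n0 by (intro exI[of _ "y + z ^ n"]) auto
qed

text \<open>The inverse of \<open>1 + u\<^sup>s\<close> is close to 1 at the zeros and close to 0 at the poles of \<open>u\<close>.\<close>

lemma approximate_indicator:
  assumes S: "finite S" "\<And>Q. Q \<in> S \<Longrightarrow> place \<iota> Q" and P: "place \<iota> P" "P \<notin> S"
  shows "\<exists>w. w - 1 \<in> ordset P N \<and> (\<forall>Q\<in>S. w \<in> ordset Q N)"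
proof -
  obtain u where u: "u \<noteq> 0" "0 < place_val P u" "\<And>Q. Q \<in> S \<Longrightarrow> place_val Q u < 0"
    using separate_place[OF assms] by blast
  define s where "s = Suc (nat N)"
  define w where "w = inverse (1 + u ^ s)"
  have vP: "place_val P (u ^ s) = int s * place_val P u" using u by (simp add: val_power P)
  have "0 < place_val P (u ^ s)" unfolding vP using u by (simp add: s_def)
  then have c: "1 + u ^ s \<noteq> 0" "place_val P (1 + u ^ s) = 0"
    using val_add_eq[OF P(1), of 1 "u ^ s"] by (auto simp: val_1 P)
  have "w - 1 = - (u ^ s / (1 + u ^ s))" using c by (simp add: w_def field_simps)
  moreover have "N \<le> int s * place_val P u"
  proof -
    have "N \<le> int s * 1" by (simp add: s_def)
    also have "\<dots> \<le> int s * place_val P u" using u by (intro mult_left_mono) auto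
    finally show ?thesis .
  qed
  ultimately have "w - 1 \<in> ordset P N" using c u vP by (simp add: ordset_def val_minus val_divide P)
  moreover have "w \<in> ordset Q N" if "Q \<in> S" for Q
  proof -
    have Q: "place \<iota> Q" using S that by blast
    have vQ: "place_val Q (u ^ s) = int s * place_val Q u" using u by (simp add: val_power Q)
    have "int s * place_val Q u \<le> int s * (- 1)" using u that by (intro mult_left_mono) force+
    then have le: "place_val Q (u ^ s) \<le> - int s" using vQ by simp
    have "0 < int s" by (simp add: s_def)
    then have "place_val Q (u ^ s) < place_val Q 1" using le by (simp only: val_1[OF Q])
    then have "place_val Q (u ^ s + 1) = place_val Q (u ^ s)"
      using val_add_eq[OF Q, of "u ^ s" 1] u(1) by simp
    then have "place_val Q w = - place_val Q (u ^ s)" using c by (simp add: w_def val_inverse Q add.commute)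
    moreover have "N \<le> int s" by (simp add: s_def)
    ultimately have "N \<le> place_val Q w" using le by linarith
    then show ?thesis by (simp add: ordset_def)
  qed
  ultimately show ?thesis by blast
qed

lemma weak_approximation:
  assumes S: "finite S" "\<And>Q. Q \<in> S \<Longrightarrow> place \<iota> Q"
  shows "\<exists>z. \<forall>P\<in>S. z - a P \<in> ordset P N"
proof -
  define M where "M = N + (\<Sum>P\<in>S. \<Sum>Q\<in>S. \<bar>place_val P (a Q)\<bar>)"
  have M: "N \<le> place_val P (a Q) + M" if "P \<in> S" "Q \<in> S" for P Q
  proof -
    have "\<bar>place_val P (a Q)\<bar> \<le> (\<Sum>Q\<in>S. \<bar>place_val P (a Q)\<bar>)"
      using S that by (intro member_le_sum) auto
    also have "\<dots> \<le> (\<Sum>P\<in>S. \<Sum>Q\<in>S. \<bar>place_val P (a Q)\<bar>)"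
      using S that by (intro member_le_sum[of P S "\<lambda>P. \<Sum>Q\<in>S. \<bar>place_val P (a Q)\<bar>"]) (auto intro: sum_nonneg)
    finally show ?thesis unfolding M_def by linarith
  qed
  have "\<forall>P\<in>S. \<exists>w. w - 1 \<in> ordset P M \<and> (\<forall>Q\<in>S - {P}. w \<in> ordset Q M)"
    using S by (intro ballI approximate_indicator) auto
  then obtain w where w: "\<And>P. P \<in> S \<Longrightarrow> w P - 1 \<in> ordset P M"
    "\<And>P Q. P \<in> S \<Longrightarrow> Q \<in> S \<Longrightarrow> Q \<noteq> P \<Longrightarrow> w P \<in> ordset Q M" by (metis DiffI singletonD)
  define z where "z = (\<Sum>Q\<in>S. a Q * w Q)"
  have "z - a P \<in> ordset P N" if P: "P \<in> S" for P
  proof -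
    have pP: "place \<iota> P" using S P by blast
    have am: "a Q * v \<in> ordset P N" if "Q \<in> S" "v \<in> ordset P M" for Q v
    proof -
      have "a Q * v \<in> ordset P (place_val P (a Q) + M)"
        by (rule ordset_mult[OF pP _ that(2)]) (simp add: ordset_def)
      then show ?thesis using ordset_antimono[OF M[OF P that(1)]] by blast
    qed
    have "z - a P = a P * (w P - 1) + (\<Sum>Q\<in>S - {P}. a Q * w Q)"
      using S P by (simp add: z_def sum.remove algebra_simps)
    also have "\<dots> \<in> ordset P N"
      using P w by (intro FV.subspace_add FV.subspace_sum ordset_subspace pP am) auto
    finally show ?thesis .
  qed
  then show ?thesis by blast
qed

lemma card_local_conditions:
  assumes S: "finite S" "\<And>Q. Q \<in> S \<Longrightarrow> place \<iota> Q" and le: "\<And>Q. Q \<in> S \<Longrightarrow> n Q \<le> m Q"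
  shows "card (PiE S (\<lambda>Q. coset (ordset Q (m Q)) ` ordset Q (n Q)))
    = CARD('k) ^ (\<Sum>Q\<in>S. nat (m Q - n Q) * place_degree \<iota> Q)"
proof -
  have "card (coset (ordset Q (m Q)) ` ordset Q (n Q)) = CARD('k) ^ (nat (m Q - n Q) * place_degree \<iota> Q)"
    if "Q \<in> S" for Q
    using idx_ordset[OF S(2)[OF that], of "n Q" "nat (m Q - n Q)"] le[OF that] by (simp add: idx_def)
  then show ?thesis using S by (simp add: card_PiE power_sum)
qed

text \<open>
  The functions regular at all points of \<open>S\<close>, modulo the multiples of \<open>x\<close>, form the product of the
  local quotients by weak approximation; as a quotient by \<open>x\<close> its size is bounded by the degree over
  \<open>k(x)\<close>.
\<close>

lemma zeros_le:
  assumes S: "finite S" "\<And>Q. Q \<in> S \<Longrightarrow> place \<iota> Q" "\<And>Q. Q \<in> S \<Longrightarrow> 0 \<le> place_val Q x"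
    and x: "x \<noteq> 0" and m: "dep x m"
  shows "(\<Sum>Q\<in>S. nat (place_val Q x) * place_degree \<iota> Q) \<le> m"
proof -
  define R where "R = {z. \<forall>Q\<in>S. z \<in> Q}"
  have xR: "x \<in> R" using S x place_iff_val by (auto simp: R_def)
  have R: "FV.subspace R" "\<And>a b. a \<in> R \<Longrightarrow> b \<in> R \<Longrightarrow> a * b \<in> R" "1 \<in> R"
    using S place_subspace
    by (auto simp: R_def place_1 place_mult FV.subspace_def)
  have mem: "z \<in> (\<lambda>a. x * a) ` R \<longleftrightarrow> (\<forall>Q\<in>S. z \<in> ordset Q (place_val Q x))" for z
  proof -
    have "z \<in> (\<lambda>a. x * a) ` R \<longleftrightarrow> z / x \<in> R" using x by (auto simp: image_iff intro: bexI[of _ "z / x"])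
    also have "\<dots> \<longleftrightarrow> (\<forall>Q\<in>S. z \<in> ordset Q (place_val Q x))" unfolding R_def mem_Collect_eq
    proof (rule ball_cong[OF refl])
      fix Q assume "Q \<in> S"
      then show "z / x \<in> Q \<longleftrightarrow> z \<in> ordset Q (place_val Q x)"
        using ordset_mult_iff[OF S(2), of Q x "z / x" "place_val Q x"] x ordset_0[OF S(2)] by simp
    qed
    finally show ?thesis .
  qed
  define f where "f = (\<lambda>v. restrict (\<lambda>Q. coset (ordset Q (place_val Q x)) v) S)"
  have feq: "f v = f w \<longleftrightarrow> v - w \<in> (\<lambda>a. x * a) ` R" for v w
  proof -
    have "f v = f w \<longleftrightarrow> (\<forall>Q\<in>S. coset (ordset Q (place_val Q x)) v = coset (ordset Q (place_val Q x)) w)"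
      by (auto simp: f_def restrict_def fun_eq_iff)
    then show ?thesis using S by (simp add: mem coset_eq_iff FV.subspace_add_subgroup ordset_subspace)
  qed
  have "add_subgroup ((\<lambda>a. x * a) ` R)" unfolding add_subgroup_def
    using S by (simp add: mem FV.subspace_diff[OF ordset_subspace])
  then have "idx R ((\<lambda>a. x * a) ` R) = card (f ` R)" by (rule idx_eqI) (rule feq)
  also have "f ` R = PiE S (\<lambda>Q. coset (ordset Q (place_val Q x)) ` ordset Q 0)"
  proof (intro equalityI subsetI)
    fix c assume "c \<in> f ` R"
    then show "c \<in> PiE S (\<lambda>Q. coset (ordset Q (place_val Q x)) ` ordset Q 0)"
      using S by (auto simp: f_def R_def ordset_0)
  next
    fix c assume c: "c \<in> PiE S (\<lambda>Q. coset (ordset Q (place_val Q x)) ` ordset Q 0)"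
    then have "\<forall>Q\<in>S. \<exists>v. v \<in> ordset Q 0 \<and> c Q = coset (ordset Q (place_val Q x)) v" by (fastforce simp: PiE_def Pi_def)
    then obtain v where v: "\<And>Q. Q \<in> S \<Longrightarrow> v Q \<in> ordset Q 0 \<and> c Q = coset (ordset Q (place_val Q x)) (v Q)" by metis
    define N where "N = (\<Sum>Q\<in>S. place_val Q x)"
    have N: "place_val Q x \<le> N" if "Q \<in> S" for Q unfolding N_def using S that by (intro member_le_sum) auto
    obtain z where z: "\<And>Q. Q \<in> S \<Longrightarrow> z - v Q \<in> ordset Q N" using weak_approximation[OF S(1,2)] by blast
    have z': "z - v Q \<in> ordset Q (place_val Q x)" if "Q \<in> S" for Q
      using z[OF that] ordset_antimono[OF N[OF that]] by blast
    have "z \<in> Q" if "Q \<in> S" for Q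
    proof -
      have "(z - v Q) + v Q \<in> ordset Q 0"
        using z'[OF that] v[OF that] ordset_antimono[OF S(3)[OF that], of Q]
        by (intro FV.subspace_add ordset_subspace S that) auto
      then show ?thesis using ordset_0 S that by simp
    qed
    then have "z \<in> R" by (simp add: R_def)
    moreover have "f z = c"
    proof (rule PiE_ext)
      show "f z \<in> PiE S (\<lambda>_. UNIV)" by (simp add: f_def)
      show "c \<in> PiE S (\<lambda>_. UNIV)" using c by (auto simp: PiE_def)
      show "f z Q = c Q" if "Q \<in> S" for Q
        using that z' v S by (simp add: f_def coset_eq_iff FV.subspace_add_subgroup ordset_subspace)
    qed
    ultimately show "c \<in> f ` R" by blast
  qed
  also have "card \<dots> = CARD('k) ^ (\<Sum>Q\<in>S. nat (place_val Q x) * place_degree \<iota> Q)"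
    using card_local_conditions[OF S(1,2), of "\<lambda>_. 0" "\<lambda>Q. place_val Q x"] S by simp
  finally have "CARD('k) ^ (\<Sum>Q\<in>S. nat (place_val Q x) * place_degree \<iota> Q) \<le> CARD('k) ^ m"
    using idx_multiples_le[OF R xR x m] by simp
  then show ?thesis using FV.power_card_le_iff by blast
qed

lemma finite_zeros: assumes x: "x \<noteq> 0" shows "finite {P. place \<iota> P \<and> 0 < place_val P x}"
proof (rule ccontr)
  assume inf: "infinite {P. place \<iota> P \<and> 0 < place_val P x}"
  obtain m where m: "dep x m" using dep_exists by blast
  obtain S where S: "finite S" "card S = Suc m" "S \<subseteq> {P. place \<iota> P \<and> 0 < place_val P x}"
    using infinite_arbitrarily_large[OF inf] by metis
  have "card S = (\<Sum>Q\<in>S. 1)" by simp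
  also have "\<dots> \<le> (\<Sum>Q\<in>S. nat (place_val Q x) * place_degree \<iota> Q)"
  proof (rule sum_mono)
    fix Q assume "Q \<in> S"
    then have "1 \<le> nat (place_val Q x)" "1 \<le> place_degree \<iota> Q"
      using S place_degree_pos[of Q] by (auto simp: Suc_le_eq)
    then show "1 \<le> nat (place_val Q x) * place_degree \<iota> Q" by (metis mult_le_mono mult_1)
  qed
  also have "\<dots> \<le> m" using S x m by (intro zeros_le) auto
  finally show False using S by simp
qed

lemma finite_support: assumes x: "x \<noteq> 0" shows "finite {P. place \<iota> P \<and> place_val P x \<noteq> 0}"
proof -
  have "{P. place \<iota> P \<and> place_val P x \<noteq> 0}
      = {P. place \<iota> P \<and> 0 < place_val P x} \<union> {P. place \<iota> P \<and> 0 < place_val P (inverse x)}"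
    using x by (auto simp: val_inverse)
  then show ?thesis using finite_zeros[of x] finite_zeros[of "inverse x"] x by simp
qed

end


section \<open>Divisors, Riemann-Roch spaces and adeles\<close>

context function_field
begin

abbreviation divisor :: "('f set \<Rightarrow> int) \<Rightarrow> bool" where "divisor \<equiv> is_divisor \<iota>"
abbreviation deg :: "('f set \<Rightarrow> int) \<Rightarrow> int" where "deg \<equiv> div_degree \<iota>"
abbreviation L :: "('f set \<Rightarrow> int) \<Rightarrow> 'f set" where "L \<equiv> riemann_roch_space \<iota>"

lemma divisorI:
  assumes "finite S" "\<And>Q. Q \<in> S \<Longrightarrow> place \<iota> Q" "\<And>Q. Q \<notin> S \<Longrightarrow> D Q = 0"
  shows "divisor D"
proof -
  have "div_supp D \<subseteq> S" using assms(3) by (auto simp: div_supp_def)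
  then show ?thesis using assms finite_subset unfolding is_divisor_def by blast
qed

lemma divisor_finite: "divisor D \<Longrightarrow> finite (div_supp D)"
  and divisor_place: "divisor D \<Longrightarrow> Q \<in> div_supp D \<Longrightarrow> place \<iota> Q"
  by (auto simp: is_divisor_def)

lemma divisor_outside: "divisor D \<Longrightarrow> \<not> place \<iota> Q \<Longrightarrow> D Q = 0"
  using divisor_place[of D Q] by (auto simp: div_supp_def)

lemma divisor_pointwise:
  assumes "divisor D" "divisor E" "f 0 0 = 0" shows "divisor (\<lambda>Q. f (D Q) (E Q))"
  by (rule divisorI[of "div_supp D \<union> div_supp E"])
    (use assms divisor_finite divisor_place in \<open>auto simp: div_supp_def\<close>)

lemma divisor_zero: "divisor 0" by (rule divisorI[of "{}"]) auto

lemma divisor_add: "divisor D \<Longrightarrow> divisor E \<Longrightarrow> divisor (D + E)"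
  using divisor_pointwise[of D E "(+)"] by (simp add: plus_fun_def)

lemma divisor_diff: "divisor D \<Longrightarrow> divisor E \<Longrightarrow> divisor (D - E)"
  using divisor_pointwise[of D E "(-)"] by (simp add: fun_diff_def)

lemma divisor_sup: "divisor D \<Longrightarrow> divisor E \<Longrightarrow> divisor (sup D E)"
  using divisor_pointwise[of D E sup] by (simp add: sup_fun_def)

lemma divisor_inf: "divisor D \<Longrightarrow> divisor E \<Longrightarrow> divisor (inf D E)"
  using divisor_pointwise[of D E inf] by (simp add: inf_fun_def)

lemma divisor_scale: "divisor D \<Longrightarrow> divisor (\<lambda>Q. n * D Q)"
  using divisor_pointwise[of D D "\<lambda>a b. n * a"] by simp

lemma divisor_point: "place \<iota> P \<Longrightarrow> divisor (point_divisor P)"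
  by (rule divisorI[of "{P}"]) (auto simp: point_divisor_def)

lemma deg_eq_sum:
  assumes "finite S" "\<And>Q. Q \<notin> S \<Longrightarrow> D Q = 0"
  shows "deg D = (\<Sum>Q\<in>S. D Q * int (place_degree \<iota> Q))"
  unfolding div_degree_def using assms
  by (intro sum.mono_neutral_left) (auto simp: div_supp_def)

lemma deg_add:
  assumes "divisor D" "divisor E" shows "deg (D + E) = deg D + deg E"
proof -
  let ?S = "div_supp D \<union> div_supp E"
  have fin: "finite ?S" using assms divisor_finite by auto
  have "deg D = (\<Sum>Q\<in>?S. D Q * int (place_degree \<iota> Q))" "deg E = (\<Sum>Q\<in>?S. E Q * int (place_degree \<iota> Q))"
    "deg (D + E) = (\<Sum>Q\<in>?S. (D + E) Q * int (place_degree \<iota> Q))"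
    by (rule deg_eq_sum[OF fin]; simp add: div_supp_def)+
  then show ?thesis by (simp add: algebra_simps sum.distrib)
qed

lemma deg_zero: "deg 0 = 0" by (simp add: div_degree_def div_supp_def)

lemma deg_diff: assumes "divisor D" "divisor E" shows "deg (D - E) = deg D - deg E"
  using deg_add[OF divisor_diff[OF assms] assms(2)] by simp

lemma deg_scale: assumes "divisor D" shows "deg (\<lambda>Q. n * D Q) = n * deg D"
proof -
  have "deg (\<lambda>Q. n * D Q) = (\<Sum>Q\<in>div_supp D. n * D Q * int (place_degree \<iota> Q))"
    using divisor_finite[OF assms] by (intro deg_eq_sum) (auto simp: div_supp_def)
  then show ?thesis by (simp add: div_degree_def sum_distrib_left mult.assoc)
qed

lemma deg_point: "deg (point_divisor P) = int (place_degree \<iota> P)"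
  using deg_eq_sum[of "{P}" "point_divisor P"] by (simp add: point_divisor_def)

lemma deg_diff_eq_sum:
  assumes "divisor D" "divisor E" "D \<le> E"
  shows "nat (deg E - deg D) = (\<Sum>Q\<in>div_supp D \<union> div_supp E. nat (E Q - D Q) * place_degree \<iota> Q)" "deg D \<le> deg E"
proof -
  have fin: "finite (div_supp D \<union> div_supp E)" using assms divisor_finite by auto
  have "deg E - deg D = (\<Sum>Q\<in>div_supp D \<union> div_supp E. (E - D) Q * int (place_degree \<iota> Q))"
    unfolding deg_diff[OF assms(2,1), symmetric] by (rule deg_eq_sum[OF fin]) (auto simp: div_supp_def)
  also have "\<dots> = int (\<Sum>Q\<in>div_supp D \<union> div_supp E. nat (E Q - D Q) * place_degree \<iota> Q)"
    unfolding of_nat_sum by (rule sum.cong) (use assms(3) in \<open>auto simp: le_fun_def\<close>)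
  finally have eq: "deg E - deg D = int (\<Sum>Q\<in>div_supp D \<union> div_supp E. nat (E Q - D Q) * place_degree \<iota> Q)" .
  then show "nat (deg E - deg D) = (\<Sum>Q\<in>div_supp D \<union> div_supp E. nat (E Q - D Q) * place_degree \<iota> Q)"
    by (simp only: nat_int)
  show "deg D \<le> deg E" using eq by linarith
qed

lemma divisor_div_fun: "h \<noteq> 0 \<Longrightarrow> divisor (div_fun \<iota> h)"
  by (rule divisorI[OF finite_support[of h]]) (auto simp: div_fun_def)

lemma div_fun_mult: "x \<noteq> 0 \<Longrightarrow> y \<noteq> 0 \<Longrightarrow> div_fun \<iota> (x * y) = div_fun \<iota> x + div_fun \<iota> y"
  by (auto simp: div_fun_def fun_eq_iff val_mult)

lemma div_fun_inverse: "x \<noteq> 0 \<Longrightarrow> div_fun \<iota> (inverse x) = - div_fun \<iota> x"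
  by (auto simp: div_fun_def fun_eq_iff val_inverse)

lemma mem_L_iff:
  assumes "\<And>Q. \<not> place \<iota> Q \<Longrightarrow> D Q = 0"
  shows "h \<in> L D \<longleftrightarrow> (\<forall>Q. place \<iota> Q \<longrightarrow> h \<in> ordset Q (- D Q))"
proof (cases "h = 0")
  case False
  have "0 \<le> (if place \<iota> Q then place_val Q h else 0) + D Q \<longleftrightarrow> (place \<iota> Q \<longrightarrow> - D Q \<le> place_val Q h)" for Q
    using assms[of Q] by auto
  then show ?thesis using False
    by (simp add: riemann_roch_space_def ordset_def le_fun_def div_fun_def)
qed (simp add: riemann_roch_space_def)

lemma mem_L: "divisor D \<Longrightarrow> h \<in> L D \<longleftrightarrow> (\<forall>Q. place \<iota> Q \<longrightarrow> h \<in> ordset Q (- D Q))"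
  by (rule mem_L_iff) (rule divisor_outside)

lemma L_subspace: "divisor D \<Longrightarrow> FV.subspace (L D)"
  by (rule FV.subspaceI)
    (auto simp: mem_L intro: FV.subspace_add[OF ordset_subspace] FV.subspace_scale[OF ordset_subspace])

lemma zero_in_L: "0 \<in> L D" by (simp add: riemann_roch_space_def)

lemma L_mono: assumes "divisor D" "divisor E" "D \<le> E" shows "L D \<subseteq> L E"
proof
  fix h assume "h \<in> L D"
  moreover have "- E Q \<le> - D Q" for Q using assms(3) by (simp add: le_fun_def)
  then have "ordset Q (- D Q) \<subseteq> ordset Q (- E Q)" for Q by (rule ordset_antimono)
  ultimately show "h \<in> L E" using mem_L[OF assms(1)] mem_L[OF assms(2)] by blast
qed

lemma L_mult: assumes "divisor D" "divisor E" "x \<in> L D" "y \<in> L E" shows "x * y \<in> L (D + E)"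
proof -
  have "x * y \<in> ordset Q (- (D + E) Q)" if "place \<iota> Q" for Q
    using ordset_mult[OF that, of x "- D Q" y "- E Q"] assms that by (simp add: mem_L)
  then show ?thesis using assms divisor_add by (simp add: mem_L)
qed

lemma L_div_fun: "h \<noteq> 0 \<Longrightarrow> h \<in> L D \<longleftrightarrow> 0 \<le> div_fun \<iota> h + D"
  by (simp add: riemann_roch_space_def)

text \<open>Components at sets that are no places are left arbitrary.\<close>

definition adele_box :: "('f set \<Rightarrow> int) \<Rightarrow> ('f set \<Rightarrow> 'f) set" where
  "adele_box D = {a. \<forall>Q. place \<iota> Q \<longrightarrow> a Q \<in> ordset Q (- D Q)}"

definition adeles :: "('f set \<Rightarrow> 'f) set" where
  "adeles = \<Union> (adele_box ` Collect divisor)"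

definition principal :: "('f set \<Rightarrow> 'f) set" where
  "principal = range (\<lambda>f _. f)"

lemma adele_box_subspace: "AV.subspace (adele_box D)"
  by (rule AV.subspaceI)
    (auto simp: adele_box_def intro: FV.subspace_add[OF ordset_subspace] FV.subspace_scale[OF ordset_subspace])

lemma adele_box_mono: assumes "D \<le> E" shows "adele_box D \<subseteq> adele_box E"
proof -
  have "ordset Q (- D Q) \<subseteq> ordset Q (- E Q)" for Q
    using assms by (intro ordset_antimono) (simp add: le_fun_def)
  then show ?thesis by (auto simp: adele_box_def)
qed

lemma adele_box_subset: "divisor D \<Longrightarrow> adele_box D \<subseteq> adeles" by (auto simp: adeles_def)

lemma adele_box_mult: "a \<in> adele_box D \<Longrightarrow> b \<in> adele_box E \<Longrightarrow> a * b \<in> adele_box (D + E)"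
proof -
  assume ab: "a \<in> adele_box D" "b \<in> adele_box E"
  have "a Q * b Q \<in> ordset Q (- (D + E) Q)" if "place \<iota> Q" for Q
    using ordset_mult[OF that, of "a Q" "- D Q" "b Q" "- E Q"] ab that by (simp add: adele_box_def)
  then show ?thesis by (simp add: adele_box_def)
qed

lemma principal_subspace: "AV.subspace principal"
proof (rule AV.subspaceI)
  show "(0::'f set \<Rightarrow> 'f) \<in> principal" unfolding principal_def by (rule range_eqI[of _ _ 0]) (simp add: zero_fun_def)
next
  fix a b :: "'f set \<Rightarrow> 'f" assume "a \<in> principal" "b \<in> principal"
  then obtain f g where "a = (\<lambda>_. f)" "b = (\<lambda>_. g)" by (auto simp: principal_def)
  then show "a + b \<in> principal" unfolding principal_def
    by (intro range_eqI[of _ _ "f + g"]) (simp add: plus_fun_def)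
next
  fix c and a :: "'f set \<Rightarrow> 'f" assume "a \<in> principal"
  then show "(\<lambda>Q. \<iota> c * a Q) \<in> principal" by (auto simp: principal_def)
qed

lemma const_in_adele_box: "divisor D \<Longrightarrow> (\<lambda>_. f) \<in> adele_box D \<longleftrightarrow> f \<in> L D"
  by (simp add: mem_L adele_box_def)

text \<open>Every function has finitely many poles, so the join of finitely many pole divisors will do.\<close>

lemma finite_subset_L:
  assumes "finite Z" shows "\<exists>C. divisor C \<and> 0 \<le> C \<and> Z \<subseteq> L C"
  using assms
proof induction
  case empty
  then show ?case using divisor_zero by blast
next
  case (insert z Z)
  then obtain C where C: "divisor C" "0 \<le> C" "Z \<subseteq> L C" by blast
  show ?case
  proof (cases "z = 0")
    case True
    then show ?thesis using C zero_in_L by blast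
  next
    case False
    define C' where "C' = sup C (0 - div_fun \<iota> z)"
    have d: "divisor C'" unfolding C'_def using C False by (intro divisor_sup divisor_diff divisor_zero divisor_div_fun)
    have le: "C \<le> C'" by (simp add: C'_def)
    have "0 - div_fun \<iota> z \<le> C'" by (simp add: C'_def)
    then have le': "- div_fun \<iota> z Q \<le> C' Q" for Q by (simp add: le_fun_def)
    then have "0 \<le> div_fun \<iota> z Q + C' Q" for Q
      using le'[of Q] by linarith
    then have "z \<in> L C'" using False by (simp add: L_div_fun le_fun_def)
    moreover have "Z \<subseteq> L C'" using L_mono[OF C(1) d le] C by blast
    moreover have "0 \<le> C'" using C(2) le by (rule order.trans)
    ultimately show ?thesis using d by blast
  qed
qed

lemma adeles_subspace: "AV.subspace adeles"
proof (rule AV.subspaceI)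
  show "0 \<in> adeles" using divisor_zero by (auto simp: adeles_def adele_box_def)
next
  fix a b assume "a \<in> adeles" "b \<in> adeles"
  then obtain D E where "divisor D" "divisor E" "a \<in> adele_box D" "b \<in> adele_box E" by (auto simp: adeles_def)
  moreover from this have "a \<in> adele_box (sup D E)" "b \<in> adele_box (sup D E)"
    using adele_box_mono[of D "sup D E"] adele_box_mono[of E "sup D E"] by auto
  ultimately show "a + b \<in> adeles" using divisor_sup AV.subspace_add[OF adele_box_subspace] unfolding adeles_def by blast
next
  fix c a assume "a \<in> adeles"
  then show "(\<lambda>Q. \<iota> c * a Q) \<in> adeles" using AV.subspace_scale[OF adele_box_subspace] unfolding adeles_def by blast
qed

lemma principal_subset_adeles: "principal \<subseteq> adeles"
proof
  fix a assume "a \<in> principal"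
  then obtain f where f: "a = (\<lambda>_. f)" by (auto simp: principal_def)
  obtain C where "divisor C" "f \<in> L C" using finite_subset_L[of "{f}"] by auto
  then show "a \<in> adeles" using const_in_adele_box f unfolding adeles_def by blast
qed

lemma adeles_mult: "a \<in> adeles \<Longrightarrow> b \<in> adeles \<Longrightarrow> a * b \<in> adeles"
proof -
  assume "a \<in> adeles" "b \<in> adeles"
  then obtain D E where "divisor D" "divisor E" "a \<in> adele_box D" "b \<in> adele_box E" by (auto simp: adeles_def)
  then have "a * b \<in> adele_box (D + E)" "divisor (D + E)" using adele_box_mult divisor_add by auto
  then show ?thesis using adele_box_subset by blast
qed

lemma idx_adele_box:
  assumes D: "divisor D" and E: "divisor E" and le: "D \<le> E"
  shows "idx (adele_box E) (adele_box D) = CARD('k) ^ nat (deg E - deg D)"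
proof -
  define S where "S = div_supp D \<union> div_supp E"
  have S: "finite S" "\<And>Q. Q \<in> S \<Longrightarrow> place \<iota> Q"
    using D E divisor_finite divisor_place by (auto simp: S_def)
  have out: "D Q = 0" "E Q = 0" if "Q \<notin> S" for Q using that by (auto simp: S_def div_supp_def)
  define f where "f = (\<lambda>v :: 'f set \<Rightarrow> 'f. restrict (\<lambda>Q. coset (ordset Q (- D Q)) (v Q)) S)"
  have feq: "f v = f w \<longleftrightarrow> v - w \<in> adele_box D" if "v \<in> adele_box E" "w \<in> adele_box E" for v w
  proof -
    have "f v = f w \<longleftrightarrow> (\<forall>Q\<in>S. coset (ordset Q (- D Q)) (v Q) = coset (ordset Q (- D Q)) (w Q))"
      by (auto simp: f_def restrict_def fun_eq_iff)
    also have "\<dots> \<longleftrightarrow> (\<forall>Q\<in>S. v Q - w Q \<in> ordset Q (- D Q))"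
      using S by (simp add: coset_eq_iff FV.subspace_add_subgroup ordset_subspace)
    also have "\<dots> \<longleftrightarrow> v - w \<in> adele_box D"
    proof -
      have "v Q - w Q \<in> ordset Q (- D Q)" if "place \<iota> Q" "Q \<notin> S" for Q
      proof -
        have "v Q \<in> ordset Q (- E Q)" "w Q \<in> ordset Q (- E Q)"
          using \<open>v \<in> adele_box E\<close> \<open>w \<in> adele_box E\<close> that by (auto simp: adele_box_def)
        then show ?thesis using out[OF that(2)] FV.subspace_diff[OF ordset_subspace[OF that(1)]] by simp
      qed
      then show ?thesis using S by (auto simp: adele_box_def)
    qed
    finally show ?thesis .
  qed
  have "idx (adele_box E) (adele_box D) = card (f ` adele_box E)"
    by (rule idx_eqI[OF AV.subspace_add_subgroup[OF adele_box_subspace]]) (rule feq)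
  also have "f ` adele_box E = PiE S (\<lambda>Q. coset (ordset Q (- D Q)) ` ordset Q (- E Q))"
  proof (intro equalityI subsetI)
    fix c assume "c \<in> f ` adele_box E"
    then show "c \<in> PiE S (\<lambda>Q. coset (ordset Q (- D Q)) ` ordset Q (- E Q))"
      using S by (auto simp: f_def adele_box_def)
  next
    fix c assume c: "c \<in> PiE S (\<lambda>Q. coset (ordset Q (- D Q)) ` ordset Q (- E Q))"
    then have "\<forall>Q\<in>S. \<exists>v. v \<in> ordset Q (- E Q) \<and> c Q = coset (ordset Q (- D Q)) v" by (fastforce simp: PiE_def Pi_def)
    then obtain v where v: "\<And>Q. Q \<in> S \<Longrightarrow> v Q \<in> ordset Q (- E Q) \<and> c Q = coset (ordset Q (- D Q)) (v Q)" by metis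
    define a where "a = (\<lambda>Q. if Q \<in> S then v Q else 0)"
    have "a \<in> adele_box E" using v by (auto simp: a_def adele_box_def)
    moreover have "f a = c"
    proof (rule PiE_ext)
      show "f a \<in> PiE S (\<lambda>_. UNIV)" by (simp add: f_def)
      show "c \<in> PiE S (\<lambda>_. UNIV)" using c by (auto simp: PiE_def)
      show "f a Q = c Q" if "Q \<in> S" for Q using that v by (simp add: f_def a_def)
    qed
    ultimately show "c \<in> f ` adele_box E" by blast
  qed
  also have "card \<dots> = CARD('k) ^ (\<Sum>Q\<in>S. nat (E Q - D Q) * place_degree \<iota> Q)"
    using card_local_conditions[OF S, of "\<lambda>Q. - E Q" "\<lambda>Q. - D Q"] le by (simp add: le_fun_def)
  finally show ?thesis using deg_diff_eq_sum[OF D E le] by (simp add: S_def)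
qed

text \<open>Intersecting the boxes with the functions turns them into \<open>L E\<close> and \<open>L D\<close>, so \<open>L E\<close> modulo \<open>L D\<close> is the
  part of \<open>adele_box E\<close> modulo \<open>adele_box D\<close> that is lost when functions are divided out.\<close>

lemma idx_adele_box_principal:
  assumes D: "divisor D" and E: "divisor E" and le: "D \<le> E"
  shows "CARD('k) ^ nat (deg E - deg D)
    = idx (sumset (adele_box E) principal) (sumset (adele_box D) principal) * idx (L E) (L D)"
proof -
  let ?B = "adele_box D" and ?C = "adele_box E"
  note sB = AV.subspace_add_subgroup[OF adele_box_subspace[of D]]
    and sC = AV.subspace_add_subgroup[OF adele_box_subspace[of E]]
    and sF = AV.subspace_add_subgroup[OF principal_subspace]
  have BC: "?B \<subseteq> ?C" by (rule adele_box_mono[OF le])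
  define T where "T = sumset (?C \<inter> principal) ?B"
  have sCF: "add_subgroup (?C \<inter> principal)" by (rule add_subgroup_Int[OF sC sF])
  have sT: "add_subgroup T" unfolding T_def by (intro add_subgroup_sumset sCF sB)
  have sBF: "add_subgroup (sumset ?B principal)" by (intro add_subgroup_sumset sF sB)
  have BT: "?B \<subseteq> T" unfolding T_def sumset_def using add_subgroup_zero[OF sCF] by force
  have TC: "T \<subseteq> ?C" unfolding T_def sumset_def using add_subgroup_add[OF sC] BC by blast
  have Teq: "T = ?C \<inter> sumset ?B principal"
  proof (intro equalityI subsetI)
    fix x assume "x \<in> T"
    then obtain c b where x: "c \<in> ?C" "c \<in> principal" "b \<in> ?B" "x = c + b" unfolding T_def sumset_def by blast
    then have "x = b + c" by (simp add: add.commute)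
    then have "x \<in> sumset ?B principal" using x unfolding sumset_def by blast
    then show "x \<in> ?C \<inter> sumset ?B principal" using TC \<open>x \<in> T\<close> by blast
  next
    fix x assume x: "x \<in> ?C \<inter> sumset ?B principal"
    then obtain b f where bf: "b \<in> ?B" "f \<in> principal" "x = b + f" unfolding sumset_def by blast
    then have "f = x - b" by simp
    then have "f \<in> ?C" using x bf BC add_subgroup_diff[OF sC] by blast
    then have "f + b \<in> T" using bf unfolding T_def sumset_def by blast
    then show "x \<in> T" using bf by (simp add: add.commute)
  qed
  have "idx T ?B = idx (?C \<inter> principal) (?C \<inter> principal \<inter> ?B)"
    unfolding T_def by (rule idx_second_iso[OF sCF sB])
  also have "?C \<inter> principal \<inter> ?B = ?B \<inter> principal" using BC by blast
  also have "idx (?C \<inter> principal) (?B \<inter> principal)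
      = card ((\<lambda>a. coset (L D) (a {})) ` (?C \<inter> principal))"
  proof (rule idx_eqI[OF add_subgroup_Int[OF sB sF]])
    fix v w assume vw: "v \<in> ?C \<inter> principal" "w \<in> ?C \<inter> principal"
    then obtain f g where "v = (\<lambda>_. f)" "w = (\<lambda>_. g)" by (auto simp: principal_def)
    moreover from this have "v - w = (\<lambda>_. f - g)" by (simp add: fun_eq_iff)
    ultimately show "coset (L D) (v {}) = coset (L D) (w {}) \<longleftrightarrow> v - w \<in> ?B \<inter> principal"
      using coset_eq_iff[OF FV.subspace_add_subgroup[OF L_subspace[OF D]]] const_in_adele_box[OF D]
      by (auto simp: principal_def)
  qed
  also have "(\<lambda>a. coset (L D) (a {})) ` (?C \<inter> principal) = coset (L D) ` L E"
  proof (intro equalityI subsetI)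
    fix c assume "c \<in> (\<lambda>a. coset (L D) (a {})) ` (?C \<inter> principal)"
    then show "c \<in> coset (L D) ` L E" using const_in_adele_box[OF E] by (auto simp: principal_def)
  next
    fix c assume "c \<in> coset (L D) ` L E"
    then obtain f where "f \<in> L E" "c = coset (L D) f" by auto
    then show "c \<in> (\<lambda>a. coset (L D) (a {})) ` (?C \<inter> principal)"
      using const_in_adele_box[OF E] by (intro image_eqI[of _ _ "\<lambda>_. f"]) (auto simp: principal_def)
  qed
  finally have 1: "idx T ?B = idx (L E) (L D)" by (simp add: idx_def)
  have "idx ?C T = idx (sumset ?C (sumset ?B principal)) (sumset ?B principal)"
    unfolding Teq by (rule idx_second_iso[OF sC sBF, symmetric])
  also have "sumset ?C (sumset ?B principal) = sumset ?C principal"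
  proof (intro equalityI subsetI)
    fix x assume "x \<in> sumset ?C (sumset ?B principal)"
    then obtain c b f where x: "c \<in> ?C" "b \<in> ?B" "f \<in> principal" "x = c + (b + f)" unfolding sumset_def by blast
    have "c + b \<in> ?C" using x BC add_subgroup_add[OF sC] by blast
    moreover have "x = (c + b) + f" using x by (simp add: add.assoc)
    ultimately show "x \<in> sumset ?C principal" using x unfolding sumset_def by blast
  next
    fix x assume "x \<in> sumset ?C principal"
    then obtain c f where x: "c \<in> ?C" "f \<in> principal" "x = c + f" unfolding sumset_def by blast
    have "0 + f \<in> sumset ?B principal" using x add_subgroup_zero[OF sB] unfolding sumset_def by blast
    then show "x \<in> sumset ?C (sumset ?B principal)" using x unfolding sumset_def by auto
  qed
  finally have 2: "idx ?C T = idx (sumset ?C principal) (sumset ?B principal)" .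
  have "idx ?C ?B = idx ?C T * idx T ?B" by (rule idx_tower[OF sB sT sC BT TC])
  then show ?thesis using 1 2 idx_adele_box[OF D E le] by simp
qed

lemma nonconstant_exists: obtains y where "\<not> algebraic_over \<iota> y"
  using one_variable by blast

lemma place_exists: obtains P where "place \<iota> P"
  using nonconstant_exists zero_exists by metis

lemma constant_inverse: assumes "inverse h \<in> range \<iota>" shows "h \<in> range \<iota>"
proof -
  obtain c where "inverse h = \<iota> c" using assms by blast
  then have "h = \<iota> (inverse c)" by (metis \<iota>_inverse inverse_inverse_eq)
  then show ?thesis by blast
qed

text \<open>A nonconstant function has a pole, at a zero of its inverse.\<close>

lemma L_0: "L 0 = range \<iota>"
proof (intro equalityI subsetI)
  fix h assume h: "h \<in> L 0"
  show "h \<in> range \<iota>"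
  proof (rule ccontr)
    assume n: "h \<notin> range \<iota>"
    then have h0: "h \<noteq> 0" using \<iota>_0 by (metis rangeI)
    have "\<not> algebraic_over \<iota> (inverse h)" using n constants constant_inverse by blast
    then obtain P where P: "place \<iota> P" "inverse h \<in> max_ideal P" using zero_exists by blast
    then have "1 \<le> place_val P (inverse h)" using max_ideal_iff_val[OF P(1), of "inverse h"] h0 by simp
    moreover have "h \<in> ordset P 0" using h P mem_L[OF divisor_zero, of h] by simp
    ultimately show False using h0 by (simp add: ordset_def val_inverse P)
  qed
next
  fix h assume "h \<in> range \<iota>"
  then show "h \<in> L 0" by (auto simp: mem_L divisor_zero ordset_0 place_const)
qed

lemma card_L_0: "card (L 0) = CARD('k)"
  unfolding L_0 by (rule card_image) (simp add: inj_on_def)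

text \<open>Above the constants \<open>L 0\<close> the index is finite, since it divides that of two boxes.\<close>

lemma finite_L: assumes D: "divisor D" shows "finite (L D)"
proof -
  let ?E = "sup D 0"
  have E: "divisor ?E" "0 \<le> ?E" "D \<le> ?E" using D divisor_zero divisor_sup by auto
  have "0 < CARD('k) ^ nat (deg ?E - deg 0)" by simp
  then have "0 < idx (L ?E) (L 0)"
    using idx_adele_box_principal[OF divisor_zero E(1,2)] by (metis mult_0_right neq0_conv)
  moreover have "idx (L ?E) {0} = idx (L ?E) (L 0) * idx (L 0) {0}"
    using L_subspace E divisor_zero L_mono zero_in_L
    by (intro idx_tower FV.subspace_add_subgroup add_subgroup_trivial) auto
  ultimately have "0 < card (L ?E)" using card_L_0 by (simp add: idx_trivial)
  then have "finite (L ?E)" by (rule card_ge_0_finite)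
  then show ?thesis using L_mono[OF D E(1,3)] finite_subset by blast
qed

lemma card_L: assumes D: "divisor D" shows "card (L D) = CARD('k) ^ ell \<iota> D"
  using FV.card_subspace[OF L_subspace[OF D] finite_L[OF D]] by (simp add: ell_def)

lemma ell_0: "ell \<iota> 0 = 1"
  using card_L[OF divisor_zero] card_L_0 FV.power_card_inject[of "ell \<iota> 0" 1] by simp

lemma idx_L: 
  assumes D: "divisor D" and E: "divisor E" and le: "D \<le> E"
  shows "CARD('k) ^ ell \<iota> E = idx (L E) (L D) * CARD('k) ^ ell \<iota> D"
proof -
  have "idx (L E) {0} = idx (L E) (L D) * idx (L D) {0}"
    using L_subspace D E L_mono[OF assms] zero_in_L
    by (intro idx_tower FV.subspace_add_subgroup add_subgroup_trivial) auto
  then show ?thesis using D E by (simp add: idx_trivial card_L)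
qed

lemma idx_sumset_principal:
  assumes D: "divisor D" and E: "divisor E" and le: "D \<le> E"
  shows "idx (sumset (adele_box E) principal) (sumset (adele_box D) principal) * CARD('k) ^ ell \<iota> E
    = CARD('k) ^ (nat (deg E - deg D) + ell \<iota> D)"
  using idx_adele_box_principal[OF assms] idx_L[OF assms] by (simp add: power_add)

lemma ell_le:
  assumes D: "divisor D" and E: "divisor E" and le: "D \<le> E"
  shows "int (ell \<iota> E) - int (ell \<iota> D) \<le> deg E - deg D" "ell \<iota> D \<le> ell \<iota> E"
proof -
  let ?i = "idx (sumset (adele_box E) principal) (sumset (adele_box D) principal)"
  have "?i \<noteq> 0" using idx_sumset_principal[OF assms] by (metis mult_0 power_eq_0_iff zero_less_card_finite less_irrefl)
  then have "CARD('k) ^ ell \<iota> E \<le> ?i * CARD('k) ^ ell \<iota> E" by (cases ?i) auto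
  then have "ell \<iota> E \<le> nat (deg E - deg D) + ell \<iota> D"
    using idx_sumset_principal[OF assms] FV.power_card_le_iff by simp
  then show "int (ell \<iota> E) - int (ell \<iota> D) \<le> deg E - deg D" using deg_diff_eq_sum(2)[OF assms] by linarith
  have "card (L D) \<le> card (L E)" using L_mono[OF assms] finite_L[OF E] by (rule card_mono[rotated])
  then show "ell \<iota> D \<le> ell \<iota> E" using FV.power_card_le_iff by (simp add: card_L D E)
qed

lemma ell_add_div_fun:
  assumes D: "divisor D" and z: "z \<noteq> 0" shows "ell \<iota> (D + div_fun \<iota> z) = ell \<iota> D"
proof -
  have E: "divisor (D + div_fun \<iota> z)" using D z by (intro divisor_add divisor_div_fun)
  have "h \<in> L (D + div_fun \<iota> z) \<longleftrightarrow> z * h \<in> L D" for h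
    using z by (cases "h = 0") (auto simp: L_div_fun div_fun_mult zero_in_L add_ac)
  then have "(\<lambda>h. z * h) ` L (D + div_fun \<iota> z) = L D"
    using z by (auto simp: image_iff intro!: bexI[of _ "_ / z"])
  moreover have "inj_on (\<lambda>h. z * h) (L (D + div_fun \<iota> z))" using z by (simp add: inj_on_def)
  ultimately have "card (L D) = card (L (D + div_fun \<iota> z))" using card_image by metis
  then show ?thesis using FV.power_card_inject by (simp add: card_L D E)
qed

end


section \<open>Riemann's theorem\<close>

context function_field
begin

definition zero_divisor :: "'f \<Rightarrow> 'f set \<Rightarrow> int" where
  "zero_divisor y = sup 0 (div_fun \<iota> y)"

lemma divisor_zero_divisor: "y \<noteq> 0 \<Longrightarrow> divisor (zero_divisor y)"
  unfolding zero_divisor_def by (intro divisor_sup divisor_zero divisor_div_fun)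

lemma val_le_zero_divisor: "place \<iota> Q \<Longrightarrow> place_val Q y \<le> zero_divisor y Q" "0 \<le> zero_divisor y Q"
  by (auto simp: zero_divisor_def div_fun_def)

lemma deg_zero_divisor_le:
  assumes y: "y \<noteq> 0" and n: "dep y n" shows "deg (zero_divisor y) \<le> int n"
proof -
  let ?S = "{P. place \<iota> P \<and> 0 < place_val P y}"
  have "deg (zero_divisor y) = (\<Sum>Q\<in>?S. zero_divisor y Q * int (place_degree \<iota> Q))"
    by (rule deg_eq_sum[OF finite_zeros[OF y]]) (auto simp: zero_divisor_def div_fun_def sup_int_def)
  also have "\<dots> = int (\<Sum>Q\<in>?S. nat (place_val Q y) * place_degree \<iota> Q)"
    unfolding of_nat_sum by (rule sum.cong) (auto simp: zero_divisor_def div_fun_def sup_int_def)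
  also have "\<dots> \<le> int n" unfolding of_nat_le_iff by (rule zeros_le[OF finite_zeros[OF y] _ _ y n]) auto
  finally show ?thesis .
qed

lemma transcendental_nonzero: "\<not> algebraic_over \<iota> y \<Longrightarrow> y \<noteq> 0"
proof -
  have "poly_at \<iota> [:0,1:] 0 = 0" by simp
  then have "algebraic_over \<iota> 0" unfolding algebraic_over_def by (intro exI[of _ "[:0,1:]"]) simp
  then show "\<not> algebraic_over \<iota> y \<Longrightarrow> y \<noteq> 0" by auto
qed

definition degree_over :: "'f \<Rightarrow> nat" where "degree_over y = (LEAST n. dep y n)"

lemma dep_degree_over: "dep y (degree_over y)"
  unfolding degree_over_def using dep_exists LeastI_ex by metis

lemma degree_over_pos: assumes "\<not> algebraic_over \<iota> y" shows "0 < degree_over y"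
proof (rule ccontr)
  assume "\<not> ?thesis"
  then have "dep y 0" using dep_degree_over[of y] by simp
  then have "\<exists>p::nat \<Rightarrow> 'k poly. p 0 \<noteq> 0 \<and> poly_at \<iota> (p 0) y = 0"
    unfolding dep_def by (drule_tac spec[of _ "\<lambda>_. 1"]) simp
  then show False using assms by (auto simp: algebraic_over_def)
qed

lemma independent_over_exists:
  obtains u :: "nat \<Rightarrow> 'f" where
    "\<And>p. (\<Sum>j<degree_over y. poly_at \<iota> (p j) y * u j) = 0 \<Longrightarrow> (\<forall>j<degree_over y. p j = 0)"
proof (cases "degree_over y")
  case 0
  then show ?thesis using that by simp
next
  case (Suc n)
  have "\<not> dep y n" using not_less_Least[of n "dep y"] Suc by (simp add: degree_over_def)
  then obtain z :: "nat \<Rightarrow> 'f" where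
    "\<not> (\<exists>p::nat \<Rightarrow> 'k poly. (\<exists>j\<le>n. p j \<noteq> 0) \<and> (\<Sum>j\<le>n. poly_at \<iota> (p j) y * z j) = 0)"
    unfolding dep_def by blast
  then show ?thesis using that[of z] unfolding Suc lessThan_Suc_atMost less_Suc_eq_le by blast
qed

text \<open>
  With \<open>n\<close> independent functions over \<open>k(y)\<close> that lie in \<open>L C\<close>, the products of these
  with the negative powers of \<open>y\<close> up to the order \<open>l\<close> give \<open>(l + 1) n\<close> independent functions
  in \<open>L (l Z + C)\<close>, where \<open>Z\<close> is the divisor of zeros of \<open>y\<close>.
\<close>

lemma ell_zero_divisor_ge:
  assumes y: "\<not> algebraic_over \<iota> y"
  obtains C where "divisor C" "0 \<le> C"
    "\<And>l. (l + 1) * degree_over y \<le> ell \<iota> ((\<lambda>Q. int l * zero_divisor y Q) + C)"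
proof -
  define n where "n = degree_over y"
  have y0: "y \<noteq> 0" by (rule transcendental_nonzero[OF y])
  obtain u :: "nat \<Rightarrow> 'f" where u: "\<And>p. (\<Sum>j<n. poly_at \<iota> (p j) y * u j) = 0 \<Longrightarrow> (\<forall>j<n. p j = 0)"
    using independent_over_exists[of y] unfolding n_def by blast
  obtain C where C: "divisor C" "0 \<le> C" "u ` {..<n} \<subseteq> L C" using finite_subset_L[of "u ` {..<n}"] by auto
  have "(l + 1) * n \<le> ell \<iota> ((\<lambda>Q. int l * zero_divisor y Q) + C)" for l
  proof -
    let ?lZ = "\<lambda>Q. int l * zero_divisor y Q"
    have lZ: "divisor ?lZ" by (rule divisor_scale) (rule divisor_zero_divisor[OF y0])
    note dC = divisor_add[OF lZ C(1)]
    let ?E = "PiE {..<n} (\<lambda>_. {p::'k poly. degree p \<le> l})"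
    define f where "f = (\<lambda>p. inverse y ^ l * (\<Sum>j<n. poly_at \<iota> (p j) y * u j))"
    have pl: "inverse y ^ l * poly_at \<iota> p y \<in> L ?lZ" if "degree p \<le> l" for p
    proof -
      have "inverse y ^ l * poly_at \<iota> p y = (\<Sum>i\<le>l. \<iota> (coeff p i) * inverse y ^ (l - i))"
        unfolding poly_at_altdef[OF that] sum_distrib_left
        by (rule sum.cong) (use y0 in \<open>auto simp: power_diff field_simps\<close>)
      moreover have "inverse y ^ i \<in> L ?lZ" if "i \<le> l" for i
      proof -
        have "- (int l * zero_divisor y Q) \<le> - (int i * place_val Q y)" if Q: "place \<iota> Q" for Q
        proof -
          have "int i * place_val Q y \<le> int i * zero_divisor y Q"
            using val_le_zero_divisor(1)[OF Q] by (intro mult_left_mono) auto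
          also have "\<dots> \<le> int l * zero_divisor y Q"
            using val_le_zero_divisor(2)[of y Q] \<open>i \<le> l\<close> by (intro mult_right_mono) auto
          finally show ?thesis by simp
        qed
        then show ?thesis using y0 by (simp add: mem_L[OF lZ] ordset_def val_power val_inverse)
      qed
      ultimately show ?thesis
        using L_subspace[OF lZ] by (auto intro!: FV.subspace_sum FV.subspace_scale)
    qed
    have "f ` ?E \<subseteq> L (?lZ + C)"
    proof
      fix g assume "g \<in> f ` ?E"
      then obtain p where p: "p \<in> ?E" "g = f p" by auto
      have "g = (\<Sum>j<n. (inverse y ^ l * poly_at \<iota> (p j) y) * u j)"
        by (simp add: p f_def sum_distrib_left mult.assoc)
      also have "\<dots> \<in> L (?lZ + C)"
        using p C by (intro FV.subspace_sum[OF L_subspace[OF dC]] L_mult pl lZ) auto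
      finally show "g \<in> L (?lZ + C)" .
    qed
    moreover have "inj_on f ?E"
    proof (rule inj_onI)
      fix p q assume pq: "p \<in> ?E" "q \<in> ?E" "f p = f q"
      then have "(\<Sum>j<n. poly_at \<iota> (p j - q j) y * u j) = 0"
        using y0 by (simp add: f_def left_diff_distrib sum_subtractf)
      from u[OF this] have "\<forall>j<n. p j - q j = 0" .
      then show "p = q" by (intro PiE_ext[OF pq(1,2)]) auto
    qed
    ultimately have "card ?E \<le> card (L (?lZ + C))"
      using card_inj_on_le[OF _ _ finite_L[OF dC]] by blast
    moreover have "card ?E = CARD('k) ^ ((l + 1) * n)"
      by (simp only: card_polynomial_families[OF finite_lessThan] card_lessThan)
    ultimately have "CARD('k) ^ ((l + 1) * n) \<le> CARD('k) ^ ell \<iota> (?lZ + C)" by (simp only: card_L[OF dC])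
    then show ?thesis by (rule FV.power_card_le_iff[THEN iffD1])
  qed
  then show ?thesis using that C unfolding n_def by blast
qed

lemma ell_le_deg: assumes "divisor D" "0 \<le> D" shows "int (ell \<iota> D) \<le> 1 + deg D"
  using ell_le(1)[OF divisor_zero assms] by (simp add: ell_0 deg_zero)

text \<open>
  One inequality is the bound on zeros. For the other one, \<open>(l + 1) n \<le> ell (l Z + C) \<le> 1 + l deg Z + deg C\<close>
  holds for all \<open>l\<close>, where \<open>n\<close> is the degree over \<open>k(y)\<close> and \<open>Z\<close> the divisor of zeros.
\<close>

lemma deg_zero_divisor: assumes y: "\<not> algebraic_over \<iota> y" shows "deg (zero_divisor y) = int (degree_over y)"
proof (rule antisym)
  have y0: "y \<noteq> 0" by (rule transcendental_nonzero[OF y])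
  show "deg (zero_divisor y) \<le> int (degree_over y)" by (rule deg_zero_divisor_le[OF y0 dep_degree_over])
  obtain C where C: "divisor C" "0 \<le> C"
    and ge: "\<And>l. (l + 1) * degree_over y \<le> ell \<iota> ((\<lambda>Q. int l * zero_divisor y Q) + C)"
    using ell_zero_divisor_ge[OF y] by blast
  define n d where "n = degree_over y" and "d = deg (zero_divisor y)"
  have Z: "divisor (zero_divisor y)" by (rule divisor_zero_divisor[OF y0])
  have le: "int ((l + 1) * n) \<le> 1 + int l * d + deg C" for l
  proof -
    let ?D = "(\<lambda>Q. int l * zero_divisor y Q) + C"
    have "0 \<le> ?D" using C val_le_zero_divisor(2) by (simp add: le_fun_def)
    then have "int (ell \<iota> ?D) \<le> 1 + deg ?D" by (intro ell_le_deg divisor_add divisor_scale Z C)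
    also have "deg ?D = int l * d + deg C" by (simp add: deg_add deg_scale divisor_scale Z C d_def)
    finally show ?thesis using ge[of l] unfolding n_def by linarith
  qed
  have c0: "0 \<le> deg C" using deg_diff_eq_sum(2)[OF divisor_zero C] by (simp add: deg_zero)
  show "int n \<le> d"
  proof (rule ccontr)
    assume "\<not> int n \<le> d"
    then have "d \<le> int n - 1" by simp
    \<comment> \<open>A deficit of one in degree, multiplied by \<open>l\<close>, exceeds the constants.\<close>
    define l where "l = nat (2 + deg C)"
    have "int l * d \<le> int l * (int n - 1)" using \<open>d \<le> int n - 1\<close> by (intro mult_left_mono) auto
    moreover have "int ((l + 1) * n) = int l * int n + int n" by (simp add: algebra_simps)
    moreover have "int l * (int n - 1) = int l * int n - int l" by (simp add: algebra_simps)
    ultimately have "int n + int l \<le> 1 + deg C" using le[of l] by linarith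
    moreover have "int l = 2 + deg C" using c0 by (simp add: l_def)
    ultimately show False by linarith
  qed
qed

lemma dep_inverse:
  assumes y: "y \<noteq> 0" and n: "dep y n" shows "dep (inverse y) n"
  unfolding dep_def
proof
  fix z :: "nat \<Rightarrow> 'f"
  obtain p :: "nat \<Rightarrow> 'k poly" where p: "\<exists>j\<le>n. p j \<noteq> 0" "(\<Sum>j\<le>n. poly_at \<iota> (p j) y * z j) = 0"
    using n unfolding dep_def by blast
  define l where "l = (\<Sum>j\<le>n. degree (p j))"
  have l: "degree (p j) \<le> l" if "j \<le> n" for j unfolding l_def using that by (intro member_le_sum) auto
  define q where "q = (\<lambda>j. \<Sum>i\<le>l. monom (coeff (p j) i) (l - i))"
  have pq: "poly_at \<iota> (q j) (inverse y) = inverse y ^ l * poly_at \<iota> (p j) y" if "j \<le> n" for j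
    unfolding q_def poly_at_sum poly_at_monom poly_at_altdef[OF l[OF that]] sum_distrib_left
    by (rule sum.cong) (use y in \<open>auto simp: power_diff field_simps\<close>)
  have "(\<Sum>j\<le>n. poly_at \<iota> (q j) (inverse y) * z j) = (\<Sum>j\<le>n. inverse y ^ l * (poly_at \<iota> (p j) y * z j))"
    by (rule sum.cong) (auto simp: pq)
  then have "(\<Sum>j\<le>n. poly_at \<iota> (q j) (inverse y) * z j) = 0" using p(2) by (simp flip: sum_distrib_left)
  moreover have "\<exists>j\<le>n. q j \<noteq> 0"
  proof -
    obtain j where j: "j \<le> n" "p j \<noteq> 0" using p by blast
    define d where "d = degree (p j)"
    have dl: "d \<le> l" using l[OF j(1)] by (simp add: d_def)
    have "coeff (q j) (l - d) = (\<Sum>i\<le>l. if i = d then coeff (p j) i else 0)"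
      unfolding q_def coeff_sum by (rule sum.cong) (use dl in auto)
    then have "coeff (q j) (l - d) = coeff (p j) d" using dl by simp
    then have "q j \<noteq> 0" using j by (auto simp: d_def)
    then show ?thesis using j by blast
  qed
  ultimately show "\<exists>p. (\<exists>j\<le>n. p j \<noteq> 0) \<and> (\<Sum>j\<le>n. poly_at \<iota> (p j) (inverse y) * z j) = 0" by blast
qed

text \<open>A nonconstant \<open>y\<close> has as many zeros as poles, as both numbers are the degree over \<open>k(y)\<close>.\<close>

lemma deg_div_fun: assumes y: "y \<noteq> 0" shows "deg (div_fun \<iota> y) = 0"
proof (cases "y \<in> range \<iota>")
  case True
  then obtain c where "y = \<iota> c" by blast
  then have "div_fun \<iota> y = 0" using y by (auto simp: div_fun_def val_const fun_eq_iff)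
  then show ?thesis by (simp add: deg_zero)
next
  case False
  then have t: "\<not> algebraic_over \<iota> y" "\<not> algebraic_over \<iota> (inverse y)"
    using constants constant_inverse by blast+
  have "dep (inverse y) n \<longleftrightarrow> dep y n" for n using dep_inverse[of y n] dep_inverse[of "inverse y" n] y by auto
  then have d: "degree_over (inverse y) = degree_over y" by (simp add: degree_over_def)
  have "div_fun \<iota> y = zero_divisor y - zero_divisor (inverse y)"
    using y by (auto simp: zero_divisor_def div_fun_inverse fun_eq_iff sup_int_def max_def)
  then have "deg (div_fun \<iota> y) = deg (zero_divisor y) - deg (zero_divisor (inverse y))"
    using y by (simp add: deg_diff divisor_zero_divisor)
  then show ?thesis by (simp add: deg_zero_divisor t d)
qed

lemma deg_neg_L: assumes D: "divisor D" and "deg D < 0" shows "L D = {0}"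
proof (rule ccontr)
  assume "L D \<noteq> {0}"
  then obtain z where z: "z \<in> L D" "z \<noteq> 0" using zero_in_L by blast
  then have "0 \<le> div_fun \<iota> z + D" by (simp add: L_div_fun)
  then have "deg 0 \<le> deg (div_fun \<iota> z + D)"
    using z D by (intro deg_diff_eq_sum(2) divisor_zero divisor_add divisor_div_fun)
  then show False using assms z by (simp add: deg_add divisor_div_fun deg_div_fun deg_zero)
qed

lemma ell_pos_iff: assumes D: "divisor D" shows "0 < ell \<iota> D \<longleftrightarrow> L D \<noteq> {0}"
proof
  assume "0 < ell \<iota> D"
  then have "CARD('k) ^ 0 < CARD('k) ^ ell \<iota> D" unfolding FV.power_card_less_iff .
  then show "L D \<noteq> {0}" using card_L[OF D] by auto
next
  assume "L D \<noteq> {0}"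
  show "0 < ell \<iota> D"
  proof (rule ccontr)
    assume "\<not> ?thesis"
    then have "card (L D) = 1" using card_L[OF D] by simp
    then show False using \<open>L D \<noteq> {0}\<close> zero_in_L[of D] by (auto simp: card_1_singleton_iff)
  qed
qed

lemma deg_minus_ell_mono:
  assumes "divisor D" "divisor E" "D \<le> E"
  shows "deg D - int (ell \<iota> D) \<le> deg E - int (ell \<iota> E)"
  using ell_le(1)[OF assms] by linarith

lemma deg_minus_ell_add_div_fun:
  assumes "divisor D" "z \<noteq> 0"
  shows "deg (D + div_fun \<iota> z) - int (ell \<iota> (D + div_fun \<iota> z)) = deg D - int (ell \<iota> D)"
  using assms by (simp add: ell_add_div_fun deg_add divisor_div_fun deg_div_fun)

lemma multiples_of_zeros:
  obtains Z \<gamma> where "divisor Z" "0 \<le> Z" "0 < deg Z"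
    "\<And>l. deg (\<lambda>Q. int l * Z Q) - int (ell \<iota> (\<lambda>Q. int l * Z Q)) \<le> \<gamma>"
proof -
  obtain y where y: "\<not> algebraic_over \<iota> y" using nonconstant_exists by blast
  have y0: "y \<noteq> 0" by (rule transcendental_nonzero[OF y])
  obtain C where C: "divisor C" "0 \<le> C"
    and ge: "\<And>l. (l + 1) * degree_over y \<le> ell \<iota> ((\<lambda>Q. int l * zero_divisor y Q) + C)"
    using ell_zero_divisor_ge[OF y] by blast
  have Z: "divisor (zero_divisor y)" by (rule divisor_zero_divisor[OF y0])
  have "deg (\<lambda>Q. int l * zero_divisor y Q) - int (ell \<iota> (\<lambda>Q. int l * zero_divisor y Q)) \<le> deg C" for l
  proof -
    let ?D = "\<lambda>Q. int l * zero_divisor y Q"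
    have D: "divisor ?D" by (rule divisor_scale[OF Z])
    have "?D \<le> ?D + C" using C by (simp add: le_fun_def)
    then have "int (ell \<iota> (?D + C)) - int (ell \<iota> ?D) \<le> deg C"
      using ell_le(1)[OF D divisor_add[OF D C(1)]] by (simp add: deg_add D C)
    moreover have "int ((l + 1) * degree_over y) \<le> int (ell \<iota> (?D + C))" using ge[of l] by linarith
    then have "int l * int (degree_over y) \<le> int (ell \<iota> (?D + C))" by (simp add: algebra_simps)
    ultimately show ?thesis by (simp add: deg_scale[OF Z] deg_zero_divisor[OF y])
  qed
  moreover have "0 \<le> zero_divisor y" using val_le_zero_divisor(2) by (simp add: le_fun_def)
  moreover have "0 < deg (zero_divisor y)" using degree_over_pos[OF y] by (simp add: deg_zero_divisor[OF y])
  ultimately show ?thesis using that Z by blast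
qed

text \<open>
  The difference \<open>deg D - ell D\<close> grows with \<open>D\<close> and does not see principal divisors. Some \<open>l Z\<close>
  is so large that \<open>L (l Z - D)\<close> contains a function \<open>z \<noteq> 0\<close>, and then \<open>D\<close> minus the divisor of \<open>z\<close> is below
  \<open>l Z\<close>, for which the difference is bounded.
\<close>

theorem riemann_bound: "\<exists>\<gamma>. \<forall>D. divisor D \<longrightarrow> deg D - int (ell \<iota> D) \<le> \<gamma>"
proof -
  obtain Z \<gamma> where Z: "divisor Z" "0 \<le> Z" "0 < deg Z"
    and bound: "\<And>l. deg (\<lambda>Q. int l * Z Q) - int (ell \<iota> (\<lambda>Q. int l * Z Q)) \<le> \<gamma>"
    using multiples_of_zeros by blast
  have "deg D - int (ell \<iota> D) \<le> \<gamma>" if D: "divisor D" for D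
  proof -
    define E where "E = sup D 0"
    have E: "divisor E" "D \<le> E" using D divisor_zero divisor_sup by (auto simp: E_def)
    have E0: "0 \<le> E" by (simp add: E_def)
    define l where "l = nat (\<gamma> + deg E + 1)"
    let ?lZ = "\<lambda>Q. int l * Z Q"
    have lZ: "divisor ?lZ" by (rule divisor_scale[OF Z(1)])
    have "int l * 1 \<le> int l * deg Z" using Z by (intro mult_left_mono) auto
    moreover have "\<gamma> + deg E + 1 \<le> int l" by (simp add: l_def)
    ultimately have "\<gamma> + deg E + 1 \<le> deg ?lZ" unfolding deg_scale[OF Z(1)] by linarith
    then have big: "deg E + 1 \<le> int (ell \<iota> ?lZ)" using bound[of l] by linarith
    have "?lZ - E \<le> ?lZ" using E0 by (simp add: le_fun_def)
    then have "int (ell \<iota> ?lZ) - int (ell \<iota> (?lZ - E)) \<le> deg E"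
      using ell_le(1)[OF divisor_diff[OF lZ E(1)] lZ] by (simp add: deg_diff lZ E)
    then have "0 < ell \<iota> (?lZ - E)" using big by linarith
    then obtain z where z: "z \<in> L (?lZ - E)" "z \<noteq> 0"
      using ell_pos_iff[OF divisor_diff[OF lZ E(1)]] zero_in_L by blast
    then have "0 \<le> div_fun \<iota> z + (?lZ - E)" by (simp add: L_div_fun)
    then have le: "E + div_fun \<iota> (inverse z) \<le> ?lZ" using z
      by (simp add: div_fun_inverse le_fun_def algebra_simps)
    have "deg D - int (ell \<iota> D) \<le> deg E - int (ell \<iota> E)" by (rule deg_minus_ell_mono[OF D E])
    also have "\<dots> = deg (E + div_fun \<iota> (inverse z)) - int (ell \<iota> (E + div_fun \<iota> (inverse z)))"
      using deg_minus_ell_add_div_fun[OF E(1), of "inverse z"] z by simp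
    also have "\<dots> \<le> deg ?lZ - int (ell \<iota> ?lZ)"
      using z by (intro deg_minus_ell_mono lZ le divisor_add E divisor_div_fun) auto
    finally show ?thesis using bound[of l] by linarith
  qed
  then show ?thesis by blast
qed

lemma int_set_max:
  fixes X :: "int set" assumes "x \<in> X" "\<And>y. y \<in> X \<Longrightarrow> y \<le> b"
  obtains m where "m \<in> X" "\<And>y. y \<in> X \<Longrightarrow> y \<le> m"
proof -
  let ?Y = "X \<inter> {x..b}"
  have fin: "finite ?Y" and ne: "?Y \<noteq> {}" using assms by auto
  have "y \<le> Max ?Y" if "y \<in> X" for y
  proof (cases "x \<le> y")
    case True
    then show ?thesis using that assms fin by (intro Max_ge) auto
  next
    case False
    moreover have "x \<le> Max ?Y" using assms fin by (intro Max_ge) auto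
    ultimately show ?thesis by linarith
  qed
  then show ?thesis using that[of "Max ?Y"] Max_in[OF fin ne] by blast
qed

lemma
  shows genus_ge: "divisor D \<Longrightarrow> deg D + 1 - genus \<iota> \<le> int (ell \<iota> D)"
    and genus_eq: "\<exists>D. divisor D \<and> int (ell \<iota> D) = deg D + 1 - genus \<iota>"
proof -
  let ?X = "{deg G - int (ell \<iota> G) + 1 | G. divisor G}"
  obtain \<gamma> where g: "\<And>D. divisor D \<Longrightarrow> deg D - int (ell \<iota> D) \<le> \<gamma>" using riemann_bound by blast
  have mem: "deg D - int (ell \<iota> D) + 1 \<in> ?X" if "divisor D" for D using that by blast
  have bound: "y \<le> \<gamma> + 1" if y: "y \<in> ?X" for y
  proof -
    obtain D where "divisor D" "y = deg D - int (ell \<iota> D) + 1" using y by blast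
    then show ?thesis using g[of D] by linarith
  qed
  obtain m where m: "m \<in> ?X" "\<And>y. y \<in> ?X \<Longrightarrow> y \<le> m"
    using int_set_max[OF mem[OF divisor_zero] bound] by blast
  have gm: "genus \<iota> = m" unfolding genus_def by (rule cSup_eq_maximum[OF m])
  show "deg D + 1 - genus \<iota> \<le> int (ell \<iota> D)" if "divisor D"
    using m(2)[OF mem[OF that]] gm by linarith
  obtain D where "divisor D" "m = deg D - int (ell \<iota> D) + 1" using m(1) by blast
  then show "\<exists>D. divisor D \<and> int (ell \<iota> D) = deg D + 1 - genus \<iota>"
    using gm by (intro exI[of _ D]) linarith
qed

text \<open>A divisor \<open>D\<close> of large degree lies, up to a principal divisor, above one that attains
  the genus, because Riemann's inequality provides a nonzero function in the space of their difference.\<close>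

lemma ell_large_degree: "\<exists>c. \<forall>D. divisor D \<longrightarrow> c \<le> deg D \<longrightarrow> int (ell \<iota> D) = deg D + 1 - genus \<iota>"
proof -
  obtain E where E: "divisor E" "int (ell \<iota> E) = deg E + 1 - genus \<iota>" using genus_eq by blast
  have "int (ell \<iota> D) = deg D + 1 - genus \<iota>" if D: "divisor D" and c: "deg E + genus \<iota> \<le> deg D" for D
  proof -
    have "1 \<le> int (ell \<iota> (D - E))" using genus_ge[OF divisor_diff[OF D E(1)]] c by (simp add: deg_diff D E)
    then obtain z where z: "z \<in> L (D - E)" "z \<noteq> 0"
      using ell_pos_iff[OF divisor_diff[OF D E(1)]] zero_in_L by auto
    then have "0 \<le> div_fun \<iota> z + (D - E)" by (simp add: L_div_fun)
    then have le: "E \<le> D + div_fun \<iota> z" by (simp add: le_fun_def algebra_simps)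
    have "deg E - int (ell \<iota> E) \<le> deg D - int (ell \<iota> D)"
      using deg_minus_ell_mono[OF E(1) _ le] deg_minus_ell_add_div_fun[OF D z(2)] D z
      by (simp add: divisor_add divisor_div_fun)
    then show ?thesis using E(2) genus_ge[OF D] by linarith
  qed
  then show ?thesis by blast
qed

lemma larger_divisor:
  assumes D: "divisor D" obtains E where "divisor E" "D \<le> E" "c \<le> deg E"
proof -
  obtain P where P: "place \<iota> P" using place_exists by blast
  define n where "n = \<bar>c - deg D\<bar>"
  let ?E = "D + (\<lambda>Q. n * point_divisor P Q)"
  have "1 \<le> int (place_degree \<iota> P)" using place_degree_pos[OF P] by linarith
  then have "n * 1 \<le> n * int (place_degree \<iota> P)" by (intro mult_left_mono) (auto simp: n_def)
  then have "c \<le> deg ?E"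
    using D P by (simp add: deg_add divisor_scale divisor_point deg_scale deg_point n_def)
  moreover have "D \<le> ?E" by (simp add: le_fun_def n_def point_divisor_def)
  moreover have "divisor ?E" using D P by (intro divisor_add divisor_scale divisor_point)
  ultimately show ?thesis using that by blast
qed

text \<open>The index of speciality; \<open>idx_adeles\<close> identifies it with the dimension of the adeles modulo
  \<open>adele_box D\<close> and the functions.\<close>

definition speciality :: "('f set \<Rightarrow> int) \<Rightarrow> nat" where
  "speciality D = nat (int (ell \<iota> D) - deg D + genus \<iota> - 1)"

lemma int_speciality: "divisor D \<Longrightarrow> int (speciality D) = int (ell \<iota> D) - deg D + genus \<iota> - 1"
  using genus_ge[of D] by (simp add: speciality_def)

lemma sumset_mono: "A \<subseteq> A' \<Longrightarrow> sumset A B \<subseteq> sumset A' B"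
  by (auto simp: sumset_def)

lemma sumset_adele_box_subgroup: "add_subgroup (sumset (adele_box D) principal)"
  by (intro add_subgroup_sumset AV.subspace_add_subgroup adele_box_subspace principal_subspace)

lemma sumset_adele_box_subspace: "AV.subspace (sumset (adele_box D) principal)"
proof -
  have "sumset (adele_box D) principal = {x + y |x y. x \<in> adele_box D \<and> y \<in> principal}"
    by (auto simp: sumset_def)
  then show ?thesis using AV.subspace_sums[OF adele_box_subspace principal_subspace] by simp
qed

lemma adele_box_subset_sumset: "adele_box D \<subseteq> sumset (adele_box D) principal"
proof
  fix x assume "x \<in> adele_box D"
  then have "x + 0 \<in> sumset (adele_box D) principal"
    unfolding sumset_def using AV.subspace_0[OF principal_subspace] by blast
  then show "x \<in> sumset (adele_box D) principal" by simp
qed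

lemma sumset_subset_adeles: assumes D: "divisor D" shows "sumset (adele_box D) principal \<subseteq> adeles"
proof
  fix x assume "x \<in> sumset (adele_box D) principal"
  then obtain b f where x: "b \<in> adele_box D" "f \<in> principal" "x = b + f" unfolding sumset_def by blast
  then have "b \<in> adeles" "f \<in> adeles" using adele_box_subset[OF D] principal_subset_adeles by auto
  then show "x \<in> adeles" unfolding x(3) by (rule AV.subspace_add[OF adeles_subspace])
qed

text \<open>Enlarging the box \<open>D\<close> gains as much in degree as in functions, so the sum with the functions stays the same.\<close>

lemma adeles_eq_sumset:
  assumes D: "divisor D" and max: "\<And>E. divisor E \<Longrightarrow> D \<le> E \<Longrightarrow> int (ell \<iota> E) = deg E + 1 - genus \<iota>"
  shows "adeles = sumset (adele_box D) principal"
proof (intro equalityI sumset_subset_adeles D subsetI)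
  fix a assume "a \<in> adeles"
  then obtain E0 where E0: "divisor E0" "a \<in> adele_box E0" by (auto simp: adeles_def)
  define E where "E = sup D E0"
  have E: "divisor E" "D \<le> E" using D E0 divisor_sup by (auto simp: E_def)
  have "E0 \<le> E" by (simp add: E_def)
  then have aE: "a \<in> adele_box E" using E0 adele_box_mono by blast
  let ?A = "sumset (adele_box D) principal" and ?B = "sumset (adele_box E) principal"
  have "int (ell \<iota> E) - int (ell \<iota> D) = deg E - deg D" using max[OF E] max[OF D] by simp
  then have "nat (deg E - deg D) + ell \<iota> D = ell \<iota> E" using ell_le(2)[OF D E] by linarith
  then have "idx ?B ?A * CARD('k) ^ ell \<iota> E = 1 * CARD('k) ^ ell \<iota> E"
    using idx_sumset_principal[OF D E] by simp
  then have "idx ?B ?A = 1" by (simp del: mult_1)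
  then have "?B = ?A"
    by (rule idx_eq_1D[OF sumset_adele_box_subgroup sumset_mono[OF adele_box_mono[OF E(2)]]])
  moreover have "a \<in> ?B" using aE adele_box_subset_sumset by blast
  ultimately show "a \<in> ?A" by simp
qed

text \<open>For \<open>E \<ge> D\<close> of large degree the box of \<open>E\<close> and the functions exhaust the adeles; counting the step
  from \<open>D\<close> to \<open>E\<close> gives the index.\<close>

theorem idx_adeles:
  assumes D: "divisor D"
  shows "idx adeles (sumset (adele_box D) principal) = CARD('k) ^ speciality D"
proof -
  obtain c where c: "\<And>E. divisor E \<Longrightarrow> c \<le> deg E \<Longrightarrow> int (ell \<iota> E) = deg E + 1 - genus \<iota>"
    using ell_large_degree by blast
  obtain E where E: "divisor E" "D \<le> E" "c \<le> deg E" using larger_divisor[OF D] by blast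
  have "int (ell \<iota> E') = deg E' + 1 - genus \<iota>" if "divisor E'" "E \<le> E'" for E'
    using c that deg_diff_eq_sum(2)[OF E(1) that] E by auto
  then have "adeles = sumset (adele_box E) principal" by (rule adeles_eq_sumset[OF E(1)])
  moreover have "nat (deg E - deg D) + ell \<iota> D = speciality D + ell \<iota> E"
    using int_speciality[OF D] c[OF E(1,3)] deg_diff_eq_sum(2)[OF D E(1,2)] by linarith
  ultimately show ?thesis using idx_sumset_principal[OF D E(1,2)] by (simp add: power_add)
qed

end


section \<open>The Frobenius map and derivations\<close>

lemma sum_fun_apply: "(\<Sum>i\<in>I. f i) x = (\<Sum>i\<in>I. f i x)"
  by (induction I rule: infinite_finite_induct) auto

lemma of_nat_card_eq_0: "of_nat CARD('k::{field,finite}) = (0::'k)"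
proof -
  have "bij (\<lambda>x::'k. x + 1)" by (rule bij_betw_byWitness[where f' = "\<lambda>x. x - 1"]) auto
  then have "(\<Sum>x\<in>UNIV. x) = (\<Sum>x\<in>UNIV. (x::'k) + 1)" using sum.reindex_bij_betw[of "\<lambda>x::'k. x + 1" UNIV UNIV "\<lambda>x. x"] by simp
  then show ?thesis by (simp add: sum.distrib)
qed

context function_field
begin

lemma \<iota>_of_nat: "\<iota> (of_nat n) = of_nat n"
  by (induction n) (auto simp: add)

text \<open>The characteristic divides the number of constants, so it is positive.\<close>

lemma prime_char: "prime CHAR('f)"
proof (rule prime_CHAR_semidom)
  have "of_nat CARD('k) = (0::'f)" using of_nat_card_eq_0[where 'k='k] \<iota>_of_nat[of "CARD('k)"] by simp
  then have "CHAR('f) dvd CARD('k)" by (simp add: of_nat_eq_0_iff_char_dvd)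
  moreover have "0 < CARD('k)" by simp
  ultimately show "0 < CHAR('f)" by (metis dvd_0_left_iff gr0I)
qed

lemma frobenius_add: "((x::'f) + y) ^ CHAR('f) = x ^ CHAR('f) + y ^ CHAR('f)"
  by (rule freshmans_dream[OF prime_char refl])

lemma frobenius_diff: "((x::'f) - y) ^ CHAR('f) = x ^ CHAR('f) - y ^ CHAR('f)"
  using frobenius_add[of "x - y" y] by (simp add: eq_diff_eq)

text \<open>
  Let \<open>p\<close> be the characteristic and \<open>Z\<close> the divisor of zeros of a nonconstant function.
  Otherwise \<open>(w\<^sub>0, \<dots>, w\<^sub>p) \<mapsto> \<Sum> w\<^sub>j\<^sup>p z\<^sub>j\<close> would embed \<open>p + 1\<close> copies of \<open>L (l Z)\<close> into
  \<open>L (p l Z + C)\<close>, whose dimension is about \<open>p\<close> times that of \<open>L (l Z)\<close> for large \<open>l\<close>.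
\<close>

lemma dependent_over_powers:
  "\<exists>w::nat \<Rightarrow> 'f. (\<exists>j\<le>CHAR('f). w j \<noteq> 0) \<and> (\<Sum>j\<le>CHAR('f). w j ^ CHAR('f) * z j) = 0"
proof (rule ccontr)
  assume no: "\<not> ?thesis"
  obtain Z \<gamma> where Z: "divisor Z" "0 \<le> Z" "0 < deg Z"
    and bound: "\<And>l. deg (\<lambda>Q. int l * Z Q) - int (ell \<iota> (\<lambda>Q. int l * Z Q)) \<le> \<gamma>"
    using multiples_of_zeros by blast
  obtain C where C: "divisor C" "0 \<le> C" "z ` {..CHAR('f)} \<subseteq> L C" using finite_subset_L[of "z ` {..CHAR('f)}"] by auto
  \<comment> \<open>Beyond this bound \<open>(p + 1) (l deg Z - \<gamma>) \<le> 1 + p l deg Z + deg C\<close> fails.\<close>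
  define l where "l = nat (2 + deg C + (int CHAR('f) + 1) * \<gamma>)"
  let ?D = "\<lambda>Q. int l * Z Q" and ?E = "(\<lambda>Q. int (CHAR('f) * l) * Z Q) + C"
  have D: "divisor ?D" and E: "divisor ?E" using Z C by (auto intro!: divisor_add divisor_scale)
  define f where "f = (\<lambda>w. \<Sum>j\<le>CHAR('f). w j ^ CHAR('f) * z j)"
  have img: "f ` PiE {..CHAR('f)} (\<lambda>_. L ?D) \<subseteq> L ?E"
  proof
    fix g assume "g \<in> f ` PiE {..CHAR('f)} (\<lambda>_. L ?D)"
    then obtain w where w: "w \<in> PiE {..CHAR('f)} (\<lambda>_. L ?D)" "g = f w" by auto
    have pow: "x ^ n \<in> L (\<lambda>Q. int (n * l) * Z Q)" if x: "x \<in> L ?D" for x n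
    proof (induction n)
      case 0
      have "(\<lambda>Q. int (0 * l) * Z Q) = 0" by auto
      then show ?case using L_0 \<iota>_1 by (metis power_0 rangeI)
    next
      case (Suc n)
      have "x * x ^ n \<in> L (?D + (\<lambda>Q. int (n * l) * Z Q))"
        by (rule L_mult[OF D divisor_scale[OF Z(1)] x Suc])
      moreover have "?D + (\<lambda>Q. int (n * l) * Z Q) = (\<lambda>Q. int (Suc n * l) * Z Q)"
        by (auto simp: algebra_simps)
      ultimately show ?case by (simp only: power_Suc)
    qed
    have "w j ^ CHAR('f) * z j \<in> L ?E" if "j \<le> CHAR('f)" for j
      using w C that by (intro L_mult pow divisor_scale Z C) auto
    then show "g \<in> L ?E" unfolding w(2) f_def by (intro FV.subspace_sum[OF L_subspace[OF E]]) auto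
  qed
  have inj: "inj_on f (PiE {..CHAR('f)} (\<lambda>_. L ?D))"
  proof (rule inj_onI)
    fix w w' assume w: "w \<in> PiE {..CHAR('f)} (\<lambda>_. L ?D)" "w' \<in> PiE {..CHAR('f)} (\<lambda>_. L ?D)" "f w = f w'"
    have "(\<Sum>j\<le>CHAR('f). (w j - w' j) ^ CHAR('f) * z j) = f w - f w'"
      unfolding f_def sum_subtractf[symmetric]
      by (rule sum.cong[OF refl]) (simp only: frobenius_diff left_diff_distrib)
    then have "(\<Sum>j\<le>CHAR('f). (w j - w' j) ^ CHAR('f) * z j) = 0" unfolding w(3) diff_self .
    with no[unfolded not_ex, THEN spec[of _ "\<lambda>j. w j - w' j"]]
    have "\<not> (\<exists>j\<le>CHAR('f). w j - w' j \<noteq> 0)" by (simp only: simp_thms)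
    then show "w = w'" by (intro PiE_ext[OF w(1,2)]) auto
  qed
  have "card (PiE {..CHAR('f)} (\<lambda>_. L ?D)) \<le> card (L ?E)"
    by (rule card_inj_on_le[OF inj img finite_L[OF E]])
  moreover have "card (PiE {..CHAR('f)} (\<lambda>_. L ?D)) = (CARD('k) ^ ell \<iota> ?D) ^ (CHAR('f) + 1)"
    by (simp only: card_PiE[OF finite_atMost] card_L[OF D] prod_constant card_atMost Suc_eq_plus1)
  ultimately have "CARD('k) ^ (ell \<iota> ?D * (CHAR('f) + 1)) \<le> CARD('k) ^ ell \<iota> ?E"
    by (simp only: card_L[OF E] power_mult)
  then have le: "ell \<iota> ?D * (CHAR('f) + 1) \<le> ell \<iota> ?E" by (rule FV.power_card_le_iff[THEN iffD1])
  have "0 \<le> ?E" using Z C by (simp add: le_fun_def)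
  then have "int (ell \<iota> ?E) \<le> 1 + deg ?E" by (rule ell_le_deg[OF E])
  also have "deg ?E = int (CHAR('f) * l) * deg Z + deg C" by (simp only: deg_add[OF divisor_scale[OF Z(1)] C(1)] deg_scale[OF Z(1)])
  finally have up: "int (ell \<iota> ?E) \<le> 1 + int CHAR('f) * (int l * deg Z) + deg C"
    by (simp only: of_nat_mult mult.assoc Groups.add.assoc)
  have "int l * deg Z - \<gamma> \<le> int (ell \<iota> ?D)" using bound[of l] by (simp add: deg_scale[OF Z(1)])
  then have "(int l * deg Z - \<gamma>) * (int CHAR('f) + 1) \<le> int (ell \<iota> ?D) * (int CHAR('f) + 1)" by (intro mult_right_mono) auto
  also have "\<dots> = int (ell \<iota> ?D * (CHAR('f) + 1))" by (simp only: of_nat_mult of_nat_add of_nat_1)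
  also have "\<dots> \<le> 1 + int CHAR('f) * (int l * deg Z) + deg C" using le up by linarith
  finally have "int l * deg Z \<le> 1 + deg C + (int CHAR('f) + 1) * \<gamma>" by (simp add: algebra_simps)
  moreover have "int l * 1 \<le> int l * deg Z" using Z by (intro mult_left_mono) auto
  ultimately show False unfolding l_def by linarith
qed

text \<open>The terms have pairwise incongruent orders modulo the characteristic, so they cannot cancel.\<close>

lemma independent_over_powers:
  assumes P: "place \<iota> P" and t: "t \<noteq> 0" "place_val P t = 1"
    and rel: "(\<Sum>i<CHAR('f). w i ^ CHAR('f) * t ^ i) = 0" and i: "i < CHAR('f)" shows "w i = 0"
proof (rule ccontr)
  assume "w i \<noteq> 0"
  define J where "J = {j. j < CHAR('f) \<and> w j \<noteq> 0}"
  have J: "finite J" "J \<noteq> {}" using \<open>w i \<noteq> 0\<close> i by (auto simp: J_def)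
  define v where "v = (\<lambda>j. place_val P (w j ^ CHAR('f) * t ^ j))"
  have v: "v j = int CHAR('f) * place_val P (w j) + int j" if "j \<in> J" for j
    using that t by (simp add: v_def J_def val_mult val_power P)
  have inj: "inj_on v J"
  proof (rule inj_onI)
    fix a b assume ab: "a \<in> J" "b \<in> J" "v a = v b"
    then have "int CHAR('f) * place_val P (w a) + int a = int CHAR('f) * place_val P (w b) + int b" by (simp add: v)
    then have "(int CHAR('f) * place_val P (w a) + int a) mod int CHAR('f) = (int CHAR('f) * place_val P (w b) + int b) mod int CHAR('f)" by simp
    then show "a = b" using ab by (simp add: J_def)
  qed
  obtain m where m: "m \<in> J" "\<And>j. j \<in> J \<Longrightarrow> v m \<le> v j"
    using ex_min_if_finite[of "v ` J"] J
    by (auto simp: not_less)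
  have "(\<Sum>i<CHAR('f). w i ^ CHAR('f) * t ^ i) = (\<Sum>j\<in>J. w j ^ CHAR('f) * t ^ j)"
    using prime_char prime_gt_0_nat by (intro sum.mono_neutral_right) (auto simp: J_def)
  also have "\<dots> = w m ^ CHAR('f) * t ^ m + (\<Sum>j\<in>J - {m}. w j ^ CHAR('f) * t ^ j)" using J m by (simp add: sum.remove)
  finally have e: "w m ^ CHAR('f) * t ^ m = - (\<Sum>j\<in>J - {m}. w j ^ CHAR('f) * t ^ j)" using rel by (simp add: eq_neg_iff_add_eq_0)
  have "w j ^ CHAR('f) * t ^ j \<in> ordset P (v m + 1)" if "j \<in> J - {m}" for j
  proof -
    have "v m \<noteq> v j" using inj that m by (auto simp: inj_on_def)
    then have "v m + 1 \<le> v j" using m(2)[of j] that by simp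
    then show ?thesis by (simp add: ordset_def v_def)
  qed
  then have "w m ^ CHAR('f) * t ^ m \<in> ordset P (v m + 1)"
    unfolding e by (intro FV.subspace_neg FV.subspace_sum ordset_subspace P) auto
  moreover have "w m ^ CHAR('f) * t ^ m \<noteq> 0" using m t by (simp add: J_def)
  ultimately show False by (simp add: ordset_def v_def)
qed

text \<open>The powers \<open>t\<^sup>0, \<dots>, t\<^sup>p\<^sup>-\<^sup>1\<close> are a basis over the \<open>p\<close>-th powers: they are independent, and
  \<open>p + 1\<close> elements never are.\<close>

lemma power_expansion:
  assumes P: "place \<iota> P" and t: "t \<noteq> 0" "place_val P t = 1"
  obtains c :: "nat \<Rightarrow> 'f" where "z = - (\<Sum>i<CHAR('f). c i ^ CHAR('f) * t ^ i)"
proof -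
  obtain w :: "nat \<Rightarrow> 'f" where w: "\<exists>j\<le>CHAR('f). w j \<noteq> 0" "(\<Sum>j\<le>CHAR('f). w j ^ CHAR('f) * (if j < CHAR('f) then t ^ j else z)) = 0"
    using dependent_over_powers[of "\<lambda>j. if j < CHAR('f) then t ^ j else z"] by blast
  have "(\<Sum>j\<le>CHAR('f). w j ^ CHAR('f) * (if j < CHAR('f) then t ^ j else z)) = (\<Sum>j<CHAR('f). w j ^ CHAR('f) * (if j < CHAR('f) then t ^ j else z)) + w CHAR('f) ^ CHAR('f) * z"
    by (simp flip: lessThan_Suc_atMost)
  also have "(\<Sum>j<CHAR('f). w j ^ CHAR('f) * (if j < CHAR('f) then t ^ j else z)) = (\<Sum>j<CHAR('f). w j ^ CHAR('f) * t ^ j)" by (rule sum.cong) auto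
  finally have e: "(\<Sum>j<CHAR('f). w j ^ CHAR('f) * t ^ j) + w CHAR('f) ^ CHAR('f) * z = 0" using w(2) by simp
  have "w CHAR('f) \<noteq> 0"
  proof
    assume wp: "w CHAR('f) = 0"
    then have "(\<Sum>j<CHAR('f). w j ^ CHAR('f) * t ^ j) = 0" using e prime_gt_0_nat[OF prime_char] by (simp add: power_0_left)
    then have "w j = 0" if "j < CHAR('f)" for j using independent_over_powers[OF P t _ that] by blast
    then show False using w(1) wp by (metis le_neq_implies_less)
  qed
  then have "z = - (\<Sum>i<CHAR('f). (w i / w CHAR('f)) ^ CHAR('f) * t ^ i)"
    using e by (simp add: power_divide sum_divide_distrib[symmetric] field_simps eq_neg_iff_add_eq_0 flip: sum_divide_distrib)
  then show ?thesis by (rule that)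
qed

text \<open>
  In the second argument a Leibniz pairing is a derivation, with values in a space of functionals of
  the first one; both \<open>f \<delta>(g)\<close> for a
  derivation \<open>\<delta>\<close> and the residue of \<open>f dg\<close> are of this kind. It vanishes at \<open>p\<close>-th powers \<open>g\<close>, so
  that it is determined by its values at \<open>g = t\<close>.
\<close>

definition leibniz_pairing :: "('f \<Rightarrow> 'f \<Rightarrow> 'm::ab_group_add) \<Rightarrow> bool" where
  "leibniz_pairing B \<longleftrightarrow> (\<forall>f f' g. B (f + f') g = B f g + B f' g) \<and>
     (\<forall>f g g'. B f (g + g') = B f g + B f g') \<and> (\<forall>f g h. B f (g * h) = B (f * g) h + B (f * h) g)"

lemma leibniz_pairing_eq:
  assumes B: "leibniz_pairing B" and z: "z = - (\<Sum>i<CHAR('f). c i ^ CHAR('f) * t ^ i)"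
  shows "B f z = B (f * - (\<Sum>i<CHAR('f). c i ^ CHAR('f) * (of_nat i * t ^ (i - 1)))) t"
proof -
  have al: "B (f + f') g = B f g + B f' g" and ar: "B f (g + g') = B f g + B f g'"
    and lz: "B f (g * h) = B (f * g) h + B (f * h) g" for f f' g g' h
    using B unfolding leibniz_pairing_def by blast+
  have l0: "B 0 g = 0" for g using al[of 0 0 g] by simp
  have r0: "B f 0 = 0" for f using ar[of f 0 0] by simp
  have lm: "B (- f) g = - B f g" for f g using al[of f "-f" g] l0 by (simp add: eq_neg_iff_add_eq_0 add.commute)
  have rm: "B f (- g) = - B f g" for f g using ar[of f g "-g"] r0 by (simp add: eq_neg_iff_add_eq_0 add.commute)
  have ls: "B (sum h I) g = (\<Sum>i\<in>I. B (h i) g)" for h g and I :: "nat set"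
    by (induction I rule: infinite_finite_induct) (auto simp: l0 al)
  have rs: "B f (sum h I) = (\<Sum>i\<in>I. B f (h i))" for h f and I :: "nat set"
    by (induction I rule: infinite_finite_induct) (auto simp: r0 ar)
  have one: "B f 1 = 0" for f using lz[of f 1 1] by simp
  have pw: "B f (g ^ n) = B (f * (of_nat n * g ^ (n - 1))) g" for f g n
  proof (induction n arbitrary: f)
    case 0
    then show ?case by (simp add: one l0)
  next
    case (Suc n)
    have "B f (g ^ Suc n) = B (f * g) (g ^ n) + B (f * g ^ n) g" by (simp add: lz)
    also have "\<dots> = B (f * g * (of_nat n * g ^ (n - 1)) + f * g ^ n) g" by (simp add: Suc al)
    also have "f * g * (of_nat n * g ^ (n - 1)) + f * g ^ n = f * (of_nat (Suc n) * g ^ (Suc n - 1))"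
      by (cases n) (simp_all add: algebra_simps)
    finally show ?case .
  qed
  \<comment> \<open>By the power rule a \<open>p\<close>-th power has derivative 0, and so acts as a constant.\<close>
  have pp: "B f (g ^ CHAR('f)) = 0" for f g using pw[of f g "CHAR('f)"] by (simp add: l0)
  have "B f z = - (\<Sum>i<CHAR('f). B f (c i ^ CHAR('f) * t ^ i))" by (simp add: z rm rs)
  also have "\<dots> = - (\<Sum>i<CHAR('f). B (f * (c i ^ CHAR('f) * (of_nat i * t ^ (i - 1)))) t)"
    by (simp add: lz pw l0 mult.assoc)
  finally show ?thesis by (simp add: ls lm sum_distrib_left)
qed

lemma derivation_leibniz:
  assumes "k_derivation \<iota> \<delta>" shows "leibniz_pairing (\<lambda>f g. f * \<delta> g)"
  using assms unfolding k_derivation_def leibniz_pairing_def by (auto simp: algebra_simps)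

text \<open>
  Every differential is \<open>h dt\<close> for a uniformizer \<open>t\<close>, and the same \<open>h\<close> describes it inside each
  Leibniz pairing.
\<close>

lemma differential_eq_scale:
  fixes X :: "'f set" and g :: "'f \<Rightarrow> 'f"
  assumes P: "place \<iota> P" and t: "uniformizer P t"
  obtains h where
    "(\<Sum>x\<in>X. scale_diff (g x) (kaehler_d \<iota> x)) = scale_diff h (kaehler_d \<iota> t)"
    "\<And>B :: 'f \<Rightarrow> 'f \<Rightarrow> 'k. leibniz_pairing B \<Longrightarrow> (\<Sum>x\<in>X. B (g x) x) = B h t"
proof -
  have t': "t \<noteq> 0" "place_val P t = 1" using t uniformizer_iff_val[OF P] by auto
  have "\<forall>x. \<exists>c. x = - (\<Sum>i<CHAR('f). c i ^ CHAR('f) * t ^ i)" using power_expansion[OF P t'] by metis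
  then obtain c where c: "\<And>x. x = - (\<Sum>i<CHAR('f). c x i ^ CHAR('f) * t ^ i)" by metis
  define e where "e = (\<lambda>x. - (\<Sum>i<CHAR('f). c x i ^ CHAR('f) * (of_nat i * t ^ (i - 1))))"
  define h where "h = (\<Sum>x\<in>X. g x * e x)"
  have B: "(\<Sum>x\<in>X. B (g x) x) = B h t" if L: "leibniz_pairing B" for B :: "'f \<Rightarrow> 'f \<Rightarrow> 'm::ab_group_add"
  proof -
    have al: "B (f + f') t = B f t + B f' t" for f f' using L unfolding leibniz_pairing_def by blast
    have "B 0 t = 0" using al[of 0 0] by simp
    then have ls: "B (sum u I) t = (\<Sum>i\<in>I. B (u i) t)" for u and I :: "'f set"
      by (induction I rule: infinite_finite_induct) (auto simp: al)
    have "B f x = B (f * e x) t" for f x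
      unfolding e_def by (rule leibniz_pairing_eq[OF L c])
    then have "(\<Sum>x\<in>X. B (g x) x) = (\<Sum>x\<in>X. B (g x * e x) t)" by (intro sum.cong refl)
    then show ?thesis by (simp add: h_def ls)
  qed
  have "(\<Sum>x\<in>X. scale_diff (g x) (kaehler_d \<iota> x)) \<delta> = scale_diff h (kaehler_d \<iota> t) \<delta>" for \<delta>
    using B[OF derivation_leibniz[of \<delta>]]
    by (cases "k_derivation \<iota> \<delta>") (auto simp: sum_fun_apply scale_diff_def kaehler_d_def)
  then have "(\<Sum>x\<in>X. scale_diff (g x) (kaehler_d \<iota> x)) = scale_diff h (kaehler_d \<iota> t)" by blast
  then show ?thesis using that B by blast
qed

lemma scale_diff_unique:
  assumes "scale_diff h (kaehler_d \<iota> t) = scale_diff h' (kaehler_d \<iota> t)" "scale_diff h (kaehler_d \<iota> t) \<noteq> 0"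
  shows "h = h'"
proof -
  obtain \<delta> where "scale_diff h (kaehler_d \<iota> t) \<delta> \<noteq> 0" using assms(2) by (auto simp: fun_eq_iff)
  moreover have "scale_diff h (kaehler_d \<iota> t) \<delta> = scale_diff h' (kaehler_d \<iota> t) \<delta>" using assms(1) by simp
  ultimately show ?thesis by (auto simp: scale_diff_def)
qed

end


section \<open>Traces of operators of finite rank\<close>

locale operators = vector_space scale
  for scale :: "'a::field \<Rightarrow> 'b::ab_group_add \<Rightarrow> 'b"
begin

sublocale endo: vector_space_pair scale scale by unfold_locales

abbreviation operator :: "('b \<Rightarrow> 'b) \<Rightarrow> bool" where
  "operator \<equiv> Vector_Spaces.linear scale scale"

definition functional :: "('b \<Rightarrow> 'a) \<Rightarrow> bool" where
  "functional \<phi> \<longleftrightarrow> (\<forall>x y. \<phi> (x + y) = \<phi> x + \<phi> y) \<and> (\<forall>c x. \<phi> (scale c x) = c * \<phi> x)"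

lemma functional_add: "functional \<phi> \<Longrightarrow> \<phi> (x + y) = \<phi> x + \<phi> y"
  and functional_scale: "functional \<phi> \<Longrightarrow> \<phi> (scale c x) = c * \<phi> x"
  by (auto simp: functional_def)

lemma functional_0: "functional \<phi> \<Longrightarrow> \<phi> 0 = 0"
  using functional_scale[of \<phi> 0 0] by simp

lemma functional_sum: "functional \<phi> \<Longrightarrow> \<phi> (sum f I) = (\<Sum>i\<in>I. \<phi> (f i))"
  by (induction I rule: infinite_finite_induct) (auto simp: functional_0 functional_add)

lemma operatorI:
  assumes "\<And>x y. A (x + y) = A x + A y" "\<And>c x. A (scale c x) = scale c (A x)" shows "operator A"
  using assms by unfold_locales auto

lemma operator_add: "operator A \<Longrightarrow> A (x + y) = A x + A y"
  and operator_scale: "operator A \<Longrightarrow> A (scale c x) = scale c (A x)"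
  and operator_0: "operator A \<Longrightarrow> A 0 = 0"
  and operator_diff: "operator A \<Longrightarrow> A (x - y) = A x - A y"
  and operator_sum: "operator A \<Longrightarrow> A (sum f I) = (\<Sum>i\<in>I. A (f i))"
  by (auto simp: endo.linear_add endo.linear_scale endo.linear_0 endo.linear_diff endo.linear_sum)

lemma operator_comp: "operator A \<Longrightarrow> operator B \<Longrightarrow> operator (\<lambda>v. A (B v))"
  by (rule operatorI) (auto simp: operator_add operator_scale)

lemma operator_plus: "operator A \<Longrightarrow> operator B \<Longrightarrow> operator (\<lambda>v. A v + B v)"
  by (rule operatorI) (auto simp: operator_add operator_scale algebra_simps scale_right_distrib)

lemma operator_minus: "operator A \<Longrightarrow> operator B \<Longrightarrow> operator (\<lambda>v. A v - B v)"
  by (rule operatorI) (auto simp: operator_add operator_scale algebra_simps scale_right_diff_distrib)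

lemma operator_id: "operator (\<lambda>v. v)" by (rule operatorI) auto

lemma operator_rank_one: "functional \<phi> \<Longrightarrow> operator (\<lambda>v. scale (\<phi> v) w)"
  by (rule operatorI) (auto simp: functional_add functional_scale scale_left_distrib)

lemma projection_exists:
  assumes "subspace W"
  obtains s where "operator s" "\<And>v. s v \<in> W" "\<And>w. w \<in> W \<Longrightarrow> s w = w"
proof -
  obtain g where "g ` UNIV \<subseteq> W" "operator g" "\<forall>v\<in>W. g v = v"
    using endo.linear_exists_left_inverse_on[OF operator_id assms] by auto
  then show ?thesis using that[of g] by blast
qed

lemma functional_exists:
  assumes W: "subspace W" and a: "a \<notin> W"
  obtains \<phi> where "functional \<phi>" "\<phi> a = 1" "\<And>w. w \<in> W \<Longrightarrow> \<phi> w = 0"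
proof -
  let ?V = "span (insert a W)"
  have sp: "?V = {x. \<exists>c. x - scale c a \<in> W}"
    using W by (simp add: span_insert span_eq_iff[THEN iffD2])
  obtain s where s: "operator s" "\<And>v. s v \<in> ?V" "\<And>w. w \<in> ?V \<Longrightarrow> s w = w"
    using projection_exists[OF subspace_span] by blast
  define \<phi> where "\<phi> = (\<lambda>v. SOME c. s v - scale c a \<in> W)"
  have ex: "s v - scale (\<phi> v) a \<in> W" for v
  proof -
    have "\<exists>c. s v - scale c a \<in> W" using s(2)[of v] unfolding sp by simp
    then show ?thesis unfolding \<phi>_def by (rule someI_ex)
  qed
  have uniq: "\<phi> v = c" if "s v - scale c a \<in> W" for v c
  proof (rule ccontr)
    assume n: "\<phi> v \<noteq> c"
    have "(s v - scale c a) - (s v - scale (\<phi> v) a) \<in> W" by (rule subspace_diff[OF W that ex])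
    then have "scale (\<phi> v - c) a \<in> W" by (simp add: scale_left_diff_distrib)
    then have "scale (inverse (\<phi> v - c)) (scale (\<phi> v - c) a) \<in> W" by (rule subspace_scale[OF W])
    then show False using n a by simp
  qed
  have "functional \<phi>" unfolding functional_def
  proof (intro conjI allI)
    fix x y
    have "(s x - scale (\<phi> x) a) + (s y - scale (\<phi> y) a) \<in> W" by (rule subspace_add[OF W ex ex])
    then show "\<phi> (x + y) = \<phi> x + \<phi> y"
      by (intro uniq) (simp add: operator_add[OF s(1)] scale_left_distrib algebra_simps)
  next
    fix c x
    have "scale c (s x - scale (\<phi> x) a) \<in> W" by (rule subspace_scale[OF W ex])
    then show "\<phi> (scale c x) = c * \<phi> x"
      by (intro uniq) (simp add: operator_scale[OF s(1)] scale_right_diff_distrib)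
  qed
  moreover have "\<phi> a = 1"
    using s(3)[of a] subspace_0[OF W] by (intro uniq) (simp add: span_base)
  moreover have "\<phi> w = 0" if "w \<in> W" for w
    using s(3)[of w] that by (intro uniq) (simp add: span_base)
  ultimately show ?thesis using that by blast
qed

definition finite_rank :: "('b \<Rightarrow> 'b) \<Rightarrow> bool" where
  "finite_rank T \<longleftrightarrow> operator T \<and> (\<exists>S. finite S \<and> range T \<subseteq> span S)"

lemma finite_rankI: "operator T \<Longrightarrow> finite S \<Longrightarrow> (\<And>v. T v \<in> span S) \<Longrightarrow> finite_rank T"
  unfolding finite_rank_def by blast

lemma finite_rank_operator: "finite_rank T \<Longrightarrow> operator T"
  by (simp add: finite_rank_def)

lemma finite_rank_span: assumes "finite_rank T" obtains S where "finite S" "\<And>v. T v \<in> span S"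
  using assms unfolding finite_rank_def by blast

lemma finite_rank_plus:
  assumes "finite_rank T" "finite_rank U" shows "finite_rank (\<lambda>v. T v + U v)"
proof -
  obtain S where S: "finite S" "\<And>v. T v \<in> span S" using finite_rank_span[OF assms(1)] by blast
  obtain S' where S': "finite S'" "\<And>v. U v \<in> span S'" using finite_rank_span[OF assms(2)] by blast
  have "T v \<in> span (S \<union> S')" "U v \<in> span (S \<union> S')" for v
    using S(2)[of v] S'(2)[of v] span_mono[of S "S \<union> S'"] span_mono[of S' "S \<union> S'"] by auto
  then have "T v + U v \<in> span (S \<union> S')" for v by (rule span_add)
  moreover have "finite (S \<union> S')" using S S' by simp
  ultimately show ?thesis
    using finite_rankI[OF operator_plus[OF finite_rank_operator[OF assms(1)] finite_rank_operator[OF assms(2)]]]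
    by blast
qed

lemma finite_rank_comp_left:
  assumes T: "finite_rank T" and A: "operator A" shows "finite_rank (\<lambda>v. A (T v))"
proof -
  obtain S where S: "finite S" "\<And>v. T v \<in> span S" using finite_rank_span[OF T] by blast
  have "A (T v) \<in> span (A ` S)" for v
    using endo.linear_span_image[OF A, of S] S(2)[of v] by auto
  then show ?thesis
    using finite_rankI[OF operator_comp[OF A finite_rank_operator[OF T]], of "A ` S"] S(1) by simp
qed

lemma finite_rank_comp_right:
  assumes T: "finite_rank T" and A: "operator A" shows "finite_rank (\<lambda>v. T (A v))"
proof -
  obtain S where S: "finite S" "\<And>v. T v \<in> span S" using finite_rank_span[OF T] by blast
  then show ?thesis using finite_rankI[OF operator_comp[OF finite_rank_operator[OF T] A], of S] by simp
qed

lemma finite_rank_scale: "finite_rank T \<Longrightarrow> finite_rank (\<lambda>v. scale c (T v))"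
  by (rule finite_rank_comp_left[of T "scale c"]) (auto intro: operatorI simp: scale_right_distrib)

lemma finite_rank_neg: "finite_rank T \<Longrightarrow> finite_rank (\<lambda>v. - T v)"
  using finite_rank_scale[of T "-1"] by simp

lemma finite_rank_minus: "finite_rank T \<Longrightarrow> finite_rank U \<Longrightarrow> finite_rank (\<lambda>v. T v - U v)"
  using finite_rank_plus[OF _ finite_rank_neg, of T U] by simp

lemma finite_rank_zero: "finite_rank (\<lambda>v. 0)"
  by (rule finite_rankI[of _ "{}"]) (auto intro: operatorI)

lemma finite_rank_sum: "(\<And>i. i \<in> I \<Longrightarrow> finite_rank (T i)) \<Longrightarrow> finite_rank (\<lambda>v. \<Sum>i\<in>I. T i v)"
  by (induction I rule: infinite_finite_induct) (auto simp: finite_rank_zero finite_rank_plus)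

lemma finite_rank_form:
  assumes "finite_rank T"
  obtains S \<phi> where "finite S" "\<And>s. s \<in> S \<Longrightarrow> functional (\<phi> s)" "\<And>v. T v = (\<Sum>s\<in>S. scale (\<phi> s v) s)"
proof -
  obtain S0 where S0: "finite S0" "\<And>v. T v \<in> span S0" using finite_rank_span[OF assms] by blast
  obtain S where S: "S \<subseteq> S0" "independent S" "S0 \<subseteq> span S"
    using maximal_independent_subset[of S0] by blast
  then have fS: "finite S" using S0 finite_subset by blast
  have T: "T v \<in> span S" for v using S0(2)[of v] span_minimal[OF S(3)] by auto
  note o = finite_rank_operator[OF assms]
  have "functional (\<lambda>v. representation S (T v) s)" for s
    unfolding functional_def
    using representation_add[OF S(2) T T] representation_scale[OF S(2) T]
    by (simp add: operator_add[OF o] operator_scale[OF o])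
  moreover have "T v = (\<Sum>s\<in>S. scale (representation S (T v) s) s)" for v
    using sum_representation_eq[OF S(2) T fS order.refl] by simp
  ultimately show ?thesis using that[OF fS, of "\<lambda>s v. representation S (T v) s"] by blast
qed

text \<open>
  The trace is the sum of the diagonal entries with respect to one fixed basis of the whole
  space. It is a finite sum for operators of finite rank, which are linear combinations of rank one operators.
\<close>

definition hamel :: "'b set" where "hamel = extend_basis {}"

lemma hamel: "independent hamel" "span hamel = UNIV"
  unfolding hamel_def using independent_extend_basis[OF independent_empty] span_extend_basis[OF independent_empty]
  by simp_all

definition trace :: "('b \<Rightarrow> 'b) \<Rightarrow> 'a" where
  "trace T = (\<Sum>b | b \<in> hamel \<and> representation hamel (T b) b \<noteq> 0. representation hamel (T b) b)"

lemma trace_eq_sum: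
  assumes "finite S" "S \<subseteq> hamel" "\<And>b. b \<in> hamel \<Longrightarrow> b \<notin> S \<Longrightarrow> representation hamel (T b) b = 0"
  shows "trace T = (\<Sum>b\<in>S. representation hamel (T b) b)"
  unfolding trace_def using assms by (intro sum.mono_neutral_left) auto

text \<open>The formula makes no reference to the basis; additivity, cyclicity and the value on
  rank one operators are read off from it.\<close>

lemma trace_form:
  assumes I: "finite I" and \<phi>: "\<And>i. i \<in> I \<Longrightarrow> functional (\<phi> i)"
    and T: "\<And>v. T v = (\<Sum>i\<in>I. scale (\<phi> i v) (w i))"
  shows "trace T = (\<Sum>i\<in>I. \<phi> i (w i))"
proof -
  let ?R = "representation hamel"
  define S where "S = (\<Union>i\<in>I. {b. ?R (w i) b \<noteq> 0})"
  have S: "finite S" unfolding S_def using I finite_representation by auto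
  have Sh: "S \<subseteq> hamel" unfolding S_def using representation_ne_zero by blast
  have rT: "?R (T b) c = (\<Sum>i\<in>I. \<phi> i b * ?R (w i) c)" for b c
    unfolding T using hamel by (simp add: representation_sum representation_scale)
  have "trace T = (\<Sum>b\<in>S. ?R (T b) b)"
    by (rule trace_eq_sum[OF S Sh]) (auto simp: rT S_def)
  also have "\<dots> = (\<Sum>i\<in>I. \<Sum>b\<in>S. \<phi> i b * ?R (w i) b)" unfolding rT by (rule sum.swap)
  also have "\<dots> = (\<Sum>i\<in>I. \<phi> i (w i))"
  proof (rule sum.cong[OF refl])
    fix i assume i: "i \<in> I"
    have "w i = (\<Sum>b\<in>S. scale (?R (w i) b) b)"
    proof -
      have "(\<Sum>b | ?R (w i) b \<noteq> 0. scale (?R (w i) b) b) = (\<Sum>b\<in>S. scale (?R (w i) b) b)"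
        using S i by (intro sum.mono_neutral_left) (auto simp: S_def)
      then show ?thesis using sum_nonzero_representation_eq[OF hamel(1), of "w i"] hamel(2) by simp
    qed
    then have "\<phi> i (w i) = \<phi> i (\<Sum>b\<in>S. scale (?R (w i) b) b)" by simp
    also have "\<dots> = (\<Sum>b\<in>S. \<phi> i b * ?R (w i) b)"
      using \<phi>[OF i] by (simp add: functional_sum functional_scale mult.commute)
    finally show "(\<Sum>b\<in>S. \<phi> i b * ?R (w i) b) = \<phi> i (w i)" by simp
  qed
  finally show ?thesis .
qed

lemma trace_rank_one: "functional \<phi> \<Longrightarrow> trace (\<lambda>v. scale (\<phi> v) w) = \<phi> w"
  using trace_form[of "{()}" "\<lambda>_. \<phi>" "\<lambda>v. scale (\<phi> v) w" "\<lambda>_. w"] by simp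

lemma trace_support:
  assumes "finite_rank T" shows "finite {b \<in> hamel. representation hamel (T b) b \<noteq> 0}"
proof -
  obtain S \<phi> where S: "finite S" "\<And>v. T v = (\<Sum>s\<in>S. scale (\<phi> s v) s)"
    using finite_rank_form[OF assms] by metis
  have "{b \<in> hamel. representation hamel (T b) b \<noteq> 0} \<subseteq> (\<Union>s\<in>S. {b. representation hamel s b \<noteq> 0})"
  proof
    fix b assume "b \<in> {b \<in> hamel. representation hamel (T b) b \<noteq> 0}"
    then have "(\<Sum>s\<in>S. \<phi> s b * representation hamel s b) \<noteq> 0"
      using S(2)[of b] hamel by (simp add: representation_sum representation_scale)
    then obtain s where "s \<in> S" "\<phi> s b * representation hamel s b \<noteq> 0" by (meson sum.not_neutral_contains_not_neutral)
    then show "b \<in> (\<Union>s\<in>S. {b. representation hamel s b \<noteq> 0})" by auto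
  qed
  then show ?thesis using S finite_representation by (auto intro: finite_subset)
qed

lemma trace_plus:
  assumes "finite_rank T" "finite_rank U" shows "trace (\<lambda>v. T v + U v) = trace T + trace U"
proof -
  let ?R = "representation hamel"
  let ?S = "{b \<in> hamel. ?R (T b) b \<noteq> 0} \<union> {b \<in> hamel. ?R (U b) b \<noteq> 0}"
  have fin: "finite ?S" using trace_support assms by auto
  have R: "?R (x + y) b = ?R x b + ?R y b" for x y b
  proof -
    have "?R (y + x) b = ?R y b + ?R x b" using representation_add[OF hamel(1), of x y] hamel(2) by simp
    then show ?thesis by (simp only: add.commute)
  qed
  have "trace T = (\<Sum>b\<in>?S. ?R (T b) b)" by (rule trace_eq_sum[OF fin]) auto
  moreover have "trace U = (\<Sum>b\<in>?S. ?R (U b) b)" by (rule trace_eq_sum[OF fin]) auto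
  moreover have "trace (\<lambda>v. T v + U v) = (\<Sum>b\<in>?S. ?R (T b + U b) b)"
    by (rule trace_eq_sum[OF fin]) (auto simp: R)
  ultimately show ?thesis by (simp add: R sum.distrib)
qed

lemma trace_scale: assumes "finite_rank T" shows "trace (\<lambda>v. scale c (T v)) = c * trace T"
proof -
  obtain S \<phi> where S: "finite S" "\<And>s. s \<in> S \<Longrightarrow> functional (\<phi> s)" "\<And>v. T v = (\<Sum>s\<in>S. scale (\<phi> s v) s)"
    using finite_rank_form[OF assms] by metis
  have "trace (\<lambda>v. scale c (T v)) = (\<Sum>s\<in>S. c * \<phi> s s)"
    by (rule trace_form[OF S(1)])
      (use S(2) in \<open>auto simp: functional_def S(3) scale_sum_right algebra_simps\<close>)
  then show ?thesis using trace_form[OF S] by (simp add: sum_distrib_left)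
qed

lemma trace_neg: "finite_rank T \<Longrightarrow> trace (\<lambda>v. - T v) = - trace T"
  using trace_scale[of T "-1"] by simp

lemma trace_minus: "finite_rank T \<Longrightarrow> finite_rank U \<Longrightarrow> trace (\<lambda>v. T v - U v) = trace T - trace U"
  using trace_plus[OF _ finite_rank_neg, of T U] by (simp add: trace_neg)

lemma trace_zero: "trace (\<lambda>v. 0) = 0"
  using trace_form[of "{}" "\<lambda>_ _. 0" "\<lambda>v. 0"] by simp

lemma trace_sum:
  "(\<And>i. i \<in> I \<Longrightarrow> finite_rank (T i)) \<Longrightarrow> trace (\<lambda>v. \<Sum>i\<in>I. T i v) = (\<Sum>i\<in>I. trace (T i))"
  by (induction I rule: infinite_finite_induct) (auto simp: trace_zero trace_plus finite_rank_sum)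

lemma trace_commute:
  assumes T: "finite_rank T" and A: "operator A" shows "trace (\<lambda>v. T (A v)) = trace (\<lambda>v. A (T v))"
proof -
  obtain S \<phi> where S: "finite S" "\<And>s. s \<in> S \<Longrightarrow> functional (\<phi> s)" "\<And>v. T v = (\<Sum>s\<in>S. scale (\<phi> s v) s)"
    using finite_rank_form[OF assms(1)] by metis
  have "trace (\<lambda>v. T (A v)) = (\<Sum>s\<in>S. \<phi> s (A s))"
    by (rule trace_form[OF S(1)])
      (use S(2) in \<open>auto simp: functional_def S(3) operator_add[OF A] operator_scale[OF A]\<close>)
  moreover have "trace (\<lambda>v. A (T v)) = (\<Sum>s\<in>S. \<phi> s (A s))"
    by (rule trace_form[OF S(1,2)]) (simp_all add: S(3) operator_sum[OF A] operator_scale[OF A])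
  ultimately show ?thesis by simp
qed


subsection \<open>Commutators\<close>

definition commutator :: "('b \<Rightarrow> 'b) \<Rightarrow> ('b \<Rightarrow> 'b) \<Rightarrow> 'b \<Rightarrow> 'b" where
  "commutator X Y = (\<lambda>v. X (Y v) - Y (X v))"

lemma commutator_finite_rank:
  assumes "finite_rank X" "operator Y"
  shows "finite_rank (commutator X Y)" "trace (commutator X Y) = 0"
  unfolding commutator_def
  using finite_rank_comp_left[OF assms] finite_rank_comp_right[OF assms]
  by (auto intro: finite_rank_minus simp: trace_minus trace_commute[OF assms])

lemma commutator_perturb_left:
  assumes X: "operator X" "operator X'" and Y: "operator Y"
    and fr: "finite_rank (\<lambda>v. X' v - X v)" and c: "finite_rank (commutator X Y)"
  shows "finite_rank (commutator X' Y)" "trace (commutator X' Y) = trace (commutator X Y)"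
proof -
  have e: "commutator X' Y = (\<lambda>v. commutator (\<lambda>v. X' v - X v) Y v + commutator X Y v)"
    by (auto simp: commutator_def fun_eq_iff operator_diff[OF Y])
  note d = commutator_finite_rank[OF fr Y]
  show "finite_rank (commutator X' Y)" unfolding e by (rule finite_rank_plus[OF d(1) c])
  show "trace (commutator X' Y) = trace (commutator X Y)" unfolding e by (simp add: trace_plus[OF d(1) c] d)
qed

lemma commutator_swap: "commutator Y X = (\<lambda>v. - commutator X Y v)"
  by (simp add: commutator_def)

lemma commutator_perturb:
  assumes X: "operator X" "operator X'" and Y: "operator Y" "operator Y'"
    and fr: "finite_rank (\<lambda>v. X' v - X v)" "finite_rank (\<lambda>v. Y' v - Y v)" and c: "finite_rank (commutator X Y)"
  shows "finite_rank (commutator X' Y')" "trace (commutator X' Y') = trace (commutator X Y)"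
proof -
  note l = commutator_perturb_left[OF X Y(1) fr(1) c]
  have s: "finite_rank (commutator Y X')" unfolding commutator_swap[of Y X'] by (rule finite_rank_neg[OF l(1)])
  note r = commutator_perturb_left[OF Y X(2) fr(2) s]
  show "finite_rank (commutator X' Y')" unfolding commutator_swap[of X' Y'] by (rule finite_rank_neg[OF r(1)])
  show "trace (commutator X' Y') = trace (commutator X Y)"
    using l(2) r(2) trace_neg[OF l(1)] trace_neg[OF r(1)]
    by (simp flip: commutator_swap)
qed

end


section \<open>Tate's residue\<close>

sublocale function_field \<subseteq> AO: operators "\<lambda>c (a::'f set \<Rightarrow> 'f) Q. \<iota> c * a Q"
  by unfold_locales

sublocale function_field \<subseteq> FO: operators "\<lambda>c (x::'f). \<iota> c * x"
  by unfold_locales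

context function_field
begin

abbreviation integral_adeles :: "('f set \<Rightarrow> 'f) set" where "integral_adeles \<equiv> adele_box 0"

definition projection_onto_integral :: "(('f set \<Rightarrow> 'f) \<Rightarrow> 'f set \<Rightarrow> 'f) \<Rightarrow> bool" where
  "projection_onto_integral \<pi> \<longleftrightarrow> AO.operator \<pi> \<and> (\<forall>v. \<pi> v \<in> integral_adeles) \<and>
     (\<forall>w\<in>integral_adeles. \<pi> w = w)"

text \<open>The compression of multiplication by \<open>a\<close> to the range of \<open>\<pi>\<close>.\<close>

definition toeplitz :: "(('f set \<Rightarrow> 'f) \<Rightarrow> 'f set \<Rightarrow> 'f) \<Rightarrow> ('f set \<Rightarrow> 'f) \<Rightarrow> ('f set \<Rightarrow> 'f) \<Rightarrow> 'f set \<Rightarrow> 'f" where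
  "toeplitz \<pi> a v = \<pi> (a * \<pi> v)"

lemma operator_mult: "AO.operator (\<lambda>v. a * v)"
  by (rule AO.operatorI) (auto simp: fun_eq_iff algebra_simps)

lemma operator_toeplitz: "AO.operator \<pi> \<Longrightarrow> AO.operator (toeplitz \<pi> a)"
  unfolding toeplitz_def by (rule AO.operator_comp[of \<pi>, OF _ AO.operator_comp[OF operator_mult]])

lemma proj_operator: "projection_onto_integral \<pi> \<Longrightarrow> AO.operator \<pi>"
  and proj_range: "projection_onto_integral \<pi> \<Longrightarrow> \<pi> v \<in> integral_adeles"
  and proj_id: "projection_onto_integral \<pi> \<Longrightarrow> w \<in> integral_adeles \<Longrightarrow> \<pi> w = w"
  by (auto simp: projection_onto_integral_def)

text \<open>Multiplication by an adele enlarges the integral adeles only to a box of finite index above them.\<close>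

lemma defect_finite_rank:
  assumes a: "a \<in> adeles" and \<sigma>: "AO.operator \<sigma>" "\<And>v. \<sigma> v \<in> integral_adeles"
    and \<pi>: "AO.operator \<pi>" "\<And>w. w \<in> integral_adeles \<Longrightarrow> \<pi> w = w"
  shows "AO.finite_rank (\<lambda>v. a * \<sigma> v - \<pi> (a * \<sigma> v))"
proof -
  obtain D where D: "divisor D" "a \<in> adele_box D" using a by (auto simp: adeles_def)
  define E where "E = sup D 0"
  have E: "divisor E" "0 \<le> E" "D + 0 \<le> E" using D divisor_sup divisor_zero by (auto simp: E_def)
  have aE: "a * \<sigma> v \<in> adele_box E" for v
    using adele_box_mult[OF D(2) \<sigma>(2)] adele_box_mono[OF E(3)] by blast
  have "0 < idx (adele_box E) (adele_box 0)" using idx_adele_box[OF divisor_zero E(1,2)] by simp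
  then obtain Z where Z: "AV.cobasis (adele_box E) (adele_box 0) Z"
    using AV.cobasis_exists[OF adele_box_subspace adele_box_subspace adele_box_mono[OF E(2)]] by blast
  define d where "d = (\<lambda>x. x - \<pi> x)"
  have d: "AO.operator d" unfolding d_def by (rule AO.operator_minus[OF AO.operator_id \<pi>(1)])
  have "d x \<in> AV.span (d ` Z)" if x: "x \<in> adele_box E" for x
  proof -
    obtain c where c: "x - (\<Sum>z\<in>Z. (\<lambda>Q. \<iota> (c z) * z Q)) \<in> adele_box 0"
      using AV.cobasis_spans[OF Z x] by blast
    let ?s = "\<Sum>z\<in>Z. (\<lambda>Q. \<iota> (c z) * z Q)"
    have "d (x - ?s) = 0" unfolding d_def using \<pi>(2)[OF c] by simp
    then have "d x = d ?s" using AO.operator_diff[OF d] by simp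
    also have "\<dots> = (\<Sum>z\<in>Z. (\<lambda>Q. \<iota> (c z) * d z Q))"
      by (simp add: AO.operator_sum[OF d] AO.operator_scale[OF d])
    also have "\<dots> \<in> AV.span (d ` Z)" by (intro AV.span_sum AV.span_scale AV.span_base) auto
    finally show ?thesis .
  qed
  then have "d (a * \<sigma> v) \<in> AV.span (d ` Z)" for v using aE by blast
  moreover have "AO.operator (\<lambda>v. d (a * \<sigma> v))"
    by (rule AO.operator_comp[OF d AO.operator_comp[OF operator_mult \<sigma>(1)]])
  moreover have "finite (d ` Z)" using AV.cobasis_finite[OF Z] by simp
  ultimately have "AO.finite_rank (\<lambda>v. d (a * \<sigma> v))" by (intro AO.finite_rankI)
  then show ?thesis by (simp only: d_def)
qed

lemma toeplitz_mult:
  assumes \<pi>: "projection_onto_integral \<pi>" and b: "b \<in> adeles"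
  shows "AO.finite_rank (\<lambda>v. toeplitz \<pi> (a * b) v - toeplitz \<pi> a (toeplitz \<pi> b v))"
proof -
  note op = proj_operator[OF \<pi>]
  have "toeplitz \<pi> (a * b) v - toeplitz \<pi> a (toeplitz \<pi> b v) = \<pi> (a * (b * \<pi> v - \<pi> (b * \<pi> v)))" for v
    using proj_id[OF \<pi> proj_range[OF \<pi>]]
    by (simp add: toeplitz_def AO.operator_diff[OF op, symmetric] right_diff_distrib mult.assoc)
  moreover have "AO.finite_rank (\<lambda>v. \<pi> (a * (b * \<pi> v - \<pi> (b * \<pi> v))))"
    by (rule AO.finite_rank_comp_left[OF _ AO.operator_comp[OF op operator_mult]])
      (rule defect_finite_rank[OF b op proj_range[OF \<pi>] op proj_id[OF \<pi>]])
  ultimately show ?thesis by simp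
qed

lemma toeplitz_commutator:
  assumes \<pi>: "projection_onto_integral \<pi>" and a: "a \<in> adeles" and b: "b \<in> adeles"
  shows "AO.finite_rank (AO.commutator (toeplitz \<pi> a) (toeplitz \<pi> b))"
proof -
  have "AO.finite_rank (\<lambda>v. (toeplitz \<pi> (b * a) v - toeplitz \<pi> b (toeplitz \<pi> a v))
      - (toeplitz \<pi> (a * b) v - toeplitz \<pi> a (toeplitz \<pi> b v)))"
    by (rule AO.finite_rank_minus[OF toeplitz_mult[OF \<pi> a] toeplitz_mult[OF \<pi> b]])
  then show ?thesis by (simp add: AO.commutator_def mult.commute)
qed

text \<open>Tate's formula for the sum of the residues of \<open>a db\<close> over all places.\<close>

definition residue_trace :: "(('f set \<Rightarrow> 'f) \<Rightarrow> 'f set \<Rightarrow> 'f) \<Rightarrow> ('f set \<Rightarrow> 'f) \<Rightarrow> ('f set \<Rightarrow> 'f) \<Rightarrow> 'k" where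
  "residue_trace \<pi> a b = AO.trace (AO.commutator (toeplitz \<pi> a) (toeplitz \<pi> b))"

text \<open>
  If \<open>\<pi>\<close> and \<open>\<rho>\<close> are projections onto the same space, then \<open>\<pi>\<close> followed by \<open>\<rho>\<close> is \<open>\<pi>\<close>; cyclicity of
  the trace moves \<open>\<rho>\<close> to the other end, where it replaces \<open>\<pi>\<close>.
\<close>

lemma residue_trace_projection:
  assumes \<pi>: "projection_onto_integral \<pi>" and \<rho>: "projection_onto_integral \<rho>"
    and a: "a \<in> adeles" and b: "b \<in> adeles"
  shows "residue_trace \<pi> a b = residue_trace \<rho> a b"
proof -
  let ?X = "AO.commutator (toeplitz \<pi> a) (toeplitz \<pi> b)"
  define U where "U = (\<lambda>a v. \<pi> (a * \<rho> v))"
  note op = proj_operator[OF \<pi>] proj_operator[OF \<rho>]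
  have oU: "AO.operator (U c)" for c unfolding U_def by (rule AO.operator_comp[OF op(1) AO.operator_comp[OF operator_mult op(2)]])
  have frX: "AO.finite_rank ?X" by (rule toeplitz_commutator[OF \<pi> a b])
  have r: "\<rho> (?X v) = ?X v" for v
    using proj_id[OF \<rho>] proj_range[OF \<pi>] AV.subspace_diff[OF adele_box_subspace]
    by (simp add: AO.commutator_def toeplitz_def)
  have TU: "toeplitz \<pi> c (\<rho> v) = U c v" for c v
    by (simp add: toeplitz_def U_def proj_id[OF \<pi> proj_range[OF \<rho>]])
  have UU: "toeplitz \<pi> c (U d v) = U c (U d v)" for c d v
    by (simp add: toeplitz_def U_def proj_id[OF \<pi> proj_range[OF \<pi>]] proj_id[OF \<rho> proj_range[OF \<pi>]])
  have XU: "(\<lambda>v. ?X (\<rho> v)) = AO.commutator (U a) (U b)"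
    by (simp add: AO.commutator_def TU UU)
  have frU: "AO.finite_rank (AO.commutator (U a) (U b))"
    unfolding XU[symmetric] by (rule AO.finite_rank_comp_right[OF frX op(2)])
  have fr: "AO.finite_rank (\<lambda>v. toeplitz \<rho> c v - U c v)" if c: "c \<in> adeles" for c
  proof -
    have "toeplitz \<rho> c v - U c v = - \<pi> (c * \<rho> v - \<rho> (c * \<rho> v))" for v
      by (simp add: toeplitz_def U_def AO.operator_diff[OF op(1)] proj_id[OF \<pi> proj_range[OF \<rho>]])
    moreover have "AO.finite_rank (\<lambda>v. - \<pi> (c * \<rho> v - \<rho> (c * \<rho> v)))"
      by (rule AO.finite_rank_neg[OF AO.finite_rank_comp_left[OF _ op(1)]])
        (rule defect_finite_rank[OF c op(2) proj_range[OF \<rho>] op(2) proj_id[OF \<rho>]])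
    ultimately show ?thesis by simp
  qed
  have "residue_trace \<pi> a b = AO.trace (\<lambda>v. \<rho> (?X v))" by (simp add: r residue_trace_def)
  also have "\<dots> = AO.trace (\<lambda>v. ?X (\<rho> v))" by (rule AO.trace_commute[OF frX op(2), symmetric])
  also have "\<dots> = AO.trace (AO.commutator (U a) (U b))" by (simp only: XU)
  also have "\<dots> = AO.trace (AO.commutator (toeplitz \<rho> a) (toeplitz \<rho> b))"
    by (rule AO.commutator_perturb(2)[OF oU operator_toeplitz[OF op(2)] oU operator_toeplitz[OF op(2)] fr[OF a] fr[OF b] frU, symmetric])
  finally show ?thesis by (simp add: residue_trace_def)
qed

text \<open>
  The residue theorem. The integral adeles and the functions are complementary in the adeles up to
  finite dimension, so a projection onto the former differs by an operator of finite rank from a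
  projection \<open>\<sigma>\<close> whose kernel in the adeles consists of functions. As multiplication by a function
  preserves that kernel, compression along \<open>\<sigma>\<close> is multiplicative on functions.
\<close>

theorem residue_trace_principal:
  assumes \<pi>: "projection_onto_integral \<pi>"
  shows "residue_trace \<pi> (\<lambda>_. f) (\<lambda>_. g) = 0"
proof -
  let ?F = "principal" and ?O = integral_adeles and ?one = "(\<lambda>_. 1) :: 'f set \<Rightarrow> 'f"
  let ?W = "sumset ?O ?F"
  note sW = sumset_adele_box_subspace[of 0]
  note OW = adele_box_subset_sumset[of 0]
  have FW: "?F \<subseteq> ?W"
  proof
    fix x assume "x \<in> ?F"
    then have "0 + x \<in> ?W" unfolding sumset_def using AV.subspace_0[OF adele_box_subspace] by blast
    then show "x \<in> ?W" by simp
  qed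
  have WA: "?W \<subseteq> adeles" by (rule sumset_subset_adeles[OF divisor_zero])
  have one: "?one \<in> ?O" using place_1 by (auto simp: adele_box_def ordset_0)
  have OF: "\<exists>c. x = (\<lambda>_. \<iota> c)" if "x \<in> ?O" "x \<in> ?F" for x
    using that L_0 const_in_adele_box[OF divisor_zero] by (auto simp: principal_def)
  have "?one \<notin> {0}" by (auto simp: fun_eq_iff)
  then obtain ev where ev: "AO.functional ev" "ev ?one = 1" using AO.functional_exists[OF AV.subspace_single_0] by blast
  obtain s where s: "AO.operator s" "\<And>v. s v \<in> ?W" "\<And>w. w \<in> ?W \<Longrightarrow> s w = w"
    using AO.projection_exists[OF sW] by blast
  \<comment> \<open>On \<open>O + F\<close> the component in \<open>O\<close> is determined up to constants, the elements of \<open>O \<inter> F\<close>.\<close>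
  define o_part where "o_part = (\<lambda>w. SOME x. x \<in> ?O \<and> w - x \<in> ?F)"
  have o_part: "o_part w \<in> ?O \<and> w - o_part w \<in> ?F" if w: "w \<in> ?W" for w
  proof -
    obtain x y where "x \<in> ?O" "y \<in> ?F" "w = x + y" using w unfolding sumset_def by blast
    then have "\<exists>x. x \<in> ?O \<and> w - x \<in> ?F" by (intro exI[of _ x]) simp
    then show ?thesis unfolding o_part_def by (rule someI_ex)
  qed
  \<comment> \<open>A projection of \<open>O\<close> along the constants; it makes the component in \<open>O\<close> unique.\<close>
  define \<nu> where "\<nu> = (\<lambda>x. x - (\<lambda>Q. \<iota> (ev x) * ?one Q))"
  have o\<nu>: "AO.operator \<nu>" unfolding \<nu>_def by (rule AO.operator_minus[OF AO.operator_id AO.operator_rank_one[OF ev(1)]])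
  have \<nu>O: "\<nu> x \<in> ?O" if "x \<in> ?O" for x
    unfolding \<nu>_def by (rule AV.subspace_diff[OF adele_box_subspace that AV.subspace_scale[OF adele_box_subspace one]])
  have \<nu>F: "x - \<nu> x \<in> ?F" for x
  proof -
    have "x - \<nu> x = (\<lambda>_. \<iota> (ev x))" by (auto simp: \<nu>_def)
    then show ?thesis by (auto simp: principal_def)
  qed
  have \<nu>0: "\<nu> x = 0" if x: "x \<in> ?O" "x \<in> ?F" for x
  proof -
    obtain c where c: "x = (\<lambda>Q. \<iota> c * ?one Q)" using OF[OF x] by auto
    have "ev x = c" unfolding c AO.functional_scale[OF ev(1)] using ev(2) by simp
    then show ?thesis unfolding \<nu>_def using c by simp
  qed
  define \<mu> where "\<mu> = (\<lambda>w. \<nu> (o_part w))"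
  have \<mu>eq: "\<mu> w = \<nu> x" if x: "x \<in> ?O" "w - x \<in> ?F" for w x
  proof -
    have "x + (w - x) \<in> ?W" using x unfolding sumset_def by blast
    then have w: "w \<in> ?W" by simp
    have "o_part w - x \<in> ?O" using o_part[OF w] x AV.subspace_diff[OF adele_box_subspace] by blast
    moreover have "(w - x) - (w - o_part w) \<in> ?F" using o_part[OF w] x AV.subspace_diff[OF principal_subspace] by blast
    then have "o_part w - x \<in> ?F" by simp
    ultimately have "\<nu> (o_part w - x) = 0" by (rule \<nu>0)
    then show ?thesis by (simp add: \<mu>_def AO.operator_diff[OF o\<nu>])
  qed
  \<comment> \<open>\<open>P1\<close> kills the functions and is the identity on \<open>O\<close> up to constants.\<close>
  define P1 where "P1 = (\<lambda>v. \<mu> (s v))"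
  have oP1: "AO.operator P1"
  proof (rule AO.operatorI)
    fix x y
    have "o_part (s x) + o_part (s y) \<in> ?O"
      using o_part[OF s(2)] AV.subspace_add[OF adele_box_subspace] by blast
    moreover have "(s x - o_part (s x)) + (s y - o_part (s y)) \<in> ?F"
      using o_part[OF s(2)] AV.subspace_add[OF principal_subspace] by blast
    then have "s (x + y) - (o_part (s x) + o_part (s y)) \<in> ?F"
      by (simp add: AO.operator_add[OF s(1)] algebra_simps)
    ultimately have "\<mu> (s (x + y)) = \<nu> (o_part (s x) + o_part (s y))" by (rule \<mu>eq)
    then show "P1 (x + y) = P1 x + P1 y" by (simp add: P1_def \<mu>_def AO.operator_add[OF o\<nu>])
  next
    fix c x
    have "(\<lambda>Q. \<iota> c * o_part (s x) Q) \<in> ?O"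
      using o_part[OF s(2)] AV.subspace_scale[OF adele_box_subspace] by blast
    moreover have "(\<lambda>Q. \<iota> c * (s x - o_part (s x)) Q) \<in> ?F"
      using o_part[OF s(2)] AV.subspace_scale[OF principal_subspace] by blast
    then have "s (\<lambda>Q. \<iota> c * x Q) - (\<lambda>Q. \<iota> c * o_part (s x) Q) \<in> ?F"
      unfolding AO.operator_scale[OF s(1)] by (simp add: right_diff_distrib fun_diff_def)
    ultimately have "\<mu> (s (\<lambda>Q. \<iota> c * x Q)) = \<nu> (\<lambda>Q. \<iota> c * o_part (s x) Q)" by (rule \<mu>eq)
    then show "P1 (\<lambda>Q. \<iota> c * x Q) = (\<lambda>Q. \<iota> c * P1 x Q)" by (simp add: P1_def \<mu>_def AO.operator_scale[OF o\<nu>])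
  qed
  have P1O: "P1 v \<in> ?O" for v unfolding P1_def \<mu>_def using o_part[OF s(2)] \<nu>O by blast
  have P1x: "P1 x = \<nu> x" if "x \<in> ?O" for x
    unfolding P1_def using that OW s(3)[of x] AV.subspace_0[OF principal_subspace] \<mu>eq[of x x] by auto
  have P1F: "P1 x = 0" if "x \<in> ?F" for x
    unfolding P1_def using that FW s(3)[of x] AV.subspace_0[OF adele_box_subspace] \<mu>eq[of 0 x] AO.operator_0[OF o\<nu>] by auto
  have P1W: "x - P1 x \<in> ?F" if x: "x \<in> ?W" for x
  proof -
    have "(x - o_part x) + (o_part x - \<nu> (o_part x)) \<in> ?F"
      using o_part[OF x] \<nu>F AV.subspace_add[OF principal_subspace] by blast
    then show ?thesis by (simp add: P1_def \<mu>_def s(3)[OF x])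
  qed
  obtain r where r: "AO.operator r" "\<And>v. r v \<in> adeles" "\<And>w. w \<in> adeles \<Longrightarrow> r w = w"
    using AO.projection_exists[OF adeles_subspace] by blast
  define d where "d = (\<lambda>v. v - s v)"
  have od: "AO.operator d" unfolding d_def by (rule AO.operator_minus[OF AO.operator_id s(1)])
  have "0 < idx adeles ?W" using idx_adeles[OF divisor_zero] by simp
  then obtain Z where Z: "AV.cobasis adeles ?W Z"
    using AV.cobasis_exists[OF sW adeles_subspace WA] by blast
  have dspan: "d x \<in> AV.span (d ` Z)" if x: "x \<in> adeles" for x
  proof -
    obtain c where c: "x - (\<Sum>z\<in>Z. (\<lambda>Q. \<iota> (c z) * z Q)) \<in> ?W"
      using AV.cobasis_spans[OF Z x] by blast
    let ?s = "\<Sum>z\<in>Z. (\<lambda>Q. \<iota> (c z) * z Q)"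
    have "d (x - ?s) = 0" unfolding d_def using s(3)[OF c] by simp
    then have "d x = d ?s" using AO.operator_diff[OF od] by simp
    also have "\<dots> = (\<Sum>z\<in>Z. (\<lambda>Q. \<iota> (c z) * d z Q))"
      by (simp add: AO.operator_sum[OF od] AO.operator_scale[OF od])
    also have "\<dots> \<in> AV.span (d ` Z)" by (intro AV.span_sum AV.span_scale AV.span_base) auto
    finally show ?thesis .
  qed
  have fr_dr: "AO.finite_rank (\<lambda>v. d (r v))"
    by (rule AO.finite_rankI[OF AO.operator_comp[OF od r(1)] finite_imageI[OF AV.cobasis_finite[OF Z]] dspan[OF r(2)]])
  \<comment> \<open>Adding the part of an adele outside \<open>O + F\<close>, a correction of finite rank, makes the kernel in the adeles
    consist of functions.\<close>
  define \<sigma> where "\<sigma> = (\<lambda>v. P1 v + d (r v))"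
  have o\<sigma>: "AO.operator \<sigma>" unfolding \<sigma>_def by (rule AO.operator_plus[OF oP1 AO.operator_comp[OF od r(1)]])
  have \<sigma>A: "\<sigma> v \<in> adeles" for v
  proof -
    have "P1 v \<in> adeles" using P1O adele_box_subset[OF divisor_zero] by blast
    moreover have "d (r v) \<in> adeles" unfolding d_def
      using r(2) s(2) WA AV.subspace_diff[OF adeles_subspace] by blast
    ultimately show ?thesis unfolding \<sigma>_def by (rule AV.subspace_add[OF adeles_subspace])
  qed
  have \<sigma>F: "\<sigma> x = 0" if x: "x \<in> ?F" for x
  proof -
    have "r x = x" using x principal_subset_adeles by (intro r(3)) blast
    moreover have "s x = x" using x FW by (intro s(3)) blast
    ultimately show ?thesis using P1F[OF x] by (simp add: \<sigma>_def d_def)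
  qed
  have ker: "x - \<sigma> x \<in> ?F" if x: "x \<in> adeles" for x
  proof -
    have "P1 (s x) = P1 x" by (simp add: P1_def s(3)[OF s(2)])
    then have "x - \<sigma> x = s x - P1 (s x)" using r(3)[OF x] by (simp add: \<sigma>_def d_def)
    then show ?thesis using P1W[OF s(2)] by simp
  qed
  have Tmult: "\<sigma> ((\<lambda>_. h) * \<sigma> x) = \<sigma> ((\<lambda>_. h) * x)" if x: "x \<in> adeles" for x h
  proof -
    obtain y where y: "x - \<sigma> x = (\<lambda>_. y)" using ker[OF x] by (auto simp: principal_def)
    have "(\<lambda>_. h) * x - (\<lambda>_. h) * \<sigma> x = (\<lambda>_. h) * (x - \<sigma> x)" by (simp only: right_diff_distrib)
    also have "\<dots> = (\<lambda>_. h * y)" unfolding y by (simp add: times_fun_def)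
    finally have "\<sigma> ((\<lambda>_. h) * x - (\<lambda>_. h) * \<sigma> x) = 0" using \<sigma>F by (auto simp: principal_def)
    then show ?thesis by (simp add: AO.operator_diff[OF o\<sigma>])
  qed
  have "AO.commutator (toeplitz \<sigma> (\<lambda>_. f)) (toeplitz \<sigma> (\<lambda>_. g)) v = 0" for v
  proof -
    have cA: "(\<lambda>_. h) * \<sigma> v \<in> adeles" for h
      by (rule adeles_mult[OF _ \<sigma>A]) (use principal_subset_adeles in \<open>auto simp: principal_def\<close>)
    have "toeplitz \<sigma> (\<lambda>_. h) (toeplitz \<sigma> (\<lambda>_. h') v) = \<sigma> ((\<lambda>_. h) * ((\<lambda>_. h') * \<sigma> v))" for h h'
    proof -
      have ss: "\<sigma> (\<sigma> x) = \<sigma> x" if "x \<in> adeles" for x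
        using Tmult[OF that, of 1] by (simp add: times_fun_def)
      show ?thesis unfolding toeplitz_def ss[OF cA] by (rule Tmult[OF cA])
    qed
    then show ?thesis by (simp add: AO.commutator_def mult.left_commute)
  qed
  then have c0: "AO.commutator (toeplitz \<sigma> (\<lambda>_. f)) (toeplitz \<sigma> (\<lambda>_. g)) = (\<lambda>v. 0)" by auto
  \<comment> \<open>Restoring the constants, a correction of rank one, gives a projection onto \<open>O\<close>.\<close>
  define \<rho> where "\<rho> = (\<lambda>v. P1 v + (\<lambda>Q. \<iota> (ev v) * ?one Q))"
  have o\<rho>: "AO.operator \<rho>" unfolding \<rho>_def by (rule AO.operator_plus[OF oP1 AO.operator_rank_one[OF ev(1)]])
  have \<rho>: "projection_onto_integral \<rho>" unfolding projection_onto_integral_def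
  proof (intro conjI o\<rho> allI ballI)
    show "\<rho> v \<in> ?O" for v unfolding \<rho>_def
      by (rule AV.subspace_add[OF adele_box_subspace P1O AV.subspace_scale[OF adele_box_subspace one]])
    show "\<rho> w = w" if "w \<in> ?O" for w unfolding \<rho>_def P1x[OF that] by (simp add: \<nu>_def)
  qed
  have "AO.finite_rank (\<lambda>v. \<lambda>Q. \<iota> (ev v) * ?one Q)"
    by (rule AO.finite_rankI[OF AO.operator_rank_one[OF ev(1)], of "{?one}"])
      (rule finite.intros, rule finite.intros, rule AV.span_scale, rule AV.span_base, rule singletonI)
  from AO.finite_rank_minus[OF this fr_dr] have dif: "AO.finite_rank (\<lambda>v. \<rho> v - \<sigma> v)"
    by (simp add: \<rho>_def \<sigma>_def)
  have frT: "AO.finite_rank (\<lambda>v. toeplitz \<rho> a v - toeplitz \<sigma> a v)" for a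
  proof -
    have "toeplitz \<rho> a v - toeplitz \<sigma> a v = (\<rho> (a * \<rho> v) - \<sigma> (a * \<rho> v)) + \<sigma> (a * (\<rho> v - \<sigma> v))" for v
      by (simp add: toeplitz_def right_diff_distrib AO.operator_diff[OF o\<sigma>])
    moreover have "AO.finite_rank (\<lambda>v. (\<rho> (a * \<rho> v) - \<sigma> (a * \<rho> v)) + \<sigma> (a * (\<rho> v - \<sigma> v)))"
      by (rule AO.finite_rank_plus[OF AO.finite_rank_comp_right[OF dif AO.operator_comp[OF operator_mult o\<rho>]]
          AO.finite_rank_comp_left[OF dif AO.operator_comp[OF o\<sigma> operator_mult]]])
    ultimately show ?thesis by simp
  qed
  have fr0: "AO.finite_rank (AO.commutator (toeplitz \<sigma> (\<lambda>_. f)) (toeplitz \<sigma> (\<lambda>_. g)))"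
    unfolding c0 by (rule AO.finite_rank_zero)
  have "residue_trace \<rho> (\<lambda>_. f) (\<lambda>_. g) = AO.trace (AO.commutator (toeplitz \<sigma> (\<lambda>_. f)) (toeplitz \<sigma> (\<lambda>_. g)))"
    unfolding residue_trace_def
    by (rule AO.commutator_perturb(2)[OF operator_toeplitz[OF o\<sigma>] operator_toeplitz[OF o\<rho>]
          operator_toeplitz[OF o\<sigma>] operator_toeplitz[OF o\<rho>] frT frT fr0])
  also have "\<dots> = 0" unfolding c0 by (rule AO.trace_zero)
  finally show ?thesis
    using residue_trace_projection[OF \<pi> \<rho>, of "\<lambda>_. f" "\<lambda>_. g"] principal_subset_adeles
    by (auto simp: principal_def)
qed

subsection \<open>The residue as a pairing\<close>

definition local_projection :: "'f set \<Rightarrow> 'f \<Rightarrow> 'f" where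
  "local_projection Q = (SOME s. FO.operator s \<and> (\<forall>v. s v \<in> Q) \<and> (\<forall>w\<in>Q. s w = w))"

lemma local_projection:
  assumes Q: "place \<iota> Q"
  shows "FO.operator (local_projection Q)" "local_projection Q v \<in> Q"
    "w \<in> Q \<Longrightarrow> local_projection Q w = w"
proof -
  obtain s where "FO.operator s" "\<And>v. s v \<in> Q" "\<And>w. w \<in> Q \<Longrightarrow> s w = w"
    using FO.projection_exists[OF place_subspace[OF Q]] by blast
  then have "FO.operator s \<and> (\<forall>v. s v \<in> Q) \<and> (\<forall>w\<in>Q. s w = w)" by simp
  then have *: "FO.operator (local_projection Q) \<and> (\<forall>v. local_projection Q v \<in> Q) \<and> (\<forall>w\<in>Q. local_projection Q w = w)"
    unfolding local_projection_def
    by (rule someI[of "\<lambda>s. FO.operator s \<and> (\<forall>v. s v \<in> Q) \<and> (\<forall>w\<in>Q. s w = w)"])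
  from * show "FO.operator (local_projection Q)" by (rule conjunct1)
  from * show "local_projection Q v \<in> Q" by simp
  from * show "local_projection Q w = w" if "w \<in> Q" using that by simp
qed

text \<open>A projection that acts on each component separately, so that the residue is a sum of local terms.\<close>

definition componentwise :: "('f set \<Rightarrow> 'f) \<Rightarrow> 'f set \<Rightarrow> 'f" where
  "componentwise v = (\<lambda>Q. if place \<iota> Q then local_projection Q (v Q) else v Q)"

lemma componentwise: "projection_onto_integral componentwise"
  unfolding projection_onto_integral_def
proof (intro conjI allI ballI)
  show "AO.operator componentwise"
    by (rule AO.operatorI)
      (auto simp: componentwise_def fun_eq_iff FO.operator_add[OF local_projection(1)] FO.operator_scale[OF local_projection(1)])
  show "componentwise v \<in> integral_adeles" for v
    by (auto simp: componentwise_def adele_box_def ordset_0 local_projection(2))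
  show "componentwise w = w" if "w \<in> integral_adeles" for w
    using that by (auto simp: componentwise_def adele_box_def ordset_0 local_projection(3) fun_eq_iff)
qed

definition residue_pairing :: "('f set \<Rightarrow> 'f) \<Rightarrow> ('f set \<Rightarrow> 'f) \<Rightarrow> 'k" where
  "residue_pairing = residue_trace componentwise"

abbreviation T :: "('f set \<Rightarrow> 'f) \<Rightarrow> ('f set \<Rightarrow> 'f) \<Rightarrow> 'f set \<Rightarrow> 'f" where
  "T \<equiv> toeplitz componentwise"

lemma operator_T: "AO.operator (T a)"
  by (rule operator_toeplitz[OF proj_operator[OF componentwise]])

lemma T_add: "T (a + b) v = T a v + T b v"
  unfolding toeplitz_def distrib_right AO.operator_add[OF proj_operator[OF componentwise]] ..

lemma T_scale: "T (\<lambda>Q. \<iota> c * a Q) v = (\<lambda>Q. \<iota> c * T a v Q)"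
proof -
  have "(\<lambda>Q. \<iota> c * a Q) * componentwise v = (\<lambda>Q. \<iota> c * (a * componentwise v) Q)"
    by (simp add: fun_eq_iff mult.assoc)
  then show ?thesis unfolding toeplitz_def by (simp only: AO.operator_scale[OF proj_operator[OF componentwise]])
qed

lemma residue_pairing_add_left:
  assumes "a \<in> adeles" "a' \<in> adeles" "b \<in> adeles"
  shows "residue_pairing (a + a') b = residue_pairing a b + residue_pairing a' b"
proof -
  have "AO.commutator (T (a + a')) (T b) = (\<lambda>v. AO.commutator (T a) (T b) v + AO.commutator (T a') (T b) v)"
    by (simp add: AO.commutator_def T_add AO.operator_add[OF operator_T] fun_eq_iff)
  then show ?thesis unfolding residue_pairing_def residue_trace_def
    by (simp add: AO.trace_plus toeplitz_commutator componentwise assms)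
qed

lemma residue_pairing_swap:
  assumes "a \<in> adeles" "b \<in> adeles" shows "residue_pairing b a = - residue_pairing a b"
  unfolding residue_pairing_def residue_trace_def AO.commutator_swap[of "T b" "T a"]
  by (rule AO.trace_neg[OF toeplitz_commutator[OF componentwise assms]])

lemma residue_pairing_add_right:
  assumes "a \<in> adeles" "b \<in> adeles" "b' \<in> adeles"
  shows "residue_pairing a (b + b') = residue_pairing a b + residue_pairing a b'"
proof -
  have "- residue_pairing a (b + b') = - (residue_pairing a b + residue_pairing a b')"
    using residue_pairing_add_left[OF assms(2,3,1)] residue_pairing_swap[OF assms(1,2)]
      residue_pairing_swap[OF assms(1,3)] residue_pairing_swap[OF assms(1) AV.subspace_add[OF adeles_subspace assms(2,3)]]
    by simp
  then show ?thesis by (simp only: neg_equal_iff_equal)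
qed

lemma residue_pairing_scale_left:
  assumes "a \<in> adeles" "b \<in> adeles"
  shows "residue_pairing (\<lambda>Q. \<iota> c * a Q) b = c * residue_pairing a b"
proof -
  have "AO.commutator (T (\<lambda>Q. \<iota> c * a Q)) (T b) = (\<lambda>v. \<lambda>Q. \<iota> c * AO.commutator (T a) (T b) v Q)"
    by (simp add: AO.commutator_def T_scale AO.operator_scale[OF operator_T] fun_eq_iff right_diff_distrib)
  then show ?thesis unfolding residue_pairing_def residue_trace_def
    by (simp add: AO.trace_scale[OF toeplitz_commutator[OF componentwise assms]])
qed

text \<open>Modulo operators of finite rank \<open>T\<close> is multiplicative, so the rule follows from
  \<open>[X, G H] = [X G, H] + [H X, G]\<close>.\<close>

lemma residue_pairing_leibniz:
  assumes a: "a \<in> adeles" and g: "g \<in> adeles" and h: "h \<in> adeles"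
  shows "residue_pairing a (g * h) = residue_pairing (a * g) h + residue_pairing (a * h) g"
proof -
  note C = componentwise
  have ag: "a * g \<in> adeles" and ha: "h * a \<in> adeles" and gh: "g * h \<in> adeles" using assms adeles_mult by auto
  note oT = operator_T
  have oc: "AO.operator (\<lambda>v. T x (T y v))" for x y by (rule AO.operator_comp[OF oT oT])
  have sym: "AO.finite_rank (\<lambda>v. T x (T y v) - T (x * y) v)" if "y \<in> adeles" for x y
    using AO.finite_rank_neg[OF toeplitz_mult[OF C that, of x]] by simp
  have self: "AO.finite_rank (\<lambda>v. T x v - T x v)" for x by (simp add: AO.finite_rank_zero)
  note p1 = AO.commutator_perturb[OF oT oT oT oc self sym[OF h] toeplitz_commutator[OF C a gh]]
  note p2 = AO.commutator_perturb[OF oT oc oT oT sym[OF g] self toeplitz_commutator[OF C ag h]]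
  note p3 = AO.commutator_perturb[OF oT oc oT oT sym[OF a] self toeplitz_commutator[OF C ha g]]
  have id: "AO.commutator (T a) (\<lambda>v. T g (T h v))
      = (\<lambda>v. AO.commutator (\<lambda>v. T a (T g v)) (T h) v + AO.commutator (\<lambda>v. T h (T a v)) (T g) v)"
    by (simp add: AO.commutator_def fun_eq_iff)
  have "residue_pairing a (g * h) = AO.trace (AO.commutator (T a) (\<lambda>v. T g (T h v)))"
    unfolding residue_pairing_def residue_trace_def using p1(2) by simp
  also have "\<dots> = AO.trace (AO.commutator (\<lambda>v. T a (T g v)) (T h)) + AO.trace (AO.commutator (\<lambda>v. T h (T a v)) (T g))"
    unfolding id by (rule AO.trace_plus[OF p2(1) p3(1)])
  also have "\<dots> = residue_pairing (a * g) h + residue_pairing (h * a) g"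
    unfolding residue_pairing_def residue_trace_def using p2(2) p3(2) by simp
  finally show ?thesis by (simp add: mult.commute)
qed

lemma residue_pairing_principal: "residue_pairing (\<lambda>_. f) (\<lambda>_. g) = 0"
  unfolding residue_pairing_def by (rule residue_trace_principal[OF componentwise])

text \<open>Multiplication by integral adeles preserves the integral adeles, where the compressions
  are plain multiplications, which commute.\<close>

lemma residue_pairing_integral:
  assumes a: "a \<in> integral_adeles" and b: "b \<in> integral_adeles" shows "residue_pairing a b = 0"
proof -
  have m: "c * v \<in> integral_adeles" if "c \<in> integral_adeles" "v \<in> integral_adeles" for c v
    using adele_box_mult[OF that] by simp
  have "T c (T c' v) = c * (c' * componentwise v)" if c: "c \<in> integral_adeles" "c' \<in> integral_adeles" for c c' v
  proof -
    have w: "c' * componentwise v \<in> integral_adeles" by (rule m[OF c(2) proj_range[OF componentwise]])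
    show ?thesis unfolding toeplitz_def proj_id[OF componentwise w] by (rule proj_id[OF componentwise m[OF c(1) w]])
  qed
  note this[OF a b] this[OF b a]
  then have "AO.commutator (T a) (T b) = (\<lambda>v. 0)"
    by (simp add: AO.commutator_def mult.left_commute)
  then show ?thesis by (simp add: residue_pairing_def residue_trace_def AO.trace_zero)
qed

definition restrict_to :: "'f set set \<Rightarrow> ('f set \<Rightarrow> 'f) \<Rightarrow> 'f set \<Rightarrow> 'f" where
  "restrict_to S a = (\<lambda>Q. if Q \<in> S then a Q else 0)"

lemma restrict_to_split: "a = restrict_to S a + restrict_to (- S) a"
  by (auto simp: restrict_to_def fun_eq_iff)

lemma restrict_to_box: "a \<in> adele_box D \<Longrightarrow> restrict_to S a \<in> adele_box D"
  by (auto simp: adele_box_def restrict_to_def)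

lemma restrict_to_adeles: "a \<in> adeles \<Longrightarrow> restrict_to S a \<in> adeles"
  unfolding adeles_def using restrict_to_box by auto

lemma residue_pairing_disjoint:
  "residue_pairing (restrict_to S a) (restrict_to (- S) b) = 0"
proof -
  have c: "componentwise (restrict_to S v) = restrict_to S (componentwise v)" for S v
    by (auto simp: componentwise_def restrict_to_def fun_eq_iff FO.operator_0[OF local_projection(1)])
  have m: "restrict_to S a * v = restrict_to S (a * v)" "restrict_to S (restrict_to S' v) = restrict_to (S \<inter> S') v" for S S' a v
    by (auto simp: restrict_to_def fun_eq_iff)
  have ml: "a * restrict_to S v = restrict_to S (a * v)" for S a v
    by (auto simp: restrict_to_def fun_eq_iff)
  have "restrict_to {} v = 0" for v by (auto simp: restrict_to_def)
  then have "AO.commutator (T (restrict_to S a)) (T (restrict_to (- S) b)) = (\<lambda>v. 0)"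
    by (simp add: AO.commutator_def toeplitz_def m c ml)
  then show ?thesis by (simp add: residue_pairing_def residue_trace_def AO.trace_zero)
qed

lemma residue_pairing_local:
  assumes "a \<in> adeles" "b \<in> adeles"
  shows "residue_pairing (restrict_to S a) b = residue_pairing (restrict_to S a) (restrict_to S b)"
proof -
  have "residue_pairing (restrict_to S a) b
      = residue_pairing (restrict_to S a) (restrict_to S b + restrict_to (- S) b)"
    using restrict_to_split[of b S] by simp
  also have "\<dots> = residue_pairing (restrict_to S a) (restrict_to S b) + residue_pairing (restrict_to S a) (restrict_to (- S) b)"
    by (intro residue_pairing_add_right restrict_to_adeles assms)
  finally show ?thesis by (simp add: residue_pairing_disjoint)
qed

end


section \<open>The residue at a place\<close>

context function_field
begin

definition at_place :: "'f set \<Rightarrow> 'f \<Rightarrow> 'f set \<Rightarrow> 'f" where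
  "at_place P w = (\<lambda>Q. if Q = P then w else 0)"

lemma at_place_self [simp]: "at_place P w P = w" by (simp add: at_place_def)

lemma at_place_eq_restrict: "at_place P w = restrict_to {P} (\<lambda>_. w)"
  by (auto simp: at_place_def restrict_to_def)

lemma at_place_adeles: "at_place P w \<in> adeles"
  unfolding at_place_eq_restrict using principal_subset_adeles by (intro restrict_to_adeles) (auto simp: principal_def)

lemma at_place_mult_const: "at_place P v * (\<lambda>_. w) = at_place P (v * w)"
  by (auto simp: at_place_def fun_eq_iff)

lemma at_place_integral: "place \<iota> P \<Longrightarrow> w \<in> P \<Longrightarrow> at_place P w \<in> integral_adeles"
  by (simp add: at_place_def adele_box_def ordset_0 place_0)

lemma const_adeles: "(\<lambda>_. f) \<in> adeles"
  using principal_subset_adeles by (auto simp: principal_def)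

lemma residue_pairing_at_place:
  "residue_pairing (at_place P f) (\<lambda>_. g) = residue_pairing (at_place P f) (at_place P g)"
  unfolding at_place_eq_restrict by (rule residue_pairing_local[OF const_adeles const_adeles])

lemma residue_pairing_regular:
  "place \<iota> P \<Longrightarrow> f \<in> P \<Longrightarrow> g \<in> P \<Longrightarrow> residue_pairing (at_place P f) (\<lambda>_. g) = 0"
  unfolding residue_pairing_at_place by (intro residue_pairing_integral at_place_integral)

text \<open>The cosets of the constants already exhaust the residue field, by their number.\<close>

lemma rational_place_value:
  assumes "rational_place \<iota> P" "h \<in> P"
  shows "h - \<iota> (value_at \<iota> P h) \<in> max_ideal P"
    and "\<And>c. h - \<iota> c \<in> max_ideal P \<Longrightarrow> value_at \<iota> P h = c"
proof -
  have P: "place \<iota> P" and d: "place_degree \<iota> P = 1" using assms by (auto simp: rational_place_def)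
  note m = FV.subspace_add_subgroup[OF max_ideal_subspace[OF P]]
  have inj: "c = c'" if "\<iota> c - \<iota> c' \<in> max_ideal P" for c c'
    using const_in_max_ideal[OF P, of "c - c'"] that by (simp add: \<iota>_diff)
  have card: "card (coset (max_ideal P) ` P) = CARD('k)" using idx_residue[OF P] d by (simp add: idx_def)
  have "inj (\<lambda>c. coset (max_ideal P) (\<iota> c))" by (rule injI) (use inj in \<open>simp add: coset_eq_iff[OF m]\<close>)
  then have "card (range (\<lambda>c. coset (max_ideal P) (\<iota> c))) = CARD('k)" by (rule card_image)
  moreover have "range (\<lambda>c. coset (max_ideal P) (\<iota> c)) \<subseteq> coset (max_ideal P) ` P"
    using place_const[OF P] by auto
  moreover have "finite (coset (max_ideal P) ` P)" using card by (intro card_ge_0_finite) simp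
  ultimately have "range (\<lambda>c. coset (max_ideal P) (\<iota> c)) = coset (max_ideal P) ` P"
    using card by (intro card_subset_eq) auto
  then have "coset (max_ideal P) h \<in> range (\<lambda>c. coset (max_ideal P) (\<iota> c))" using assms(2) by simp
  then obtain c where c: "h - \<iota> c \<in> max_ideal P" using coset_eq_iff[OF m] by auto
  have uniq: "c' = c''" if "h - \<iota> c' \<in> max_ideal P" "h - \<iota> c'' \<in> max_ideal P" for c' c''
    using inj[of c'' c'] add_subgroup_diff[OF m that] by simp
  have v: "value_at \<iota> P h = c" unfolding value_at_def by (rule the_equality) (use c uniq in auto)
  show "h - \<iota> (value_at \<iota> P h) \<in> max_ideal P" using c v by simp
  show "\<And>c. h - \<iota> c \<in> max_ideal P \<Longrightarrow> value_at \<iota> P h = c" using uniq c v by blast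
qed

lemma value_at_const: "rational_place \<iota> P \<Longrightarrow> value_at \<iota> P (\<iota> c) = c"
  by (rule rational_place_value(2)) (auto simp: rational_place_def place_const zero_in_max_ideal)

lemma value_at_add:
  assumes r: "rational_place \<iota> P" and x: "x \<in> P" and y: "y \<in> P"
  shows "value_at \<iota> P (x + y) = value_at \<iota> P x + value_at \<iota> P y"
proof (rule rational_place_value(2)[OF r])
  have P: "place \<iota> P" using r by (simp add: rational_place_def)
  show "x + y \<in> P" by (rule place_add[OF P x y])
  have "(x - \<iota> (value_at \<iota> P x)) + (y - \<iota> (value_at \<iota> P y)) \<in> max_ideal P"
    by (intro max_ideal_add P rational_place_value(1) r x y)
  then show "x + y - \<iota> (value_at \<iota> P x + value_at \<iota> P y) \<in> max_ideal P" by (simp add: add algebra_simps)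
qed

lemma value_at_mult:
  assumes r: "rational_place \<iota> P" and x: "x \<in> P" and y: "y \<in> P"
  shows "value_at \<iota> P (x * y) = value_at \<iota> P x * value_at \<iota> P y"
proof (rule rational_place_value(2)[OF r])
  have P: "place \<iota> P" using r by (simp add: rational_place_def)
  let ?v = "value_at \<iota> P"
  show "x * y \<in> P" by (rule place_mult[OF P x y])
  have "(x - \<iota> (?v x)) * y + (y - \<iota> (?v y)) * \<iota> (?v x) \<in> max_ideal P"
    by (intro max_ideal_add max_ideal_mult P rational_place_value(1) r x y place_const)
  then show "x * y - \<iota> (?v x * ?v y) \<in> max_ideal P" by (simp add: mult algebra_simps)
qed

end

locale local_parameter = function_field \<iota> for \<iota> :: "'k::{field,finite} \<Rightarrow> 'f::field" +
  fixes P :: "'f set" and t :: 'f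
  assumes P: "place \<iota> P" and t: "uniformizer P t"
begin

lemma t_nonzero: "t \<noteq> 0" and t_max: "t \<in> max_ideal P" and t_place: "t \<in> P"
  using uniformizer_max_ideal[OF P t] max_ideal_subset by auto

abbreviation lp :: "'f \<Rightarrow> 'f" where "lp \<equiv> local_projection P"

lemmas lp = local_projection[OF P]

text \<open>Projects \<open>P\<close> onto a complement of its maximal ideal.\<close>

definition q :: "'f \<Rightarrow> 'f" where "q w = w - t * lp (w / t)"

lemma q_diff: "q (w - w') = q w - q w'"
  by (simp add: q_def diff_divide_distrib FO.operator_diff[OF lp(1)] algebra_simps)

lemma q_add: "q (w + w') = q w + q w'"
  by (simp add: q_def add_divide_distrib FO.operator_add[OF lp(1)] algebra_simps)

lemma q_scale: "q (\<iota> c * w) = \<iota> c * q w"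
  using FO.operator_scale[OF lp(1), of c "w / t"] by (simp add: q_def algebra_simps)

lemma q_max: assumes "w \<in> max_ideal P" shows "q w = 0"
proof -
  obtain u where "u \<in> P" "w = t * u" using assms t unfolding uniformizer_def by auto
  then show ?thesis using t_nonzero lp(3)[of u] by (simp add: q_def)
qed

lemma q_minus_max: "w - q w \<in> max_ideal P"
  unfolding q_def using max_ideal_mult[OF P t_max lp(2)] by simp

lemma q_place: "w \<in> P \<Longrightarrow> q w \<in> P"
  unfolding q_def by (intro place_diff place_mult P t_place lp(2))

lemma q_mult_q: assumes "u \<in> P" "w \<in> P" shows "q (u * q w) = q (u * w)"
proof -
  have "(w - q w) * u \<in> max_ideal P" by (rule max_ideal_mult[OF P q_minus_max assms(1)])
  then have "q ((w - q w) * u) = 0" by (rule q_max)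
  then have "q (w * u) - q (q w * u) = 0" by (simp only: left_diff_distrib q_diff)
  then show ?thesis by (simp add: mult.commute)
qed

text \<open>Multiplication by \<open>u\<close> on the residue field at \<open>P\<close>, realized on the complement.\<close>

definition M :: "'f \<Rightarrow> ('f set \<Rightarrow> 'f) \<Rightarrow> 'f set \<Rightarrow> 'f" where
  "M u v = at_place P (q (u * lp (v P)))"

lemma M_operator: "AO.operator (M u)"
proof (rule AO.operatorI)
  show "M u (x + y) = M u x + M u y" for x y
    by (simp add: M_def FO.operator_add[OF lp(1)] distrib_left q_add) (auto simp: at_place_def fun_eq_iff)
  show "M u (\<lambda>Q. \<iota> c * x Q) = (\<lambda>Q. \<iota> c * M u x Q)" for c x
    by (simp add: M_def FO.operator_scale[OF lp(1)] mult.left_commute[of u] q_scale) (auto simp: at_place_def fun_eq_iff)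
qed

text \<open>The terms of the commutator are \<open>u\<close> and \<open>t \<circ> lp \<circ> u / t\<close>, and \<open>q\<close> is by construction the identity minus
  \<open>t \<circ> lp \<circ> 1 / t\<close>.\<close>

lemma M_eq_commutator:
  assumes u: "u \<in> P" shows "M u = AO.commutator (T (at_place P (u / t))) (T (at_place P t))"
proof
  fix v
  have Tp: "T (at_place P a) v = at_place P (lp (a * lp (v P)))" for a v
    using P by (auto simp: toeplitz_def componentwise_def at_place_def fun_eq_iff FO.operator_0[OF local_projection(1)])
  have Tt: "T (at_place P t) v = at_place P (t * lp (v P))" for v :: "'f set \<Rightarrow> 'f"
    unfolding Tp by (subst lp(3)) (auto intro: place_mult P t_place lp(2))
  have "T (at_place P (u / t)) (T (at_place P t) v) = at_place P (lp (u / t * lp (t * lp (v P))))"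
    unfolding Tp[of "u / t" "T (at_place P t) v"] by (simp only: Tt at_place_self)
  also have "lp (t * lp (v P)) = t * lp (v P)" by (intro lp(3) place_mult P t_place lp(2))
  also have "lp (u / t * (t * lp (v P))) = u * lp (v P)"
    using t_nonzero by simp (intro lp(3) place_mult P u lp(2))
  finally have 1: "T (at_place P (u / t)) (T (at_place P t) v) = at_place P (u * lp (v P))" .
  have "T (at_place P t) (T (at_place P (u / t)) v) = at_place P (t * lp (lp (u / t * lp (v P))))"
    unfolding Tt[of "T (at_place P (u / t)) v"] by (simp only: Tp at_place_self)
  also have "lp (lp (u / t * lp (v P))) = lp (u * lp (v P) / t)" by (subst lp(3)[OF lp(2)]) simp
  finally have 2: "T (at_place P t) (T (at_place P (u / t)) v) = at_place P (t * lp (u * lp (v P) / t))" .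
  show "M u v = AO.commutator (T (at_place P (u / t))) (T (at_place P t)) v"
    unfolding AO.commutator_def 1 2 M_def q_def by (auto simp: at_place_def fun_eq_iff)
qed

lemma M_finite_rank: "u \<in> P \<Longrightarrow> AO.finite_rank (M u)"
  by (simp add: M_eq_commutator toeplitz_commutator[OF componentwise at_place_adeles at_place_adeles])

lemma residue_pairing_simple_pole:
  "u \<in> P \<Longrightarrow> residue_pairing (at_place P (u / t)) (\<lambda>_. t) = AO.trace (M u)"
  unfolding residue_pairing_at_place by (simp add: residue_pairing_def residue_trace_def M_eq_commutator)

lemma M_cong: assumes "u - u' \<in> max_ideal P" shows "M u = M u'"
proof
  fix v
  have "(u - u') * lp (v P) \<in> max_ideal P" by (rule max_ideal_mult[OF P assms lp(2)])
  then have "q ((u - u') * lp (v P)) = 0" by (rule q_max)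
  then have "q (u * lp (v P)) - q (u' * lp (v P)) = 0" by (simp only: left_diff_distrib q_diff)
  then have "q (u * lp (v P)) = q (u' * lp (v P))" by simp
  then show "M u v = M u' v" by (simp add: M_def)
qed

lemma M_mult: assumes "u \<in> P" "u' \<in> P" shows "M u (M u' v) = M (u * u') v"
proof -
  have w: "u' * lp (v P) \<in> P" using assms by (intro place_mult P lp(2))
  then have "lp (q (u' * lp (v P))) = q (u' * lp (v P))" by (intro lp(3) q_place)
  then show ?thesis using q_mult_q[OF assms(1) w] by (simp add: M_def mult.assoc)
qed

text \<open>At a rational place \<open>M u\<close> has rank one: its range is spanned by the representative \<open>q 1\<close> of 1.\<close>

lemma trace_M_rational:
  assumes r: "rational_place \<iota> P" and u: "u \<in> P" shows "AO.trace (M u) = value_at \<iota> P u"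
proof -
  let ?v = "value_at \<iota> P"
  note v = rational_place_value[OF r]
  note vm = value_at_mult[OF r] and va = value_at_add[OF r] and vc = value_at_const[OF r]
  define \<phi> where "\<phi> = (\<lambda>v::'f set \<Rightarrow> 'f. ?v u * ?v (lp (v P)))"
  have \<phi>: "AO.functional \<phi>"
    unfolding AO.functional_def
  proof (intro conjI allI)
    fix x y :: "'f set \<Rightarrow> 'f"
    show "\<phi> (x + y) = \<phi> x + \<phi> y"
      by (simp add: \<phi>_def FO.operator_add[OF lp(1)] va[OF lp(2) lp(2)] distrib_left)
  next
    fix c and x :: "'f set \<Rightarrow> 'f"
    show "\<phi> (\<lambda>Q. \<iota> c * x Q) = c * \<phi> x"
      by (simp add: \<phi>_def FO.operator_scale[OF lp(1)] vm[OF place_const[OF P] lp(2)] vc)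
  qed
  have "M u = (\<lambda>v Q. \<iota> (\<phi> v) * at_place P (q 1) Q)"
  proof
    fix v
    have uw: "u * lp (v P) \<in> P" by (intro place_mult P u lp(2))
    have "q (u * lp (v P) - \<iota> (?v (u * lp (v P)))) = 0" by (rule q_max[OF v(1)[OF uw]])
    then have "q (u * lp (v P)) = \<iota> (\<phi> v) * q 1"
      using q_scale[of _ 1] by (simp add: q_diff \<phi>_def vm[OF u lp(2)])
    then show "M u v = (\<lambda>Q. \<iota> (\<phi> v) * at_place P (q 1) Q)" by (auto simp: M_def at_place_def)
  qed
  then have "AO.trace (M u) = \<phi> (at_place P (q 1))" using AO.trace_rank_one[OF \<phi>] by simp
  also have "lp (q 1) = q 1" by (intro lp(3) q_place place_1 P)
  then have "\<phi> (at_place P (q 1)) = ?v u * ?v (q 1)" by (simp add: \<phi>_def)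
  also have "?v (q 1) = 1"
    using v(2)[OF q_place[OF place_1[OF P]], of 1] FV.subspace_neg[OF max_ideal_subspace[OF P] q_minus_max[of 1]] by simp
  finally show ?thesis by simp
qed

text \<open>
  Let \<open>S\<close> be an operator of rank one and trace 1 on the residue field. The sum of its conjugates under the
  multiplicative group commutes with all multiplications, so it is a multiplication itself. Its
  trace is the order of the group, which is \<open>-1\<close> in \<open>k\<close>.
\<close>

lemma trace_M_nonzero: "\<exists>u\<in>P. AO.trace (M u) \<noteq> 0"
proof -
  let ?m = "max_ideal P"
  note sm = FV.subspace_add_subgroup[OF max_ideal_subspace[OF P]]
  define Cs where "Cs = coset ?m ` (P - ?m)"
  have finP: "finite (coset ?m ` P)"
    using idx_residue_pos[OF P] by (intro card_ge_0_finite) (simp add: idx_def)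
  then have finC: "finite Cs" unfolding Cs_def by (rule finite_subset[rotated]) auto
  define r where "r = (\<lambda>c. SOME h. h \<in> P - ?m \<and> coset ?m h = c)"
  have r: "r c \<in> P" "r c \<notin> ?m" "coset ?m (r c) = c" if "c \<in> Cs" for c
  proof -
    have "\<exists>h. h \<in> P - ?m \<and> coset ?m h = c" using that by (auto simp: Cs_def)
    then have "r c \<in> P - ?m \<and> coset ?m (r c) = c" unfolding r_def by (rule someI_ex)
    then show "r c \<in> P" "r c \<notin> ?m" "coset ?m (r c) = c" by auto
  qed
  have inv: "inverse h \<in> P" "h \<noteq> 0" if "h \<in> P" "h \<notin> ?m" for h
    using that place_unit_iff[OF P, of h] by (auto simp: place_unit_def)
  define w0 where "w0 = at_place P (q 1)"
  have q1: "q 1 \<noteq> 0" using q_minus_max[of 1] one_notin_max_ideal[OF P] by auto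
  have w0: "w0 \<notin> {0}" using q1 by (auto simp: w0_def at_place_def fun_eq_iff)
  obtain \<phi> where \<phi>: "AO.functional \<phi>" "\<phi> w0 = 1" using AO.functional_exists[OF AV.subspace_single_0 w0] by blast
  define S where "S = (\<lambda>v Q. \<iota> (\<phi> v) * w0 Q)"
  have oS: "AO.operator S" unfolding S_def by (rule AO.operator_rank_one[OF \<phi>(1)])
  define A where "A = (\<lambda>v. \<Sum>c\<in>Cs. M (inverse (r c)) (S (M (r c) v)))"
  have oA: "AO.operator A"
    by (rule AO.operatorI)
      (simp_all add: A_def AO.operator_add[OF M_operator] AO.operator_scale[OF M_operator]
        AO.operator_add[OF oS] AO.operator_scale[OF oS] sum.distrib AV.scale_sum_right)
  have comm: "A (M h v) = M h (A v)" if h: "h \<in> P" "h \<notin> ?m" for h v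
  proof -
    \<comment> \<open>Multiplication by \<open>h\<close> permutes the nonzero residue classes, and so the summands of \<open>A\<close>.\<close>
    define s where "s = (\<lambda>c. coset ?m (r c * h))"
    have rh: "r c * h \<in> P" "r c * h \<notin> ?m" if c: "c \<in> Cs" for c
    proof -
      show "r c * h \<in> P" using r[OF c] h by (intro place_mult P)
      show "r c * h \<notin> ?m"
      proof
        assume "r c * h \<in> ?m"
        then have "r c * h * inverse h \<in> ?m" by (rule max_ideal_mult[OF P _ inv(1)[OF h]])
        then show False using r(2)[OF c] inv(2)[OF h] by (simp add: mult.assoc)
      qed
    qed
    have sC: "s c \<in> Cs" if "c \<in> Cs" for c using rh[OF that] by (auto simp: s_def Cs_def)
    have "inj_on s Cs"
    proof (rule inj_onI)
      fix c c' assume c: "c \<in> Cs" "c' \<in> Cs" "s c = s c'"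
      then have "(r c - r c') * h \<in> ?m" by (simp add: s_def coset_eq_iff[OF sm] left_diff_distrib)
      then have "(r c - r c') * h * inverse h \<in> ?m" by (rule max_ideal_mult[OF P _ inv(1)[OF h]])
      then have "r c - r c' \<in> ?m" using inv(2)[OF h] by (simp add: mult.assoc)
      then show "c = c'" using r(3) c coset_eq_iff[OF sm, of "r c" "r c'"] by metis
    qed
    moreover have "s ` Cs \<subseteq> Cs" using sC by auto
    ultimately have bij: "bij_betw s Cs Cs" using endo_inj_surj[OF finC] by (simp add: bij_betw_def)
    have summand: "M (inverse (r c)) (S (M (r c) (M h v))) = M h (M (inverse (r (s c))) (S (M (r (s c)) v)))"
      if c: "c \<in> Cs" for c
    proof -
      have d: "r (s c) - r c * h \<in> ?m"
        using r(3)[OF sC[OF c]] coset_eq_iff[OF sm, of "r (s c)" "r c * h"] by (simp add: s_def)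
      note rc = r[OF c] and rs = r[OF sC[OF c]]
      have 1: "M (r c) (M h v) = M (r (s c)) v" using M_mult[OF rc(1) h(1)] M_cong[OF d] by simp
      have "(r (s c) - r c * h) * (inverse (r c) * inverse (r (s c))) \<in> ?m"
        by (intro max_ideal_mult P d place_mult inv rc rs)
      then have "inverse (r c) - h * inverse (r (s c)) \<in> ?m"
        using inv(2)[OF rc(1,2)] inv(2)[OF rs(1,2)] by (simp add: left_diff_distrib field_simps)
      then have 2: "M (inverse (r c)) = M (h * inverse (r (s c)))" by (rule M_cong)
      show ?thesis unfolding 1 2 by (rule M_mult[OF h(1) inv(1)[OF rs(1,2)], symmetric])
    qed
    have "A (M h v) = (\<Sum>c\<in>Cs. M h (M (inverse (r (s c))) (S (M (r (s c)) v))))"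
      unfolding A_def by (rule sum.cong[OF refl]) (rule summand)
    also have "\<dots> = (\<Sum>c\<in>Cs. M h (M (inverse (r c)) (S (M (r c) v))))"
      by (rule sum.reindex_bij_betw[OF bij, of "\<lambda>c. M h (M (inverse (r c)) (S (M (r c) v)))"])
    also have "\<dots> = M h (A v)" unfolding A_def by (rule AO.operator_sum[OF M_operator, symmetric])
    finally show ?thesis .
  qed
  \<comment> \<open>An operator that commutes with all multiplications is determined by the image \<open>z\<close> of 1.\<close>
  define z where "z = lp (A w0 P)"
  have zP: "z \<in> P" unfolding z_def by (rule lp(2))
  have "A v = M z v" for v
  proof -
    define w where "w = lp (v P)"
    have wP: "w \<in> P" unfolding w_def by (rule lp(2))
    show ?thesis
    proof (cases "w \<in> ?m")
      case True
      have "M g v = 0" if "g \<in> P" for g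
      proof -
        have "q (w * g) = 0" by (rule q_max[OF max_ideal_mult[OF P True that]])
        then show ?thesis by (auto simp: M_def at_place_def w_def mult.commute)
      qed
      then show ?thesis using r zP AO.operator_0[OF oS] AO.operator_0[OF M_operator] by (simp add: A_def)
    next
      case False
      have "lp (q 1) = q 1" by (intro lp(3) q_place place_1 P)
      then have Mw: "M w w0 = M 1 v"
        using q_mult_q[OF wP place_1[OF P]] by (simp add: M_def w0_def w_def)
      have "A v = A (M 1 v)" unfolding A_def
        by (rule sum.cong[OF refl]) (use M_mult[OF r(1) place_1[OF P]] in simp)
      also have "\<dots> = M w (A w0)" unfolding Mw[symmetric] by (rule comm[OF wP False])
      also have "\<dots> = M z v" by (simp add: M_def z_def w_def mult.commute)
      finally show ?thesis .
    qed
  qed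
  then have Az: "A = M z" by auto
  have frS: "AO.finite_rank (\<lambda>v. S (M (r c) v))" if "c \<in> Cs" for c
    by (rule AO.finite_rank_comp_left[OF M_finite_rank[OF r(1)[OF that]] oS])
  have "AO.trace (\<lambda>v. M (inverse (r c)) (S (M (r c) v))) = 1" if c: "c \<in> Cs" for c
  proof -
    have i: "inverse (r c) \<in> P" using inv r c by blast
    have "AO.trace (\<lambda>v. M (inverse (r c)) (S (M (r c) v))) = AO.trace (\<lambda>v. S (M (r c) (M (inverse (r c)) v)))"
      by (rule AO.trace_commute[OF frS[OF c] M_operator, symmetric])
    also have "(\<lambda>v. S (M (r c) (M (inverse (r c)) v))) = (\<lambda>v Q. \<iota> (\<phi> (M 1 v)) * w0 Q)"
      using M_mult[OF r(1)[OF c] i] inv(2)[OF r(1,2)[OF c]] by (simp add: S_def)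
    also have "AO.trace \<dots> = \<phi> (M 1 w0)"
      by (rule AO.trace_rank_one)
        (simp add: AO.functional_def AO.operator_add[OF M_operator] AO.operator_scale[OF M_operator]
          AO.functional_add[OF \<phi>(1)] AO.functional_scale[OF \<phi>(1)])
    also have "M 1 w0 = w0"
    proof -
      have "lp (q 1) = q 1" by (intro lp(3) q_place place_1 P)
      moreover have "q (q 1) = q 1" using q_mult_q[OF place_1[OF P] place_1[OF P]] by simp
      ultimately show ?thesis by (simp add: M_def w0_def)
    qed
    finally show ?thesis using \<phi>(2) by simp
  qed
  then have "AO.trace A = of_nat (card Cs)"
    using frS AO.finite_rank_comp_left[OF _ M_operator] unfolding A_def by (subst AO.trace_sum) auto
  moreover have "of_nat (card Cs) = (- 1 :: 'k)"
  proof -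
    have "coset ?m ` P = insert (coset ?m 0) Cs"
    proof (intro equalityI subsetI)
      fix c assume "c \<in> coset ?m ` P"
      then obtain x where x: "x \<in> P" "c = coset ?m x" by auto
      show "c \<in> insert (coset ?m 0) Cs"
        using x coset_eq_iff[OF sm, of x 0] by (cases "x \<in> ?m") (simp_all add: Cs_def)
    next
      fix c assume "c \<in> insert (coset ?m 0) Cs"
      then show "c \<in> coset ?m ` P" using place_0[OF P] by (auto simp: Cs_def)
    qed
    moreover have "coset ?m 0 \<notin> Cs"
      using coset_eq_iff[OF sm, of _ 0] by (auto simp: Cs_def)
    ultimately have "Suc (card Cs) = card (coset ?m ` P)" using finC by simp
    then have "Suc (card Cs) = CARD('k) ^ place_degree \<iota> P" using idx_residue[OF P] unfolding idx_def by (rule trans)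
    then have "of_nat (Suc (card Cs)) = (of_nat (CARD('k) ^ place_degree \<iota> P) :: 'k)" by (rule arg_cong)
    also have "\<dots> = 0"
      unfolding of_nat_power of_nat_card_eq_0 by (rule zero_power[OF place_degree_pos[OF P]])
    finally show ?thesis by (simp add: eq_neg_iff_add_eq_0 add.commute)
  qed
  ultimately have "AO.trace (M z) \<noteq> 0" unfolding Az by simp
  then show ?thesis using zP by blast
qed

lemma residue_nonzero: "\<exists>u\<in>P. residue_pairing (at_place P (u / t)) (\<lambda>_. t) \<noteq> 0"
  using trace_M_nonzero residue_pairing_simple_pole by auto

lemma residue_rational:
  "rational_place \<iota> P \<Longrightarrow> u \<in> P \<Longrightarrow> residue_pairing (at_place P (u / t)) (\<lambda>_. t) = value_at \<iota> P u"
  by (simp add: residue_pairing_simple_pole trace_M_rational)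

end


section \<open>Duality\<close>

context function_field
begin

lemma adeles_eq_large_degree:
  "\<exists>c. \<forall>D. divisor D \<longrightarrow> c \<le> deg D \<longrightarrow> adeles = sumset (adele_box D) principal"
proof -
  obtain c where c: "\<And>E. divisor E \<Longrightarrow> c \<le> deg E \<Longrightarrow> int (ell \<iota> E) = deg E + 1 - genus \<iota>"
    using ell_large_degree by blast
  have "adeles = sumset (adele_box D) principal" if D: "divisor D" "c \<le> deg D" for D
  proof (rule adeles_eq_sumset[OF D(1)])
    fix E assume E: "divisor E" "D \<le> E"
    show "int (ell \<iota> E) = deg E + 1 - genus \<iota>"
      using c[OF E(1)] deg_diff_eq_sum(2)[OF D(1) E] D(2) by linarith
  qed
  then show ?thesis by blast
qed

lemma adeles_decompose:
  assumes "finite S" shows "a = (\<Sum>P\<in>S. at_place P (a P)) + restrict_to (- S) a"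
proof
  fix Q
  have "(\<Sum>P\<in>S. at_place P (a P)) Q = (\<Sum>P\<in>S. at_place P (a P) Q)"
    using assms by (induction S) auto
  also have "\<dots> = (\<Sum>P\<in>S. if P = Q then a Q else 0)" by (rule sum.cong) (auto simp: at_place_def)
  finally show "a Q = ((\<Sum>P\<in>S. at_place P (a P)) + restrict_to (- S) a) Q"
    using assms by (simp add: restrict_to_def)
qed

lemma const_mult_adeles: "a \<in> adeles \<Longrightarrow> (\<lambda>_. f) * a \<in> adeles"
  by (rule adeles_mult[OF const_adeles])

lemma at_place_box:
  assumes "w \<in> ordset P (- D P)" shows "at_place P w \<in> adele_box D"
  using assms by (auto simp: at_place_def adele_box_def)

end

locale differential_form = function_field \<iota> for \<iota> :: "'k::{field,finite} \<Rightarrow> 'f::field" +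
  fixes X :: "'f set" and g :: "'f \<Rightarrow> 'f"
  assumes finite_X: "finite X"
    and nonzero: "(\<Sum>x\<in>X. scale_diff (g x) (kaehler_d \<iota> x)) \<noteq> 0"
begin

definition \<eta> :: "('f \<Rightarrow> 'f) \<Rightarrow> 'f" where "\<eta> = (\<Sum>x\<in>X. scale_diff (g x) (kaehler_d \<iota> x))"

text \<open>The Weil differential of \<open>\<eta>\<close>: the sum of the residues of \<open>a \<eta>\<close> over all places.\<close>

definition \<omega> :: "('f set \<Rightarrow> 'f) \<Rightarrow> 'k" where
  "\<omega> a = (\<Sum>x\<in>X. residue_pairing (a * (\<lambda>_. g x)) (\<lambda>_. x))"

lemma \<omega>_add: "a \<in> adeles \<Longrightarrow> b \<in> adeles \<Longrightarrow> \<omega> (a + b) = \<omega> a + \<omega> b"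
  unfolding \<omega>_def
  by (simp add: distrib_right residue_pairing_add_left adeles_mult const_adeles sum.distrib)

lemma \<omega>_scale: assumes "a \<in> adeles" shows "\<omega> (\<lambda>Q. \<iota> c * a Q) = c * \<omega> a"
proof -
  have "(\<lambda>Q. \<iota> c * a Q) * (\<lambda>_. g x) = (\<lambda>Q. \<iota> c * (a * (\<lambda>_. g x)) Q)" for x
    by (simp add: fun_eq_iff mult.assoc)
  then show ?thesis unfolding \<omega>_def
    by (simp add: residue_pairing_scale_left adeles_mult[OF assms const_adeles] const_adeles sum_distrib_left
        del: times_fun_apply)
qed

lemma \<omega>_0: "\<omega> 0 = 0"
proof -
  have "\<omega> (0 + 0) = \<omega> 0 + \<omega> 0" using AV.subspace_0[OF adeles_subspace] by (intro \<omega>_add)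
  then have "\<omega> 0 + 0 = \<omega> 0 + \<omega> 0" by (simp only: Groups.add_0_right)
  then show ?thesis by (simp only: add_left_cancel)
qed

lemma \<omega>_sum: "(\<And>i. i \<in> I \<Longrightarrow> f i \<in> adeles) \<Longrightarrow> \<omega> (sum f I) = (\<Sum>i\<in>I. \<omega> (f i))"
proof (induction I rule: infinite_finite_induct)
  case (insert x F)
  have e: "\<omega> (f x + sum f F) = \<omega> (f x) + \<omega> (sum f F)"
    using insert.prems by (intro \<omega>_add AV.subspace_sum[OF adeles_subspace]) auto
  have ih: "\<omega> (sum f F) = (\<Sum>i\<in>F. \<omega> (f i))" using insert by auto
  show ?case unfolding sum.insert[OF insert.hyps(1,2)] by (simp only: e ih)
qed (simp_all add: \<omega>_0)

lemma \<omega>_const: "\<omega> (\<lambda>_. f) = 0"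
proof -
  have "(\<lambda>_. f) * (\<lambda>_. g x) = ((\<lambda>_. f * g x) :: 'f set \<Rightarrow> 'f)" for x by (simp add: times_fun_def)
  then show ?thesis unfolding \<omega>_def by (simp only: residue_pairing_principal sum.neutral_const)
qed

text \<open>For fixed \<open>a\<close> the residue of \<open>a f dy\<close> is a Leibniz pairing in \<open>f\<close> and \<open>y\<close>, so \<open>\<omega>\<close> may be computed from
  the expression \<open>h dt\<close> for \<open>\<eta>\<close>.\<close>

lemma coefficient:
  assumes P: "place \<iota> P" and t: "uniformizer P t"
  obtains h where "h \<noteq> 0" "\<eta> = scale_diff h (kaehler_d \<iota> t)"
    "\<And>a. a \<in> adeles \<Longrightarrow> \<omega> a = residue_pairing (a * (\<lambda>_. h)) (\<lambda>_. t)"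
proof -
  obtain h where h: "\<eta> = scale_diff h (kaehler_d \<iota> t)"
    "\<And>B :: 'f \<Rightarrow> 'f \<Rightarrow> 'k. leibniz_pairing B \<Longrightarrow> (\<Sum>x\<in>X. B (g x) x) = B h t"
    unfolding \<eta>_def using differential_eq_scale[OF P t, where X = X and g = g] by blast
  have "h \<noteq> 0"
  proof
    assume "h = 0"
    then have "\<eta> = 0" using h(1) by (simp add: scale_diff_def fun_eq_iff)
    then show False using nonzero by (simp add: \<eta>_def)
  qed
  moreover have "\<omega> a = residue_pairing (a * (\<lambda>_. h)) (\<lambda>_. t)" if a: "a \<in> adeles" for a
  proof -
    have ac: "a * (\<lambda>_. f) \<in> adeles" for f by (rule adeles_mult[OF a const_adeles])
    have "leibniz_pairing (\<lambda>f y. residue_pairing (a * (\<lambda>_. f)) (\<lambda>_. y))"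
      unfolding leibniz_pairing_def
    proof (intro conjI allI)
      fix f f' y y' :: 'f
      have "a * (\<lambda>_. f + f') = a * (\<lambda>_. f) + a * (\<lambda>_. f')" by (simp add: fun_eq_iff algebra_simps)
      then show "residue_pairing (a * (\<lambda>_. f + f')) (\<lambda>_. y)
          = residue_pairing (a * (\<lambda>_. f)) (\<lambda>_. y) + residue_pairing (a * (\<lambda>_. f')) (\<lambda>_. y)"
        using residue_pairing_add_left[OF ac ac const_adeles] by metis
      have "(\<lambda>_. y + y') = (\<lambda>_. y) + (\<lambda>_. y') " by (simp add: fun_eq_iff)
      then show "residue_pairing (a * (\<lambda>_. f)) (\<lambda>_. y + y')
          = residue_pairing (a * (\<lambda>_. f)) (\<lambda>_. y) + residue_pairing (a * (\<lambda>_. f)) (\<lambda>_. y')"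
        using residue_pairing_add_right[OF ac const_adeles const_adeles] by metis
      have "(\<lambda>_. y * y') = (\<lambda>_. y) * (\<lambda>_. y')" "a * (\<lambda>_. f * y) = a * (\<lambda>_. f) * (\<lambda>_. y)"
        "a * (\<lambda>_. f * y') = a * (\<lambda>_. f) * (\<lambda>_. y')"
        by (simp_all add: fun_eq_iff mult.assoc)
      then show "residue_pairing (a * (\<lambda>_. f)) (\<lambda>_. y * y')
          = residue_pairing (a * (\<lambda>_. f * y)) (\<lambda>_. y') + residue_pairing (a * (\<lambda>_. f * y')) (\<lambda>_. y)"
        using residue_pairing_leibniz[OF ac const_adeles const_adeles] by metis
    qed
    from h(2)[OF this] show ?thesis by (simp add: \<omega>_def)
  qed
  ultimately show ?thesis using that h(1) by blast
qed

lemma \<omega>_at_place_regular: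
  assumes P: "place \<iota> P" and t: "uniformizer P t"
    and h: "\<And>a. a \<in> adeles \<Longrightarrow> \<omega> a = residue_pairing (a * (\<lambda>_. h)) (\<lambda>_. t)" and w: "w * h \<in> P"
  shows "\<omega> (at_place P w) = 0"
  using uniformizer_max_ideal[OF P t] max_ideal_subset w
  by (auto simp: h[OF at_place_adeles] at_place_mult_const intro!: residue_pairing_regular[OF P])

lemma \<omega>_at_place_nonzero:
  assumes P: "place \<iota> P" and t: "uniformizer P t" and h0: "h \<noteq> 0"
    and h: "\<And>a. a \<in> adeles \<Longrightarrow> \<omega> a = residue_pairing (a * (\<lambda>_. h)) (\<lambda>_. t)"
  shows "\<exists>w. w \<noteq> 0 \<and> place_val P w = - place_val P h - 1 \<and> \<omega> (at_place P w) \<noteq> 0"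
proof -
  interpret local_parameter \<iota> P t by unfold_locales (rule P, rule t)
  obtain u where u: "u \<in> P" "residue_pairing (at_place P (u / t)) (\<lambda>_. t) \<noteq> 0" using residue_nonzero by blast
  have um: "u \<notin> max_ideal P"
  proof
    assume "u \<in> max_ideal P"
    then have "u / t \<in> P" using t t_nonzero unfolding uniformizer_def by auto
    then show False using u(2) residue_pairing_regular[OF P _ t_place] by blast
  qed
  then have pu: "place_unit P u" using u by (simp add: place_unit_def)
  then have u0: "u \<noteq> 0" using place_unit_iff[OF P] by blast
  define w where "w = u / (t * h)"
  have "w * h = u / t" using h0 by (simp add: w_def)
  then have "\<omega> (at_place P w) \<noteq> 0" using u(2) by (simp add: h[OF at_place_adeles] at_place_mult_const)
  moreover have "w \<noteq> 0" using u0 t_nonzero h0 by (simp add: w_def)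
  moreover have "place_val P w = - place_val P h - 1"
    using u0 t_nonzero h0 val_unit[OF P pu] val_uniformizer[OF P t] by (simp add: w_def val_divide val_mult P)
  ultimately show ?thesis by blast
qed

text \<open>The order of \<open>\<eta>\<close> is read off from \<open>\<omega>\<close>, hence does not depend on the uniformizer.\<close>

lemma val_diff_eq:
  assumes P: "place \<iota> P" and t: "uniformizer P t" and e: "\<eta> = scale_diff h (kaehler_d \<iota> t)"
  shows "val_diff \<iota> P \<eta> = place_val P h"
    and "\<And>a. a \<in> adeles \<Longrightarrow> \<omega> a = residue_pairing (a * (\<lambda>_. h)) (\<lambda>_. t)" and "h \<noteq> 0"
proof -
  have coeff: "h \<noteq> 0 \<and> (\<forall>a\<in>adeles. \<omega> a = residue_pairing (a * (\<lambda>_. h)) (\<lambda>_. t))"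
    if t: "uniformizer P t" and e: "\<eta> = scale_diff h (kaehler_d \<iota> t)" for t h
  proof -
    obtain h' where h': "h' \<noteq> 0" "\<eta> = scale_diff h' (kaehler_d \<iota> t)"
      "\<And>a. a \<in> adeles \<Longrightarrow> \<omega> a = residue_pairing (a * (\<lambda>_. h')) (\<lambda>_. t)"
      using coefficient[OF P t] by blast
    have "h = h'"
    proof (rule scale_diff_unique)
      show "scale_diff h (kaehler_d \<iota> t) = scale_diff h' (kaehler_d \<iota> t)" using e h'(2) by simp
      show "scale_diff h (kaehler_d \<iota> t) \<noteq> 0" using nonzero e by (simp add: \<eta>_def)
    qed
    then show ?thesis using h' by simp
  qed
  have le: "place_val P h' \<le> place_val P h"
    if th: "uniformizer P t" "\<eta> = scale_diff h (kaehler_d \<iota> t)"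
      "uniformizer P t'" "\<eta> = scale_diff h' (kaehler_d \<iota> t')"
    for t h t' h'
  proof (rule ccontr)
    assume n: "\<not> place_val P h' \<le> place_val P h"
    have c: "h \<noteq> 0" "\<And>a. a \<in> adeles \<Longrightarrow> \<omega> a = residue_pairing (a * (\<lambda>_. h)) (\<lambda>_. t)"
      and c': "h' \<noteq> 0" "\<And>a. a \<in> adeles \<Longrightarrow> \<omega> a = residue_pairing (a * (\<lambda>_. h')) (\<lambda>_. t')"
      using coeff[OF th(1,2)] coeff[OF th(3,4)] by auto
    obtain w where w: "w \<noteq> 0" "place_val P w = - place_val P h - 1" "\<omega> (at_place P w) \<noteq> 0"
      using \<omega>_at_place_nonzero[OF P th(1) c] by blast
    have "w * h' \<in> P" using w n c' by (simp add: place_iff_val[OF P] val_mult[OF P])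
    then show False using \<omega>_at_place_regular[OF P th(3) c'(2)] w(3) by blast
  qed
  show "val_diff \<iota> P \<eta> = place_val P h" unfolding val_diff_def
  proof (rule the_equality)
    show "\<exists>t h'. uniformizer P t \<and> \<eta> = scale_diff h' (kaehler_d \<iota> t) \<and> place_val P h = place_val P h'"
      using t e by blast
    fix n assume "\<exists>t h. uniformizer P t \<and> \<eta> = scale_diff h (kaehler_d \<iota> t) \<and> n = place_val P h"
    then obtain t' h' where "uniformizer P t'" "\<eta> = scale_diff h' (kaehler_d \<iota> t')" "n = place_val P h'" by blast
    then show "n = place_val P h" using le[OF t e] le[OF _ _ t e] by (intro antisym) auto
  qed
  show "h \<noteq> 0" "\<And>a. a \<in> adeles \<Longrightarrow> \<omega> a = residue_pairing (a * (\<lambda>_. h)) (\<lambda>_. t)"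
    using coeff[OF t e] by auto
qed

abbreviation K :: "'f set \<Rightarrow> int" where "K \<equiv> div_diff \<iota> \<eta>"

lemma \<omega>_local_zero: assumes P: "place \<iota> P" and w: "w \<in> ordset P (- K P)" shows "\<omega> (at_place P w) = 0"
proof -
  obtain t where t: "uniformizer P t" using uniformizer_exists[OF P] by blast
  obtain h where h: "\<eta> = scale_diff h (kaehler_d \<iota> t)" using coefficient[OF P t] by blast
  note v = val_diff_eq[OF P t h]
  have "h * w \<in> ordset P 0" using w P v(1,3) ordset_mult_iff[OF P v(3), of w 0] by (simp add: div_diff_def)
  then show ?thesis using \<omega>_at_place_regular[OF P t v(2)] ordset_0[OF P] by (simp add: mult.commute)
qed

lemma \<omega>_local_nonzero:
  assumes P: "place \<iota> P"
  obtains w where "w \<noteq> 0" "place_val P w = - K P - 1" "\<omega> (at_place P w) \<noteq> 0"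
proof -
  obtain t where t: "uniformizer P t" using uniformizer_exists[OF P] by blast
  obtain h where h: "\<eta> = scale_diff h (kaehler_d \<iota> t)" using coefficient[OF P t] by blast
  note v = val_diff_eq[OF P t h]
  show ?thesis using \<omega>_at_place_nonzero[OF P t v(3,2)] v(1) P that by (auto simp: div_diff_def)
qed

lemma \<omega>_nontrivial: obtains a where "a \<in> adeles" "\<omega> a \<noteq> 0"
proof -
  obtain P where P: "place \<iota> P" using place_exists by blast
  show ?thesis using \<omega>_local_nonzero[OF P] that at_place_adeles by metis
qed

text \<open>Where all \<open>x\<close> and \<open>g x\<close> are regular, the residue of \<open>a \<eta>\<close> vanishes for regular \<open>a\<close>.\<close>

lemma \<omega>_integral_away:
  obtains S where "finite S" "\<And>Q. Q \<in> S \<Longrightarrow> place \<iota> Q"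
    "\<And>a. a \<in> integral_adeles \<Longrightarrow> (\<And>Q. Q \<in> S \<Longrightarrow> a Q = 0) \<Longrightarrow> \<omega> a = 0"
proof -
  define N where "N = (\<lambda>y. {Q. place \<iota> Q \<and> y \<notin> Q})"
  have finN: "finite (N y)" for y
  proof (cases "y = 0")
    case True
    then have "N y = {}" using place_0 by (auto simp: N_def)
    then show ?thesis by simp
  next
    case False
    then have "N y \<subseteq> {Q. place \<iota> Q \<and> place_val Q y \<noteq> 0}" by (auto simp: N_def place_iff_val)
    then show ?thesis by (rule finite_subset[OF _ finite_support[OF False]])
  qed
  define S where "S = (\<Union>x\<in>X. N x \<union> N (g x))"
  have S: "finite S" "\<And>Q. Q \<in> S \<Longrightarrow> place \<iota> Q" using finite_X finN by (auto simp: S_def N_def)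
  have reg: "x \<in> Q" "g x \<in> Q" if "x \<in> X" "place \<iota> Q" "Q \<notin> S" for x Q
    using that by (auto simp: S_def N_def)
  have "\<omega> a = 0" if a: "a \<in> integral_adeles" "\<And>Q. Q \<in> S \<Longrightarrow> a Q = 0" for a
    unfolding \<omega>_def
  proof (rule sum.neutral, rule ballI)
    fix x assume x: "x \<in> X"
    define b where "b = a * (\<lambda>_. g x)"
    have bi: "b \<in> integral_adeles" unfolding adele_box_def
    proof (intro CollectI allI impI)
      fix Q assume Q: "place \<iota> Q"
      have "a Q \<in> Q" using a(1) Q by (auto simp: adele_box_def ordset_0)
      then have "b Q \<in> Q" using a(2)[of Q] reg(2)[OF x Q] place_mult[OF Q] place_0[OF Q]
        by (cases "Q \<in> S") (auto simp: b_def)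
      then show "b Q \<in> ordset Q (- 0 Q)" by (simp add: ordset_0[OF Q])
    qed
    then have bA: "b \<in> adeles" using adele_box_subset[OF divisor_zero] by blast
    have br: "b = restrict_to (- S) b" using a(2) by (auto simp: restrict_to_def b_def fun_eq_iff)
    have "restrict_to (- S) (\<lambda>_. x) \<in> integral_adeles"
      using reg(1)[OF x] place_0 by (auto simp: adele_box_def restrict_to_def ordset_0)
    then have "residue_pairing b (restrict_to (- S) (\<lambda>_. x)) = 0" by (rule residue_pairing_integral[OF bi])
    moreover have "residue_pairing b (\<lambda>_. x) = residue_pairing b (restrict_to (- S) (\<lambda>_. x))"
      using residue_pairing_local[OF bA const_adeles, of "- S" x] br by simp
    ultimately show "residue_pairing (a * (\<lambda>_. g x)) (\<lambda>_. x) = 0" by (simp add: b_def)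
  qed
  then show ?thesis using that S by blast
qed

text \<open>Only finitely many places are not covered by \<open>\<omega>_integral_away\<close>, and there the order of \<open>\<eta>\<close> decides.\<close>

lemma \<omega>_box:
  assumes D: "divisor D" and le: "\<And>Q. place \<iota> Q \<Longrightarrow> D Q \<le> K Q" and a: "a \<in> adele_box D"
  shows "\<omega> a = 0"
proof -
  obtain S where S: "finite S" "\<And>Q. Q \<in> S \<Longrightarrow> place \<iota> Q"
    "\<And>a. a \<in> integral_adeles \<Longrightarrow> (\<And>Q. Q \<in> S \<Longrightarrow> a Q = 0) \<Longrightarrow> \<omega> a = 0"
    using \<omega>_integral_away by blast
  define S' where "S' = S \<union> div_supp D"
  have S': "finite S'" "\<And>Q. Q \<in> S' \<Longrightarrow> place \<iota> Q"
    using S(1,2) divisor_finite[OF D] divisor_place[OF D] by (auto simp: S'_def)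
  have aA: "a \<in> adeles" using a adele_box_subset[OF D] by blast
  have "\<omega> (at_place Q (a Q)) = 0" if "Q \<in> S'" for Q
  proof (rule \<omega>_local_zero[OF S'(2)[OF that]])
    have "- K Q \<le> - D Q" using le S'(2)[OF that] by simp
    moreover have "a Q \<in> ordset Q (- D Q)" using a S'(2)[OF that] by (simp add: adele_box_def)
    ultimately show "a Q \<in> ordset Q (- K Q)" by (rule subsetD[OF ordset_antimono])
  qed
  moreover have "\<omega> (restrict_to (- S') a) = 0"
  proof (rule S(3))
    show "restrict_to (- S') a \<in> integral_adeles"
      unfolding adele_box_def
    proof (intro CollectI allI impI)
      fix Q assume Q: "place \<iota> Q"
      have "a Q \<in> ordset Q (- D Q)" using a Q by (simp add: adele_box_def)
      then show "restrict_to (- S') a Q \<in> ordset Q (- 0 Q)"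
        by (cases "Q \<in> S'") (auto simp: restrict_to_def S'_def div_supp_def)
    qed
  qed (simp add: restrict_to_def S'_def)
  moreover have "\<omega> a = \<omega> (\<Sum>Q\<in>S'. at_place Q (a Q)) + \<omega> (restrict_to (- S') a)"
    by (subst adeles_decompose[OF S'(1), of a])
      (intro \<omega>_add restrict_to_adeles aA AV.subspace_sum[OF adeles_subspace] at_place_adeles)
  ultimately show ?thesis by (simp add: \<omega>_sum at_place_adeles)
qed

text \<open>If \<open>\<eta>\<close> had infinitely many zeros, \<open>\<omega>\<close> would vanish on boxes of arbitrarily large degree. As these and the
  functions exhaust the adeles, \<open>\<omega>\<close> would be zero.\<close>

lemma divisor_K: "divisor K"
proof -
  obtain S where S: "finite S" "\<And>Q. Q \<in> S \<Longrightarrow> place \<iota> Q"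
    and away: "\<And>a. a \<in> integral_adeles \<Longrightarrow> (\<And>Q. Q \<in> S \<Longrightarrow> a Q = 0) \<Longrightarrow> \<omega> a = 0"
    using \<omega>_integral_away by blast
  have nonneg: "0 \<le> K Q" if Q: "place \<iota> Q" "Q \<notin> S" for Q
  proof (rule ccontr)
    assume n: "\<not> 0 \<le> K Q"
    obtain w where w: "w \<noteq> 0" "place_val Q w = - K Q - 1" "\<omega> (at_place Q w) \<noteq> 0"
      using \<omega>_local_nonzero[OF Q(1)] .
    have "w \<in> Q" using w n place_iff_val[OF Q(1)] by simp
    then have "at_place Q w \<in> integral_adeles" by (rule at_place_integral[OF Q(1)])
    moreover have "at_place Q w R = 0" if "R \<in> S" for R using that Q(2) by (auto simp: at_place_def)
    ultimately show False using away w(3) by blast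
  qed
  define T0 where "T0 = {Q. place \<iota> Q \<and> Q \<notin> S \<and> 0 < K Q}"
  have "finite T0"
  proof (rule ccontr)
    assume inf: "infinite T0"
    obtain c where c: "\<And>D. divisor D \<Longrightarrow> c \<le> deg D \<Longrightarrow> adeles = sumset (adele_box D) principal"
      using adeles_eq_large_degree by blast
    define D1 where "D1 = (\<lambda>Q. if Q \<in> S then K Q else 0)"
    obtain U where U: "finite U" "card U = nat (c - deg D1)" "U \<subseteq> T0"
      using infinite_arbitrarily_large[OF inf] by metis
    define D2 where "D2 = (\<lambda>Q. if Q \<in> U then 1 else (0::int))"
    have D1: "divisor D1" by (rule divisorI[OF S]) (auto simp: D1_def)
    have Up: "place \<iota> Q" "Q \<notin> S" "0 < K Q" if "Q \<in> U" for Q using U(3) that by (auto simp: T0_def)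
    have D2: "divisor D2" by (rule divisorI[OF U(1) Up(1)]) (auto simp: D2_def)
    have "int (card U) = (\<Sum>Q\<in>U. 1)" by simp
    also have "\<dots> \<le> (\<Sum>Q\<in>U. D2 Q * int (place_degree \<iota> Q))"
    proof (rule sum_mono)
      fix Q assume "Q \<in> U"
      then show "1 \<le> D2 Q * int (place_degree \<iota> Q)" using place_degree_pos[OF Up(1)] by (simp add: D2_def Suc_le_eq)
    qed
    also have "\<dots> = deg D2" by (rule deg_eq_sum[OF U(1), symmetric]) (simp add: D2_def)
    finally have "int (card U) \<le> deg D2" .
    moreover have "c - deg D1 \<le> int (card U)" using U(2) by simp
    ultimately have "c \<le> deg (D1 + D2)" unfolding deg_add[OF D1 D2] by linarith
    then have A: "adeles = sumset (adele_box (D1 + D2)) principal" by (rule c[OF divisor_add[OF D1 D2]])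
    have le: "(D1 + D2) Q \<le> K Q" if "place \<iota> Q" for Q
      using nonneg[OF that] Up[of Q] by (cases "Q \<in> S"; cases "Q \<in> U") (auto simp: D1_def D2_def)
    obtain a where a: "a \<in> adeles" "\<omega> a \<noteq> 0" using \<omega>_nontrivial .
    then obtain b f where bf: "b \<in> adele_box (D1 + D2)" "a = b + (\<lambda>_. f)"
      unfolding A sumset_def principal_def by blast
    have "b \<in> adeles" using bf(1) adele_box_subset[OF divisor_add[OF D1 D2]] by blast
    then have "\<omega> a = \<omega> b" using bf(2) by (simp add: \<omega>_add const_adeles \<omega>_const)
    then show False using \<omega>_box[OF divisor_add[OF D1 D2] le bf(1)] a(2) by simp
  qed
  then show ?thesis
  proof (intro divisorI[of "S \<union> T0"])
    fix Q assume "Q \<notin> S \<union> T0"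
    then show "K Q = 0" using nonneg[of Q] by (cases "place \<iota> Q") (auto simp: T0_def div_diff_def)
  qed (use S in \<open>auto simp: T0_def\<close>)
qed

lemma \<omega>_box_K: "a \<in> adele_box K \<Longrightarrow> \<omega> a = 0"
  by (rule \<omega>_box[OF divisor_K]) auto

lemma \<omega>_const_mult_zero:
  assumes D: "divisor D" and f: "f \<in> L (K - D)" and a: "a \<in> sumset (adele_box D) principal"
  shows "\<omega> ((\<lambda>_. f) * a) = 0"
proof -
  obtain b y where b: "b \<in> adele_box D" "a = b + (\<lambda>_. y)" using a unfolding sumset_def principal_def by blast
  have "(\<lambda>_. f) \<in> adele_box (K - D)" using f const_in_adele_box[OF divisor_diff[OF divisor_K D]] by blast
  then have "(\<lambda>_. f) * b \<in> adele_box K" using adele_box_mult[OF _ b(1)] by fastforce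
  moreover have "(\<lambda>_. f) * b \<in> adeles" using b(1) adele_box_subset[OF D] const_mult_adeles by blast
  moreover have "(\<lambda>_. f) * a = (\<lambda>_. f) * b + (\<lambda>_. f * y)" by (simp add: b(2) fun_eq_iff distrib_left)
  ultimately show ?thesis by (simp add: \<omega>_add const_adeles \<omega>_const \<omega>_box_K)
qed

lemma \<omega>_mult_faithful:
  assumes "\<And>a. a \<in> adeles \<Longrightarrow> \<omega> ((\<lambda>_. f) * a) = 0" shows "f = 0"
proof (rule ccontr)
  assume f: "f \<noteq> 0"
  obtain a where a: "a \<in> adeles" "\<omega> a \<noteq> 0" using \<omega>_nontrivial .
  have "(\<lambda>_. f) * ((\<lambda>_. inverse f) * a) = a" using f by (simp add: fun_eq_iff)
  then show False using assms[OF const_mult_adeles[OF a(1)], of "inverse f"] a(2) by simp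
qed

lemma zero_on_cobasis:
  assumes D: "divisor D" and Z: "AV.cobasis adeles (sumset (adele_box D) principal) Z"
    and \<phi>: "\<And>a b. a \<in> adeles \<Longrightarrow> b \<in> adeles \<Longrightarrow> \<phi> (a + b) = \<phi> a + (\<phi> b :: 'k)"
      "\<And>c a. a \<in> adeles \<Longrightarrow> \<phi> (\<lambda>Q. \<iota> c * a Q) = c * \<phi> a"
    and 0: "\<And>a. a \<in> sumset (adele_box D) principal \<Longrightarrow> \<phi> a = 0" "\<And>z. z \<in> Z \<Longrightarrow> \<phi> z = 0"
    and a: "a \<in> adeles"
  shows "\<phi> a = 0"
proof -
  obtain c where c: "a - (\<Sum>z\<in>Z. (\<lambda>Q. \<iota> (c z) * z Q)) \<in> sumset (adele_box D) principal"
    using AV.cobasis_spans[OF Z a] by blast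
  let ?s = "\<Sum>z\<in>Z. (\<lambda>Q. \<iota> (c z) * z Q)"
  have zA: "z \<in> adeles" if "z \<in> Z" for z using AV.cobasis_subset[OF Z] that by blast
  have \<phi>0: "\<phi> 0 = 0" using 0(1) AV.subspace_0[OF sumset_adele_box_subspace] by blast
  have s: "(\<Sum>z\<in>Y. (\<lambda>Q. \<iota> (c z) * z Q)) \<in> adeles \<and> \<phi> (\<Sum>z\<in>Y. (\<lambda>Q. \<iota> (c z) * z Q)) = 0" if "Y \<subseteq> Z" for Y
    using that
  proof (induction Y rule: infinite_finite_induct)
    case (insert z Y)
    have h1: "(\<lambda>Q. \<iota> (c z) * z Q) \<in> adeles" using zA insert.prems AV.subspace_scale[OF adeles_subspace] by blast
    have h2: "(\<Sum>z\<in>Y. (\<lambda>Q. \<iota> (c z) * z Q)) \<in> adeles" "\<phi> (\<Sum>z\<in>Y. (\<lambda>Q. \<iota> (c z) * z Q)) = 0"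
      using insert by auto
    have h3: "\<phi> (\<lambda>Q. \<iota> (c z) * z Q) = 0" using \<phi>(2)[OF zA, of z] 0(2)[of z] insert.prems by simp
    show ?case
      unfolding sum.insert[OF insert.hyps(1,2)]
      using AV.subspace_add[OF adeles_subspace h1 h2(1)] \<phi>(1)[OF h1 h2(1)] unfolding h2(2) h3 Groups.add_0_right
      by (rule conjI)
  qed (simp_all add: \<phi>0 AV.subspace_0[OF adeles_subspace])
  have "a - ?s \<in> adeles" using c sumset_subset_adeles[OF D] by blast
  then have "\<phi> ((a - ?s) + ?s) = \<phi> (a - ?s) + \<phi> ?s" using s[of Z] by (intro \<phi>(1)) auto
  then show ?thesis using 0(1)[OF c] s[of Z] by simp
qed

lemma cobasis_adeles:
  assumes D: "divisor D"
  obtains Z where "AV.cobasis adeles (sumset (adele_box D) principal) Z" "card Z = speciality D" "finite Z"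
proof -
  note sW = sumset_adele_box_subspace[of D]
  have "0 < idx adeles (sumset (adele_box D) principal)" using idx_adeles[OF D] by simp
  then obtain Z where Z: "AV.cobasis adeles (sumset (adele_box D) principal) Z"
    using AV.cobasis_exists[OF sW adeles_subspace sumset_subset_adeles[OF D]] by blast
  have "card Z = speciality D"
    using AV.cobasis_card[OF sW adeles_subspace Z] idx_adeles[OF D] FV.power_card_inject by simp
  then show ?thesis using that Z AV.cobasis_finite[OF Z] by blast
qed

lemma ell_neg: assumes "divisor D" "deg D < 0" shows "ell \<iota> D = 0"
  using ell_pos_iff[OF assms(1)] deg_neg_L[OF assms] by simp

text \<open>
  Weil differentials form a line over the function field: for a large divisor \<open>B\<close> the multiples \<open>f\<^sub>1 \<omega>\<close> with
  \<open>f\<^sub>1 \<in> L (K + B)\<close> and \<open>f\<^sub>2 l\<close> with \<open>f\<^sub>2 \<in> L (D + B)\<close> vanish on \<open>adele_box (- B)\<close> and on functions,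
  and there are more pairs \<open>(f\<^sub>1, f\<^sub>2)\<close> than functionals with this property. So some nontrivial pair has
  \<open>f\<^sub>1 \<omega> + f\<^sub>2 l = 0\<close>.
\<close>

lemma weil_differential_multiple:
  assumes D: "divisor D" and l: "AO.functional l" "\<And>a. a \<in> sumset (adele_box D) principal \<Longrightarrow> l a = 0"
  obtains f where "\<And>a. a \<in> adeles \<Longrightarrow> l a = \<omega> ((\<lambda>_. f) * a)"
proof -
  \<comment> \<open>With this degree \<open>ell (K + B) + ell (D + B)\<close>, at least \<open>deg K + deg D + 2 deg B + 2 - 2 g\<close>,
    exceeds the speciality \<open>deg B + g - 1\<close> of \<open>- B\<close>.\<close>
  obtain B where B: "divisor B" "0 \<le> B" "\<bar>3 * genus \<iota> - deg K - deg D\<bar> + 1 \<le> deg B"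
    using larger_divisor[OF divisor_zero] by metis
  define W where "W = sumset (adele_box (0 - B)) principal"
  have mB: "divisor (0 - B)" by (rule divisor_diff[OF divisor_zero B(1)])
  have degmB: "deg (0 - B) = - deg B" by (simp add: deg_diff divisor_zero B deg_zero del: diff_0)
  obtain Z where Z: "AV.cobasis adeles W Z" "card Z = speciality (0 - B)" "finite Z"
    using cobasis_adeles[OF mB] unfolding W_def by blast
  have KB: "divisor (K + B)" and DB: "divisor (D + B)" using divisor_add divisor_K D B by auto
  define \<phi> where "\<phi> = (\<lambda>f1 f2 a. \<omega> ((\<lambda>_. f1) * a) + l ((\<lambda>_. f2) * a))"
  have mulW: "(\<lambda>_. f) * a \<in> sumset (adele_box E) principal" if aW: "a \<in> W" and fE: "f \<in> L (E + B)" and E: "divisor E" for f a E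
  proof -
    obtain b y where b: "b \<in> adele_box (0 - B)" "a = b + (\<lambda>_. y)"
      using aW unfolding W_def sumset_def principal_def by blast
    have "(\<lambda>_. f) \<in> adele_box (E + B)" using fE const_in_adele_box[OF divisor_add[OF E B(1)]] by blast
    from adele_box_mult[OF this b(1)] have "(\<lambda>_. f) * b \<in> adele_box E" by (simp del: diff_0)
    moreover have "(\<lambda>_. f) * a = (\<lambda>_. f) * b + (\<lambda>_. f * y)" by (simp add: b(2) fun_eq_iff distrib_left)
    moreover have "(\<lambda>_. f * y) \<in> principal" by (simp add: principal_def)
    ultimately show ?thesis unfolding sumset_def by blast
  qed
  have \<phi>W: "\<phi> f1 f2 a = 0" if "a \<in> W" "f1 \<in> L (K + B)" "f2 \<in> L (D + B)" for f1 f2 a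
  proof -
    have "\<omega> ((\<lambda>_. 1) * ((\<lambda>_. f1) * a)) = 0"
      by (rule \<omega>_const_mult_zero[OF divisor_K _ mulW[OF that(1,2) divisor_K]])
        (simp add: L_0, metis \<iota>_1 rangeI)
    then have "\<omega> ((\<lambda>_. f1) * a) = 0" by (simp add: times_fun_def)
    then show ?thesis using l(2)[OF mulW[OF that(1,3) D]] by (simp add: \<phi>_def)
  qed
  have \<phi>add: "\<phi> f1 f2 (a + b) = \<phi> f1 f2 a + \<phi> f1 f2 b" if "a \<in> adeles" "b \<in> adeles" for f1 f2 a b
    using that by (simp add: \<phi>_def distrib_left \<omega>_add const_mult_adeles AO.functional_add[OF l(1)])
  have \<phi>scale: "\<phi> f1 f2 (\<lambda>Q. \<iota> c * a Q) = c * \<phi> f1 f2 a" if "a \<in> adeles" for f1 f2 c a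
  proof -
    have "(\<lambda>_. f) * (\<lambda>Q. \<iota> c * a Q) = (\<lambda>Q. \<iota> c * ((\<lambda>_. f) * a) Q)" for f
      by (simp add: fun_eq_iff mult.left_commute)
    then have "\<phi> f1 f2 (\<lambda>Q. \<iota> c * a Q) = \<omega> (\<lambda>Q. \<iota> c * ((\<lambda>_. f1) * a) Q) + l (\<lambda>Q. \<iota> c * ((\<lambda>_. f2) * a) Q)"
      by (simp only: \<phi>_def)
    then show ?thesis
      unfolding \<omega>_scale[OF const_mult_adeles[OF that]] AO.functional_scale[OF l(1)]
      by (simp only: \<phi>_def distrib_left)
  qed
  have \<phi>diff: "\<phi> (f1 - h1) (f2 - h2) a = \<phi> f1 f2 a - \<phi> h1 h2 a" if a: "a \<in> adeles" for f1 f2 h1 h2 a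
  proof -
    have e: "(\<lambda>_. f) * a = (\<lambda>_. f - h) * a + (\<lambda>_. h) * a" for f h by (simp add: fun_eq_iff algebra_simps)
    have "\<omega> ((\<lambda>_. f1) * a) = \<omega> ((\<lambda>_. f1 - h1) * a) + \<omega> ((\<lambda>_. h1) * a)"
      unfolding e[of f1 h1] by (rule \<omega>_add[OF const_mult_adeles[OF a] const_mult_adeles[OF a]])
    moreover have "l ((\<lambda>_. f2) * a) = l ((\<lambda>_. f2 - h2) * a) + l ((\<lambda>_. h2) * a)"
      unfolding e[of f2 h2] by (rule AO.functional_add[OF l(1)])
    ultimately show ?thesis by (simp add: \<phi>_def)
  qed
  define F where "F = (\<lambda>(f1, f2). restrict (\<phi> f1 f2) Z)"
  have "int (speciality (0 - B)) = deg B + genus \<iota> - 1"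
    using int_speciality[OF mB] ell_neg[OF mB] B(3) degmB by linarith
  moreover have "deg K + deg B + 1 - genus \<iota> \<le> int (ell \<iota> (K + B))"
    using genus_ge[OF KB] by (simp add: deg_add divisor_K B)
  moreover have "deg D + deg B + 1 - genus \<iota> \<le> int (ell \<iota> (D + B))"
    using genus_ge[OF DB] by (simp add: deg_add D B)
  ultimately have "speciality (0 - B) < ell \<iota> (K + B) + ell \<iota> (D + B)" using B(3) by linarith
  then have "CARD('k) ^ card Z < CARD('k) ^ (ell \<iota> (K + B) + ell \<iota> (D + B))"
    unfolding Z(2) by (rule FV.power_card_less_iff[THEN iffD2])
  then have "card (PiE Z (\<lambda>_. UNIV :: 'k set)) < card (L (K + B) \<times> L (D + B))"
    using Z(3) by (simp add: card_PiE card_cartesian_product card_L[OF KB] card_L[OF DB] power_add)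
  moreover have "F ` (L (K + B) \<times> L (D + B)) \<subseteq> PiE Z (\<lambda>_. UNIV)" by (auto simp: F_def)
  moreover have "finite (PiE Z (\<lambda>_. UNIV :: 'k set))" using Z(3) by (intro finite_PiE) auto
  ultimately have "\<not> inj_on F (L (K + B) \<times> L (D + B))"
    using card_inj_on_le[of F "L (K + B) \<times> L (D + B)" "PiE Z (\<lambda>_. UNIV)"] by linarith
  then obtain f1 f2 h1 h2 where fh: "f1 \<in> L (K + B)" "f2 \<in> L (D + B)" "h1 \<in> L (K + B)" "h2 \<in> L (D + B)"
    "(f1, f2) \<noteq> (h1, h2)" "F (f1, f2) = F (h1, h2)" unfolding inj_on_def by blast
  define u1 u2 where "u1 = f1 - h1" and "u2 = f2 - h2"
  have u: "u1 \<in> L (K + B)" "u2 \<in> L (D + B)" "u1 \<noteq> 0 \<or> u2 \<noteq> 0"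
    using fh FV.subspace_diff[OF L_subspace[OF KB]] FV.subspace_diff[OF L_subspace[OF DB]] by (auto simp: u1_def u2_def)
  have zA: "z \<in> adeles" if "z \<in> Z" for z using AV.cobasis_subset[OF Z(1)] that by blast
  have "\<phi> u1 u2 z = 0" if "z \<in> Z" for z
  proof -
    have "F (f1, f2) z = F (h1, h2) z" using fh(6) by simp
    then show ?thesis unfolding u1_def u2_def \<phi>diff[OF zA[OF that]] using that by (simp add: F_def)
  qed
  then have zero: "\<phi> u1 u2 a = 0" if "a \<in> adeles" for a
    using zero_on_cobasis[where \<phi> = "\<phi> u1 u2", OF mB Z(1)[unfolded W_def] \<phi>add \<phi>scale \<phi>W[OF _ u(1,2), unfolded W_def] _ that]
    by blast
  have u2: "u2 \<noteq> 0"
  proof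
    assume z: "u2 = 0"
    have "\<omega> ((\<lambda>_. u1) * a) = 0" if "a \<in> adeles" for a
    proof -
      have "(\<lambda>_. u2) * a = 0" using z by (simp add: fun_eq_iff)
      then show ?thesis using zero[OF that] AO.functional_0[OF l(1)] by (simp add: \<phi>_def)
    qed
    then have "u1 = 0" by (rule \<omega>_mult_faithful)
    then show False using u(3) z by simp
  qed
  have "l a = \<omega> ((\<lambda>_. - u1 / u2) * a)" if a: "a \<in> adeles" for a
  proof -
    let ?b = "(\<lambda>_. inverse u2) * a"
    have bA: "?b \<in> adeles" by (rule const_mult_adeles[OF a])
    have e: "(\<lambda>_. u2) * ?b = a" using u2 by (simp add: fun_eq_iff)
    have "\<omega> ((\<lambda>_. u1) * ?b) + l a = 0" using zero[OF bA] unfolding \<phi>_def e .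
    moreover have "\<omega> ((\<lambda>_. u1) * ?b) + \<omega> ((\<lambda>_. - u1 / u2) * a) = \<omega> ((\<lambda>_. u1) * ?b + (\<lambda>_. - u1 / u2) * a)"
      by (rule \<omega>_add[OF const_mult_adeles[OF bA] const_mult_adeles[OF a], symmetric])
    moreover have "(\<lambda>_. u1) * ?b + (\<lambda>_. - u1 / u2) * a = 0" by (simp add: fun_eq_iff divide_inverse)
    ultimately show ?thesis using \<omega>_0 by (metis add_left_cancel)
  qed
  then show ?thesis by (rule that)
qed

text \<open>
  A separating functional for the complement of \<open>adele_box D\<close> and the functions is a Weil
  differential, hence a multiple \<open>f \<omega>\<close>, and the conductor of \<open>\<omega>\<close> at each place forces \<open>f \<in> L (K - D)\<close>.
\<close>

theorem duality:
  assumes D: "divisor D" and a: "a \<in> adeles" and 0: "\<And>f. f \<in> L (K - D) \<Longrightarrow> \<omega> ((\<lambda>_. f) * a) = 0"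
  shows "a \<in> sumset (adele_box D) principal"
proof (rule ccontr)
  let ?W = "sumset (adele_box D) principal"
  assume n: "a \<notin> ?W"
  obtain l where l: "AO.functional l" "l a = 1" "\<And>w. w \<in> ?W \<Longrightarrow> l w = 0"
    using AO.functional_exists[OF sumset_adele_box_subspace n] by blast
  obtain f where f: "\<And>a. a \<in> adeles \<Longrightarrow> l a = \<omega> ((\<lambda>_. f) * a)"
    using weil_differential_multiple[OF D l(1,3)] by blast
  have "f \<in> L (K - D)" unfolding mem_L[OF divisor_diff[OF divisor_K D]]
  proof (intro allI impI)
    fix Q assume Q: "place \<iota> Q"
    show "f \<in> ordset Q (- (K - D) Q)"
    proof (rule ccontr)
      assume nf: "f \<notin> ordset Q (- (K - D) Q)"
      then have f0: "f \<noteq> 0" and v: "place_val Q f < D Q - K Q" by (auto simp: ordset_def)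
      obtain w where w: "w \<noteq> 0" "place_val Q w = - K Q - 1" "\<omega> (at_place Q w) \<noteq> 0"
        using \<omega>_local_nonzero[OF Q] .
      have "w / f \<in> ordset Q (- D Q)" using w f0 v by (simp add: ordset_def val_divide[OF Q])
      then have "at_place Q (w / f) \<in> adele_box D" by (rule at_place_box)
      then have "l (at_place Q (w / f)) = 0" using l(3) adele_box_subset_sumset by blast
      moreover have "(\<lambda>_. f) * at_place Q (w / f) = at_place Q w" using f0 by (simp add: at_place_def fun_eq_iff)
      ultimately show False using f[OF at_place_adeles[of Q "w / f"]] w(3) by simp
    qed
  qed
  then show False using 0 f[OF a] l(2) by simp
qed

text \<open>By \<open>duality\<close> the pairing \<open>\<omega> (f a)\<close> of \<open>L (K - D)\<close> with the adeles modulo \<open>adele_box D\<close> and the functions is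
  nondegenerate on both sides, so each of the two spaces embeds into the dual of the other.\<close>

theorem riemann_roch: assumes D: "divisor D" shows "ell \<iota> (K - D) = speciality D"
proof (rule antisym)
  let ?W = "sumset (adele_box D) principal"
  have KD: "divisor (K - D)" by (rule divisor_diff[OF divisor_K D])
  obtain Z where Z: "AV.cobasis adeles ?W Z" "card Z = speciality D" "finite Z" using cobasis_adeles[OF D] .
  have zA: "z \<in> adeles" if "z \<in> Z" for z using AV.cobasis_subset[OF Z(1)] that by blast
  have add: "\<omega> ((\<lambda>_. f) * (a + b)) = \<omega> ((\<lambda>_. f) * a) + \<omega> ((\<lambda>_. f) * b)" if "a \<in> adeles" "b \<in> adeles" for f a b
    using that by (simp add: distrib_left \<omega>_add const_mult_adeles)
  have sc: "\<omega> ((\<lambda>_. f) * (\<lambda>Q. \<iota> c * a Q)) = c * \<omega> ((\<lambda>_. f) * a)" if "a \<in> adeles" for f c a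
  proof -
    have "(\<lambda>_. f) * (\<lambda>Q. \<iota> c * a Q) = (\<lambda>Q. \<iota> c * ((\<lambda>_. f) * a) Q)" by (simp add: fun_eq_iff mult.left_commute)
    then show ?thesis using \<omega>_scale[OF const_mult_adeles[OF that]] by simp
  qed
  have addl: "\<omega> ((\<lambda>_. f + h) * a) = \<omega> ((\<lambda>_. f) * a) + \<omega> ((\<lambda>_. h) * a)" if "a \<in> adeles" for f h a
  proof -
    have "(\<lambda>_. f + h) * a = (\<lambda>_. f) * a + (\<lambda>_. h) * a" by (simp add: fun_eq_iff distrib_right)
    then show ?thesis using that by (simp add: \<omega>_add const_mult_adeles)
  qed
  have scl: "\<omega> ((\<lambda>_. \<iota> c * f) * a) = c * \<omega> ((\<lambda>_. f) * a)" if "a \<in> adeles" for f c a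
  proof -
    have "(\<lambda>_. \<iota> c * f) * a = (\<lambda>Q. \<iota> c * ((\<lambda>_. f) * a) Q)" by (simp add: fun_eq_iff mult.assoc)
    then show ?thesis using \<omega>_scale[OF const_mult_adeles[OF that]] by simp
  qed
  show "ell \<iota> (K - D) \<le> speciality D"
  proof -
    define F where "F = (\<lambda>f. restrict (\<lambda>z. \<omega> ((\<lambda>_. f) * z)) Z)"
    have "inj_on F (L (K - D))"
    proof (rule inj_onI)
      fix f h assume fh: "f \<in> L (K - D)" "h \<in> L (K - D)" "F f = F h"
      have fhL: "f - h \<in> L (K - D)" by (rule FV.subspace_diff[OF L_subspace[OF KD] fh(1,2)])
      have "\<omega> ((\<lambda>_. f - h) * z) = 0" if "z \<in> Z" for z
      proof -
        have "F f z = F h z" using fh(3) by simp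
        then have "\<omega> ((\<lambda>_. f) * z) = \<omega> ((\<lambda>_. h) * z)" using that by (simp add: F_def)
        then show ?thesis using addl[OF zA[OF that], of "f - h" h] by simp
      qed
      then have "\<omega> ((\<lambda>_. f - h) * a) = 0" if "a \<in> adeles" for a
        using zero_on_cobasis[where \<phi> = "\<lambda>a. \<omega> ((\<lambda>_. f - h) * a)", OF D Z(1) add sc \<omega>_const_mult_zero[OF D fhL] _ that]
        by blast
      then have "f - h = 0" by (rule \<omega>_mult_faithful)
      then show "f = h" by simp
    qed
    moreover have "F ` L (K - D) \<subseteq> PiE Z (\<lambda>_. UNIV)" by (auto simp: F_def)
    moreover have "finite (PiE Z (\<lambda>_. UNIV :: 'k set))" using Z(3) by (intro finite_PiE) auto
    ultimately have "card (L (K - D)) \<le> card (PiE Z (\<lambda>_. UNIV :: 'k set))" by (rule card_inj_on_le)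
    then have "CARD('k) ^ ell \<iota> (K - D) \<le> CARD('k) ^ speciality D" using Z by (simp add: card_PiE card_L[OF KD])
    then show ?thesis by (rule FV.power_card_le_iff[THEN iffD1])
  qed
  show "speciality D \<le> ell \<iota> (K - D)"
  proof -
    have t0: "FV.subspace {0}" by simp
    have cardL: "idx (L (K - D)) {0} = CARD('k) ^ ell \<iota> (K - D)" by (simp add: idx_trivial card_L[OF KD])
    then have "0 < idx (L (K - D)) {0}" by simp
    then obtain B where B: "FV.cobasis (L (K - D)) {0} B"
      using FV.cobasis_exists[OF t0 L_subspace[OF KD]] zero_in_L by auto
    have cB: "card B = ell \<iota> (K - D)"
      using FV.cobasis_card[OF t0 L_subspace[OF KD] B] cardL FV.power_card_inject by simp
    define F where "F = (\<lambda>a. restrict (\<lambda>b. \<omega> ((\<lambda>_. b) * a)) B)"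
    have "F v = F w \<longleftrightarrow> v - w \<in> ?W" if vw: "v \<in> adeles" "w \<in> adeles" for v w
    proof -
      have d: "v - w \<in> adeles" by (rule AV.subspace_diff[OF adeles_subspace vw])
      have "F v = F w \<longleftrightarrow> (\<forall>b\<in>B. \<omega> ((\<lambda>_. b) * v) = \<omega> ((\<lambda>_. b) * w))"
        by (auto simp: F_def restrict_def fun_eq_iff)
      also have "\<dots> \<longleftrightarrow> (\<forall>b\<in>B. \<omega> ((\<lambda>_. b) * (v - w)) = 0)"
      proof (rule ball_cong[OF refl])
        fix b
        have "\<omega> ((\<lambda>_. b) * v) = \<omega> ((\<lambda>_. b) * (v - w)) + \<omega> ((\<lambda>_. b) * w)"
          using add[OF d vw(2), of b] by simp
        then show "\<omega> ((\<lambda>_. b) * v) = \<omega> ((\<lambda>_. b) * w) \<longleftrightarrow> \<omega> ((\<lambda>_. b) * (v - w)) = 0" by simp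
      qed
      also have "\<dots> \<longleftrightarrow> v - w \<in> ?W"
      proof
        assume z: "\<forall>b\<in>B. \<omega> ((\<lambda>_. b) * (v - w)) = 0"
        show "v - w \<in> ?W"
        proof (rule duality[OF D d])
          fix f assume "f \<in> L (K - D)"
          from FV.cobasis_spans[OF B this] obtain c where f: "f = (\<Sum>b\<in>B. \<iota> (c b) * b)" by auto
          have "\<omega> ((\<lambda>_. \<Sum>b\<in>Y. \<iota> (c b) * b) * (v - w)) = 0" if "Y \<subseteq> B" for Y
            using that
          proof (induction Y rule: infinite_finite_induct)
            case (insert b Y)
            then have "b \<in> B" "Y \<subseteq> B" by auto
            have b: "\<omega> ((\<lambda>_. b) * (v - w)) = 0" using z \<open>b \<in> B\<close> by (rule bspec)
            have Y: "\<omega> ((\<lambda>_. \<Sum>b\<in>Y. \<iota> (c b) * b) * (v - w)) = 0" by (rule insert.IH[OF \<open>Y \<subseteq> B\<close>])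
            show ?case
              unfolding sum.insert[OF insert.hyps(1,2)] addl[OF d] scl[OF d] b Y by simp
          qed (simp_all add: times_fun_def \<omega>_0[unfolded zero_fun_def])
          then show "\<omega> ((\<lambda>_. f) * (v - w)) = 0" using f by simp
        qed
      next
        assume "v - w \<in> ?W"
        then show "\<forall>b\<in>B. \<omega> ((\<lambda>_. b) * (v - w)) = 0"
          using \<omega>_const_mult_zero[OF D] FV.cobasis_subset[OF B] by blast
      qed
      finally show ?thesis .
    qed
    then have "idx adeles ?W = card (F ` adeles)" by (intro idx_eqI sumset_adele_box_subgroup)
    also have "\<dots> \<le> card (PiE B (\<lambda>_. UNIV :: 'k set))"
      using FV.cobasis_finite[OF B] by (intro card_mono finite_PiE) (auto simp: F_def)
    also have "\<dots> = CARD('k) ^ ell \<iota> (K - D)" using FV.cobasis_finite[OF B] cB by (simp add: card_PiE)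
    finally have "CARD('k) ^ speciality D \<le> CARD('k) ^ ell \<iota> (K - D)" by (simp only: idx_adeles[OF D])
    then show ?thesis by (rule FV.power_card_le_iff[THEN iffD1])
  qed
qed

text \<open>Riemann-Roch for \<open>0\<close> and for \<open>K\<close>, where \<open>ell 0 = 1\<close>.\<close>

lemma deg_K: "deg K = 2 * genus \<iota> - 2"
proof -
  have "K - 0 = K" "K - K = 0" by auto
  then have "ell \<iota> K = speciality 0" "ell \<iota> 0 = speciality K"
    using riemann_roch[OF divisor_zero] riemann_roch[OF divisor_K] by simp_all
  then show ?thesis using int_speciality[OF divisor_zero] int_speciality[OF divisor_K] ell_0 deg_zero by linarith
qed

lemma ell_eq: assumes D: "divisor D" and d: "2 * genus \<iota> - 2 < deg D" shows "int (ell \<iota> D) = deg D + 1 - genus \<iota>"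
proof -
  have "deg (K - D) < 0" using d by (simp add: deg_diff divisor_K D deg_K)
  then have "speciality D = 0" using riemann_roch[OF D] ell_neg[OF divisor_diff[OF divisor_K D]] by simp
  then show ?thesis using int_speciality[OF D] by simp
qed

end


section \<open>Evaluation codes\<close>

context differential_form
begin

lemma \<omega>_at_rational_place:
  assumes r: "rational_place \<iota> P" and pole: "val_diff \<iota> P \<eta> = -1" and w: "w \<in> P"
  shows "\<omega> (at_place P w) = value_at \<iota> P w * \<omega> (at_place P 1)"
proof -
  have P: "place \<iota> P" using r by (simp add: rational_place_def)
  let ?c = "value_at \<iota> P w"
  have "w - \<iota> ?c \<in> ordset P (- K P)"
    using rational_place_value(1)[OF r w] ordset_1[OF P] pole P by (simp add: div_diff_def)
  then have z: "\<omega> (at_place P (w - \<iota> ?c)) = 0" by (rule \<omega>_local_zero[OF P])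
  have "at_place P w = at_place P (w - \<iota> ?c) + (\<lambda>Q. \<iota> ?c * at_place P 1 Q)"
    by (simp add: at_place_def fun_eq_iff)
  then have "\<omega> (at_place P w) = \<omega> (at_place P (w - \<iota> ?c)) + \<omega> (\<lambda>Q. \<iota> ?c * at_place P 1 Q)"
    using \<omega>_add[OF at_place_adeles AV.subspace_scale[OF adeles_subspace at_place_adeles]] by simp
  then show ?thesis by (simp add: z \<omega>_scale[OF at_place_adeles])
qed

text \<open>The residue is the value of \<open>h t\<close> at \<open>P\<close>, and in the principal part of \<open>h\<close> all coefficients beyond the first one vanish.\<close>

lemma residue_at_simple_pole:
  assumes r: "rational_place \<iota> P" and pole: "val_diff \<iota> P \<eta> = -1"
  shows "residue_at \<iota> P \<eta> = \<omega> (at_place P 1)"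
  unfolding residue_at_def
proof (rule the_equality)
  have P: "place \<iota> P" using r by (simp add: rational_place_def)
  have main: "h * t \<in> P \<and> h \<noteq> 0 \<and> t \<noteq> 0 \<and> t \<in> max_ideal P \<and> value_at \<iota> P (h * t) = \<omega> (at_place P 1)"
    if t: "uniformizer P t" and e: "\<eta> = scale_diff h (kaehler_d \<iota> t)" for t h
  proof -
    interpret local_parameter \<iota> P t by unfold_locales (rule P, rule t)
    note v = val_diff_eq[OF P t e]
    have ht: "h * t \<in> P"
      using v(1,3) pole t_nonzero by (simp add: place_iff_val[OF P] val_mult[OF P] val_uniformizer[OF P t])
    have "\<omega> (at_place P 1) = residue_pairing (at_place P (h * t / t)) (\<lambda>_. t)"
      using t_nonzero by (simp add: v(2)[OF at_place_adeles] at_place_mult_const)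
    then show ?thesis using residue_rational[OF r ht] ht v(3) t_nonzero t_max by simp
  qed
  obtain t where t: "uniformizer P t" using uniformizer_exists[OF P] by blast
  obtain h where e: "\<eta> = scale_diff h (kaehler_d \<iota> t)" using coefficient[OF P t] by blast
  note m = main[OF t e]
  have "h * t - \<iota> (value_at \<iota> P (h * t)) \<in> max_ideal P" using rational_place_value(1)[OF r] m by blast
  then obtain u where u: "u \<in> P" "h * t - \<iota> (value_at \<iota> P (h * t)) = t * u" using t unfolding uniformizer_def by auto
  have "h - (\<Sum>i=1..1. \<iota> (\<omega> (at_place P 1)) * inverse t ^ i) = u"
    using u(2) m by (simp add: field_simps)
  then show "\<exists>t h m a. uniformizer P t \<and> \<eta> = scale_diff h (kaehler_d \<iota> t) \<and> 1 \<le> m \<and>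
      h - (\<Sum>i=1..m. \<iota> (a i) * inverse t ^ i) \<in> P \<and> \<omega> (at_place P 1) = a (1::nat)"
    using t e u(1) by (intro exI[of _ t] exI[of _ h] exI[of _ "1::nat"] exI[of _ "\<lambda>_. \<omega> (at_place P 1)"]) simp
  fix c assume "\<exists>t h m a. uniformizer P t \<and> \<eta> = scale_diff h (kaehler_d \<iota> t) \<and> 1 \<le> m \<and>
      h - (\<Sum>i=1..m. \<iota> (a i) * inverse t ^ i) \<in> P \<and> c = a (1::nat)"
  then obtain t h m a where t: "uniformizer P t" "\<eta> = scale_diff h (kaehler_d \<iota> t)" and m: "1 \<le> m"
    and hP: "h - (\<Sum>i=1..m. \<iota> (a i) * inverse t ^ i) \<in> P" and c: "c = a (1::nat)" by blast
  note th = main[OF t]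
  have tP: "t \<in> P" using th max_ideal_subset by blast
  have "value_at \<iota> P (h * t) = a 1"
    using m hP
  proof (induction m rule: dec_induct)
    case base
    have "t * (h - (\<Sum>i=1..1. \<iota> (a i) * inverse t ^ i)) \<in> max_ideal P"
      using th by (intro max_ideal_mult[OF P _ base]) blast
    moreover have "t * (h - (\<Sum>i=1..1. \<iota> (a i) * inverse t ^ i)) = h * t - \<iota> (a 1)"
      using th by (simp add: field_simps)
    ultimately show ?case using rational_place_value(2)[OF r] th by auto
  next
    case (step n)
    \<comment> \<open>After multiplication by the top power of \<open>t\<close> only the leading coefficient is left modulo \<open>t\<close>.\<close>
    have x: "t ^ Suc n * (h - (\<Sum>i=1..Suc n. \<iota> (a i) * inverse t ^ i)) \<in> max_ideal P"
      using th step.prems max_ideal_mult[OF P _ place_mult[OF P place_power[OF P tP]], of t _ n] by (auto simp: mult.assoc)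
    have "t ^ Suc n * (h - (\<Sum>i=1..Suc n. \<iota> (a i) * inverse t ^ i))
        = t ^ n * (h * t) - (\<Sum>i=1..n. t ^ Suc n * (\<iota> (a i) * inverse t ^ i)) - \<iota> (a (Suc n))"
      using th by (simp add: sum_distrib_left field_simps)
    moreover have "t * (t ^ (n - 1) * (h * t)) \<in> max_ideal P"
      using th by (intro max_ideal_mult[OF P _ place_mult[OF P place_power[OF P tP]]]) auto
    then have "t ^ n * (h * t) \<in> max_ideal P" using step.hyps by (cases n) (simp_all add: mult.assoc)
    moreover have "(\<Sum>i=1..n. t ^ Suc n * (\<iota> (a i) * inverse t ^ i)) \<in> max_ideal P"
    proof (rule FV.subspace_sum[OF max_ideal_subspace[OF P]])
      fix i assume i: "i \<in> {1..n}"
      have "t ^ Suc n = t * t ^ (n - i) * t ^ i" using i by (simp flip: power_add)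
      then have "t ^ Suc n * (\<iota> (a i) * inverse t ^ i) = t * (t ^ (n - i) * \<iota> (a i))"
        using th by (simp add: power_inverse)
      also have "\<dots> \<in> max_ideal P"
        using th by (intro max_ideal_mult[OF P] place_mult[OF P] place_power[OF P] place_const[OF P] tP) auto
      finally show "t ^ Suc n * (\<iota> (a i) * inverse t ^ i) \<in> max_ideal P" .
    qed
    ultimately have "t ^ n * (h * t) - (\<Sum>i=1..n. t ^ Suc n * (\<iota> (a i) * inverse t ^ i))
        - t ^ Suc n * (h - (\<Sum>i=1..Suc n. \<iota> (a i) * inverse t ^ i)) \<in> max_ideal P"
      using x FV.subspace_diff[OF max_ideal_subspace[OF P]] by blast
    moreover have "t ^ n * (h * t) - (\<Sum>i=1..n. t ^ Suc n * (\<iota> (a i) * inverse t ^ i))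
        - t ^ Suc n * (h - (\<Sum>i=1..Suc n. \<iota> (a i) * inverse t ^ i)) = \<iota> (a (Suc n))"
      using th by (simp add: sum_distrib_left field_simps)
    ultimately have "a (Suc n) = 0" using const_in_max_ideal[OF P] by simp
    then have "(\<Sum>i=1..Suc n. \<iota> (a i) * inverse t ^ i) = (\<Sum>i=1..n. \<iota> (a i) * inverse t ^ i)" by simp
    with step.prems have "h - (\<Sum>i=1..n. \<iota> (a i) * inverse t ^ i) \<in> P" by (simp only:)
    then show ?case by (rule step.IH)
  qed
  then show "c = \<omega> (at_place P 1)" using th c by simp
qed

end

locale evaluation_setting = differential_form \<iota> X g
  for \<iota> :: "'k::{field,finite} \<Rightarrow> 'f::field" and X g +
  fixes P :: "'n::finite \<Rightarrow> 'f set" and G :: "'f set \<Rightarrow> int"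
  assumes inj_P: "inj P" and rational: "\<And>i. rational_place \<iota> (P i)"
    and simple_pole: "\<And>i. val_diff \<iota> (P i) \<eta> = -1"
    and residue_one: "\<And>i. residue_at \<iota> (P i) \<eta> = 1"
    and divisor_G: "divisor G" and G_away: "\<And>i. G (P i) = 0"
begin

abbreviation D :: "'f set \<Rightarrow> int" where "D \<equiv> sum_points P"

definition A :: "'f set \<Rightarrow> int" where "A = D - G + K"

definition ev :: "'f \<Rightarrow> 'k ^ 'n" where "ev h = (\<chi> i. value_at \<iota> (P i) h)"

lemma place_P: "place \<iota> (P i)" using rational[of i] by (simp add: rational_place_def)

lemma D_eq: "D Q = (if Q \<in> range P then 1 else 0)"
proof -
  have "D Q = (\<Sum>i\<in>UNIV. point_divisor (P i) Q)"
    unfolding sum_points_def by (rule sum_fun_apply)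
  also have "\<dots> = (\<Sum>R\<in>range P. point_divisor R Q)"
    using sum.reindex[OF inj_P, of "\<lambda>R. point_divisor R Q"] by simp
  also have "\<dots> = (\<Sum>R\<in>range P. if R = Q then 1 else 0)" by (rule sum.cong) (auto simp: point_divisor_def)
  finally show ?thesis by simp
qed

lemma divisor_D: "divisor D"
  by (rule divisorI[of "range P"]) (auto simp: D_eq place_P)

lemma deg_D: "deg D = int CARD('n)"
proof -
  have "deg D = (\<Sum>Q\<in>range P. D Q * int (place_degree \<iota> Q))" by (rule deg_eq_sum) (auto simp: D_eq)
  also have "\<dots> = (\<Sum>Q\<in>range P. 1)" using rational by (intro sum.cong) (auto simp: D_eq rational_place_def)
  finally show ?thesis using card_image[OF inj_P] by simp
qed

lemma divisor_A: "divisor A"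
  unfolding A_def by (intro divisor_add divisor_diff divisor_D divisor_G divisor_K)

lemma K_P: "K (P i) = -1" using simple_pole place_P by (simp add: div_diff_def)

lemma A_away: "A (P i) = 0" by (simp add: A_def D_eq G_away K_P)

lemma deg_A: "deg A = int CARD('n) - deg G + 2 * genus \<iota> - 2"
  unfolding A_def
  by (simp add: deg_add[OF divisor_diff[OF divisor_D divisor_G] divisor_K] deg_diff[OF divisor_D divisor_G] deg_D deg_K)

lemma deg_inf_sup: "deg (inf G A) + deg (sup G A) = int CARD('n) + 2 * genus \<iota> - 2"
proof -
  have "inf G A + sup G A = G + A" by (auto simp: fun_eq_iff inf_int_def sup_int_def min_def max_def)
  then have "deg (inf G A) + deg (sup G A) = deg G + deg A"
    using deg_add[OF divisor_inf[OF divisor_G divisor_A] divisor_sup[OF divisor_G divisor_A]]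
      deg_add[OF divisor_G divisor_A] by simp
  then show ?thesis by (simp add: deg_A)
qed

lemma regular: "divisor E \<Longrightarrow> E (P i) = 0 \<Longrightarrow> h \<in> L E \<Longrightarrow> h \<in> P i"
  using mem_L[of E h] place_P[of i] ordset_0[OF place_P[of i]] by auto

lemma evaluation_code_eq: "evaluation_code \<iota> P E = ev ` L E"
  by (simp add: evaluation_code_def ev_def)

lemma \<omega>_at_P: "w \<in> P i \<Longrightarrow> \<omega> (at_place (P i) w) = value_at \<iota> (P i) w"
  using \<omega>_at_rational_place[OF rational simple_pole] residue_at_simple_pole[OF rational simple_pole] residue_one
  by simp

lemma sum_over_P: "(\<Sum>Q\<in>range P. f Q) = (\<Sum>i\<in>UNIV. f (P i))"
  using sum.reindex[OF inj_P, of f] by simp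

text \<open>The residue theorem for \<open>f \<eta>\<close>. For \<open>f\<close> regular at the points of \<open>D\<close>, the poles of \<open>f \<eta>\<close> are simple and lie in the support of \<open>D\<close>, with
  the values of \<open>f\<close> as residues.\<close>

lemma sum_values_zero:
  assumes f: "f \<in> L (D + K)" and reg: "\<And>i. f \<in> P i" shows "(\<Sum>i\<in>UNIV. value_at \<iota> (P i) f) = 0"
proof -
  let ?f = "(\<lambda>_. f) :: 'f set \<Rightarrow> 'f" and ?S = "range P"
  have "restrict_to (- ?S) ?f \<in> adele_box K" unfolding adele_box_def
  proof (intro CollectI allI impI)
    fix Q assume Q: "place \<iota> Q"
    have "f \<in> ordset Q (- (D + K) Q)" using f Q mem_L[OF divisor_add[OF divisor_D divisor_K]] by blast
    then show "restrict_to (- ?S) ?f Q \<in> ordset Q (- K Q)" by (auto simp: restrict_to_def D_eq)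
  qed
  then have r: "\<omega> (restrict_to (- ?S) ?f) = 0" by (rule \<omega>_box_K)
  have "\<omega> ?f = \<omega> (\<Sum>Q\<in>?S. at_place Q f) + \<omega> (restrict_to (- ?S) ?f)"
    by (subst adeles_decompose[of ?S ?f])
      (auto intro!: \<omega>_add restrict_to_adeles const_adeles AV.subspace_sum[OF adeles_subspace] at_place_adeles)
  then have "(\<Sum>Q\<in>?S. \<omega> (at_place Q f)) = 0" using r by (simp add: \<omega>_const \<omega>_sum at_place_adeles)
  then show ?thesis by (simp add: sum_over_P \<omega>_at_P reg)
qed

lemma orthogonal:
  assumes f: "f \<in> L G" and h: "h \<in> L A"
  shows "(\<Sum>i\<in>UNIV. value_at \<iota> (P i) f * value_at \<iota> (P i) h) = 0"
proof -
  have rf: "f \<in> P i" and rh: "h \<in> P i" for i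
    using regular[OF divisor_G G_away f] regular[OF divisor_A A_away h] by auto
  have "G + A = D + K" by (simp add: A_def)
  then have "f * h \<in> L (D + K)" using L_mult[OF divisor_G divisor_A f h] by simp
  then have "(\<Sum>i\<in>UNIV. value_at \<iota> (P i) (f * h)) = 0"
    by (rule sum_values_zero) (intro place_mult place_P rf rh)
  then show ?thesis by (simp add: value_at_mult[OF rational rf rh])
qed

text \<open>
  A word \<open>x\<close> gives the adele with the entries of \<open>x\<close> as components at the points of \<open>D\<close>. If \<open>x\<close> is
  orthogonal to the code of \<open>G\<close>, that adele is a function up to \<open>adele_box (A - D)\<close>, and
  the function has the values \<open>x\<close> and lies in \<open>L A\<close>.
\<close>

lemma dual_evaluation_code: "dual_code (ev ` L G) = ev ` L A"
proof (intro equalityI subsetI)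
  fix x assume x: "x \<in> dual_code (ev ` L G)"
  define a where "a = (\<Sum>i\<in>UNIV. at_place (P i) (\<iota> (x $ i)))"
  have aA: "a \<in> adeles" unfolding a_def by (intro AV.subspace_sum[OF adeles_subspace] at_place_adeles)
  have aQ: "a Q = (\<Sum>i\<in>UNIV. at_place (P i) (\<iota> (x $ i)) Q)" for Q
    unfolding a_def by (rule sum_fun_apply)
  have aP: "a (P i) = \<iota> (x $ i)" for i
  proof -
    have "a (P i) = (\<Sum>j\<in>UNIV. if j = i then \<iota> (x $ i) else 0)"
      unfolding aQ by (rule sum.cong) (auto simp: at_place_def dest: injD[OF inj_P])
    then show ?thesis by simp
  qed
  have aO: "a Q = 0" if "Q \<notin> range P" for Q
    unfolding aQ using that by (intro sum.neutral) (auto simp: at_place_def)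
  have AD: "divisor (A - D)" by (rule divisor_diff[OF divisor_A divisor_D])
  have "a \<in> sumset (adele_box (A - D)) principal"
  proof (rule duality[OF AD aA])
    fix f assume "f \<in> L (K - (A - D))"
    moreover have "K - (A - D) = G" by (simp add: A_def)
    ultimately have f: "f \<in> L G" by simp
    have rf: "f \<in> P i" for i by (rule regular[OF divisor_G G_away f])
    have "(\<lambda>_. f) * a = (\<Sum>i\<in>UNIV. at_place (P i) (f * \<iota> (x $ i)))"
      unfolding a_def sum_distrib_left by (rule sum.cong) (auto simp: at_place_def fun_eq_iff)
    then have "\<omega> ((\<lambda>_. f) * a) = (\<Sum>i\<in>UNIV. \<omega> (at_place (P i) (f * \<iota> (x $ i))))"
      by (simp add: \<omega>_sum at_place_adeles)
    also have "\<dots> = (\<Sum>i\<in>UNIV. x $ i * value_at \<iota> (P i) f)"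
    proof (rule sum.cong[OF refl])
      fix i
      have c: "\<iota> (x $ i) \<in> P i" by (rule place_const[OF place_P])
      show "\<omega> (at_place (P i) (f * \<iota> (x $ i))) = x $ i * value_at \<iota> (P i) f"
        using \<omega>_at_P[OF place_mult[OF place_P rf c]]
        by (simp add: value_at_mult[OF rational rf c] value_at_const[OF rational])
    qed
    also have "\<dots> = 0" using x f unfolding dual_code_def by (auto simp: ev_def)
    finally show "\<omega> ((\<lambda>_. f) * a) = 0" .
  qed
  then obtain b y where bf: "b \<in> adele_box (A - D)" "a = b + (\<lambda>_. y)"
    unfolding sumset_def principal_def by blast
  have bQ: "a Q - y \<in> ordset Q (- (A - D) Q)" if "place \<iota> Q" for Q
    using bf that by (auto simp: adele_box_def)
  have close: "y - \<iota> (x $ i) \<in> max_ideal (P i)" for i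
    using bQ[OF place_P[of i]] ordset_1[OF place_P[of i]] FV.subspace_neg[OF max_ideal_subspace[OF place_P], of "a (P i) - y" i]
    by (simp add: aP A_away D_eq)
  have yP: "y \<in> P i" for i
    using place_add[OF place_P[of i] subsetD[OF max_ideal_subset close] place_const[OF place_P, of "x $ i"]] by simp
  have "y \<in> L A" unfolding mem_L[OF divisor_A]
  proof (intro allI impI)
    fix Q assume Q: "place \<iota> Q"
    show "y \<in> ordset Q (- A Q)"
    proof (cases "Q \<in> range P")
      case True
      then show ?thesis using yP A_away ordset_0[OF Q] by auto
    next
      case False
      then show ?thesis
        using bQ[OF Q] aO[OF False] FV.subspace_neg[OF ordset_subspace[OF Q], of "- y"] by (simp add: D_eq)
    qed
  qed
  moreover have "ev y = x"
    using rational_place_value(2)[OF rational yP close] by (simp add: ev_def vec_eq_iff)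
  ultimately show "x \<in> ev ` L A" by blast
next
  fix x assume "x \<in> ev ` L A"
  then obtain h where h: "h \<in> L A" "x = ev h" by blast
  have "(\<Sum>i\<in>UNIV. x $ i * ev f $ i) = 0" if "f \<in> L G" for f
    using orthogonal[OF that h(1)] by (simp add: h(2) ev_def mult.commute)
  then show "x \<in> dual_code (ev ` L G)" by (auto simp: dual_code_def)
qed

lemma ev_add: "(\<And>i. f \<in> P i) \<Longrightarrow> (\<And>i. h \<in> P i) \<Longrightarrow> ev (f + h) = ev f + ev h"
  by (simp add: ev_def vec_eq_iff value_at_add[OF rational])

text \<open>The difference lies in \<open>L (G \<or> A)\<close> and vanishes at all \<open>N\<close> points, which exceed the degree.\<close>

lemma ev_eq_imp_eq:
  assumes d: "deg (sup G A) < int CARD('n)" and f: "f \<in> L G" and h: "h \<in> L A" and e: "ev f = ev h"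
  shows "f = h"
proof -
  let ?E = "sup G A"
  have E: "divisor ?E" by (rule divisor_sup[OF divisor_G divisor_A])
  have ED: "divisor (?E - D)" by (rule divisor_diff[OF E divisor_D])
  have fE: "f \<in> L ?E" and hE: "h \<in> L ?E"
    using f h L_mono[OF divisor_G E] L_mono[OF divisor_A E] by auto
  have "f - h \<in> L (?E - D)" unfolding mem_L[OF ED]
  proof (intro allI impI)
    fix Q assume Q: "place \<iota> Q"
    show "f - h \<in> ordset Q (- (?E - D) Q)"
    proof (cases "Q \<in> range P")
      case True
      then obtain i where i: "Q = P i" by auto
      have "f - \<iota> (value_at \<iota> Q f) \<in> max_ideal Q" "h - \<iota> (value_at \<iota> Q h) \<in> max_ideal Q"
        unfolding i using regular[OF divisor_G G_away f] regular[OF divisor_A A_away h]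
        by (auto intro: rational_place_value(1)[OF rational])
      moreover have "value_at \<iota> Q f = value_at \<iota> Q h" using e i by (simp add: ev_def vec_eq_iff)
      ultimately have "(f - \<iota> (value_at \<iota> Q f)) - (h - \<iota> (value_at \<iota> Q f)) \<in> max_ideal Q"
        by (simp only: FV.subspace_diff[OF max_ideal_subspace[OF Q]])
      then show ?thesis using ordset_1[OF Q] i by (simp add: G_away A_away D_eq)
    next
      case False
      have "f - h \<in> L ?E" by (rule FV.subspace_diff[OF L_subspace[OF E] fE hE])
      then show ?thesis using mem_L[OF E] Q False by (simp add: D_eq)
    qed
  qed
  moreover have "L (?E - D) = {0}" using d by (intro deg_neg_L[OF ED]) (simp add: deg_diff[OF E divisor_D] deg_D)
  ultimately show ?thesis by simp
qed

lemma L_inf: "L (inf G A) = L G \<inter> L A"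
proof -
  note I = divisor_inf[OF divisor_G divisor_A]
  have "h \<in> ordset Q (- inf G A Q) \<longleftrightarrow> h \<in> ordset Q (- G Q) \<and> h \<in> ordset Q (- A Q)" for h Q
    by (auto simp: ordset_def inf_int_def)
  then show ?thesis unfolding set_eq_iff Int_iff mem_L[OF I] mem_L[OF divisor_G] mem_L[OF divisor_A] by blast
qed

text \<open>A word of the hull comes from functions in \<open>L G\<close> and in \<open>L A\<close>, and these agree.\<close>

lemma hull_eq:
  assumes "deg (sup G A) < int CARD('n)" shows "code_hull (ev ` L G) = ev ` L (inf G A)"
  unfolding code_hull_def dual_evaluation_code L_inf
proof (intro equalityI subsetI)
  fix x assume "x \<in> ev ` L G \<inter> ev ` L A"
  then obtain f h where fh: "f \<in> L G" "h \<in> L A" "x = ev f" "x = ev h" by auto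
  then have "f = h" by (intro ev_eq_imp_eq[OF assms]) auto
  then show "x \<in> ev ` (L G \<inter> L A)" using fh by blast
qed auto

lemma dim_evaluation:
  assumes "deg (sup G A) < int CARD('n)" shows "vec.dim (ev ` L (inf G A)) = ell \<iota> (inf G A)"
proof -
  interpret C: finite_scalars "(*s) :: 'k \<Rightarrow> 'k ^ 'n \<Rightarrow> 'k ^ 'n" by unfold_locales
  note I = divisor_inf[OF divisor_G divisor_A]
  have reg: "f \<in> P i" if "f \<in> L (inf G A)" for f i
    using that regular[OF divisor_G G_away] by (auto simp: L_inf)
  have "vec.subspace (ev ` L (inf G A))"
  proof (rule vec.subspaceI)
    have "ev 0 = 0" using value_at_const[OF rational, of _ 0] by (simp add: ev_def vec_eq_iff)
    then show "0 \<in> ev ` L (inf G A)" using zero_in_L by force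
  next
    fix x y assume "x \<in> ev ` L (inf G A)" "y \<in> ev ` L (inf G A)"
    then obtain f h where fh: "f \<in> L (inf G A)" "h \<in> L (inf G A)" "x = ev f" "y = ev h" by auto
    then have "x + y = ev (f + h)" using ev_add reg by simp
    then show "x + y \<in> ev ` L (inf G A)" using FV.subspace_add[OF L_subspace[OF I] fh(1,2)] by blast
  next
    fix c x assume "x \<in> ev ` L (inf G A)"
    then obtain f where f: "f \<in> L (inf G A)" "x = ev f" by auto
    have "ev (\<iota> c * f) = c *s x"
      using value_at_mult[OF rational place_const[OF place_P] reg[OF f(1)]] value_at_const[OF rational]
      by (simp add: ev_def f(2) vec_eq_iff)
    then show "c *s x \<in> ev ` L (inf G A)" using FV.subspace_scale[OF L_subspace[OF I] f(1), of c] by force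
  qed
  then have "card (ev ` L (inf G A)) = CARD('k) ^ vec.dim (ev ` L (inf G A))"
    using C.card_subspace finite_L[OF I] by blast
  moreover have "inj_on ev (L (inf G A))"
    by (rule inj_onI) (auto simp: L_inf intro: ev_eq_imp_eq[OF assms])
  then have "card (ev ` L (inf G A)) = CARD('k) ^ ell \<iota> (inf G A)" by (simp add: card_image card_L[OF I])
  ultimately show ?thesis using FV.power_card_inject by simp
qed

end

theorem corollary3p3:
  fixes \<iota> :: "'k::{field,finite} \<Rightarrow> 'f::field"
    and P :: "'n::finite \<Rightarrow> 'f set"
    and D G K A :: "'f set \<Rightarrow> int"
    and \<eta> :: "('f \<Rightarrow> 'f) \<Rightarrow> 'f"
  assumes "function_field \<iota>"
    and "inj P" and "\<And>i. rational_place \<iota> (P i)"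
    and "D = sum_points P"
    and "is_divisor \<iota> G" and "div_supp G \<inter> div_supp D = {}"
    and "\<eta> \<in> differentials \<iota>" and "\<eta> \<noteq> 0"
    and "\<And>Q. Q \<in> div_supp D \<Longrightarrow> val_diff \<iota> Q \<eta> = -1"
    and "\<And>Q. Q \<in> div_supp D \<Longrightarrow> residue_at \<iota> Q \<eta> = 1"
    and "K = div_diff \<iota> \<eta>"
    and "A = D - G + K"
  shows
    "(div_degree \<iota> (inf G A) + div_degree \<iota> (sup G A) = int CARD('n) + 2 * genus \<iota> - 2 \<and>
      (div_degree \<iota> (sup G A) < int CARD('n) \<longleftrightarrow> div_degree \<iota> (inf G A) > 2 * genus \<iota> - 2)) \<and>
     (div_degree \<iota> (inf G A) > 2 * genus \<iota> - 2 \<longrightarrow>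
      code_hull (evaluation_code \<iota> P G) = evaluation_code \<iota> P (inf G A) \<and>
      int (vec.dim (code_hull (evaluation_code \<iota> P G))) = div_degree \<iota> (inf G A) + 1 - genus \<iota>)"
proof -
  interpret function_field \<iota> by fact
  obtain X g where X: "finite X" "\<eta> = (\<Sum>x\<in>X. scale_diff (g x) (kaehler_d \<iota> x))"
    using \<open>\<eta> \<in> differentials \<iota>\<close> unfolding differentials_def by blast
  interpret F: differential_form \<iota> X g
    by unfold_locales (use X \<open>\<eta> \<noteq> 0\<close> in auto)
  have \<eta>: "F.\<eta> = \<eta>" by (simp add: F.\<eta>_def X)
  have supp: "P i \<in> div_supp D" for i
  proof -
    have "D (P i) = (\<Sum>j\<in>UNIV. point_divisor (P j) (P i))"
      unfolding \<open>D = sum_points P\<close> sum_points_def by (rule sum_fun_apply)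
    also have "\<dots> = (\<Sum>j\<in>UNIV. if j = i then 1 else 0)"
      by (rule sum.cong) (auto simp: point_divisor_def dest: injD[OF \<open>inj P\<close>])
    finally show ?thesis by (simp add: div_supp_def)
  qed
  interpret E: evaluation_setting \<iota> X g P G
  proof unfold_locales
    show "inj P" "\<And>i. rational_place \<iota> (P i)" "is_divisor \<iota> G" by fact+
    show "val_diff \<iota> (P i) F.\<eta> = -1" "residue_at \<iota> (P i) F.\<eta> = 1" for i
      using assms(9,10)[OF supp[of i]] by (simp_all add: \<eta>)
    show "G (P i) = 0" for i using supp[of i] assms(6) by (auto simp: div_supp_def)
  qed
  have A: "E.A = A" using assms(4,11,12) by (simp add: E.A_def \<eta>)
  note sum = E.deg_inf_sup[unfolded A]
  have iff: "div_degree \<iota> (sup G A) < int CARD('n) \<longleftrightarrow> div_degree \<iota> (inf G A) > 2 * genus \<iota> - 2"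
    using sum by linarith
  have "code_hull (evaluation_code \<iota> P G) = evaluation_code \<iota> P (inf G A) \<and>
      int (vec.dim (code_hull (evaluation_code \<iota> P G))) = div_degree \<iota> (inf G A) + 1 - genus \<iota>"
    if d: "div_degree \<iota> (inf G A) > 2 * genus \<iota> - 2"
  proof -
    have s: "div_degree \<iota> (sup G A) < int CARD('n)" using d iff by blast
    have h: "code_hull (evaluation_code \<iota> P G) = evaluation_code \<iota> P (inf G A)"
      using E.hull_eq s by (simp add: E.evaluation_code_eq A)
    have "divisor (inf G A)" using divisor_inf[OF E.divisor_G E.divisor_A] A by simp
    then have "int (ell \<iota> (inf G A)) = div_degree \<iota> (inf G A) + 1 - genus \<iota>" using d by (rule F.ell_eq)
    then show ?thesis using h E.dim_evaluation s by (simp add: E.evaluation_code_eq A)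
  qed
  then show ?thesis using sum iff by blast
qed

end
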